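(* Let $U\subset\mathbb{R}^2$ be a domain with a smooth Riemannian metric $g$. Suppose that $u\in c^{1,1/2}_{loc}\cap BV^2_{loc}(U;\mathbb{R}^3)$ is an isometric embedding of $(U,g)$ and that $u(U)$ is parametrised as a graph of $f:U'\to\mathbb{R}$, where $u=(\Psi,v)$ with $\Psi:U\to U'\subset\mathbb{R}^2$ a ($C^1$) diffeomorphism with inverse $\Phi$, and $f:=v\circ\Phi$. Denote by $\nabla^2f$ the (density of the) absolutely continuous part of the Radon measure $D^2f$ with respect to the $2$-dimensional Lebesgue measure $\mathcal{L}^2$. Then $$\det(\nabla^2f(x))=K_g(\Phi(x))\,(1+|Df(x)|^2)^2\quad\text{for }\mathcal{L}^2\text{-a.e. }x\in U'.$$
   Context: $K_g$ is the Gaussian curvature of $g$. $u$ isometric means $\partial_iu\cdot\partial_ju=g_{ij}$. For a bounded Lipschitz domain $V$, $c^{1,1/2}(V)$ is the closure of $C^\infty(\overline V)$ in the $C^{1,1/2}(V)$-norm, and $BV^2(V)$ is the space of $h\in W^{1,1}(V)$ whose second-order distributional derivatives are all signed Radon measures of finite mass. The subscript $loc$ means on every (Lipschitz) $V\subset\subset U$. Under these hypotheses $f\in c^{1,1/2}_{loc}\cap BV^2_{loc}(U')$, so that $D^2f$ is a matrix-valued Radon measure on $U'$. *)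

theory Defs
  imports "HOL-Analysis.Analysis"
begin

type_synonym plane = "real ^ 2"
definition pd :: "2 \<Rightarrow> (plane \<Rightarrow> 'b::real_normed_vector) \<Rightarrow> plane \<Rightarrow> 'b" where
  "pd i f x = frechet_derivative f (at x) (axis i 1)"

definition grad :: "(plane \<Rightarrow> real) \<Rightarrow> plane \<Rightarrow> plane" where
  "grad f x = (\<chi> i. pd i f x)"

text \<open>The predicate \<open>Ck_on\<close> is meant for open sets \<open>S\<close>; it depends only on the values of \<open>f\<close> on \<open>S\<close>.\<close>

primrec Ck_on :: "nat \<Rightarrow> plane set \<Rightarrow> (plane \<Rightarrow> 'b::real_normed_vector) \<Rightarrow> bool" where
  "Ck_on 0 S f \<longleftrightarrow> continuous_on S f"
| "Ck_on (Suc k) S f \<longleftrightarrow>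
     (\<forall>x\<in>S. f differentiable (at x)) \<and> (\<forall>i. Ck_on k S (pd i f))"

definition smooth_on :: "plane set \<Rightarrow> (plane \<Rightarrow> 'b::real_normed_vector) \<Rightarrow> bool" where
  "smooth_on S f \<longleftrightarrow> (\<forall>k. Ck_on k S f)"

definition test_function :: "plane set \<Rightarrow> (plane \<Rightarrow> real) \<Rightarrow> bool" where
  "test_function V \<phi> \<longleftrightarrow> smooth_on UNIV \<phi> \<and>
     compact (closure {x. \<phi> x \<noteq> 0}) \<and> closure {x. \<phi> x \<noteq> 0} \<subseteq> V"

definition C1_diffeomorphism :: "plane set \<Rightarrow> plane set \<Rightarrow> (plane \<Rightarrow> plane) \<Rightarrow> (plane \<Rightarrow> plane) \<Rightarrow> bool" where
  "C1_diffeomorphism U U' \<Psi> \<Phi> \<longleftrightarrow> open U \<and> open U' \<and>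
     homeomorphism U U' \<Psi> \<Phi> \<and> Ck_on 1 U \<Psi> \<and> Ck_on 1 U' \<Phi>"

definition planar_domain :: "plane set \<Rightarrow> bool" where
  "planar_domain V \<longleftrightarrow> open V \<and> connected V \<and> V \<noteq> {}"

text \<open>Near each boundary point, in suitable orthonormal coordinates \<open>(e, n)\<close> centred at that
  point, the domain is the set strictly above the graph of a Lipschitz function.\<close>

definition bounded_lipschitz_domain :: "plane set \<Rightarrow> bool" where
  "bounded_lipschitz_domain V \<longleftrightarrow> planar_domain V \<and> bounded V \<and>
     (\<forall>p\<in>frontier V. \<exists>e n r L. \<exists>\<gamma> :: real \<Rightarrow> real.
        norm e = 1 \<and> norm n = 1 \<and> e \<bullet> n = 0 \<and> r > 0 \<and> L-lipschitz_on UNIV \<gamma> \<and>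
        V \<inter> ball p r = {y \<in> ball p r. \<gamma> ((y - p) \<bullet> e) < (y - p) \<bullet> n})"

definition locally_in :: "(plane set \<Rightarrow> (plane \<Rightarrow> real) \<Rightarrow> bool) \<Rightarrow> plane set \<Rightarrow> (plane \<Rightarrow> real) \<Rightarrow> bool" where
  "locally_in X U h \<longleftrightarrow> (\<forall>V. bounded_lipschitz_domain V \<and> closure V \<subseteq> U \<longrightarrow> X V h)"

text \<open>Diagonal terms vanish, since division by zero gives zero.\<close>

definition holder_seminorm :: "real \<Rightarrow> plane set \<Rightarrow> (plane \<Rightarrow> real) \<Rightarrow> ennreal" where
  "holder_seminorm \<alpha> V h =
     (SUP x\<in>V. SUP y\<in>V. ennreal (\<bar>h x - h y\<bar> / (dist x y powr \<alpha>)))"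

definition C1_holder_norm :: "real \<Rightarrow> plane set \<Rightarrow> (plane \<Rightarrow> real) \<Rightarrow> ennreal" where
  "C1_holder_norm \<alpha> V h =
     (SUP x\<in>V. ennreal \<bar>h x\<bar>) + (\<Sum>i\<in>UNIV. SUP x\<in>V. ennreal \<bar>pd i h x\<bar>)
     + (\<Sum>i\<in>UNIV. holder_seminorm \<alpha> V (pd i h))"

definition C1_holder :: "real \<Rightarrow> plane set \<Rightarrow> (plane \<Rightarrow> real) \<Rightarrow> bool" where
  "C1_holder \<alpha> V h \<longleftrightarrow> Ck_on 1 V h \<and> C1_holder_norm \<alpha> V h < \<infinity>"

text \<open>Functions smooth up to the boundary are taken to be the restrictions of smooth functions
  on the whole plane; for bounded Lipschitz domains this agrees with the other usual conventions.\<close>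

definition little_C1_holder :: "real \<Rightarrow> plane set \<Rightarrow> (plane \<Rightarrow> real) \<Rightarrow> bool" where
  "little_C1_holder \<alpha> V h \<longleftrightarrow> C1_holder \<alpha> V h \<and>
     (\<forall>\<epsilon>>0. \<exists>\<phi>. smooth_on UNIV \<phi> \<and> C1_holder_norm \<alpha> V (\<lambda>x. h x - \<phi> x) < ennreal \<epsilon>)"

definition radon_measure_on :: "plane set \<Rightarrow> plane measure \<Rightarrow> bool" where
  "radon_measure_on V M \<longleftrightarrow> sets M = sets borel \<and> emeasure M (- V) = 0 \<and>
     (\<forall>K. compact K \<and> K \<subseteq> V \<longrightarrow> emeasure M K < \<infinity>)"

text \<open>A matrix-valued signed Radon measure is represented entrywise as a difference
  \<open>P i j - N i j\<close> of positive Radon measures. By the Jordan decomposition every signed Radon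
  measure has this form, and it has finite mass iff both measures can be chosen finite.\<close>

definition hessian_measure ::
  "plane set \<Rightarrow> (plane \<Rightarrow> real) \<Rightarrow> (2 \<Rightarrow> 2 \<Rightarrow> plane measure) \<Rightarrow> (2 \<Rightarrow> 2 \<Rightarrow> plane measure) \<Rightarrow> bool" where
  "hessian_measure V h P N \<longleftrightarrow>
     (\<forall>K. compact K \<and> K \<subseteq> V \<longrightarrow> h absolutely_integrable_on K) \<and>
     (\<forall>i j. radon_measure_on V (P i j) \<and> radon_measure_on V (N i j) \<and>
        (\<forall>\<phi>. test_function V \<phi> \<longrightarrow>
           (LINT x:V|lebesgue. h x * pd i (pd j \<phi>) x)
             = (LINT x|P i j. \<phi> x) - (LINT x|N i j. \<phi> x)))"

definition W11 :: "plane set \<Rightarrow> (plane \<Rightarrow> real) \<Rightarrow> bool" where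
  "W11 V h \<longleftrightarrow> h absolutely_integrable_on V \<and>
     (\<forall>i. \<exists>d. d absolutely_integrable_on V \<and>
        (\<forall>\<phi>. test_function V \<phi> \<longrightarrow>
           (LINT x:V|lebesgue. h x * pd i \<phi> x) = - (LINT x:V|lebesgue. d x * \<phi> x)))"

definition BV2 :: "plane set \<Rightarrow> (plane \<Rightarrow> real) \<Rightarrow> bool" where
  "BV2 V h \<longleftrightarrow> W11 V h \<and>
     (\<exists>P N. hessian_measure V h P N \<and>
        (\<forall>i j. finite_measure (P i j) \<and> finite_measure (N i j)))"

text \<open>\<open>p\<close> is the density of the absolutely continuous part in the Lebesgue decomposition of the
  positive measure \<open>M\<close>, whose singular part is \<open>S\<close>.\<close>

definition ac_density :: "plane measure \<Rightarrow> (plane \<Rightarrow> real) \<Rightarrow> bool" where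
  "ac_density M p \<longleftrightarrow> p \<in> borel_measurable borel \<and> (\<forall>x. 0 \<le> p x) \<and>
     (\<exists>S. sets S = sets borel \<and> (\<exists>Z\<in>null_sets lborel. emeasure S (- Z) = 0) \<and>
        (\<forall>A\<in>sets borel. emeasure M A = emeasure (density lborel (\<lambda>x. ennreal (p x))) A + emeasure S A))"

text \<open>The density is determined only up to Lebesgue null sets; a representative is chosen.
  It does not depend on \<open>P\<close> and \<open>N\<close> beyond their difference.\<close>

definition ac_hessian :: "plane set \<Rightarrow> (plane \<Rightarrow> real) \<Rightarrow> plane \<Rightarrow> real ^ 2 ^ 2" where
  "ac_hessian V f = (SOME H. \<exists>P N p n. hessian_measure V f P N \<and>
     (\<forall>i j. ac_density (P i j) (p i j) \<and> ac_density (N i j) (n i j)) \<and>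
     H = (\<lambda>x. \<chi> i j. p i j x - n i j x))"

definition riemannian_metric_on :: "plane set \<Rightarrow> (plane \<Rightarrow> real ^ 2 ^ 2) \<Rightarrow> bool" where
  "riemannian_metric_on U g \<longleftrightarrow> smooth_on U g \<and>
     (\<forall>x\<in>U. transpose (g x) = g x \<and> (\<forall>\<xi>. \<xi> \<noteq> 0 \<longrightarrow> \<xi> \<bullet> (g x *v \<xi>) > 0))"

text \<open>\<open>christoffel g k i j\<close> has the upper index \<open>k\<close>, and the curvature coefficients are those of
  \<open>R(\<partial>\<^sub>i, \<partial>\<^sub>j) \<partial>\<^sub>k = (\<Sum>l. riemann_coeff g l i j k * \<partial>\<^sub>l)\<close>,
  with the sign convention \<open>R(\<partial>\<^sub>i, \<partial>\<^sub>j) = \<nabla>\<^sub>i \<nabla>\<^sub>j - \<nabla>\<^sub>j \<nabla>\<^sub>i\<close>.\<close>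

definition christoffel :: "(plane \<Rightarrow> real ^ 2 ^ 2) \<Rightarrow> 2 \<Rightarrow> 2 \<Rightarrow> 2 \<Rightarrow> plane \<Rightarrow> real" where
  "christoffel g k i j x = (1/2) * (\<Sum>l\<in>UNIV. matrix_inv (g x) $ k $ l *
     (pd i (\<lambda>y. g y $ j $ l) x + pd j (\<lambda>y. g y $ i $ l) x - pd l (\<lambda>y. g y $ i $ j) x))"

definition riemann_coeff :: "(plane \<Rightarrow> real ^ 2 ^ 2) \<Rightarrow> 2 \<Rightarrow> 2 \<Rightarrow> 2 \<Rightarrow> 2 \<Rightarrow> plane \<Rightarrow> real" where
  "riemann_coeff g l i j k x =
     pd i (christoffel g l j k) x - pd j (christoffel g l i k) x
     + (\<Sum>m\<in>UNIV. christoffel g m j k x * christoffel g l i m x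
                 - christoffel g m i k x * christoffel g l j m x)"

text \<open>\<open>K = \<langle>R(\<partial>\<^sub>1, \<partial>\<^sub>2) \<partial>\<^sub>2, \<partial>\<^sub>1\<rangle> / det g\<close>, positive for round spheres.\<close>

definition gauss_curvature :: "(plane \<Rightarrow> real ^ 2 ^ 2) \<Rightarrow> plane \<Rightarrow> real" where
  "gauss_curvature g x = (\<Sum>l\<in>UNIV. g x $ 1 $ l * riemann_coeff g l 1 2 2 x) / det (g x)"

definition isometric_embedding :: "plane set \<Rightarrow> (plane \<Rightarrow> real ^ 2 ^ 2) \<Rightarrow> (plane \<Rightarrow> real ^ 3) \<Rightarrow> bool" where
  "isometric_embedding U g u \<longleftrightarrow> Ck_on 1 U u \<and>
     (\<exists>w. homeomorphism U (u ` U) u w) \<and>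
     (\<forall>x\<in>U. \<forall>i j. pd i u x \<bullet> pd j u x = g x $ i $ j)"

end

theory Submission
  imports Defs "HOL-Computational_Algebra.Polynomial"
begin

text \<open>A function with \<open>BV\<close> derivatives has first derivatives that are differentiable in the mean at
  almost every point, the differential being the density of the absolutely continuous part of the
  Hessian measure. Hence the Gauss equation can be derived pointwise. Differentiating
  \<open>\<partial>\<^sub>iu \<bullet> \<partial>\<^sub>ju = g\<^sub>i\<^sub>j\<close> in the mean gives the tangential components
  \<open>A\<^sub>i\<^sub>j \<bullet> \<partial>\<^sub>ku = \<Gamma>\<^sub>i\<^sub>j\<^sub>,\<^sub>k\<close> of the second derivatives \<open>A\<^sub>i\<^sub>j\<close> of \<open>u\<close>. Testing
  \<open>\<partial>\<^sub>1\<partial>\<^sub>2g\<^sub>1\<^sub>2 - \<partial>\<^sub>1\<partial>\<^sub>1g\<^sub>2\<^sub>2/2 - \<partial>\<^sub>2\<partial>\<^sub>2g\<^sub>1\<^sub>1/2\<close> with kernels shrinking to a point identifies it with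
  \<open>A\<^sub>1\<^sub>1 \<bullet> A\<^sub>2\<^sub>2 - A\<^sub>1\<^sub>2 \<bullet> A\<^sub>1\<^sub>2\<close>: by the curl-free structure only the affine part of the gradient
  survives in the limit. Together these determine the determinant of the normal components, which
  equal those of the Hessian of \<open>f\<close> transported by \<open>\<Psi>\<close>. That the second derivatives of \<open>f\<close> are
  measures, so that \<open>ac_hessian\<close> is not an arbitrary choice, follows since the first derivatives of
  \<open>f\<close> composed with \<open>\<Psi>\<close> are rational expressions in those of \<open>u\<close>.\<close>

section \<open>Partial derivatives, cubes and test functions\<close>

text \<open>The Gauss equation is quadratic in second derivatives, so differentiability in the mean
  is needed in the L^2 sense; the plane is exactly the dimension in which a Poincare inequality
  bounds L^2 oscillation by the mass of the derivative. Oscillation is measured over pairs of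
  points, which avoids fixing a base value. The delicate step is the second order identity. Near x a
  gradient is its value at a nearby point w, plus a linear part of size r, plus an error whose
  squared integral over a square of size r is o(r^4), while second derivatives of a kernel of radius
  r have size r^-4. Products of two errors, or of an error with a linear part, vanish in the limit,
  but value times error is only o(1/r). No estimate removes these terms. They cancel exactly,
  because a gradient is curl free and the combination of second derivatives is the very weak form of
  a determinant. On the side of f the obstacle is that composition with a C^1 map does not obviously
  preserve measures as derivatives. Products and quotients of continuous functions of bounded
  variation are therefore handled through smooth approximations.\<close>

lemma UNIV_2_eq: "(UNIV::2 set) = {1, 2}"
  using exhaust_2 by auto

lemma plane_eqI: "x $ 1 = y $ 1 \<Longrightarrow> x $ 2 = y $ 2 \<Longrightarrow> x = (y::plane)"
  by (simp add: vec_eq_iff forall_2)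

lemma inner_plane: "x \<bullet> (y::plane) = x $ 1 * y $ 1 + x $ 2 * y $ 2"
  by (simp add: inner_vec_def sum_2)

lemma axis_plane [simp]:
  "(axis 1 1 :: plane) $ 1 = 1" "(axis 1 1 :: plane) $ 2 = 0"
  "(axis 2 1 :: plane) $ 1 = 0" "(axis 2 1 :: plane) $ 2 = 1"
  by (simp_all add: axis_def)

lemma pd_eqI: "(f has_derivative f') (at x) \<Longrightarrow> pd i f x = f' (axis i 1)"
  unfolding pd_def using frechet_derivative_at by fastforce

lemma has_derivative_pd:
  fixes f :: "plane \<Rightarrow> 'b::real_normed_vector"
  assumes "f differentiable (at x)"
  shows "(f has_derivative (\<lambda>v. v $ 1 *\<^sub>R pd 1 f x + v $ 2 *\<^sub>R pd 2 f x)) (at x)"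
proof -
  let ?D = "frechet_derivative f (at x)"
  have D: "(f has_derivative ?D) (at x)" using assms frechet_derivative_works by blast
  interpret linear ?D by (rule has_derivative_linear[OF D])
  have "?D v = v $ 1 *\<^sub>R pd 1 f x + v $ 2 *\<^sub>R pd 2 f x" for v
  proof -
    have "v = v $ 1 *\<^sub>R axis 1 1 + v $ 2 *\<^sub>R axis 2 1"
      by (rule plane_eqI) auto
    then show ?thesis by (metis add scaleR pd_def)
  qed
  then have "?D = (\<lambda>v. v $ 1 *\<^sub>R pd 1 f x + v $ 2 *\<^sub>R pd 2 f x)" by blast
  with D show ?thesis by simp
qed

lemma has_derivative_grad:
  fixes f :: "plane \<Rightarrow> real"
  assumes "f differentiable (at x)"
  shows "(f has_derivative (\<lambda>v. grad f x \<bullet> v)) (at x)"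
  using has_derivative_pd[OF assms] by (simp add: grad_def inner_plane mult.commute)

lemma pd_cong:
  assumes "open S" "x \<in> S" "\<And>y. y \<in> S \<Longrightarrow> f y = g y"
  shows "pd i f x = pd i g x"
proof -
  have "(f has_derivative D) (at x) \<longleftrightarrow> (g has_derivative D) (at x)" for D
    using has_derivative_transform_within_open[OF _ assms(1,2)] assms(3) by metis
  then show ?thesis by (simp add: pd_def frechet_derivative_def)
qed

lemma differentiable_cong:
  assumes "open S" "x \<in> S" "\<And>y. y \<in> S \<Longrightarrow> f y = g y"
  shows "f differentiable (at x) \<longleftrightarrow> g differentiable (at x)"
  using has_derivative_transform_within_open[OF _ assms(1,2)] assms(3)
  unfolding differentiable_def by metis

text \<open>\<open>Ck_on\<close> differentiates the total functions \<open>pd i f\<close>, while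
  product and quotient rules for \<open>pd\<close> hold only on \<open>S\<close>. The closure lemmas
  below pass through this congruence, which rests on \<open>S\<close> being open.\<close>

lemma Ck_on_cong:
  assumes "open S" "\<And>y. y \<in> S \<Longrightarrow> f y = g y"
  shows "Ck_on k S f \<longleftrightarrow> Ck_on k S g"
  using assms(2)
proof (induction k arbitrary: f g)
  case 0
  then show ?case by (auto intro: continuous_on_cong[THEN iffD1])
next
  case (Suc k)
  have d: "f differentiable (at x) \<longleftrightarrow> g differentiable (at x)" if "x \<in> S" for x
    by (rule differentiable_cong[OF assms(1) that Suc.prems])
  have "Ck_on k S (pd i f) \<longleftrightarrow> Ck_on k S (pd i g)" for i
    by (rule Suc.IH, rule pd_cong[OF assms(1) _ Suc.prems])
  with d show ?case by simp
qed

lemma Ck_on_continuous: "Ck_on k S f \<Longrightarrow> continuous_on S f"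
  by (cases k) (simp_all add: differentiable_at_imp_differentiable_on differentiable_imp_continuous_on)

lemma Ck_on_Suc_D: "Ck_on (Suc k) S f \<Longrightarrow> Ck_on k S f"
proof (induction k arbitrary: f)
  case 0 then show ?case using Ck_on_continuous[of "Suc 0" S f] by simp
next
  case (Suc k)
  have "Ck_on k S (pd i f)" for i
    by (rule Suc.IH) (use Suc.prems Ck_on.simps(2)[of "Suc k" S f] in blast)
  then show ?case using Suc.prems Ck_on.simps(2)[of "Suc k" S f] Ck_on.simps(2)[of k S f] by blast
qed

lemma Ck_on_subset: "Ck_on k S f \<Longrightarrow> T \<subseteq> S \<Longrightarrow> Ck_on k T f"
  by (induction k arbitrary: f) (auto intro: continuous_on_subset)

lemma pd_add: "f differentiable (at x) \<Longrightarrow> g differentiable (at x) \<Longrightarrow>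
    pd i (\<lambda>x. f x + g x) x = pd i f x + pd i g x"
  by (rule pd_eqI[THEN trans, OF has_derivative_add])
     (auto simp: frechet_derivative_works pd_def)

lemma pd_diff: "f differentiable (at x) \<Longrightarrow> g differentiable (at x) \<Longrightarrow>
    pd i (\<lambda>x. f x - g x) x = pd i f x - pd i g x"
  by (rule pd_eqI[THEN trans, OF has_derivative_diff])
     (auto simp: frechet_derivative_works pd_def)

lemma pd_mult:
  fixes f g :: "plane \<Rightarrow> real"
  shows "f differentiable (at x) \<Longrightarrow> g differentiable (at x) \<Longrightarrow>
    pd i (\<lambda>x. f x * g x) x = f x * pd i g x + pd i f x * g x"
  by (rule pd_eqI[THEN trans, OF has_derivative_mult])
     (auto simp: frechet_derivative_works pd_def)

lemma pd_inverse:
  fixes f :: "plane \<Rightarrow> real"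
  assumes "f differentiable (at x)" "f x \<noteq> 0"
  shows "pd i (\<lambda>x. inverse (f x)) x = - (inverse (f x) * inverse (f x) * pd i f x)"
  using pd_eqI[OF Deriv.has_derivative_inverse[OF assms(2) frechet_derivative_works[THEN iffD1, OF assms(1)]]]
  by (simp add: pd_def)

lemma pd_const [simp]: "pd i (\<lambda>x. c) x = 0"
  by (rule pd_eqI[THEN trans, OF has_derivative_const]) simp

lemma Ck_on_const: "Ck_on k S (\<lambda>x. c)"
proof (induction k arbitrary: c)
  case (Suc k)
  have "pd i (\<lambda>x::plane. c) = (\<lambda>x. 0)" for i by auto
  with Suc show ?case by auto
qed simp

lemma Ck_on_add:
  assumes "open S" shows "Ck_on k S f \<Longrightarrow> Ck_on k S g \<Longrightarrow> Ck_on k S (\<lambda>x. f x + g x)"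
proof (induction k arbitrary: f g)
  case 0 then show ?case by (auto intro: continuous_intros)
next
  case (Suc k)
  have "Ck_on k S (pd i (\<lambda>x. f x + g x))" for i
    by (subst Ck_on_cong[OF assms, where g="\<lambda>x. pd i f x + pd i g x"])
       (use Suc in \<open>auto simp: pd_add\<close>)
  with Suc.prems show ?case by auto
qed

lemma Ck_on_mult:
  fixes f g :: "plane \<Rightarrow> real"
  assumes "open S" shows "Ck_on k S f \<Longrightarrow> Ck_on k S g \<Longrightarrow> Ck_on k S (\<lambda>x. f x * g x)"
proof (induction k arbitrary: f g)
  case 0 then show ?case by (auto intro: continuous_intros)
next
  case (Suc k)
  have "Ck_on k S (pd i (\<lambda>x. f x * g x))" for i
  proof -
    have "Ck_on k S (\<lambda>x. f x * pd i g x + pd i f x * g x)"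
      using Suc.prems Ck_on_Suc_D[OF Suc.prems(1)] Ck_on_Suc_D[OF Suc.prems(2)]
      by (intro Ck_on_add[OF assms] Suc.IH) simp_all
    then show ?thesis
      by (rule Ck_on_cong[OF assms, THEN iffD1, rotated]) (use Suc.prems in \<open>simp add: pd_mult\<close>)
  qed
  with Suc.prems show ?case by auto
qed

lemma Ck_on_diff:
  fixes f g :: "plane \<Rightarrow> real"
  assumes "open S" "Ck_on k S f" "Ck_on k S g" shows "Ck_on k S (\<lambda>x. f x - g x)"
  using Ck_on_add[OF assms(1,2) Ck_on_mult[OF assms(1) Ck_on_const[where c="-1"] assms(3)]] by simp

lemma Ck_on_inverse:
  fixes f :: "plane \<Rightarrow> real"
  assumes "open S" "\<And>x. x \<in> S \<Longrightarrow> f x \<noteq> 0" "Ck_on k S f"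
  shows "Ck_on k S (\<lambda>x. inverse (f x))"
  using assms(3)
proof (induction k)
  case 0 then show ?case using assms(2) by (auto intro: continuous_intros)
next
  case (Suc k)
  have *: "Ck_on k S (\<lambda>x. inverse (f x))" using Suc Ck_on_Suc_D by blast
  have "Ck_on k S (pd i (\<lambda>x. inverse (f x)))" for i
  proof -
    have "Ck_on k S (\<lambda>x. 0 - inverse (f x) * inverse (f x) * pd i f x)"
      using Suc.prems by (intro Ck_on_diff Ck_on_mult Ck_on_const assms(1) *) simp
    then show ?thesis
      by (rule Ck_on_cong[OF assms(1), THEN iffD1, rotated]) (use Suc.prems assms(2) in \<open>simp add: pd_inverse\<close>)
  qed
  with Suc.prems assms(2) show ?case by auto
qed

lemma Ck_on_sum:
  fixes f :: "'i \<Rightarrow> plane \<Rightarrow> real"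
  assumes "open S" "\<And>j. j \<in> I \<Longrightarrow> Ck_on k S (f j)"
  shows "Ck_on k S (\<lambda>x. \<Sum>j\<in>I. f j x)"
  using assms(2)
  by (induction I rule: infinite_finite_induct) (auto intro: Ck_on_const Ck_on_add assms(1))

lemma Ck_on_prod:
  fixes f :: "'i \<Rightarrow> plane \<Rightarrow> real"
  assumes "open S" "\<And>j. j \<in> I \<Longrightarrow> Ck_on k S (f j)"
  shows "Ck_on k S (\<lambda>x. \<Prod>j\<in>I. f j x)"
  using assms(2)
  by (induction I rule: infinite_finite_induct) (auto intro: Ck_on_const Ck_on_mult assms(1))

lemma pd_affine:
  fixes f :: "plane \<Rightarrow> real"
  assumes "\<And>x. f differentiable (at x)"
  shows "pd i (\<lambda>x. f (a *\<^sub>R x + c)) x = a * pd i f (a *\<^sub>R x + c)"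
proof -
  have "((\<lambda>x. f (a *\<^sub>R x + c)) has_derivative (\<lambda>v. grad f (a *\<^sub>R x + c) \<bullet> (a *\<^sub>R v))) (at x)"
    by (rule has_derivative_compose[OF _ has_derivative_grad[OF assms]])
       (auto intro!: derivative_eq_intros)
  from pd_eqI[OF this] show ?thesis
    by (simp add: grad_def inner_axis)
qed

lemma Ck_on_affine:
  fixes f :: "plane \<Rightarrow> real"
  shows "Ck_on k UNIV f \<Longrightarrow> Ck_on k UNIV (\<lambda>x. f (a *\<^sub>R x + c))"
proof (induction k arbitrary: f)
  case 0
  then have "continuous_on UNIV (\<lambda>x. f (a *\<^sub>R x + c))"
    by (intro continuous_on_compose2[of UNIV f "UNIV" "\<lambda>x. a *\<^sub>R x + c"]) (auto intro!: continuous_intros)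
  then show ?case by simp
next
  case (Suc k)
  have "pd i (\<lambda>x. f (a *\<^sub>R x + c)) = (\<lambda>x. a * pd i f (a *\<^sub>R x + c))" for i
    using Suc.prems by (auto simp: pd_affine)
  moreover have "(\<lambda>x. f (a *\<^sub>R x + c)) differentiable (at x)" for x
    using Suc.prems
    by (intro differentiable_chain_at[of "\<lambda>x. a *\<^sub>R x + c" _ f, unfolded o_def])
       (auto intro!: derivative_intros)
  ultimately show ?case
    using Suc by (auto intro!: Ck_on_mult Ck_on_const)
qed

text \<open>The factor \<open>poly p (1 / t)\<close> makes this family closed under differentiation,
  so that smoothness of exp(-1/t) is an induction in which \<open>p\<close> varies.\<close>

definition flat :: "real poly \<Rightarrow> real \<Rightarrow> real" where
  "flat p t = (if t > 0 then poly p (1 / t) * exp (- (1 / t)) else 0)"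

text \<open>With s = 1/t one has d/dt = -s^2 d/ds, which sends p(s) exp(-s) to s^2 (p - p')(s)
  exp(-s).\<close>

definition flat_deriv :: "real poly \<Rightarrow> real poly" where
  "flat_deriv p = [:0, 0, 1:] * (p - pderiv p)"

lemma poly_exp_tendsto_0: "((\<lambda>s. poly p s * exp (- s)) \<longlongrightarrow> (0::real)) at_top"
proof -
  have "((\<lambda>s. \<Sum>i\<le>degree p. coeff p i * (s ^ i / exp s)) \<longlongrightarrow> (\<Sum>i\<le>degree p. coeff p i * 0)) at_top"
    by (intro tendsto_sum tendsto_mult tendsto_const tendsto_power_div_exp_0)
  then show ?thesis
    by (simp add: poly_altdef sum_distrib_right exp_minus divide_inverse mult.assoc)
qed

lemma flat_has_derivative: "(flat p has_real_derivative flat (flat_deriv p) t) (at t)"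
proof -
  consider "t > 0" | "t < 0" | "t = 0" by linarith
  then show ?thesis
  proof cases
    case 1
    have "((\<lambda>t. poly p (1 / t) * exp (- (1 / t))) has_real_derivative flat (flat_deriv p) t) (at t)"
      using 1 unfolding flat_def flat_deriv_def
      by (auto intro!: derivative_eq_intros poly_DERIV[THEN DERIV_chain2] simp: field_simps power2_eq_square)
    then show ?thesis
      by (rule has_field_derivative_transform_within_open[of _ _ _ "{0<..}"]) (use 1 in \<open>auto simp: flat_def\<close>)
  next
    case 2
    have "((\<lambda>t. 0) has_real_derivative flat (flat_deriv p) t) (at t)"
      using 2 by (simp add: flat_def)
    then show ?thesis
      by (rule has_field_derivative_transform_within_open[of _ _ _ "{..<0}"]) (use 2 in \<open>auto simp: flat_def\<close>)
  next
    case 3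
    have "((\<lambda>h. flat p h / h) \<longlongrightarrow> 0) (at_right 0)"
    proof -
      \<comment> \<open>Dividing by \<open>h\<close> multiplies \<open>p\<close> by the variable s =
        1/h, so the difference quotient at 0 stays within the family and decays.\<close>
      have "((\<lambda>h. poly ([:0,1:] * p) (inverse h) * exp (- inverse h)) \<longlongrightarrow> 0) (at_right (0::real))"
        by (rule filterlim_compose[OF poly_exp_tendsto_0 filterlim_inverse_at_top_right])
      then show ?thesis
        by (rule Lim_transform_eventually)
           (auto simp: flat_def eventually_at_filter divide_inverse)
    qed
    moreover have "((\<lambda>h. flat p h / h) \<longlongrightarrow> 0) (at_left 0)"
      by (rule Lim_transform_eventually[OF tendsto_const]) (auto simp: flat_def eventually_at_filter)
    ultimately have "((\<lambda>h. flat p h / h) \<longlongrightarrow> 0) (at 0)"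
      by (simp add: filterlim_split_at)
    then show ?thesis using 3 by (simp add: DERIV_def flat_def)
  qed
qed

lemma smooth_flat: "Ck_on k UNIV (\<lambda>x::plane. flat p (a \<bullet> x + c))"
proof (induction k arbitrary: p)
  case 0
  have "continuous_on UNIV (flat p)"
    by (intro continuous_at_imp_continuous_on ballI DERIV_isCont[OF flat_has_derivative])
  then have "continuous_on UNIV (\<lambda>x::plane. flat p (a \<bullet> x + c))"
    by (rule continuous_on_compose2) (auto intro!: continuous_intros)
  then show ?case by simp
next
  case (Suc k)
  have der: "((\<lambda>x::plane. flat p (a \<bullet> x + c)) has_derivative (\<lambda>v. flat (flat_deriv p) (a \<bullet> x + c) * (a \<bullet> v))) (at x)" for x
    by (rule has_derivative_compose[OF _ flat_has_derivative[unfolded has_field_derivative_def]])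
       (auto intro!: derivative_eq_intros)
  have "pd i (\<lambda>x. flat p (a \<bullet> x + c)) = (\<lambda>x. flat (flat_deriv p) (a \<bullet> x + c) * a $ i)" for i
    using pd_eqI[OF der] by (auto simp: inner_axis)
  moreover have "(\<lambda>x::plane. flat p (a \<bullet> x + c)) differentiable (at x)" for x
    using der differentiableI by blast
  ultimately show ?case by (auto intro!: Ck_on_mult Ck_on_const Suc.IH)
qed

lemma flat_1_pos: "flat 1 t > 0 \<longleftrightarrow> t > 0" and flat_1_nonneg: "flat 1 t \<ge> 0"
  and flat_1_zero: "flat 1 t = 0 \<longleftrightarrow> t \<le> 0"
  by (auto simp: flat_def)

text \<open>Squares of half side \<open>r\<close> instead of discs: they are products of coordinate
  segments, as the two-point Poincare argument requires, and instances of \<open>cbox\<close>, so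
  that the gauge integral and its Fubini theorem apply directly.\<close>

definition cube :: "plane \<Rightarrow> real \<Rightarrow> plane set" where
  "cube c r = cbox (c - (\<chi> i. r)) (c + (\<chi> i. r))"

lemma mem_cube: "x \<in> cube c r \<longleftrightarrow> (\<forall>i. \<bar>x $ i - c $ i\<bar> \<le> r)"
  unfolding cube_def mem_box_cart by (auto simp: abs_le_iff algebra_simps)

lemma mem_cube2: "x \<in> cube c r \<longleftrightarrow> \<bar>x $ 1 - c $ 1\<bar> \<le> r \<and> \<bar>x $ 2 - c $ 2\<bar> \<le> r"
  by (simp add: mem_cube forall_2)

lemma compact_cube [simp, intro]: "compact (cube c r)" and closed_cube [simp, intro]: "closed (cube c r)"
  and convex_cube [simp, intro]: "convex (cube c r)" and borel_cube [measurable]: "cube c r \<in> sets borel"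
  by (auto simp: cube_def)

lemma cube_mono: "r \<le> s \<Longrightarrow> cube c r \<subseteq> cube c s"
  by (meson mem_cube order_trans subsetI)

lemma cball_subset_cube: "cball c r \<subseteq> cube c r"
proof
  fix x assume "x \<in> cball c r"
  moreover have "\<bar>(x - c) $ i\<bar> \<le> norm (x - c)" for i by (rule component_le_norm_cart)
  ultimately show "x \<in> cube c r"
    unfolding mem_cube by (metis dist_commute dist_norm mem_cball order_trans vector_minus_component)
qed

lemma cube_subset_cball: "cube c r \<subseteq> cball c (2 * r)"
proof
  fix x assume x: "x \<in> cube c r"
  have "norm (x - c) \<le> (\<Sum>i\<in>UNIV. \<bar>(x - c) $ i\<bar>)" by (rule norm_le_l1_cart)
  also have "\<dots> \<le> 2 * r" using x by (simp add: mem_cube2 sum_2)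
  finally show "x \<in> cball c (2 * r)" by (simp add: dist_norm norm_minus_commute)
qed

lemma open_contains_cube:
  assumes "open W" "x \<in> W" obtains r where "r > 0" "cube x r \<subseteq> W"
proof -
  obtain e where e: "e > 0" "cball x e \<subseteq> W" using assms open_contains_cball by blast
  show thesis
    by (rule that[of "e / 2"]) (use e cube_subset_cball[of x "e/2"] in auto)
qed

definition bump :: "plane \<Rightarrow> real \<Rightarrow> plane \<Rightarrow> real" where
  "bump c r x = (\<Prod>i\<in>UNIV. flat 1 (r + (x $ i - c $ i)) * flat 1 (r - (x $ i - c $ i)))"

lemma Ck_on_bump: "Ck_on k UNIV (bump c r)"
proof -
  have "Ck_on k UNIV (\<lambda>x::plane. flat 1 (axis i 1 \<bullet> x + (r - c $ i)))"
    "Ck_on k UNIV (\<lambda>x::plane. flat 1 (- axis i 1 \<bullet> x + (r + c $ i)))" for i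
    by (rule smooth_flat)+
  then show ?thesis unfolding bump_def
    by (intro Ck_on_prod Ck_on_mult) (auto simp: inner_axis' algebra_simps)
qed

lemma bump_nonneg: "bump c r x \<ge> 0"
  unfolding bump_def by (intro prod_nonneg mult_nonneg_nonneg) (auto simp: flat_1_nonneg)

lemma bump_pos_iff: "bump c r x > 0 \<longleftrightarrow> (\<forall>i. \<bar>x $ i - c $ i\<bar> < r)"
proof -
  have "bump c r x > 0 \<longleftrightarrow> bump c r x \<noteq> 0" using bump_nonneg[of c r x] by linarith
  also have "\<dots> \<longleftrightarrow> (\<forall>i. \<bar>x $ i - c $ i\<bar> < r)"
    unfolding bump_def by (auto simp: flat_1_zero abs_less_iff not_le)
      (metis add.commute diff_gt_0_iff_gt less_diff_eq minus_diff_eq diff_less_eq diff_minus_eq_add add_0)+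
  finally show ?thesis .
qed

text \<open>The quotient b / (b + d), where b is positive exactly on the open square of half side
  \<open>2 * r\<close> and d vanishes exactly on the closed square of half side \<open>r\<close>.
  For positive \<open>r\<close> the first set contains the second, so the denominator never
  vanishes.\<close>

definition cutoff :: "plane \<Rightarrow> real \<Rightarrow> plane \<Rightarrow> real" where
  "cutoff c r x = bump c (2 * r) x * inverse (bump c (2 * r) x +
     (\<Sum>i\<in>UNIV. flat 1 (x $ i - c $ i - r) + flat 1 (c $ i - x $ i - r)))"

lemma cutoff_denominator:
  assumes "r > 0"
  shows "bump c (2 * r) x + (\<Sum>i\<in>UNIV. flat 1 (x $ i - c $ i - r) + flat 1 (c $ i - x $ i - r)) > 0"
proof (cases "bump c (2 * r) x > 0")
  case True
  then show ?thesis by (auto intro!: add_pos_nonneg sum_nonneg add_nonneg_nonneg flat_1_nonneg)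
next
  case False
  then obtain i where i: "\<bar>x $ i - c $ i\<bar> \<ge> 2 * r" using bump_pos_iff[of c "2*r" x] by (meson not_le)
  have "0 < flat 1 (x $ i - c $ i - r) + flat 1 (c $ i - x $ i - r)"
  proof (cases "x $ i - c $ i \<ge> 0")
    case True
    then have "flat 1 (x $ i - c $ i - r) > 0" using i assms by (simp add: flat_1_pos)
    then show ?thesis by (simp add: add_pos_nonneg flat_1_nonneg)
  next
    case False
    then have "flat 1 (c $ i - x $ i - r) > 0" using i assms by (simp add: flat_1_pos)
    then show ?thesis by (simp add: add_nonneg_pos flat_1_nonneg)
  qed
  also have "\<dots> \<le> (\<Sum>i\<in>UNIV. flat 1 (x $ i - c $ i - r) + flat 1 (c $ i - x $ i - r))"
    by (rule member_le_sum) (auto intro: add_nonneg_nonneg flat_1_nonneg)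
  finally show ?thesis using bump_nonneg[of c "2*r" x] by linarith
qed

lemma Ck_on_cutoff:
  assumes "r > 0" shows "Ck_on k UNIV (cutoff c r)"
proof -
  have "Ck_on k UNIV (\<lambda>x::plane. flat 1 (axis i 1 \<bullet> x + (- c $ i - r)))"
    "Ck_on k UNIV (\<lambda>x::plane. flat 1 (- axis i 1 \<bullet> x + (c $ i - r)))" for i
    by (rule smooth_flat)+
  then have *: "Ck_on k UNIV (\<lambda>x::plane. flat 1 (x $ i - c $ i - r))"
    "Ck_on k UNIV (\<lambda>x::plane. flat 1 (c $ i - x $ i - r))" for i
    by (simp_all add: inner_axis' algebra_simps)
  show ?thesis unfolding cutoff_def
    by (intro Ck_on_mult Ck_on_inverse Ck_on_add Ck_on_sum Ck_on_bump * open_UNIV)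
       (use less_imp_neq[OF cutoff_denominator[OF assms], symmetric] in blast)
qed

lemma cutoff_bounds: assumes "r > 0" shows "0 \<le> cutoff c r x" "cutoff c r x \<le> 1"
proof -
  let ?D = "\<Sum>i\<in>UNIV. flat 1 (x $ i - c $ i - r) + flat 1 (c $ i - x $ i - r)"
  have "?D \<ge> 0" by (auto intro!: sum_nonneg add_nonneg_nonneg flat_1_nonneg)
  with cutoff_denominator[OF assms, of c x] bump_nonneg[of c "2*r" x]
  show "0 \<le> cutoff c r x" "cutoff c r x \<le> 1"
    by (auto simp: cutoff_def field_simps)
qed

lemma cutoff_eq_1: assumes "r > 0" "x \<in> cube c r" shows "cutoff c r x = 1"
proof -
  have "flat 1 (x $ i - c $ i - r) = 0" "flat 1 (c $ i - x $ i - r) = 0" for i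
    using assms(2)[unfolded mem_cube, rule_format, of i] by (auto simp: flat_1_zero)
  with cutoff_denominator[OF assms(1), of c x] show ?thesis by (simp add: cutoff_def)
qed

lemma cutoff_eq_0: assumes "x \<notin> cube c (2 * r)" shows "cutoff c r x = 0"
proof -
  have "\<not> bump c (2 * r) x > 0" using assms unfolding bump_pos_iff mem_cube by (meson less_imp_le)
  then show ?thesis using bump_nonneg[of c "2*r" x] by (simp add: cutoff_def)
qed

section \<open>Test functions\<close>

lemma test_functionI:
  assumes "\<And>k. Ck_on k UNIV \<phi>" "compact K" "K \<subseteq> V" "\<And>x. x \<notin> K \<Longrightarrow> \<phi> x = 0"
  shows "test_function V \<phi>"
proof -
  have "closure {x. \<phi> x \<noteq> 0} \<subseteq> K"
    using assms by (intro closure_minimal) (auto intro: compact_imp_closed)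
  then show ?thesis unfolding test_function_def smooth_on_def
    using assms by (meson closed_closure compact_Int_closed inf.absorb_iff2 order_trans
        bounded_subset compact_eq_bounded_closed)
qed

lemma test_functionE:
  assumes "test_function V \<phi>"
  obtains K where "compact K" "K \<subseteq> V" "\<And>x. x \<notin> K \<Longrightarrow> \<phi> x = 0"
  using assms closure_subset[of "{x. \<phi> x \<noteq> 0}"] unfolding test_function_def by blast

lemma test_function_Ck: "test_function V \<phi> \<Longrightarrow> Ck_on k UNIV \<phi>"
  by (simp add: test_function_def smooth_on_def)

lemma pd_eq_0_outside:
  assumes "closed K" "\<And>x. x \<notin> K \<Longrightarrow> \<phi> x = 0" "x \<notin> K" shows "pd i \<phi> x = 0"
  using pd_cong[of "- K" x \<phi> "\<lambda>x. 0" i] assms by auto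

lemma test_function_pd:
  assumes "test_function V \<phi>"
  shows "test_function V (pd i \<phi>)"
proof -
  obtain K where K: "compact K" "K \<subseteq> V" "\<And>x. x \<notin> K \<Longrightarrow> \<phi> x = 0"
    using test_functionE[OF assms] by metis
  have "Ck_on k UNIV (pd i \<phi>)" for k
    using test_function_Ck[OF assms, of "Suc k"] by simp
  then show ?thesis
    by (rule test_functionI[OF _ K(1,2)]) (auto intro: pd_eq_0_outside K compact_imp_closed)
qed

lemma test_function_subset: "test_function V \<phi> \<Longrightarrow> V \<subseteq> V' \<Longrightarrow> test_function V' \<phi>"
  unfolding test_function_def by auto

section \<open>Integration by parts and mollifying kernels\<close>

lemma integrable_continuous_compact:
  fixes \<psi> :: "'a::euclidean_space \<Rightarrow> real"
  assumes "continuous_on UNIV \<psi>" "compact K" "\<And>x. x \<notin> K \<Longrightarrow> \<psi> x = 0"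
  shows "integrable lborel \<psi>"
proof -
  have "integrable lborel (\<lambda>x. indicator K x *\<^sub>R \<psi> x)"
    using assms by (intro borel_integrable_compact continuous_on_subset[OF assms(1)]) auto
  also have "(\<lambda>x. indicator K x *\<^sub>R \<psi> x) = \<psi>"
  proof (rule ext)
    show "indicator K x *\<^sub>R \<psi> x = \<psi> x" for x using assms(3) by (cases "x \<in> K") auto
  qed
  finally show ?thesis .
qed

lemma lborel_integral_eq_integral_cbox:
  fixes \<psi> :: "'a::euclidean_space \<Rightarrow> real"
  assumes "continuous_on UNIV \<psi>" "\<And>x. x \<notin> cbox a b \<Longrightarrow> \<psi> x = 0"
  shows "integral\<^sup>L lborel \<psi> = integral (cbox a b) \<psi>"
proof -
  have "(\<psi> has_integral integral\<^sup>L lborel \<psi>) UNIV"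
    using assms by (intro has_integral_integral_lborel integrable_continuous_compact[of _ "cbox a b"]) auto
  moreover have "(\<lambda>x. if x \<in> cbox a b then \<psi> x else 0) = \<psi>"
    using assms(2) by auto
  ultimately have "(\<psi> has_integral integral\<^sup>L lborel \<psi>) (cbox a b)"
    using has_integral_restrict_UNIV[of "cbox a b" \<psi>] by simp
  then show ?thesis by (simp add: integral_unique)
qed

lemma continuous_imp_borel_measurable:
  "continuous_on UNIV (\<psi>::plane \<Rightarrow> real) \<Longrightarrow> \<psi> \<in> borel_measurable borel"
  by (rule borel_measurable_continuous_onI)

lemma lborel_integral_translate:
  fixes \<psi> :: "'a::euclidean_space \<Rightarrow> real"
  assumes "\<psi> \<in> borel_measurable borel"
  shows "(LINT x|lborel. \<psi> (c + x)) = (LINT x|lborel. \<psi> x)"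
proof -
  have "(LINT x|lborel. \<psi> x) = (LINT x|distr lborel borel ((+) c). \<psi> x)"
    by (simp add: lborel_distr_plus)
  also have "\<dots> = (LINT x|lborel. \<psi> (c + x))"
    using assms by (subst integral_distr) auto
  finally show ?thesis by simp
qed

lemma lborel_integral_affine_plane:
  fixes \<psi> :: "plane \<Rightarrow> real"
  assumes [measurable]: "\<psi> \<in> borel_measurable borel" and "c \<noteq> 0"
  shows "(LINT x|lborel. \<psi> (t + c *\<^sub>R x)) = (LINT x|lborel. \<psi> x) / c\<^sup>2"
proof -
  have "(LINT x|lborel. \<psi> x) = (LINT x|density (distr lborel borel (\<lambda>x. t + c *\<^sub>R x)) (\<lambda>_. ennreal (\<bar>c\<bar> ^ DIM(plane))). \<psi> x)"
    by (subst lborel_affine[OF assms(2), of t]) simp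
  also have "\<dots> = c\<^sup>2 * (LINT x|lborel. \<psi> (t + c *\<^sub>R x))"
    by (subst integral_density) (auto simp: integral_distr)
  finally show ?thesis using assms(2) by (simp add: field_simps)
qed

lemma bounded_in_cbox:
  assumes "bounded (K::plane set)"
  obtains a where "a > 0" "K \<subseteq> cube 0 a"
proof -
  obtain a where "a > 0" "K \<subseteq> ball 0 a" using assms bounded_subset_ballD by blast
  then have "K \<subseteq> cube 0 a"
    using cball_subset_cube[of 0 a] by (auto intro: less_imp_le simp: subset_iff)
  with that \<open>a > 0\<close> show thesis by blast
qed

text \<open>By translation invariance the integral of \<psi>(x + t e) does not depend on t;
  differentiation under the integral at t = 0 gives the claim.\<close>

lemma integral_pd_eq_0:
  fixes \<psi> :: "plane \<Rightarrow> real"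
  assumes d: "\<And>x. \<psi> differentiable (at x)" and c: "continuous_on UNIV (pd i \<psi>)"
    and K: "compact K" "\<And>x. x \<notin> K \<Longrightarrow> \<psi> x = 0"
  shows "(LINT x|lborel. pd i \<psi> x) = 0"
proof -
  obtain a where a: "a > 0" "K \<subseteq> cube 0 a"
    using bounded_in_cbox compact_imp_bounded K(1) by blast
  \<comment> \<open>The margin 1 keeps the supports of all translates with |t| <= 1 inside the fixed
    square \<open>?Q\<close>.\<close>
  let ?e = "axis i 1 :: plane" let ?Q = "cube 0 (a + 1)"
  have cont: "continuous_on UNIV \<psi>"
    using d by (intro differentiable_imp_continuous_on differentiable_at_imp_differentiable_on) auto
  have out: "\<psi> (x + t *\<^sub>R ?e) = 0" if "\<bar>t\<bar> \<le> 1" "x \<notin> ?Q" for t x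
  proof (rule K(2), rule)
    assume "x + t *\<^sub>R ?e \<in> K"
    then have "x + t *\<^sub>R ?e \<in> cube 0 a" using a(2) by blast
    then have m: "\<bar>x $ j + (t *\<^sub>R ?e) $ j\<bar> \<le> a" for j by (simp add: mem_cube)
    have n: "\<bar>(t *\<^sub>R ?e) $ j\<bar> \<le> 1" for j using that(1) by (simp add: axis_def)
    have "\<bar>x $ j\<bar> \<le> a + 1" for j using m[of j] n[of j] by linarith
    then show False using that(2) by (simp add: mem_cube)
  qed
  have der: "((\<lambda>t. \<psi> (x + t *\<^sub>R ?e)) has_field_derivative pd i \<psi> (x + t *\<^sub>R ?e)) (at t within S)" for x t S
  proof -
    have "((\<lambda>t. \<psi> (x + t *\<^sub>R ?e)) has_derivative (\<lambda>s. grad \<psi> (x + t *\<^sub>R ?e) \<bullet> (s *\<^sub>R ?e))) (at t within S)"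
      by (rule has_derivative_compose[OF _ has_derivative_grad[OF d]]) (auto intro!: derivative_eq_intros)
    then show ?thesis by (simp add: has_field_derivative_def grad_def inner_axis mult_commute_abs)
  qed
  have G: "integral ?Q (\<lambda>x. \<psi> (x + t *\<^sub>R ?e)) = integral\<^sup>L lborel \<psi>" if "\<bar>t\<bar> \<le> 1" for t
  proof -
    have "continuous_on UNIV (\<lambda>x. \<psi> (x + t *\<^sub>R ?e))"
      by (intro continuous_on_compose2[OF cont]) (auto intro!: continuous_intros)
    then have "integral ?Q (\<lambda>x. \<psi> (x + t *\<^sub>R ?e)) = (LINT x|lborel. \<psi> (x + t *\<^sub>R ?e))"
      using out[OF that] unfolding cube_def by (intro lborel_integral_eq_integral_cbox[symmetric]) auto
    also have "\<dots> = integral\<^sup>L lborel \<psi>"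
      using lborel_integral_translate[of \<psi> "t *\<^sub>R ?e"] continuous_imp_borel_measurable[OF cont]
      by (simp add: add.commute)
    finally show ?thesis .
  qed
  have "((\<lambda>t. integral ?Q (\<lambda>x. \<psi> (x + t *\<^sub>R ?e))) has_field_derivative
      integral ?Q (\<lambda>x. pd i \<psi> (x + 0 *\<^sub>R ?e))) (at 0 within {-1<..<1})"
    unfolding cube_def
  proof (rule leibniz_rule_field_derivative)
    show "(\<lambda>x. \<psi> (x + t *\<^sub>R ?e)) integrable_on cbox ((0::plane) - (\<chi> i. a + 1)) (0 + (\<chi> i. a + 1))" for t
      by (intro integrable_continuous continuous_on_compose2[OF cont]) (auto intro!: continuous_intros)
    show "continuous_on ({-1<..<1} \<times> cbox ((0::plane) - (\<chi> i. a + 1)) (0 + (\<chi> i. a + 1))) (\<lambda>(t, x). pd i \<psi> (x + t *\<^sub>R ?e))"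
      unfolding split_beta by (intro continuous_on_compose2[OF c]) (auto intro!: continuous_intros)
  qed (auto intro: der)
  moreover have "((\<lambda>t. integral ?Q (\<lambda>x. \<psi> (x + t *\<^sub>R ?e))) has_field_derivative 0) (at 0 within {-1<..<1})"
    by (rule has_field_derivative_transform_within[OF DERIV_const[of "integral\<^sup>L lborel \<psi>"], of 1])
       (auto simp: G)
  ultimately have "integral ?Q (pd i \<psi>) = 0"
    using at_within_open[of "0::real" "{-1<..<1}"] by (simp add: DERIV_unique)
  moreover have "(LINT x|lborel. pd i \<psi> x) = integral ?Q (pd i \<psi>)"
    unfolding cube_def
  proof (rule lborel_integral_eq_integral_cbox[OF c])
    fix x :: plane assume "x \<notin> cbox (0 - (\<chi> i. a + 1)) (0 + (\<chi> i. a + 1))"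
    then have "x \<notin> K" using a cube_mono[of a "a+1" 0] unfolding cube_def[symmetric] by auto
    then show "pd i \<psi> x = 0" using K by (intro pd_eq_0_outside) (auto intro: compact_imp_closed)
  qed
  ultimately show ?thesis by simp
qed

text \<open>\<open>h\<close> is arbitrary off \<open>W\<close>. The product is continuous because
  \<open>W\<close> and the complement of \<open>K\<close> are open and cover the plane, and on the
  latter it is zero.\<close>

lemma continuous_on_extend_0:
  fixes h \<psi> :: "plane \<Rightarrow> real"
  assumes "open W" "continuous_on W h" "continuous_on UNIV \<psi>"
    and "compact K" "K \<subseteq> W" "\<And>x. x \<notin> K \<Longrightarrow> \<psi> x = 0"
  shows "continuous_on UNIV (\<lambda>x. h x * \<psi> x)"
proof -
  have "continuous_on (W \<union> - K) (\<lambda>x. h x * \<psi> x)"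
  proof (rule continuous_on_open_Un)
    show "continuous_on W (\<lambda>x. h x * \<psi> x)"
      by (intro continuous_intros assms continuous_on_subset[OF assms(3)]) auto
    show "continuous_on (- K) (\<lambda>x. h x * \<psi> x)"
      by (rule continuous_on_eq[of _ "\<lambda>x. 0"]) (use assms(6) in auto)
  qed (use assms in \<open>auto intro: compact_imp_closed\<close>)
  moreover have "W \<union> - K = UNIV" using assms by auto
  ultimately show ?thesis by simp
qed

lemma set_integral_lebesgue_eq_lborel:
  fixes \<psi> :: "plane \<Rightarrow> real"
  assumes "\<psi> \<in> borel_measurable borel" "\<And>x. x \<notin> W \<Longrightarrow> \<psi> x = 0"
  shows "(LINT x:W|lebesgue. \<psi> x) = (LINT x|lborel. \<psi> x)"
proof -
  have "(LINT x:W|lebesgue. \<psi> x) = (LINT x|lebesgue. \<psi> x)"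
    unfolding set_lebesgue_integral_def
    by (rule Bochner_Integration.integral_cong) (use assms(2) in \<open>auto simp: indicator_def\<close>)
  then show ?thesis using assms(1) by (simp add: integral_completion)
qed

text \<open>Only C^1 regularity on \<open>W\<close> is asked of \<phi>, because in the change of
  variables this role is played by a test function composed with a C^1 diffeomorphism.\<close>

lemma integral_by_parts:
  fixes h \<phi> :: "plane \<Rightarrow> real"
  assumes W: "open W" and h: "Ck_on 1 W h" and \<phi>: "Ck_on 1 W \<phi>"
    and K: "compact K" "K \<subseteq> W" "\<And>x. x \<notin> K \<Longrightarrow> \<phi> x = 0"
  shows "(LINT x|lborel. h x * pd i \<phi> x) = - (LINT x|lborel. pd i h x * \<phi> x)"
proof -
  have cl: "closed K" using K compact_imp_closed by blast
  have out: "pd i \<phi> x = 0" if "x \<notin> K" for x using that K(3) by (intro pd_eq_0_outside[OF cl]) auto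
  have d0: "\<phi> differentiable (at x)" for x
  proof (cases "x \<in> W")
    case True with \<phi> show ?thesis by simp
  next
    case False then show ?thesis
      using differentiable_cong[of "- K" x \<phi> "\<lambda>_. 0"] K cl by auto
  qed
  have c0: "continuous_on UNIV f" if "continuous_on W f" "\<And>x. x \<notin> K \<Longrightarrow> f x = 0" for f :: "plane \<Rightarrow> real"
  proof -
    have "continuous_on (W \<union> - K) f"
      by (rule continuous_on_open_Un)
         (use that W cl in \<open>auto intro: continuous_on_eq[of _ "\<lambda>x. 0"]\<close>)
    moreover have "W \<union> - K = UNIV" using K by auto
    ultimately show ?thesis by simp
  qed
  have c\<phi>: "continuous_on UNIV \<phi>" "continuous_on UNIV (pd i \<phi>)"
    using \<phi> Ck_on_continuous[OF \<phi>] by (auto intro!: c0 K(3) out)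
  have d: "(\<lambda>x. h x * \<phi> x) differentiable (at x)" for x
  proof (cases "x \<in> W")
    case True with h d0 show ?thesis by auto
  next
    case False
    then show ?thesis
      using differentiable_cong[of "- K" x "\<lambda>x. h x * \<phi> x" "\<lambda>_. 0"] K cl by auto
  qed
  have p: "pd i (\<lambda>x. h x * \<phi> x) x = h x * pd i \<phi> x + pd i h x * \<phi> x" for x
  proof (cases "x \<in> W")
    case True with h d0 show ?thesis by (auto simp: pd_mult)
  next
    case False
    then have "x \<notin> K" using K by auto
    moreover have "pd i (\<lambda>x. h x * \<phi> x) x = 0"
      using K(3) \<open>x \<notin> K\<close> by (intro pd_eq_0_outside[OF cl]) auto
    ultimately show ?thesis using out K(3) by simp
  qed
  have c1: "continuous_on UNIV (\<lambda>x. h x * pd i \<phi> x)"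
    using h by (intro continuous_on_extend_0[OF W _ c\<phi>(2) K(1,2) out] Ck_on_continuous[where k=1])
  have c2: "continuous_on UNIV (\<lambda>x. pd i h x * \<phi> x)"
    using h by (intro continuous_on_extend_0[OF W _ c\<phi>(1) K]) auto
  have "(LINT x|lborel. h x * pd i \<phi> x) + (LINT x|lborel. pd i h x * \<phi> x)
      = (LINT x|lborel. h x * pd i \<phi> x + pd i h x * \<phi> x)"
    by (rule Bochner_Integration.integral_add[symmetric];
        rule integrable_continuous_compact[OF _ K(1)]) (use c1 c2 out K(3) in auto)
  also have "\<dots> = (LINT x|lborel. pd i (\<lambda>x. h x * \<phi> x) x)"
    by (simp add: p)
  also have "\<dots> = 0"
    by (rule integral_pd_eq_0[OF d _ K(1)])
       (use p c1 c2 K(3) in \<open>auto intro!: continuous_intros simp: fun_eq_iff cong: continuous_on_cong\<close>)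
  finally show ?thesis by simp
qed

text \<open>Equality of mixed partials is read off from the mean value theorem applied to a second
  difference in both orders.\<close>

lemma second_difference_mean_value:
  fixes f :: "plane \<Rightarrow> real"
  assumes f: "Ck_on 2 UNIV f" and "s > 0"
  shows "\<exists>y\<in>cube x (2 * s). f (x + s *\<^sub>R axis i 1 + s *\<^sub>R axis j 1) - f (x + s *\<^sub>R axis i 1) - f (x + s *\<^sub>R axis j 1) + f x
     = s\<^sup>2 * pd j (pd i f) y"
proof -
  have d: "f differentiable (at y)" "pd i f differentiable (at y)" for y
    using f by (auto simp: numeral_2_eq_2)
  have dline: "((\<lambda>t. h (y + t *\<^sub>R axis k 1)) has_real_derivative pd k h (y + t *\<^sub>R axis k 1)) (at t)"
    if "\<And>y. h differentiable (at y)" for h :: "plane \<Rightarrow> real" and y k t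
  proof -
    have "((\<lambda>t. h (y + t *\<^sub>R axis k 1)) has_derivative (\<lambda>s. grad h (y + t *\<^sub>R axis k 1) \<bullet> (s *\<^sub>R axis k 1))) (at t)"
      by (rule has_derivative_compose[OF _ has_derivative_grad[OF that]]) (auto intro!: derivative_eq_intros)
    then show ?thesis by (simp add: has_field_derivative_def grad_def inner_axis mult_commute_abs)
  qed
  let ?g = "\<lambda>t. f ((x + s *\<^sub>R axis j 1) + t *\<^sub>R axis i 1) - f (x + t *\<^sub>R axis i 1)"
  have "\<exists>z. 0 < z \<and> z < s \<and> ?g s - ?g 0 = (s - 0) * (pd i f ((x + s *\<^sub>R axis j 1) + z *\<^sub>R axis i 1) - pd i f (x + z *\<^sub>R axis i 1))"
    using \<open>s > 0\<close> by (intro MVT2) (auto intro!: derivative_eq_intros dline d)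
  then obtain z where z: "0 < z" "z < s" "?g s - ?g 0 = s * (pd i f ((x + s *\<^sub>R axis j 1) + z *\<^sub>R axis i 1) - pd i f (x + z *\<^sub>R axis i 1))"
    by auto
  let ?k = "\<lambda>t. pd i f ((x + z *\<^sub>R axis i 1) + t *\<^sub>R axis j 1)"
  have "\<exists>w. 0 < w \<and> w < s \<and> ?k s - ?k 0 = (s - 0) * pd j (pd i f) ((x + z *\<^sub>R axis i 1) + w *\<^sub>R axis j 1)"
    using \<open>s > 0\<close> by (intro MVT2) (auto intro!: dline d)
  then obtain w where w: "0 < w" "w < s" "?k s - ?k 0 = s * pd j (pd i f) ((x + z *\<^sub>R axis i 1) + w *\<^sub>R axis j 1)"
    by auto
  let ?y = "(x + z *\<^sub>R axis i 1) + w *\<^sub>R axis j 1"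
  have "?y \<in> cube x (2 * s)" using z w by (auto simp: mem_cube axis_def)
  moreover have "f (x + s *\<^sub>R axis i 1 + s *\<^sub>R axis j 1) - f (x + s *\<^sub>R axis i 1) - f (x + s *\<^sub>R axis j 1) + f x
     = ?g s - ?g 0"
    by (simp add: algebra_simps)
  moreover have "?g s - ?g 0 = s * (?k s - ?k 0)"
    unfolding z(3) by (simp add: algebra_simps)
  then have "?g s - ?g 0 = s\<^sup>2 * pd j (pd i f) ?y" unfolding w(3) by (simp add: power2_eq_square)
  ultimately show ?thesis by metis
qed

lemma pd_commute:
  fixes f :: "plane \<Rightarrow> real"
  assumes f: "Ck_on 2 UNIV f"
  shows "pd i (pd j f) x = pd j (pd i f) x"
proof (rule ccontr)
  assume ne: "pd i (pd j f) x \<noteq> pd j (pd i f) x"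
  let ?a = "pd i (pd j f)" and ?b = "pd j (pd i f)"
  define e where "e = \<bar>?a x - ?b x\<bar> / 2"
  have e: "e > 0" using ne by (simp add: e_def)
  have "continuous_on UNIV ?a" "continuous_on UNIV ?b" using f by (auto simp: numeral_2_eq_2)
  then have c: "isCont ?a x" "isCont ?b x" by (auto simp: continuous_on_eq_continuous_at)
  obtain d1 where d1: "d1 > 0" "\<And>y. dist y x < d1 \<Longrightarrow> dist (?a y) (?a x) < e"
    using c(1) e unfolding continuous_at_eps_delta by meson
  obtain d2 where d2: "d2 > 0" "\<And>y. dist y x < d2 \<Longrightarrow> dist (?b y) (?b x) < e"
    using c(2) e unfolding continuous_at_eps_delta by meson
  \<comment> \<open>The mean value points lie in \<open>cube x (2 * s)\<close>, hence within
    distance 4 s, half of \<open>min d1 d2\<close>, of \<open>x\<close>.\<close>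
  define s where "s = min d1 d2 / 8"
  have s: "s > 0" using d1 d2 by (simp add: s_def)
  have near: "dist y x < d1" "dist y x < d2" if "y \<in> cube x (2 * s)" for y
    using cube_subset_cball[of x "2 * s"] that d1 d2 by (auto simp: s_def dist_commute min_def split: if_splits)
  obtain y where y: "y \<in> cube x (2 * s)" "f (x + s *\<^sub>R axis i 1 + s *\<^sub>R axis j 1) - f (x + s *\<^sub>R axis i 1) - f (x + s *\<^sub>R axis j 1) + f x = s\<^sup>2 * ?b y"
    using second_difference_mean_value[OF f s] by blast
  obtain z where z: "z \<in> cube x (2 * s)" "f (x + s *\<^sub>R axis j 1 + s *\<^sub>R axis i 1) - f (x + s *\<^sub>R axis j 1) - f (x + s *\<^sub>R axis i 1) + f x = s\<^sup>2 * ?a z"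
    using second_difference_mean_value[OF f s] by blast
  have "f (x + s *\<^sub>R axis j 1 + s *\<^sub>R axis i 1) = f (x + s *\<^sub>R axis i 1 + s *\<^sub>R axis j 1)"
    by (simp add: ac_simps)
  with y(2) z(2) have "s\<^sup>2 * ?b y = s\<^sup>2 * ?a z" by linarith
  with s have "?b y = ?a z" by simp
  with d1(2)[OF near(1)[OF z(1)]] d2(2)[OF near(2)[OF y(1)]]
  show False by (simp add: e_def dist_real_def abs_if field_simps split: if_splits)
qed

section \<open>Mollifying kernels\<close>

definition kernel :: "real \<Rightarrow> plane \<Rightarrow> real" where
  "kernel r w = bump 0 1 (w /\<^sub>R r) / (r\<^sup>2 * (LINT x|lborel. bump 0 1 x))"

lemma bump_eq_0: "x \<notin> cube c r \<Longrightarrow> bump c r x = 0"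
  using bump_pos_iff[of c r x] bump_nonneg[of c r x] unfolding mem_cube by (metis less_imp_le order_le_less)

lemma bump_continuous: "continuous_on UNIV (bump c r)"
  using Ck_on_bump Ck_on_continuous by blast

lemma bump_measurable [measurable]: "bump c r \<in> borel_measurable borel"
  using bump_continuous continuous_imp_borel_measurable by blast

text \<open>A nonnegative function with zero integral vanishes almost everywhere, whereas
  \<open>bump 0 1\<close> is positive on a nonempty open set.\<close>

lemma bump_integral_pos: "(LINT x|lborel. bump 0 1 x) > 0"
proof -
  have int: "integrable lborel (bump 0 1)"
    by (rule integrable_continuous_compact[OF bump_continuous compact_cube[of 0 1] bump_eq_0])
  have "(LINT x|lborel. bump 0 1 x) \<noteq> 0"
  proof
    assume "(LINT x|lborel. bump 0 1 x) = 0"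
    then have "AE x in lborel. bump 0 1 x = 0"
      using integral_nonneg_eq_0_iff_AE[OF int] by (simp add: bump_nonneg)
    then have "AE x in lebesgue. x \<notin> {x. bump 0 1 x > 0}"
      by (auto dest: AE_completion elim: eventually_mono)
    then have "negligible {x. bump 0 1 x > 0}"
      by (simp add: AE_iff_null_sets negligible_iff_null_sets eventually_ae_filter)
    moreover have "open {x. bump 0 1 x > 0}"
      by (intro open_Collect_less continuous_intros bump_continuous)
    moreover have "0 \<in> {x. bump 0 1 x > 0}" by (simp add: bump_pos_iff)
    ultimately show False using open_not_negligible by blast
  qed
  moreover have "(LINT x|lborel. bump 0 1 x) \<ge> 0" by (intro integral_nonneg_AE) (simp add: bump_nonneg)
  ultimately show ?thesis by linarith
qed

lemma kernel_nonneg: "kernel r w \<ge> 0"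
  unfolding kernel_def using bump_integral_pos by (auto intro!: divide_nonneg_nonneg bump_nonneg)

lemma kernel_minus: "kernel r (- w) = kernel r w"
  unfolding kernel_def bump_def by (simp add: mult.commute)

lemma Ck_on_kernel: "Ck_on k UNIV (kernel r)"
proof -
  have "Ck_on k UNIV (\<lambda>x. bump 0 1 ((1 / r) *\<^sub>R x + 0) * (1 / (r\<^sup>2 * (LINT x|lborel. bump 0 1 x))))"
    by (intro Ck_on_mult Ck_on_const Ck_on_affine Ck_on_bump open_UNIV)
  moreover have "(\<lambda>x. bump 0 1 ((1 / r) *\<^sub>R x + 0) * (1 / (r\<^sup>2 * (LINT x|lborel. bump 0 1 x)))) = kernel r"
    by (auto simp: kernel_def fun_eq_iff divide_inverse)
  ultimately show ?thesis by simp
qed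

lemma Ck_on_kernel_shift: "Ck_on k UNIV (\<lambda>z. kernel r (x - z))"
  using Ck_on_affine[OF Ck_on_kernel, of k r "-1" x] by simp

lemma kernel_eq_0: "r > 0 \<Longrightarrow> w \<notin> cube 0 r \<Longrightarrow> kernel r w = 0"
  unfolding kernel_def by (auto simp: mem_cube abs_mult field_simps intro!: bump_eq_0)

lemma kernel_continuous: "continuous_on UNIV (kernel r)"
  using Ck_on_kernel Ck_on_continuous by blast

lemma kernel_measurable [measurable]: "kernel r \<in> borel_measurable borel"
  using kernel_continuous continuous_imp_borel_measurable by blast

lemma kernel_integral:
  assumes "r > 0" shows "(LINT w|lborel. kernel r w) = 1"
proof -
  let ?N = "LINT x|lborel. bump 0 1 x"
  have "(LINT w|lborel. kernel r w) = (LINT w|lborel. bump 0 1 (0 + (1 / r) *\<^sub>R w)) / (r\<^sup>2 * ?N)"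
    by (simp add: kernel_def inverse_eq_divide)
  also have "\<dots> = (?N / (1 / r)\<^sup>2) / (r\<^sup>2 * ?N)"
    using assms by (subst lborel_integral_affine_plane) auto
  also have "\<dots> = 1" using assms bump_integral_pos by (simp add: power_one_over)
  finally show ?thesis .
qed

lemma kernel_integral_shift: "r > 0 \<Longrightarrow> (LINT z|lborel. kernel r (x - z)) = 1"
proof -
  assume "r > 0"
  have "(LINT z|lborel. kernel r (x - z)) = (LINT z|lborel. kernel r (- x + z))"
    by (metis kernel_minus minus_diff_eq uminus_add_conv_diff)
  then show ?thesis using lborel_integral_translate[of "kernel r" "- x"] kernel_integral[OF \<open>r > 0\<close>] by simp
qed

lemma test_function_kernel:
  assumes "r > 0" "cube x r \<subseteq> W"
  shows "test_function W (\<lambda>z. kernel r (x - z))"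
proof (rule test_functionI[OF Ck_on_kernel_shift compact_cube assms(2)])
  fix z assume "z \<notin> cube x r"
  then have "x - z \<notin> cube 0 r" by (simp add: mem_cube abs_minus_commute)
  with assms(1) show "kernel r (x - z) = 0" by (rule kernel_eq_0)
qed

section \<open>Radon measures and densities\<close>

lemma borel_measurable_transfer:
  "sets M = sets borel \<Longrightarrow> f \<in> borel_measurable borel \<Longrightarrow> f \<in> borel_measurable M"
  using measurable_cong_sets by blast

section \<open>Countable sums of measures\<close>

definition sum_measure :: "(nat \<Rightarrow> plane measure) \<Rightarrow> plane measure" where
  "sum_measure M = measure_of UNIV (sets borel) (\<lambda>A. \<Sum>n. emeasure (M n) A)"

lemma sets_sum_measure [simp, measurable_cong]: "sets (sum_measure M) = sets borel"
  unfolding sum_measure_def using sets.sigma_sets_eq[of "borel :: plane measure"] by simp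

lemma space_sum_measure [simp]: "space (sum_measure M) = UNIV"
  using sets_eq_imp_space_eq[OF sets_sum_measure] by simp

lemma suminf_commute_ennreal: "(\<Sum>i. \<Sum>n. f i n) = (\<Sum>n. \<Sum>i. f i n :: ennreal)" for f :: "nat \<Rightarrow> nat \<Rightarrow> ennreal"
proof -
  have "(\<integral>\<^sup>+n. (\<Sum>i. f i n) \<partial>count_space UNIV) = (\<Sum>i. \<integral>\<^sup>+n. f i n \<partial>count_space UNIV)"
    by (rule nn_integral_suminf) simp
  then show ?thesis by (simp add: nn_integral_count_space_nat)
qed

lemma emeasure_sum_measure:
  assumes M: "\<And>n. sets (M n) = sets borel" and A: "A \<in> sets borel"
  shows "emeasure (sum_measure M) A = (\<Sum>n. emeasure (M n) A)"
proof (rule emeasure_measure_of[OF sum_measure_def])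
  show "positive (sets (sum_measure M)) (\<lambda>A. \<Sum>n. emeasure (M n) A)"
    by (simp add: positive_def)
  show "countably_additive (sets (sum_measure M)) (\<lambda>A. \<Sum>n. emeasure (M n) A)"
  proof (rule countably_additiveI)
    fix B :: "nat \<Rightarrow> plane set"
    assume B: "range B \<subseteq> sets (sum_measure M)" "disjoint_family B"
    have "(\<Sum>i. emeasure (M n) (B i)) = emeasure (M n) (\<Union>i. B i)" for n
      using B M by (intro suminf_emeasure) auto
    then show "(\<Sum>i. \<Sum>n. emeasure (M n) (B i)) = (\<Sum>n. emeasure (M n) (\<Union>i. B i))"
      by (subst suminf_commute_ennreal) simp
  qed
qed (use A in auto)

lemma nn_integral_sum_measure:
  assumes M: "\<And>n. sets (M n) = sets borel" and f: "f \<in> borel_measurable borel"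
  shows "(\<integral>\<^sup>+x. f x \<partial>sum_measure M) = (\<Sum>n. \<integral>\<^sup>+x. f x \<partial>M n)"
  using f
proof (induction f rule: borel_measurable_induct)
  case (cong f g)
  then have "f = g" by (auto simp: fun_eq_iff)
  with cong show ?case by simp
next
  case (set A)
  then show ?case using M by (simp add: emeasure_sum_measure)
next
  case (mult u c)
  then have "u \<in> borel_measurable (M n)" for n using mult by (auto intro: borel_measurable_transfer[OF M])
  moreover have "u \<in> borel_measurable (sum_measure M)" using mult by simp
  ultimately show ?case using mult by (simp add: nn_integral_cmult ennreal_suminf_cmult)
next
  case (add u v)
  then have "u \<in> borel_measurable (M n)" "v \<in> borel_measurable (M n)" for n using add by (auto intro: borel_measurable_transfer[OF M])
  moreover have "u \<in> borel_measurable (sum_measure M)" "v \<in> borel_measurable (sum_measure M)"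
    using add by auto
  ultimately show ?case using add by (simp add: nn_integral_add suminf_add[symmetric])
next
  case (seq U)
  have m: "U i \<in> borel_measurable (M n)" for i n by (rule borel_measurable_transfer[OF M seq(1)])
  have m': "U i \<in> borel_measurable (sum_measure M)" for i
    using seq(1) by simp
  have "(\<integral>\<^sup>+x. (SUP i. U i x) \<partial>sum_measure M) = (SUP i. \<integral>\<^sup>+x. U i x \<partial>sum_measure M)"
    by (rule nn_integral_monotone_convergence_SUP) (use seq m' in auto)
  \<comment> \<open>The series over n is read as an integral against counting measure, so that
    exchanging it with the supremum is monotone convergence once more.\<close>
  also have "\<dots> = (SUP i. \<integral>\<^sup>+n. (\<integral>\<^sup>+x. U i x \<partial>M n) \<partial>count_space UNIV)"
    using seq by (simp add: nn_integral_count_space_nat)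
  also have "\<dots> = (\<integral>\<^sup>+n. (SUP i. \<integral>\<^sup>+x. U i x \<partial>M n) \<partial>count_space UNIV)"
    using seq by (intro nn_integral_monotone_convergence_SUP[symmetric])
      (auto simp: incseq_def le_fun_def intro!: nn_integral_mono)
  also have "(\<lambda>n. SUP i. \<integral>\<^sup>+x. U i x \<partial>M n) = (\<lambda>n. \<integral>\<^sup>+x. (SUP i. U i x) \<partial>M n)"
    by (intro ext nn_integral_monotone_convergence_SUP[symmetric]) (use seq m in auto)
  finally show ?case by (simp add: nn_integral_count_space_nat image_comp)
qed

text \<open>The measures from index \<open>k\<close> on do not see \<phi>, which is what a locally
  finite partition of unity provides on a compact support. The positive and negative parts thus
  become finite sums of finite numbers and may be subtracted.\<close>

lemma integral_sum_measure:
  fixes \<phi> :: "plane \<Rightarrow> real"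
  assumes M: "\<And>n. sets (M n) = sets borel" and \<phi>: "\<phi> \<in> borel_measurable borel"
    and int: "\<And>n. integrable (M n) \<phi>" and fin: "\<And>n. n \<ge> k \<Longrightarrow> (\<integral>\<^sup>+x. ennreal \<bar>\<phi> x\<bar> \<partial>M n) = 0"
  shows "integrable (sum_measure M) \<phi>" "(LINT x|sum_measure M. \<phi> x) = (\<Sum>n<k. LINT x|M n. \<phi> x)"
proof -
  have suminf: "(\<integral>\<^sup>+x. f x \<partial>sum_measure M) = (\<Sum>n<k. \<integral>\<^sup>+x. f x \<partial>M n)"
    if "f \<in> borel_measurable borel" "\<And>x. f x \<le> ennreal \<bar>\<phi> x\<bar>" for f
  proof -
    have "(\<integral>\<^sup>+x. f x \<partial>M n) = 0" if "n \<ge> k" for n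
      using nn_integral_mono[of "M n" f "\<lambda>x. ennreal \<bar>\<phi> x\<bar>"] \<open>\<And>x. f x \<le> ennreal \<bar>\<phi> x\<bar>\<close> fin[OF that] by simp
    then show ?thesis
      using that(1) by (subst nn_integral_sum_measure[OF M]) (auto intro!: suminf_finite simp: not_less[symmetric])
  qed
  have fin': "(\<integral>\<^sup>+x. f x \<partial>M n) < \<infinity>" if "\<And>x. f x \<le> ennreal \<bar>\<phi> x\<bar>" for f n
    using int[of n] nn_integral_mono[of "M n" f "\<lambda>x. ennreal \<bar>\<phi> x\<bar>"] that
    by (auto simp: integrable_iff_bounded intro: le_less_trans)
  have "(\<integral>\<^sup>+x. ennreal \<bar>\<phi> x\<bar> \<partial>sum_measure M) < \<infinity>"
    using suminf[of "\<lambda>x. ennreal \<bar>\<phi> x\<bar>"] fin' \<phi> by (simp add: ennreal_sum_less_top)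
  then show int': "integrable (sum_measure M) \<phi>"
    using \<phi> by (subst integrable_iff_bounded) auto
  have le: "ennreal (\<phi> x) \<le> ennreal \<bar>\<phi> x\<bar>" "ennreal (- \<phi> x) \<le> ennreal \<bar>\<phi> x\<bar>" for x
    by (auto intro!: ennreal_leI)
  have "(LINT x|sum_measure M. \<phi> x) = enn2real (\<Sum>n<k. \<integral>\<^sup>+x. ennreal (\<phi> x) \<partial>M n) - enn2real (\<Sum>n<k. \<integral>\<^sup>+x. ennreal (- \<phi> x) \<partial>M n)"
    using \<phi> le by (simp add: real_lebesgue_integral_def[OF int'] suminf)
  also have "\<dots> = (\<Sum>n<k. enn2real (\<integral>\<^sup>+x. ennreal (\<phi> x) \<partial>M n)) - (\<Sum>n<k. enn2real (\<integral>\<^sup>+x. ennreal (- \<phi> x) \<partial>M n))"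
    using fin'[OF le(1)] fin'[OF le(2)] by (simp add: enn2real_sum)
  also have "\<dots> = (\<Sum>n<k. LINT x|M n. \<phi> x)"
    by (simp add: real_lebesgue_integral_def[OF int] sum_subtractf)
  finally show "(LINT x|sum_measure M. \<phi> x) = (\<Sum>n<k. LINT x|M n. \<phi> x)" .
qed

text \<open>Padding with null measures makes the binary sum an instance of
  \<open>sum_measure\<close>, from which its properties are inherited.\<close>

definition add_measure :: "plane measure \<Rightarrow> plane measure \<Rightarrow> plane measure" where
  "add_measure M N = sum_measure (\<lambda>n. if n = 0 then M else if n = 1 then N else null_measure borel)"

lemma sets_add_measure [simp, measurable_cong]: "sets (add_measure M N) = sets borel"
  by (simp add: add_measure_def)

lemma space_add_measure [simp]: "space (add_measure M N) = UNIV"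
  by (simp add: add_measure_def)

lemma suminf_two:
  "(\<Sum>n. f n) = f 0 + f 1" if "\<And>n. n \<ge> 2 \<Longrightarrow> f n = 0" for f :: "nat \<Rightarrow> ennreal"
proof -
  have "(\<Sum>n. f n) = (\<Sum>n<2. f n)" by (rule suminf_finite) (use that in auto)
  then show ?thesis by (simp add: numeral_2_eq_2)
qed

lemma emeasure_add_measure:
  assumes "sets M = sets borel" "sets N = sets borel" "A \<in> sets borel"
  shows "emeasure (add_measure M N) A = emeasure M A + emeasure N A"
  unfolding add_measure_def using assms by (subst emeasure_sum_measure) (auto simp: suminf_two)

lemma integrable_add_measure:
  fixes \<phi> :: "plane \<Rightarrow> real"
  assumes "sets M = sets borel" "sets N = sets borel" "integrable M \<phi>" "integrable N \<phi>"
  shows "integrable (add_measure M N) \<phi>"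
    "(LINT x|add_measure M N. \<phi> x) = (LINT x|M. \<phi> x) + (LINT x|N. \<phi> x)"
proof -
  let ?S = "\<lambda>n::nat. if n = 0 then M else if n = 1 then N else null_measure borel"
  have m: "\<phi> \<in> borel_measurable borel"
    using borel_measurable_integrable[OF assms(3)] unfolding measurable_cong_sets[OF assms(1) refl] .
  have "integrable (null_measure borel) \<phi>"
    by (rule integrableI_bounded) (use m in \<open>auto simp: nn_integral_null_measure\<close>)
  then have i: "integrable (?S n) \<phi>" for n
    using assms(3,4) by simp
  have s: "sets (?S n) = sets borel" for n using assms by auto
  have z: "n \<ge> 2 \<Longrightarrow> (\<integral>\<^sup>+x. ennreal \<bar>\<phi> x\<bar> \<partial>?S n) = 0" for n by (auto simp: nn_integral_null_measure)
  show "integrable (add_measure M N) \<phi>"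
    unfolding add_measure_def by (rule integral_sum_measure(1)[OF s m i z])
  show "(LINT x|add_measure M N. \<phi> x) = (LINT x|M. \<phi> x) + (LINT x|N. \<phi> x)"
    unfolding add_measure_def by (subst integral_sum_measure(2)[OF s m i z]) (auto simp: numeral_2_eq_2)
qed

lemma finite_measure_add_measure:
  assumes "sets M = sets borel" "sets N = sets borel" "finite_measure M" "finite_measure N"
  shows "finite_measure (add_measure M N)"
proof
  have "space M = UNIV" "space N = UNIV"
    using assms(1,2) by (auto dest: sets_eq_imp_space_eq)
  then show "emeasure (add_measure M N) (space (add_measure M N)) \<noteq> \<infinity>"
    using finite_measure.emeasure_finite[OF assms(3)] finite_measure.emeasure_finite[OF assms(4)] assms
    by (simp add: emeasure_add_measure)
qed

lemma integrable_compact_support: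
  fixes \<phi> :: "plane \<Rightarrow> real"
  assumes "sets M = sets borel" "continuous_on UNIV \<phi>" "compact K" "\<And>x. x \<notin> K \<Longrightarrow> \<phi> x = 0"
    and "emeasure M K < \<infinity>"
  shows "integrable M \<phi>"
proof -
  have "bounded (\<phi> ` K)"
    using assms by (intro compact_imp_bounded compact_continuous_image continuous_on_subset[OF assms(2)]) auto
  then obtain B where B: "\<And>x. x \<in> K \<Longrightarrow> norm (\<phi> x) \<le> B" by (auto simp: bounded_iff)
  have "K \<in> sets M" using assms(1) borel_compact[OF assms(3)] by simp
  then show ?thesis
    by (rule integrableI_bounded_set[OF _ borel_measurable_transfer[OF assms(1) continuous_imp_borel_measurable[OF assms(2)]] assms(5)])
       (use assms(4) B in blast)+
qed

lemma emeasure_lborel_cube: "r \<ge> 0 \<Longrightarrow> emeasure lborel (cube c r) = ennreal (4 * r\<^sup>2)"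
  unfolding cube_def
  by (subst emeasure_lborel_cbox_eq)
     (auto simp: Basis_vec_def inner_axis axis_eq_axis UNIV_2_eq power2_eq_square algebra_simps)

text \<open>The Vitali covering theorem is applied inside an open set that avoids a compact set carrying
  almost all of the mass.\<close>

lemma negligible_positive_upper_density:
  fixes M :: "plane measure"
  assumes M: "sets M = sets borel" and fin: "emeasure M V < \<infinity>"
    and V: "open V" and E: "E \<in> sets borel" "emeasure M (E \<inter> V) = 0" and t: "t > 0"
  shows "negligible {x \<in> E \<inter> V. \<forall>d>0. \<exists>r. 0 < r \<and> r < d \<and> emeasure M (cball x r) > ennreal (t * r\<^sup>2)}"
    (is "negligible ?S")
  unfolding negligible_outer_le
proof (intro allI impI)
  fix e :: real assume e: "e > 0"
  \<comment> \<open>A selected ball has area at most 4 r^2, hence at most 4 / t times its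
    \<open>M\<close>-mass. Disjoint balls of total mass at most \<eta> thus have total area at most
    \<open>e\<close>.\<close>
  define \<eta> where "\<eta> = e * t / 4"
  have \<eta>: "\<eta> > 0" using e t by (simp add: \<eta>_def)
  \<comment> \<open>Restriction to \<open>V\<close> yields a finite measure, to which inner
    regularity by compact sets applies.\<close>
  define M' where "M' = density M (indicator V)"
  have M': "sets M' = sets borel" using M by (simp add: M'_def)
  have V': "V \<in> sets M" using M V by simp
  have em: "emeasure M' A = emeasure M (V \<inter> A)" if "A \<in> sets borel" for A
    unfolding M'_def using V' that M
    by (subst emeasure_density) (auto simp: indicator_inter_arith[symmetric] nn_integral_indicator)
  have spM': "space M' = UNIV" using M' by (auto dest: sets_eq_imp_space_eq)
  interpret M': finite_measure M'
    by standard (use em[of UNIV] fin spM' in auto)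
  have VE: "V - E \<in> sets borel" using V E by auto
  have "\<exists>K. K \<subseteq> V - E \<and> compact K \<and> measure M' (V - E) \<le> measure M' K + \<eta>"
  proof (cases "measure M' (V - E) \<le> \<eta>")
    case True
    then show ?thesis by (intro exI[of _ "{}"]) auto
  next
    case False
    have "emeasure M' (V - E) = (SUP K \<in> {K. K \<subseteq> V - E \<and> compact K}. emeasure M' K)"
      using VE by (intro inner_regular M') (auto simp: M'.emeasure_eq_measure)
    moreover have "ennreal (measure M' (V - E) - \<eta>) < emeasure M' (V - E)"
      using False \<eta> by (simp add: M'.emeasure_eq_measure ennreal_lessI)
    ultimately obtain K where "K \<subseteq> V - E" "compact K" "ennreal (measure M' (V - E) - \<eta>) < emeasure M' K"
      by (auto simp: less_SUP_iff)
    then show ?thesis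
      using False by (intro exI[of _ K]) (auto simp: M'.emeasure_eq_measure ennreal_less_iff)
  qed
  then obtain K where K: "K \<subseteq> V - E" "compact K" "measure M' (V - E) \<le> measure M' K + \<eta>"
    by blast
  have Kb: "K \<in> sets M'" using borel_compact[OF K(2)] M' by simp
  have VE': "V - E \<in> sets M'" using VE M' by auto
  have EV: "E \<inter> V \<in> sets M'" using E V M' by auto
  have small: "emeasure M (V - K) \<le> ennreal \<eta>"
  proof -
    have "measure M' (E \<inter> V) = 0"
      using em[of "E \<inter> V"] E V by (simp add: measure_def Int_ac)
    moreover have "measure M' ((V - E) - K) = measure M' (V - E) - measure M' K"
      by (rule M'.finite_measure_Diff) (use VE' Kb K in auto)
    moreover have "measure M' (V - K) \<le> measure M' ((E \<inter> V) \<union> ((V - E) - K))"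
      by (rule M'.finite_measure_mono) (use VE' Kb EV in auto)
    moreover have "measure M' ((E \<inter> V) \<union> ((V - E) - K)) \<le> measure M' (E \<inter> V) + measure M' ((V - E) - K)"
      by (rule measure_Un_le) (use VE' Kb EV in auto)
    ultimately have "measure M' (V - K) \<le> \<eta>" using K(3) by linarith
    then have "emeasure M' (V - K) \<le> ennreal \<eta>" by (simp add: M'.emeasure_eq_measure ennreal_leI)
    moreover have "V \<inter> (V - K) = V - K" by auto
    ultimately show ?thesis using em[of "V - K"] V Kb M' by auto
  qed
  \<comment> \<open>Points of \<open>?S\<close> belong to \<open>E\<close> and so avoid
    \<open>K\<close>; the open set \<open>V - K\<close> leaves room for arbitrarily small balls
    around each of them, as Vitali covering demands.\<close>
  define I where "I = {(x, r). x \<in> ?S \<and> r > 0 \<and> cball x r \<subseteq> V - K \<and> emeasure M (cball x r) > ennreal (t * r\<^sup>2)}"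
  have "open (V - K)" using V K by (auto intro: compact_imp_closed)
  obtain C where C: "countable C" "C \<subseteq> I"
    "pairwise (\<lambda>i j. disjnt (cball (fst i) (snd i)) (cball (fst j) (snd j))) C"
    "negligible (?S - (\<Union>i\<in>C. cball (fst i) (snd i)))"
  proof (rule Vitali_covering_theorem_cballs[of I snd ?S fst])
    show "0 < snd i" if "i \<in> I" for i using that by (auto simp: I_def)
    fix x d assume x: "x \<in> ?S" and d: "(0::real) < d"
    then have "x \<in> V - K" using K(1) by auto
    with \<open>open (V - K)\<close> obtain e' where e': "e' > 0" "cball x e' \<subseteq> V - K"
      using open_contains_cball by blast
    obtain r where r: "0 < r" "r < min d e'" "emeasure M (cball x r) > ennreal (t * r\<^sup>2)"
      using x d e' by (auto dest!: spec[of _ "min d e'"])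
    have "cball x r \<subseteq> cball x e'" using r by auto
    with x r e' show "\<exists>i. i \<in> I \<and> x \<in> cball (fst i) (snd i) \<and> snd i < d"
      by (intro exI[of _ "(x, r)"]) (auto simp: I_def)
  qed blast
  let ?B = "\<lambda>i::plane \<times> real. cball (fst i) (snd i)"
  let ?U = "\<Union>i\<in>C. ?B i"
  have disj: "disjoint_family_on ?B C"
    using C(3) by (auto simp: disjoint_family_on_def pairwise_def disjnt_def)
  have "emeasure lborel ?U = (\<integral>\<^sup>+i. emeasure lborel (?B i) \<partial>count_space C)"
    by (rule emeasure_UN_countable[OF _ C(1) disj]) auto
  also have "\<dots> \<le> (\<integral>\<^sup>+i. ennreal (4 / t) * emeasure M (?B i) \<partial>count_space C)"
  proof (rule nn_integral_mono)
    fix i assume "i \<in> space (count_space C)"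
    then have "i \<in> I" using C by auto
    then have i: "snd i > 0" "emeasure M (?B i) > ennreal (t * (snd i)\<^sup>2)" by (auto simp: I_def)
    have "emeasure lborel (?B i) \<le> emeasure lborel (cube (fst i) (snd i))"
      by (intro emeasure_mono cball_subset_cube) auto
    also have "\<dots> = ennreal (4 * (snd i)\<^sup>2)"
      using i by (simp add: emeasure_lborel_cube)
    also have "\<dots> = ennreal (4 / t) * ennreal (t * (snd i)\<^sup>2)"
      using t by (simp add: ennreal_mult[symmetric])
    also have "\<dots> \<le> ennreal (4 / t) * emeasure M (?B i)" using i by (intro mult_left_mono) auto
    finally show "emeasure lborel (?B i) \<le> ennreal (4 / t) * emeasure M (?B i)" .
  qed
  also have "\<dots> = ennreal (4 / t) * emeasure M ?U"
    using M by (subst emeasure_UN_countable[OF _ C(1) disj]) (auto simp: nn_integral_cmult)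
  also have "\<dots> \<le> ennreal (4 / t) * ennreal \<eta>"
  proof -
    have "?B i \<subseteq> V - K" if "i \<in> C" for i
    proof -
      have "i \<in> I" using C(2) that by blast
      then show ?thesis unfolding I_def by (cases i) simp
    qed
    then have "?U \<subseteq> V - K" by blast
    then have "emeasure M ?U \<le> emeasure M (V - K)"
      using M \<open>open (V - K)\<close> by (intro emeasure_mono) auto
    with small show ?thesis by (intro mult_left_mono) (auto intro: order_trans)
  qed
  also have "\<dots> = ennreal e" using t e by (simp add: ennreal_mult[symmetric] \<eta>_def)
  finally have le: "emeasure lborel ?U \<le> ennreal e" .
  have Ub: "?U \<in> sets lborel" using C(1) by (intro sets.countable_UN') auto
  have Ul: "?U \<in> lmeasurable" "measure lebesgue ?U \<le> e"
    using le Ub e by (auto simp: fmeasurable_def measure_def intro: le_less_trans enn2real_leI)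
  let ?T = "(?S - ?U) \<union> ?U"
  have "?S \<subseteq> ?T" by blast
  moreover have "?T \<in> lmeasurable" by (rule fmeasurable.Un[OF negligible_imp_measurable[OF C(4)] Ul(1)])
  moreover have "measure lebesgue ?T \<le> e"
    using measure_Un_le[of "?S - ?U" lebesgue ?U] C(4) Ul negligible_imp_measure0[OF C(4)] negligible_imp_sets[OF C(4)]
    by (metis (no_types, lifting) add_0 fmeasurableD order_trans)
  ultimately show "\<exists>T. ?S \<subseteq> T \<and> T \<in> lmeasurable \<and> measure lebesgue T \<le> e" by blast
qed

text \<open>\<open>M\<close> is only locally finite on \<open>W\<close>. Countably many balls with
  closure in \<open>W\<close> and the thresholds 1 / (n + 1) reduce the claim to countably many
  negligible sets.\<close>

lemma AE_density_zero:
  fixes M :: "plane measure"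
  assumes M: "sets M = sets borel" and W: "open W"
    and fin: "\<And>K. compact K \<Longrightarrow> K \<subseteq> W \<Longrightarrow> emeasure M K < \<infinity>"
    and E: "E \<in> sets borel" "emeasure M (E \<inter> W) = 0"
  shows "AE x in lebesgue. x \<in> E \<inter> W \<longrightarrow>
    (\<forall>e>0. \<exists>d>0. \<forall>r. 0 < r \<and> r < d \<longrightarrow> emeasure M (cball x r) \<le> ennreal (e * r\<^sup>2))"
proof -
  let ?F = "{ball x e | x e. cball x e \<subseteq> W}"
  obtain F where F: "F \<subseteq> ?F" "countable F" "\<Union>F = \<Union>?F"
    using Lindelof[of ?F] by auto
  have cov: "W \<subseteq> \<Union>F"
  proof
    fix x assume "x \<in> W"
    then obtain e where "e > 0" "cball x e \<subseteq> W" using W open_contains_cball by blast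
    then show "x \<in> \<Union>F" unfolding F(3) by (auto intro!: exI[of _ "ball x e"])
  qed
  let ?N = "\<lambda>V n. {x \<in> E \<inter> V. \<forall>d>0. \<exists>r. 0 < r \<and> r < d \<and> emeasure M (cball x r) > ennreal (1 / Suc n * r\<^sup>2)}"
  have "negligible (?N V n)" if V: "V \<in> F" for V n
  proof (rule negligible_positive_upper_density[OF M])
    obtain x e where x: "V = ball x e" "cball x e \<subseteq> W" using V F by auto
    have "emeasure M V \<le> emeasure M (cball x e)" using x M by (intro emeasure_mono) auto
    also have "\<dots> < \<infinity>" using x by (intro fin) auto
    finally show "emeasure M V < \<infinity>" .
    show "open V" using x by simp
    have "V \<subseteq> W" using x ball_subset_cball by blast
    then have "emeasure M (E \<inter> V) \<le> emeasure M (E \<inter> W)" using M E W by (intro emeasure_mono) auto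
    then show "emeasure M (E \<inter> V) = 0" using E by simp
  qed (use E in auto)
  then have neg: "negligible (\<Union>V\<in>F. \<Union>n. ?N V n)"
    using F(2) by (auto intro!: negligible_countable_Union)
  have "x \<in> (\<Union>V\<in>F. \<Union>n. ?N V n)"
    if x: "x \<in> E \<inter> W" and bad: "\<not> (\<forall>e>0. \<exists>d>0. \<forall>r. 0 < r \<and> r < d \<longrightarrow> emeasure M (cball x r) \<le> ennreal (e * r\<^sup>2))" for x
  proof -
    obtain e where e: "e > 0" "\<And>d. d > 0 \<Longrightarrow> \<exists>r. 0 < r \<and> r < d \<and> \<not> emeasure M (cball x r) \<le> ennreal (e * r\<^sup>2)"
      using bad by meson
    obtain n where n: "1 / Suc n < e" using e(1) nat_approx_posE by metis
    obtain V where V: "V \<in> F" "x \<in> V" using x cov by blast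
    have "\<exists>r. 0 < r \<and> r < d \<and> emeasure M (cball x r) > ennreal (1 / Suc n * r\<^sup>2)" if d: "d > 0" for d
    proof -
      obtain r where r: "0 < r" "r < d" "ennreal (e * r\<^sup>2) < emeasure M (cball x r)"
        using e(2)[OF d] by (auto simp: not_le)
      have "ennreal (1 / Suc n * r\<^sup>2) \<le> ennreal (e * r\<^sup>2)"
        using n by (intro ennreal_leI mult_right_mono) auto
      with r show ?thesis by (intro exI[of _ r]) auto
    qed
    then show ?thesis using V x by blast
  qed
  then have "{x. \<not> (x \<in> E \<inter> W \<longrightarrow> (\<forall>e>0. \<exists>d>0. \<forall>r. 0 < r \<and> r < d \<longrightarrow> emeasure M (cball x r) \<le> ennreal (e * r\<^sup>2)))}
     \<subseteq> (\<Union>V\<in>F. \<Union>n. ?N V n)" by blast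
  with neg show ?thesis
    by (intro AE_I'[of "\<Union>V\<in>F. \<Union>n. ?N V n"]) (auto simp: negligible_iff_null_sets)
qed

text \<open>With \<open>f\<close> the density of Lebesgue measure with respect to \<open>lborel + M\<close>, the singular
  part of \<open>M\<close> is its restriction to the zero set of \<open>f\<close>.\<close>

lemma ac_density_exists:
  fixes M :: "plane measure"
  assumes M: "sets M = sets borel" and sf: "sigma_finite_measure (add_measure lborel M)" "sigma_finite_measure M"
  shows "\<exists>p. ac_density M p"
proof -
  let ?R = "add_measure lborel M"
  interpret R: sigma_finite_measure ?R by fact
  interpret M: sigma_finite_measure M by fact
  have spM: "space M = UNIV" using M by (auto dest: sets_eq_imp_space_eq)
  have R: "emeasure ?R A = emeasure lborel A + emeasure M A" if "A \<in> sets borel" for A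
    using that M by (simp add: emeasure_add_measure)
  have "absolutely_continuous ?R lborel"
    unfolding absolutely_continuous_def null_sets_def by (auto simp: R)
  then obtain f where f: "f \<in> borel_measurable ?R" "density ?R f = lborel"
    using R.Radon_Nikodym[of lborel] by auto
  have fb: "f \<in> borel_measurable borel" using f(1) by simp
  define Z where "Z = {x. f x = 0}"
  have Z: "Z \<in> sets borel" using fb unfolding Z_def by measurable
  have "emeasure lborel Z = (\<integral>\<^sup>+x. f x * indicator Z x \<partial>?R)"
    using f(1) Z by (subst f(2)[symmetric], subst emeasure_density) auto
  also have "(\<lambda>x. f x * indicator Z x) = (\<lambda>x. 0)" by (auto simp: Z_def indicator_def fun_eq_iff)
  finally have Z0: "Z \<in> null_sets lborel" using Z by (auto simp: null_sets_def)
  define A where "A = density M (indicator (- Z))"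
  define S where "S = density M (indicator Z)"
  have sA: "sets A = sets borel" "sets S = sets borel" using M by (simp_all add: A_def S_def)
  have eA: "emeasure A B = emeasure M (B - Z)" "emeasure S B = emeasure M (B \<inter> Z)" if "B \<in> sets borel" for B
    unfolding A_def S_def using that M Z
    by (auto simp: emeasure_density indicator_inter_arith[symmetric] nn_integral_indicator Diff_eq Int_commute)
  \<comment> \<open>Off \<open>Z\<close> the density \<open>f\<close> is positive, so a Lebesgue
    null set has measure zero there for \<open>?R\<close> and hence for \<open>M\<close>.\<close>
  have "absolutely_continuous lborel A"
    unfolding absolutely_continuous_def
  proof
    fix B :: "plane set" assume "B \<in> null_sets lborel"
    then have B: "B \<in> sets borel" "emeasure lborel B = 0" by auto
    have "(\<integral>\<^sup>+x. f x * indicator B x \<partial>?R) = 0"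
      using f(1) B by (subst emeasure_density[symmetric]) (auto simp: f(2))
    then have "AE x in ?R. f x * indicator B x = 0"
      using f(1) B by (subst (asm) nn_integral_0_iff_AE) auto
    then have "AE x in ?R. x \<notin> B - Z" by eventually_elim (auto simp: Z_def indicator_def)
    then have "emeasure ?R (B - Z) = 0"
      using B Z by (subst (asm) AE_iff_measurable[of "B - Z"]) auto
    then have "emeasure M (B - Z) = 0" using R[of "B - Z"] B Z by simp
    then show "B \<in> null_sets A" using B sA eA(1)[of B] by (auto simp: null_sets_def)
  qed
  then obtain q where q: "q \<in> borel_measurable lborel" "density lborel q = A"
    using sigma_finite_measure.Radon_Nikodym[OF sigma_finite_lborel, of A] sA by auto
  \<comment> \<open>Sigma-finiteness forces \<open>q\<close> to be finite almost everywhere, so that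
    passing to the real-valued \<open>p\<close> loses nothing.\<close>
  have "sigma_finite_measure (density lborel q)"
  proof
    obtain F :: "nat \<Rightarrow> plane set" where F: "range F \<subseteq> sets M" "(\<Union>i. F i) = space M" "\<And>i. emeasure M (F i) \<noteq> \<infinity>"
      using M.sigma_finite by metis
    have "emeasure A (F i) \<noteq> \<infinity>" for i
    proof -
      have Fi: "F i \<in> sets borel" using F(1) M by auto
      have "emeasure M (F i - Z) \<le> emeasure M (F i)" using Fi M by (intro emeasure_mono) auto
      then show ?thesis using eA(1)[OF Fi] F(3)[of i] by (auto simp: top_unique)
    qed
    then show "\<exists>A. countable A \<and> A \<subseteq> sets (density lborel q) \<and> \<Union> A = space (density lborel q) \<and> (\<forall>a\<in>A. emeasure (density lborel q) a \<noteq> \<infinity>)"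
      using F M spM by (intro exI[of _ "range F"]) (auto simp: q(2) sA sets_eq_imp_space_eq[OF sA(1)])
  qed
  then have fin: "AE x in lborel. q x \<noteq> \<infinity>"
    using sigma_finite_measure.sigma_finite_iff_density_finite[OF sigma_finite_lborel q(1)] by blast
  define p where "p = (\<lambda>x. enn2real (q x))"
  have p: "p \<in> borel_measurable borel" unfolding p_def using q(1) by simp
  have "density lborel (\<lambda>x. ennreal (p x)) = density lborel q"
    using fin q(1) by (intro density_cong) (auto simp: p_def ennreal_enn2real_if elim: eventually_mono)
  then have dens: "density lborel (\<lambda>x. ennreal (p x)) = A" using q by simp
  have "emeasure M B = emeasure A B + emeasure S B" if B: "B \<in> sets borel" for B
    unfolding eA[OF B]
    using plus_emeasure[of "B - Z" M "B \<inter> Z"] B M Z by (simp add: Diff_Int_distrib2 Un_Diff_Int)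
  moreover have "emeasure S (- Z) = 0" using eA(2)[of "- Z"] Z by simp
  ultimately have "ac_density M p"
    unfolding ac_density_def dens using p sA Z0 by (auto simp: p_def)
  then show ?thesis by blast
qed

section \<open>A Poincare inequality for functions of bounded variation\<close>

text \<open>The domain of integration is a fixed square because \<open>h\<close> carries information
  only on an open set. For \<open>x\<close> in \<open>cube c s\<close> and \<open>R = s + r\<close>
  this is the usual convolution, the kernel being carried by the square of half side
  \<open>r\<close> around \<open>x\<close>.\<close>

definition mollify :: "plane \<Rightarrow> real \<Rightarrow> real \<Rightarrow> (plane \<Rightarrow> real) \<Rightarrow> plane \<Rightarrow> real" where
  "mollify c R r h x = integral (cube c R) (\<lambda>z. kernel r (x - z) * h z)"

lemma kernel_differentiable: "kernel r differentiable (at x)"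
  using Ck_on_kernel[of 1 r] by simp

lemma pd_kernel_continuous: "continuous_on UNIV (pd i (kernel r))"
  using Ck_on_kernel[of 1 r] by simp

lemma mollify_has_derivative:
  assumes h: "continuous_on (cube c R) h"
  shows "(mollify c R r h has_derivative
    (\<lambda>v. integral (cube c R) (\<lambda>z. (h z *\<^sub>R grad (kernel r) (x - z)) \<bullet> v))) (at x)"
proof -
  let ?a = "c - (\<chi> i. R)" and ?b = "c + (\<chi> i. R)"
  let ?fx = "\<lambda>x z. blinfun_inner_right (h z *\<^sub>R grad (kernel r) (x - z))"
  have h': "continuous_on (cbox ?a ?b) h" using h by (simp add: cube_def)
  have g: "continuous_on UNIV (grad (kernel r))"
    unfolding grad_def by (intro continuous_on_vec_lambda pd_kernel_continuous)
  have cfx: "continuous_on (UNIV \<times> cbox ?a ?b) (\<lambda>(x, z). ?fx x z)"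
    unfolding split_beta
    by (intro continuous_intros bounded_linear.continuous_on[OF bounded_linear_blinfun_inner_right]
        continuous_on_compose2[OF h'] continuous_on_compose2[OF g]) auto
  have "((\<lambda>x. integral (cbox ?a ?b) (\<lambda>z. kernel r (x - z) * h z)) has_derivative
      blinfun_apply (integral (cbox ?a ?b) (?fx x))) (at x within UNIV)"
  proof (rule leibniz_rule[OF _ _ cfx])
    show "((\<lambda>x. kernel r (x - z) * h z) has_derivative blinfun_apply (?fx x z)) (at x within UNIV)" for x z
    proof -
      have "((\<lambda>x. x - z) has_derivative (\<lambda>v. v)) (at x)" by (auto intro!: derivative_eq_intros)
      then have "((\<lambda>x. kernel r (x - z)) has_derivative (\<lambda>v. grad (kernel r) (x - z) \<bullet> v)) (at x)"
        by (rule has_derivative_compose[OF _ has_derivative_grad[OF kernel_differentiable]])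
      then show ?thesis by (auto intro!: derivative_eq_intros simp: fun_eq_iff)
    qed
    show "(\<lambda>z. kernel r (x - z) * h z) integrable_on cbox ?a ?b" for x
      by (intro integrable_continuous continuous_intros h' continuous_on_compose2[OF kernel_continuous]) auto
  qed auto
  moreover have "?fx x integrable_on cbox ?a ?b"
    by (intro integrable_continuous continuous_on_compose2[OF cfx, of _ "\<lambda>z. (x, z)", simplified] continuous_intros) auto
  then have "blinfun_apply (integral (cbox ?a ?b) (?fx x))
      = (\<lambda>v. integral (cbox ?a ?b) (\<lambda>z. (h z *\<^sub>R grad (kernel r) (x - z)) \<bullet> v))"
    by (intro ext) (simp only: blinfun_apply_integral blinfun_inner_right.rep_eq)
  ultimately show ?thesis
    unfolding mollify_def[abs_def] cube_def by simp
qed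

lemma pd_mollify:
  assumes "continuous_on (cube c R) h"
  shows "pd i (mollify c R r h) x = integral (cube c R) (\<lambda>z. h z * pd i (kernel r) (x - z))"
  using pd_eqI[OF mollify_has_derivative[OF assms]] by (simp add: inner_axis grad_def)

lemma Ck_on_mollify:
  assumes "continuous_on (cube c R) h"
  shows "Ck_on 1 UNIV (mollify c R r h)"
proof -
  have h': "continuous_on (cbox (c - (\<chi> i. R)) (c + (\<chi> i. R))) h" using assms by (simp add: cube_def)
  have "continuous_on UNIV (\<lambda>x. integral (cube c R) (\<lambda>z. h z * pd i (kernel r) (x - z)))" for i
    unfolding cube_def
    by (intro integral_continuous_on_param, unfold split_beta,
        intro continuous_intros continuous_on_compose2[OF h'] continuous_on_compose2[OF pd_kernel_continuous]) auto
  moreover have "pd i (mollify c R r h) = (\<lambda>x. integral (cube c R) (\<lambda>z. h z * pd i (kernel r) (x - z)))" for i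
    using pd_mollify[OF assms] by blast
  ultimately show ?thesis
    using differentiableI[OF mollify_has_derivative[OF assms]] by simp
qed

lemma pd_reflect_kernel: "pd i (\<lambda>z. kernel r (x - z)) z = - pd i (kernel r) (x - z)"
  using pd_affine[OF kernel_differentiable, of i r "-1" x z] by simp

lemma integral_cube_lborel:
  fixes h \<psi> :: "plane \<Rightarrow> real"
  assumes "open W" "continuous_on W h" "continuous_on UNIV \<psi>" "cube c R \<subseteq> W"
    and "\<And>z. z \<notin> cube c R \<Longrightarrow> \<psi> z = 0"
  shows "integral (cube c R) (\<lambda>z. h z * \<psi> z) = (LINT z|lborel. h z * \<psi> z)"
  unfolding cube_def
  by (rule lborel_integral_eq_integral_cbox[symmetric,
        OF continuous_on_extend_0[OF assms(1-3) compact_cube assms(4,5)]])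
     (use assms(5) in \<open>auto simp: cube_def\<close>)

lemma cube_trans: "z \<in> cube x r \<Longrightarrow> x \<in> cube c s \<Longrightarrow> z \<in> cube c (s + r)"
proof -
  assume a: "z \<in> cube x r" "x \<in> cube c s"
  have "\<bar>z $ i - c $ i\<bar> \<le> s + r" for i
    using a[unfolded mem_cube, rule_format, of i] by linarith
  then show ?thesis by (simp add: mem_cube)
qed

lemma cube_shift: "x - z \<in> cube 0 r \<longleftrightarrow> z \<in> cube x r"
  by (simp add: mem_cube abs_minus_commute)

text \<open>Moving the derivative to the variable \<open>z\<close> of the kernel (whence the sign)
  turns it into a pairing of \<open>h\<close> with the derivative of a test function. Bounds on the
  distributional derivative of \<open>h\<close> thus become pointwise information on its
  mollification.\<close>

lemma mollify_pd_eq: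
  assumes W: "open W" and h: "continuous_on W h" and r: "r > 0" and c: "cube c (s + r) \<subseteq> W" and x: "x \<in> cube c s"
  shows "pd i (mollify c (s + r) r h) x = - (LINT z|lborel. h z * pd i (\<lambda>z. kernel r (x - z)) z)"
proof -
  have out: "pd i (\<lambda>z. kernel r (x - z)) z = 0" if "z \<notin> cube c (s + r)" for z
    by (rule pd_eq_0_outside[of "cube x r"]) (use r cube_trans[OF _ x] that in \<open>auto simp: cube_shift intro!: kernel_eq_0\<close>)
  have cont: "continuous_on UNIV (pd i (\<lambda>z. kernel r (x - z)))"
    using Ck_on_kernel_shift[of 1 r x] by simp
  have "pd i (mollify c (s + r) r h) x = integral (cube c (s + r)) (\<lambda>z. h z * - pd i (\<lambda>z. kernel r (x - z)) z)"
    unfolding pd_reflect_kernel using pd_mollify[OF continuous_on_subset[OF h c], of i r x] by simp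
  also have "\<dots> = (LINT z|lborel. h z * - pd i (\<lambda>z. kernel r (x - z)) z)"
    by (rule integral_cube_lborel[OF W h _ c]) (use cont out in \<open>auto intro: continuous_intros\<close>)
  finally show ?thesis by simp
qed

lemma mollify_close:
  assumes W: "open W" and h: "continuous_on W h" and r: "r > 0" and c: "cube c (s + r) \<subseteq> W" and x: "x \<in> cube c s"
    and e: "\<And>z. z \<in> cube x r \<Longrightarrow> \<bar>h z - h x\<bar> \<le> e"
  shows "\<bar>mollify c (s + r) r h x - h x\<bar> \<le> e"
proof -
  have out: "kernel r (x - z) = 0" if "z \<notin> cube c (s + r)" for z
    using r cube_trans[OF _ x] that by (intro kernel_eq_0) (auto simp: cube_shift)
  have k: "continuous_on UNIV (\<lambda>z. kernel r (x - z))"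
    using Ck_on_kernel_shift[of 0 r x] by simp
  have ik: "integrable lborel (\<lambda>z. kernel r (x - z))"
    by (rule integrable_continuous_compact[OF k compact_cube out])
  have ck: "continuous_on UNIV (\<lambda>z. h z * kernel r (x - z))"
    by (rule continuous_on_extend_0[OF W h k compact_cube c out])
  have ihk: "integrable lborel (\<lambda>z. h z * kernel r (x - z))"
    by (rule integrable_continuous_compact[OF ck compact_cube, of c "s + r"]) (simp add: out)
  have "mollify c (s + r) r h x = integral (cube c (s + r)) (\<lambda>z. h z * kernel r (x - z))"
    unfolding mollify_def by (simp add: mult.commute)
  also have "\<dots> = (LINT z|lborel. h z * kernel r (x - z))"
    by (rule integral_cube_lborel[OF W h k c out])
  finally have "mollify c (s + r) r h x - h x = (LINT z|lborel. h z * kernel r (x - z)) - h x * (LINT z|lborel. kernel r (x - z))"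
    using kernel_integral_shift[OF r] by simp
  also have "\<dots> = (LINT z|lborel. h z * kernel r (x - z) - h x * kernel r (x - z))"
    using ik ihk by simp
  finally have eq: "mollify c (s + r) r h x - h x = (LINT z|lborel. h z * kernel r (x - z) - h x * kernel r (x - z))" .
  have "\<bar>h z * kernel r (x - z) - h x * kernel r (x - z)\<bar> \<le> e * kernel r (x - z)" for z
  proof (cases "z \<in> cube x r")
    case True
    have "\<bar>h z * kernel r (x - z) - h x * kernel r (x - z)\<bar> = \<bar>h z - h x\<bar> * kernel r (x - z)"
      using kernel_nonneg[of r "x - z"] by (simp add: abs_mult left_diff_distrib[symmetric])
    also have "\<dots> \<le> e * kernel r (x - z)" by (intro mult_right_mono e[OF True] kernel_nonneg)
    finally show ?thesis .
  next
    case False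
    then have "kernel r (x - z) = 0" using r by (intro kernel_eq_0) (auto simp: cube_shift)
    then show ?thesis by simp
  qed
  then have "\<bar>LINT z|lborel. h z * kernel r (x - z) - h x * kernel r (x - z)\<bar> \<le> (LINT z|lborel. e * kernel r (x - z))"
    using ik ihk by (intro order_trans[OF integral_abs_bound] integral_mono) auto
  then show ?thesis using eq kernel_integral_shift[OF r] by simp
qed

text \<open>\<open>M\<close> dominates the variation of the distributional derivative of
  \<open>h\<close> in direction \<open>i\<close>. The bound is formulated for nonnegative test
  functions, since it is applied to kernels.\<close>

definition pd_dominated :: "2 \<Rightarrow> plane set \<Rightarrow> (plane \<Rightarrow> real) \<Rightarrow> plane measure \<Rightarrow> bool" where
  "pd_dominated i W h M \<longleftrightarrow> sets M = sets borel \<and> (\<forall>K. compact K \<and> K \<subseteq> W \<longrightarrow> emeasure M K < \<infinity>) \<and>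
     (\<forall>\<phi>. test_function W \<phi> \<and> (\<forall>x. 0 \<le> \<phi> x) \<longrightarrow> \<bar>LINT x|lborel. h x * pd i \<phi> x\<bar> \<le> (LINT x|M. \<phi> x))"

text \<open>At each point the derivative is bounded by the kernel integrated against
  \<open>M\<close>. Tonelli allows integrating over \<open>x\<close> first, where the kernel has
  mass one.\<close>

lemma mollify_L1_bound:
  assumes W: "open W" and h: "continuous_on W h" and M: "pd_dominated i W h M"
    and r: "r > 0" and c: "cube c (s + r) \<subseteq> W"
  shows "(\<integral>\<^sup>+x. ennreal \<bar>pd i (mollify c (s + r) r h) x\<bar> * indicator (cube c s) x \<partial>lborel) \<le> emeasure M (cube c (s + r))"
proof -
  let ?Q = "cube c s" and ?R = "cube c (s + r)"
  have sM: "sets M = sets borel" using M by (simp add: pd_dominated_def)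
  have fR: "emeasure M ?R < \<infinity>" using M c unfolding pd_dominated_def by blast
  \<comment> \<open>Cutting down to the larger square makes the measure finite, as the product
    measure argument requires; kernels centred in \<open>?Q\<close> vanish outside it.\<close>
  define M' where "M' = density M (indicator ?R)"
  have sM': "sets M' = sets borel" using sM by (simp add: M'_def)
  have RM: "?R \<in> sets M" using sM by simp
  have "emeasure M' (space M') < \<infinity>"
    using fR RM emeasure_restricted[OF RM sets.top] by (simp add: M'_def sets.Int_space_eq2)
  then interpret M': finite_measure M' by (intro finite_measureI) auto
  have le: "ennreal \<bar>pd i (mollify c (s + r) r h) x\<bar> * indicator ?Q x \<le> (\<integral>\<^sup>+z. ennreal (kernel r (x - z)) * indicator ?Q x \<partial>M')" for x
  proof (cases "x \<in> ?Q")
    case True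
    have sub: "cube x r \<subseteq> ?R" using cube_trans[OF _ True] by blast
    have t: "test_function W (\<lambda>z. kernel r (x - z))" using test_function_kernel[OF r] sub c by blast
    have out: "kernel r (x - z) = 0" if "z \<notin> ?R" for z
      using r sub that by (intro kernel_eq_0) (auto simp: cube_shift)
    have k: "continuous_on UNIV (\<lambda>z. kernel r (x - z))"
      using Ck_on_kernel_shift[of 0 r x] by simp
    have int: "integrable M (\<lambda>z. kernel r (x - z))"
      by (rule integrable_compact_support[OF sM k compact_cube out fR])
    have km: "(\<lambda>z. kernel r (x - z)) \<in> borel_measurable M"
      using int by (rule borel_measurable_integrable)
    have "\<bar>pd i (mollify c (s + r) r h) x\<bar> \<le> (LINT z|M. kernel r (x - z))"
      using M t kernel_nonneg unfolding mollify_pd_eq[OF W h r c True] pd_dominated_def by auto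
    then have "ennreal \<bar>pd i (mollify c (s + r) r h) x\<bar> \<le> ennreal (LINT z|M. kernel r (x - z))"
      by (rule ennreal_leI)
    also have "\<dots> = (\<integral>\<^sup>+z. ennreal (kernel r (x - z)) \<partial>M)"
      using int kernel_nonneg by (intro nn_integral_eq_integral[symmetric]) auto
    also have "\<dots> = (\<integral>\<^sup>+z. indicator ?R z * ennreal (kernel r (x - z)) \<partial>M)"
      using out by (intro nn_integral_cong) (auto simp: indicator_def)
    also have "\<dots> = (\<integral>\<^sup>+z. ennreal (kernel r (x - z)) \<partial>M')"
      unfolding M'_def using km RM by (subst nn_integral_density) auto
    finally show ?thesis using True by simp
  qed simp
  interpret P: pair_sigma_finite lborel M' ..
  have m: "(\<lambda>(x, z). ennreal (kernel r (x - z)) * indicator ?Q x) \<in> borel_measurable (lborel \<Otimes>\<^sub>M M')"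
  proof -
    have [measurable_cong]: "sets M' = sets borel" by (rule sM')
    show ?thesis by measurable
  qed
  have "(\<integral>\<^sup>+x. ennreal \<bar>pd i (mollify c (s + r) r h) x\<bar> * indicator ?Q x \<partial>lborel)
     \<le> (\<integral>\<^sup>+x. \<integral>\<^sup>+z. ennreal (kernel r (x - z)) * indicator ?Q x \<partial>M' \<partial>lborel)"
    by (intro nn_integral_mono le)
  also have "\<dots> = (\<integral>\<^sup>+z. \<integral>\<^sup>+x. ennreal (kernel r (x - z)) * indicator ?Q x \<partial>lborel \<partial>M')"
    using P.Fubini'[OF m] by simp
  also have "\<dots> \<le> (\<integral>\<^sup>+z. 1 \<partial>M')"
  proof (rule nn_integral_mono)
    fix z
    have sym: "(\<lambda>x. kernel r (x - z)) = (\<lambda>x. kernel r (z - x))"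
      by (metis kernel_minus minus_diff_eq)
    have "continuous_on UNIV (\<lambda>x. kernel r (z - x))"
      using Ck_on_kernel_shift[of 0 r z] by simp
    then have ki: "integrable lborel (\<lambda>x. kernel r (x - z))"
      unfolding sym by (rule integrable_continuous_compact[OF _ compact_cube[of z r]])
        (use r in \<open>auto simp: cube_shift intro: kernel_eq_0\<close>)
    have "(\<integral>\<^sup>+x. ennreal (kernel r (x - z)) * indicator ?Q x \<partial>lborel) \<le> (\<integral>\<^sup>+x. ennreal (kernel r (x - z)) \<partial>lborel)"
      by (intro nn_integral_mono) (auto simp: indicator_def)
    also have "\<dots> = ennreal (LINT x|lborel. kernel r (x - z))"
      using ki kernel_nonneg by (intro nn_integral_eq_integral) auto
    also have "(LINT x|lborel. kernel r (x - z)) = 1"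
      using lborel_integral_translate[of "kernel r" "- z"] kernel_integral[OF r] by simp
    finally show "(\<integral>\<^sup>+x. ennreal (kernel r (x - z)) * indicator ?Q x \<partial>lborel) \<le> 1" by simp
  qed
  also have "\<dots> = emeasure M' (space M')" by simp
  also have "\<dots> = emeasure M ?R"
    using RM emeasure_restricted[OF RM sets.top] by (simp add: M'_def sets.Int_space_eq2)
  finally show ?thesis .
qed

section \<open>Fubini in the plane\<close>

definition pt :: "real \<Rightarrow> real \<Rightarrow> plane" where "pt s t = (\<chi> i. if i = 1 then s else t)"

lemma pt_nth [simp]: "pt s t $ 1 = s" "pt s t $ 2 = t" by (simp_all add: pt_def)

lemma pt_eta: "pt (z $ 1) (z $ 2) = z" by (rule plane_eqI) auto

lemma pt_eq: "pt s t = s *\<^sub>R axis 1 1 + t *\<^sub>R axis 2 1" by (rule plane_eqI) auto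

lemma pt_measurable [measurable]: "(\<lambda>(s, t). pt s t) \<in> borel_measurable (borel \<Otimes>\<^sub>M borel)"
  unfolding pt_eq by measurable

text \<open>Lebesgue measure is characterised by the volumes of boxes. The identification makes
  Tonelli for product measures available on \<open>real ^ 2\<close>.\<close>

lemma lborel_plane: "lborel = distr (lborel \<Otimes>\<^sub>M lborel) borel (\<lambda>(s, t). pt s t)"
proof (rule lborel_eqI)
  fix l u :: plane assume lu: "\<And>b. b \<in> Basis \<Longrightarrow> l \<bullet> b \<le> u \<bullet> b"
  have lu': "l $ i \<le> u $ i" for i using lu[of "axis i 1"] by (simp add: inner_axis)
  have B: "(\<Prod>b\<in>Basis. (u - l) \<bullet> b) = (u $ 1 - l $ 1) * (u $ 2 - l $ 2)"
    by (auto simp: Basis_vec_def inner_axis axis_eq_axis UNIV_2_eq)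
  have "(\<lambda>(s, t). pt s t) -` box l u \<inter> space (lborel \<Otimes>\<^sub>M lborel) = {l $ 1<..<u $ 1} \<times> {l $ 2<..<u $ 2}"
    by (auto simp: mem_box_cart forall_2 space_pair_measure)
  then have "emeasure (distr (lborel \<Otimes>\<^sub>M lborel) borel (\<lambda>(s, t). pt s t)) (box l u)
     = emeasure (lborel \<Otimes>\<^sub>M lborel) ({l $ 1<..<u $ 1} \<times> {l $ 2<..<u $ 2})"
    by (subst emeasure_distr) auto
  also have "\<dots> = ennreal ((u $ 1 - l $ 1) * (u $ 2 - l $ 2))"
    using lu' by (subst lborel.emeasure_pair_measure_Times) (auto simp: ennreal_mult)
  finally show "emeasure (distr (lborel \<Otimes>\<^sub>M lborel) borel (\<lambda>(s, t). pt s t)) (box l u) = ennreal (\<Prod>b\<in>Basis. (u - l) \<bullet> b)"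
    unfolding B .
qed simp

lemma nn_integral_plane:
  assumes [measurable]: "f \<in> borel_measurable borel"
  shows "(\<integral>\<^sup>+x. f x \<partial>lborel) = (\<integral>\<^sup>+s. \<integral>\<^sup>+t. f (pt s t) \<partial>lborel \<partial>lborel)"
    and "(\<integral>\<^sup>+x. f x \<partial>lborel) = (\<integral>\<^sup>+t. \<integral>\<^sup>+s. f (pt s t) \<partial>lborel \<partial>lborel)"
proof -
  have "(\<integral>\<^sup>+x. f x \<partial>lborel) = (\<integral>\<^sup>+p. f (case p of (s, t) \<Rightarrow> pt s t) \<partial>(lborel \<Otimes>\<^sub>M lborel))"
    by (subst lborel_plane, subst nn_integral_distr) auto
  also have "(\<lambda>p. f (case p of (s, t) \<Rightarrow> pt s t)) = (\<lambda>(s, t). f (pt s t))" by auto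
  finally have "(\<integral>\<^sup>+x. f x \<partial>lborel) = (\<integral>\<^sup>+(s, t). f (pt s t) \<partial>(lborel \<Otimes>\<^sub>M lborel))" .
  moreover have "(\<lambda>(s, t). f (pt s t)) \<in> borel_measurable (lborel \<Otimes>\<^sub>M lborel)" by measurable
  ultimately show "(\<integral>\<^sup>+x. f x \<partial>lborel) = (\<integral>\<^sup>+s. \<integral>\<^sup>+t. f (pt s t) \<partial>lborel \<partial>lborel)"
    "(\<integral>\<^sup>+x. f x \<partial>lborel) = (\<integral>\<^sup>+t. \<integral>\<^sup>+s. f (pt s t) \<partial>lborel \<partial>lborel)"
    using lborel.nn_integral_fst[of "\<lambda>(s, t). f (pt s t)" lborel] lborel_pair.nn_integral_snd[of "\<lambda>(s, t). f (pt s t)"]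
    by auto
qed

lemma nn_integral_plane_times:
  fixes f g :: "real \<Rightarrow> ennreal"
  assumes [measurable]: "f \<in> borel_measurable borel" "g \<in> borel_measurable borel"
  shows "(\<integral>\<^sup>+z. f ((z::plane) $ 1) * g (z $ 2) \<partial>lborel) = (\<integral>\<^sup>+s. f s \<partial>lborel) * (\<integral>\<^sup>+t. g t \<partial>lborel)"
proof -
  have "(\<lambda>z::plane. f (z $ 1) * g (z $ 2)) \<in> borel_measurable borel" by measurable
  then show ?thesis
    by (subst nn_integral_plane(1)) (auto simp: nn_integral_cmult nn_integral_multc)
qed

lemma line_difference_bound:
  fixes m :: "plane \<Rightarrow> real"
  assumes m: "Ck_on 1 UNIV m" and p: "p \<in> {a..b}" and q: "q \<in> {a..b}"
  shows "ennreal \<bar>m (pt p t) - m (pt q t)\<bar> \<le> (\<integral>\<^sup>+s. ennreal \<bar>pd 1 m (pt s t)\<bar> * indicator {a..b} s \<partial>lborel)"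
    "ennreal \<bar>m (pt t p) - m (pt t q)\<bar> \<le> (\<integral>\<^sup>+s. ennreal \<bar>pd 2 m (pt t s)\<bar> * indicator {a..b} s \<partial>lborel)"
proof -
  have gen: "ennreal \<bar>m (l p) - m (l q)\<bar> \<le> (\<integral>\<^sup>+s. ennreal \<bar>pd i m (l s)\<bar> * indicator {a..b} s \<partial>lborel)"
    if l: "\<And>s. (l has_derivative (\<lambda>v. v *\<^sub>R axis i 1)) (at s)" and pq: "p \<in> {a..b}" "q \<in> {a..b}" "q \<le> p" for l i p q
  proof -
    have cl: "continuous_on UNIV l" by (intro has_derivative_continuous_on[of UNIV l]) (use l in auto)
    have cm: "continuous_on UNIV (pd i m)" using m by simp
    have "((\<lambda>s. m (l s)) has_vector_derivative pd i m (l s)) (at s within {q..p})" for s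
    proof -
      have "m differentiable (at (l s))" using m by simp
      from has_derivative_compose[OF l has_derivative_grad[OF this]]
      have "((\<lambda>s. m (l s)) has_derivative (\<lambda>v. v *\<^sub>R pd i m (l s))) (at s)"
        by (simp add: grad_def inner_axis)
      then show ?thesis
        unfolding has_vector_derivative_def by (rule has_derivative_at_withinI)
    qed
    then have B: "has_bochner_integral lborel (\<lambda>s. indicator {q..p} s *\<^sub>R pd i m (l s)) (m (l p) - m (l q))"
      by (intro has_bochner_integral_FTC_Icc pq(3) continuous_on_compose2[OF cm continuous_on_subset[OF cl]]) auto
    have "ennreal (norm (m (l p) - m (l q))) \<le> (\<integral>\<^sup>+s. ennreal (norm (indicator {q..p} s *\<^sub>R pd i m (l s))) \<partial>lborel)"
      by (rule has_bochner_integral_norm_bound[OF B])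
    also have "\<dots> \<le> (\<integral>\<^sup>+s. ennreal \<bar>pd i m (l s)\<bar> * indicator {a..b} s \<partial>lborel)"
      using pq by (intro nn_integral_mono) (auto simp: indicator_def)
    finally show ?thesis by simp
  qed
  have l1: "((\<lambda>s. pt s t) has_derivative (\<lambda>v. v *\<^sub>R axis 1 1)) (at s)"
    and l2: "((\<lambda>s. pt t s) has_derivative (\<lambda>v. v *\<^sub>R axis 2 1)) (at s)" for s
    unfolding pt_eq by (auto intro!: derivative_eq_intros)
  show "ennreal \<bar>m (pt p t) - m (pt q t)\<bar> \<le> (\<integral>\<^sup>+s. ennreal \<bar>pd 1 m (pt s t)\<bar> * indicator {a..b} s \<partial>lborel)"
    using gen[OF l1 p q] gen[OF l1 q p] by (cases "q \<le> p") (auto simp: abs_minus_commute)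
  show "ennreal \<bar>m (pt t p) - m (pt t q)\<bar> \<le> (\<integral>\<^sup>+s. ennreal \<bar>pd 2 m (pt t s)\<bar> * indicator {a..b} s \<partial>lborel)"
    using gen[OF l2 p q] gen[OF l2 q p] by (cases "q \<le> p") (auto simp: abs_minus_commute)
qed

text \<open>In two dimensions both \<open>\<bar>m z - m z'\<bar> \<le> a(z\<^sub>2) + b(z'\<^sub>1)\<close> and
  \<open>\<bar>m z - m z'\<bar> \<le> b(z\<^sub>1) + a(z'\<^sub>2)\<close> hold, where \<open>a\<close> and \<open>b\<close> are the
  line integrals of the partial derivatives. The product of the two bounds integrates exactly.\<close>

lemma Poincare_two_point:
  fixes m :: "plane \<Rightarrow> real"
  assumes m: "Ck_on 1 UNIV m" and s: "s > 0"
  shows "(\<integral>\<^sup>+z. \<integral>\<^sup>+z'. ennreal ((m z - m z')\<^sup>2) * indicator (cube c s) z * indicator (cube c s) z' \<partial>lborel \<partial>lborel)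
    \<le> ennreal (4 * s\<^sup>2) * ((\<integral>\<^sup>+z. ennreal \<bar>pd 1 m z\<bar> * indicator (cube c s) z \<partial>lborel)
        + (\<integral>\<^sup>+z. ennreal \<bar>pd 2 m z\<bar> * indicator (cube c s) z \<partial>lborel))\<^sup>2"
proof -
  define I where "I i = {c $ i - s..c $ i + s}" for i
  have Q: "indicator (cube c s) z = (indicator (I 1) (z $ 1) * indicator (I 2) (z $ 2) :: ennreal)" for z
    by (auto simp: indicator_def mem_cube2 I_def abs_le_iff)
  have [measurable]: "pd i m \<in> borel_measurable borel" for i
    using m continuous_imp_borel_measurable by auto
  have [measurable]: "I i \<in> sets borel" for i by (simp add: I_def)
  \<comment> \<open>The line integrals run over the full side of the square, so they bound the
    difference between any two points of the line and do not depend on the end points.\<close>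
  define a where "a t = (\<integral>\<^sup>+p. ennreal \<bar>pd 1 m (pt p t)\<bar> * indicator (I 1) p \<partial>lborel)" for t
  define b where "b p = (\<integral>\<^sup>+t. ennreal \<bar>pd 2 m (pt p t)\<bar> * indicator (I 2) t \<partial>lborel)" for p
  have am [measurable]: "a \<in> borel_measurable borel" "b \<in> borel_measurable borel"
    unfolding a_def b_def pt_eq by measurable
  define \<alpha> where "\<alpha> t = a t * indicator (I 2) t" for t
  define \<beta> where "\<beta> p = b p * indicator (I 1) p" for p
  have abm [measurable]: "\<alpha> \<in> borel_measurable borel" "\<beta> \<in> borel_measurable borel"
    unfolding \<alpha>_def \<beta>_def by measurable
  let ?A = "\<integral>\<^sup>+z. ennreal \<bar>pd 1 m z\<bar> * indicator (cube c s) z \<partial>lborel"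
  let ?B = "\<integral>\<^sup>+z. ennreal \<bar>pd 2 m z\<bar> * indicator (cube c s) z \<partial>lborel"
  have A: "(\<integral>\<^sup>+t. \<alpha> t \<partial>lborel) = ?A"
    by (subst nn_integral_plane(2))
       (auto simp: Q \<alpha>_def[abs_def] a_def mult.assoc[symmetric] nn_integral_multc pt_eq)
  have B: "(\<integral>\<^sup>+p. \<beta> p \<partial>lborel) = ?B"
  proof -
    have "(\<integral>\<^sup>+t. ennreal \<bar>pd 2 m (pt p t)\<bar> * indicator (cube c s) (pt p t) \<partial>lborel) = \<beta> p" for p
    proof -
      have "(\<integral>\<^sup>+t. ennreal \<bar>pd 2 m (pt p t)\<bar> * indicator (cube c s) (pt p t) \<partial>lborel)
          = (\<integral>\<^sup>+t. (ennreal \<bar>pd 2 m (pt p t)\<bar> * indicator (I 2) t) * indicator (I 1) p \<partial>lborel)"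
        by (intro nn_integral_cong) (simp add: Q ac_simps)
      also have "\<dots> = \<beta> p"
        unfolding \<beta>_def b_def pt_eq by (rule nn_integral_multc) measurable
      finally show ?thesis .
    qed
    then show ?thesis by (subst nn_integral_plane(1)) auto
  qed
  define \<iota> where "\<iota> i t = (indicator (I i) t :: ennreal)" for i t
  have [measurable]: "\<iota> i \<in> borel_measurable borel" for i unfolding \<iota>_def by measurable
  have L: "(\<integral>\<^sup>+t. \<iota> i t \<partial>lborel) = ennreal (2 * s)" for i
    using s by (simp add: \<iota>_def I_def)
  \<comment> \<open>The four summands come from multiplying out the two bounds. Each is a product of
    functions of single, different coordinates, so its integral factorises.\<close>
  have le: "ennreal ((m z - m z')\<^sup>2) * indicator (cube c s) z * indicator (cube c s) z'
     \<le> (\<beta> (z $ 1) * \<alpha> (z $ 2)) * (\<iota> 1 (z' $ 1) * \<iota> 2 (z' $ 2))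
      + (\<iota> 1 (z $ 1) * \<alpha> (z $ 2)) * (\<iota> 1 (z' $ 1) * \<alpha> (z' $ 2))
      + (\<beta> (z $ 1) * \<iota> 2 (z $ 2)) * (\<beta> (z' $ 1) * \<iota> 2 (z' $ 2))
      + (\<iota> 1 (z $ 1) * \<iota> 2 (z $ 2)) * (\<beta> (z' $ 1) * \<alpha> (z' $ 2))" for z z'
  proof (cases "z \<in> cube c s \<and> z' \<in> cube c s")
    case True
    then have I: "z $ i \<in> I i" "z' $ i \<in> I i" for i
      by (auto simp: mem_cube I_def abs_le_iff) (smt (verit))+
    \<comment> \<open>One route from z to z' turns at (z'_1, z_2), the other at (z_1, z'_2). Using
      both is essential: squaring the bound from a single route would produce the square of a line
      integral, which the L^1 norm of the gradient does not control.\<close>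
    have d1: "ennreal \<bar>m z - m (pt (z' $ 1) (z $ 2))\<bar> \<le> a (z $ 2)"
      using line_difference_bound(1)[OF m, of "z $ 1" _ _ "z' $ 1" "z $ 2"] I[of 1] unfolding a_def I_def by (simp add: pt_eta)
    have d2: "ennreal \<bar>m (pt (z' $ 1) (z $ 2)) - m z'\<bar> \<le> b (z' $ 1)"
      using line_difference_bound(2)[OF m, of "z $ 2" _ _ "z' $ 2" "z' $ 1"] I[of 2] unfolding b_def I_def by (simp add: pt_eta)
    have d3: "ennreal \<bar>m z - m (pt (z $ 1) (z' $ 2))\<bar> \<le> b (z $ 1)"
      using line_difference_bound(2)[OF m, of "z $ 2" _ _ "z' $ 2" "z $ 1"] I[of 2] unfolding b_def I_def by (simp add: pt_eta)
    have d4: "ennreal \<bar>m (pt (z $ 1) (z' $ 2)) - m z'\<bar> \<le> a (z' $ 2)"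
      using line_difference_bound(1)[OF m, of "z $ 1" _ _ "z' $ 1" "z' $ 2"] I[of 1] unfolding a_def I_def by (simp add: pt_eta)
    have tri: "ennreal \<bar>m z - m z'\<bar> \<le> ennreal \<bar>m z - y\<bar> + ennreal \<bar>y - m z'\<bar>" for y
      by (auto simp del: ennreal_plus simp: ennreal_plus[symmetric] intro!: ennreal_leI)
    have e1: "ennreal \<bar>m z - m z'\<bar> \<le> a (z $ 2) + b (z' $ 1)"
      by (rule order_trans[OF tri add_mono[OF d1 d2]])
    have e2: "ennreal \<bar>m z - m z'\<bar> \<le> b (z $ 1) + a (z' $ 2)"
      by (rule order_trans[OF tri add_mono[OF d3 d4]])
    have "ennreal ((m z - m z')\<^sup>2) = ennreal \<bar>m z - m z'\<bar> * ennreal \<bar>m z - m z'\<bar>"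
      by (simp add: ennreal_mult[symmetric] power2_eq_square abs_mult[symmetric])
    also have "\<dots> \<le> (a (z $ 2) + b (z' $ 1)) * (b (z $ 1) + a (z' $ 2))"
      by (intro mult_mono e1 e2) auto
    finally show ?thesis using True I
      by (simp add: \<alpha>_def \<beta>_def \<iota>_def algebra_simps)
  qed (auto simp: indicator_def)
  have prod: "(\<integral>\<^sup>+z. f ((z::plane) $ 1) * g (z $ 2) \<partial>lborel) = (\<integral>\<^sup>+s. f s \<partial>lborel) * (\<integral>\<^sup>+t. g t \<partial>lborel)"
    if "f \<in> borel_measurable borel" "g \<in> borel_measurable borel" for f g :: "real \<Rightarrow> ennreal"
    using that by (rule nn_integral_plane_times)
  have "(\<integral>\<^sup>+z. \<integral>\<^sup>+z'. ennreal ((m z - m z')\<^sup>2) * indicator (cube c s) z * indicator (cube c s) z' \<partial>lborel \<partial>lborel)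
     \<le> (\<integral>\<^sup>+z. \<integral>\<^sup>+z'. (\<beta> ((z::plane) $ 1) * \<alpha> (z $ 2)) * (\<iota> 1 ((z'::plane) $ 1) * \<iota> 2 (z' $ 2))
      + (\<iota> 1 (z $ 1) * \<alpha> (z $ 2)) * (\<iota> 1 (z' $ 1) * \<alpha> (z' $ 2))
      + (\<beta> (z $ 1) * \<iota> 2 (z $ 2)) * (\<beta> (z' $ 1) * \<iota> 2 (z' $ 2))
      + (\<iota> 1 (z $ 1) * \<iota> 2 (z $ 2)) * (\<beta> (z' $ 1) * \<alpha> (z' $ 2)) \<partial>lborel \<partial>lborel)"
    by (intro nn_integral_mono le)
  also have "\<dots> = (?B * ?A) * (ennreal (2 * s) * ennreal (2 * s)) + (ennreal (2 * s) * ?A) * (ennreal (2 * s) * ?A)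
      + (?B * ennreal (2 * s)) * (?B * ennreal (2 * s)) + (ennreal (2 * s) * ennreal (2 * s)) * (?B * ?A)"
    by (simp add: nn_integral_add nn_integral_cmult nn_integral_multc prod A B L)
  also have "\<dots> = (ennreal (2 * s) * ennreal (2 * s)) * (?A + ?B)\<^sup>2"
    by (simp add: power2_eq_square algebra_simps)
  also have "ennreal (2 * s) * ennreal (2 * s) = ennreal (4 * s\<^sup>2)"
    using s by (simp add: ennreal_mult[symmetric] power2_eq_square)
  finally show ?thesis .
qed

section \<open>Integrals over pairs of points of a square\<close>

lemma cube_Times: "cube c s \<times> cube d t = cbox (c - (\<chi> i. s), d - (\<chi> i. t)) (c + (\<chi> i. s), d + (\<chi> i. t))"
  by (simp add: cube_def cbox_Pair_eq)

lemma integrable_on_cube_Times: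
  fixes F :: "plane \<times> plane \<Rightarrow> real"
  shows "continuous_on (cube c s \<times> cube d t) F \<Longrightarrow> F integrable_on (cube c s \<times> cube d t)"
  unfolding cube_Times by (rule integrable_continuous)

lemma integrable_on_cube:
  fixes F :: "plane \<Rightarrow> real"
  shows "continuous_on (cube c s) F \<Longrightarrow> F integrable_on (cube c s)"
  unfolding cube_def by (rule integrable_continuous)

lemma continuous_on_integral_cube:
  fixes F :: "plane \<times> plane \<Rightarrow> real"
  assumes "continuous_on (cube c s \<times> cube d t) F"
  shows "continuous_on (cube c s) (\<lambda>z. integral (cube d t) (\<lambda>w. F (z, w)))"
  using assms integral_continuous_on_param[of "cube c s" "d - (\<chi> i. t)" "d + (\<chi> i. t)" "\<lambda>z w. F (z, w)"]
  by (simp add: cube_def)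

lemma integral_cube_Times:
  fixes F :: "plane \<times> plane \<Rightarrow> real"
  assumes "continuous_on (cube c s \<times> cube d t) F"
  shows "integral (cube c s \<times> cube d t) F = integral (cube c s) (\<lambda>z. integral (cube d t) (\<lambda>w. F (z, w)))"
  using integral_prod_continuous[OF assms[unfolded cube_Times]] unfolding cube_Times by (simp add: cube_def)

lemma content_cube: "s \<ge> 0 \<Longrightarrow> measure lborel (cube c s) = 4 * s\<^sup>2"
  using emeasure_lborel_cube[of s c] by (simp add: measure_def)

lemma integral_cube_const: "s \<ge> 0 \<Longrightarrow> integral (cube c s) (\<lambda>z. k) = 4 * s\<^sup>2 * (k::real)"
  using content_cube[of s c] by (simp add: cube_def)

lemma integral_cube_Times_const:
  assumes "s \<ge> 0"
  shows "integral (cube c s \<times> cube c s) (\<lambda>z. k) = 16 * s ^ 4 * (k::real)"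
  by (subst integral_cube_Times) (auto simp: integral_cube_const assms power4_eq_xxxx power2_eq_square)

lemma nn_integral_cube:
  fixes F :: "plane \<Rightarrow> real"
  assumes "continuous_on (cube c s) F" "\<And>z. z \<in> cube c s \<Longrightarrow> 0 \<le> F z"
  shows "(\<integral>\<^sup>+z. ennreal (F z) * indicator (cube c s) z \<partial>lborel) = ennreal (integral (cube c s) F)"
  by (rule nn_integral_has_integral_lebesgue'[OF assms(2) integrable_integral[OF integrable_on_cube[OF assms(1)]]])

lemma nn_integral_cube_Times:
  fixes F :: "plane \<times> plane \<Rightarrow> real"
  assumes F: "continuous_on (cube c s \<times> cube c s) F" "\<And>p. p \<in> cube c s \<times> cube c s \<Longrightarrow> 0 \<le> F p"
  shows "(\<integral>\<^sup>+z. \<integral>\<^sup>+w. ennreal (F (z, w)) * indicator (cube c s) z * indicator (cube c s) w \<partial>lborel \<partial>lborel)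
    = ennreal (integral (cube c s \<times> cube c s) F)"
proof -
  let ?G = "\<lambda>z. integral (cube c s) (\<lambda>w. F (z, w))"
  have sl: "continuous_on (cube c s) (\<lambda>w. F (z, w))" if "z \<in> cube c s" for z
    using that by (intro continuous_on_compose2[OF F(1)] continuous_intros) auto
  have inner: "(\<integral>\<^sup>+w. ennreal (F (z, w)) * indicator (cube c s) z * indicator (cube c s) w \<partial>lborel)
      = ennreal (?G z) * indicator (cube c s) z" for z
  proof (cases "z \<in> cube c s")
    case True
    then show ?thesis using nn_integral_cube[OF sl[OF True]] F(2) by simp
  qed simp
  have "?G z \<ge> 0" if "z \<in> cube c s" for z
    using F(2) that by (intro integral_nonneg integrable_on_cube sl) auto
  then show ?thesis
    unfolding inner integral_cube_Times[OF F(1)]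
    by (intro nn_integral_cube continuous_on_integral_cube[OF F(1)]) auto
qed

lemma sum_square_le: "(a + b)\<^sup>2 \<le> 2 * a\<^sup>2 + 2 * (b::real)\<^sup>2"
  using zero_le_power2[of "a - b"] by (simp add: power2_eq_square algebra_simps)

text \<open>The two-point inequality is applied to a mollification, whose gradient has L^1 norm at
  most the mass on the larger square. The constant 8 is twice the 4 obtained there, the price of
  splitting off the approximation error by (a + b)^2 <= 2 a^2 + 2 b^2.\<close>

lemma Poincare_BV:
  assumes W: "open W" and h: "continuous_on W h" and M: "\<And>i. pd_dominated i W h (M i)"
    and s: "s > 0" and t: "t > 0" and c: "cube c (s + t) \<subseteq> W"
  shows "integral (cube c s \<times> cube c s) (\<lambda>(z, w). (h z - h w)\<^sup>2)
    \<le> 8 * s\<^sup>2 * (measure (M 1) (cube c (s + t)) + measure (M 2) (cube c (s + t)))\<^sup>2"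
proof -
  let ?Q = "cube c s" and ?R = "cube c (s + t)"
  let ?\<mu> = "measure (M 1) ?R + measure (M 2) ?R"
  have fin: "emeasure (M i) ?R < \<infinity>" for i using M[of i] c unfolding pd_dominated_def by blast
  have sM: "sets (M i) = sets borel" for i using M[of i] by (simp add: pd_dominated_def)
  have QW: "?Q \<subseteq> W" using c cube_mono[of s "s+t" c] t by auto
  have hQ: "continuous_on ?Q h" by (rule continuous_on_subset[OF h QW])
  have hR: "continuous_on ?R h" by (rule continuous_on_subset[OF h c])
  have h2: "continuous_on (?Q \<times> ?Q) (\<lambda>(z, w). (h z - h w)\<^sup>2)"
    unfolding split_beta by (intro continuous_intros continuous_on_compose2[OF hQ]) auto
  \<comment> \<open>The error term is 2 (2 e)^2 = 8 e^2 integrated over the pairs of points, a set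
    of volume 16 s^4.\<close>
  have main: "integral (?Q \<times> ?Q) (\<lambda>(z, w). (h z - h w)\<^sup>2) \<le> 8 * s\<^sup>2 * ?\<mu>\<^sup>2 + 128 * s ^ 4 * e\<^sup>2" if e: "e > 0" for e
  proof -
    have "uniformly_continuous_on ?R h" by (rule compact_uniformly_continuous[OF hR]) auto
    then obtain d where d: "d > 0" "\<And>x y. x \<in> ?R \<Longrightarrow> y \<in> ?R \<Longrightarrow> dist y x < d \<Longrightarrow> dist (h y) (h x) < e"
      unfolding uniformly_continuous_on_def using e by metis
    define r where "r = min t (d / 4)"
    have r: "r > 0" "r \<le> t" "2 * r < d" using d t by (auto simp: r_def min_def)
    have cr: "cube c (s + r) \<subseteq> W" using c cube_mono[of "s+r" "s+t" c] r by auto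
    define m where "m = mollify c (s + r) r h"
    have m: "Ck_on 1 UNIV m" unfolding m_def by (rule Ck_on_mollify[OF continuous_on_subset[OF h cr]])
    have mc: "continuous_on UNIV m" using m Ck_on_continuous by blast
    have close: "\<bar>m x - h x\<bar> \<le> e" if x: "x \<in> ?Q" for x
      unfolding m_def
    proof (rule mollify_close[OF W h r(1) cr x])
      fix z assume z: "z \<in> cube x r"
      have "dist z x \<le> 2 * r" using cube_subset_cball[of x r] z by (auto simp: dist_commute)
      moreover have "z \<in> ?R" "x \<in> ?R" using cube_trans[OF z x] cube_mono[of "s+r" "s+t" c] cube_mono[of s "s+t" c] x r t by auto
      ultimately show "\<bar>h z - h x\<bar> \<le> e" using d(2)[of x z] r by (auto simp: dist_real_def)
    qed
    have L1: "(\<integral>\<^sup>+x. ennreal \<bar>pd i m x\<bar> * indicator ?Q x \<partial>lborel) \<le> ennreal (measure (M i) ?R)" for i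
    proof -
      have "(\<integral>\<^sup>+x. ennreal \<bar>pd i m x\<bar> * indicator ?Q x \<partial>lborel) \<le> emeasure (M i) (cube c (s + r))"
        unfolding m_def by (rule mollify_L1_bound[OF W h M r(1) cr])
      also have "\<dots> \<le> emeasure (M i) ?R"
        using sM cube_mono[of "s+r" "s+t" c] r by (intro emeasure_mono) auto
      also have "\<dots> = ennreal (measure (M i) ?R)" using fin[of i] by (intro emeasure_eq_ennreal_measure) auto
      finally show ?thesis .
    qed
    have m2: "continuous_on (?Q \<times> ?Q) (\<lambda>(z, w). (m z - m w)\<^sup>2)"
      unfolding split_beta by (intro continuous_intros continuous_on_compose2[OF mc]) auto
    have "ennreal (integral (?Q \<times> ?Q) (\<lambda>(z, w). (m z - m w)\<^sup>2))
        = (\<integral>\<^sup>+z. \<integral>\<^sup>+w. ennreal ((m z - m w)\<^sup>2) * indicator ?Q z * indicator ?Q w \<partial>lborel \<partial>lborel)"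
      by (subst nn_integral_cube_Times[OF m2, symmetric]) auto
    also have "\<dots> \<le> ennreal (4 * s\<^sup>2) * (ennreal (measure (M 1) ?R) + ennreal (measure (M 2) ?R))\<^sup>2"
      by (rule order_trans[OF Poincare_two_point[OF m s]]) (intro mult_left_mono power_mono add_mono L1; simp)
    also have "\<dots> = ennreal (4 * s\<^sup>2 * ?\<mu>\<^sup>2)"
      by (simp add: ennreal_mult[symmetric] ennreal_power ennreal_plus[symmetric] del: ennreal_plus)
    finally have m3: "integral (?Q \<times> ?Q) (\<lambda>(z, w). (m z - m w)\<^sup>2) \<le> 4 * s\<^sup>2 * ?\<mu>\<^sup>2"
      by (subst (asm) ennreal_le_iff) auto
    have "integral (?Q \<times> ?Q) (\<lambda>(z, w). (h z - h w)\<^sup>2)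
        \<le> integral (?Q \<times> ?Q) (\<lambda>p. 2 * (case p of (z, w) \<Rightarrow> (m z - m w)\<^sup>2) + 8 * e\<^sup>2)"
    proof (rule integral_le)
      show "(\<lambda>(z, w). (h z - h w)\<^sup>2) integrable_on ?Q \<times> ?Q" by (rule integrable_on_cube_Times[OF h2])
      show "(\<lambda>p. 2 * (case p of (z, w) \<Rightarrow> (m z - m w)\<^sup>2) + 8 * e\<^sup>2) integrable_on ?Q \<times> ?Q"
        by (rule integrable_on_cube_Times) (intro continuous_intros m2)
      fix p assume "p \<in> ?Q \<times> ?Q"
      then obtain z w where p: "p = (z, w)" "z \<in> ?Q" "w \<in> ?Q" by auto
      have "\<bar>(h z - m z) - (h w - m w)\<bar> \<le> 2 * e" using close[OF p(2)] close[OF p(3)] by linarith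
      then have "((h z - m z) - (h w - m w))\<^sup>2 \<le> (2 * e)\<^sup>2" by (rule abs_le_square_iff[THEN iffD1, OF order_trans]) (use e in auto)
      then have "(h z - h w)\<^sup>2 \<le> 2 * (m z - m w)\<^sup>2 + 2 * (2 * e)\<^sup>2"
        using sum_square_le[of "m z - m w" "(h z - m z) - (h w - m w)"] by (simp add: algebra_simps)
      then show "(case p of (z, w) \<Rightarrow> (h z - h w)\<^sup>2) \<le> 2 * (case p of (z, w) \<Rightarrow> (m z - m w)\<^sup>2) + 8 * e\<^sup>2"
        using p by (simp add: power_mult_distrib)
    qed
    also have "\<dots> = integral (?Q \<times> ?Q) (\<lambda>p. 2 * (case p of (z, w) \<Rightarrow> (m z - m w)\<^sup>2)) + integral (?Q \<times> ?Q) (\<lambda>p. 8 * e\<^sup>2)"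
      by (rule Henstock_Kurzweil_Integration.integral_add; rule integrable_on_cube_Times) (intro continuous_intros m2)+
    also have "\<dots> = 2 * integral (?Q \<times> ?Q) (\<lambda>(z, w). (m z - m w)\<^sup>2) + 128 * s ^ 4 * e\<^sup>2"
      using s by (simp add: integral_cube_Times_const)
    finally show ?thesis using m3 by simp
  qed
  show ?thesis
  proof (rule field_le_epsilon)
    fix \<eta> :: real assume \<eta>: "\<eta> > 0"
    define e where "e = sqrt (\<eta> / (128 * s ^ 4))"
    have "e > 0" "128 * s ^ 4 * e\<^sup>2 = \<eta>" using \<eta> s by (auto simp: e_def)
    with main[of e] show "integral (?Q \<times> ?Q) (\<lambda>(z, w). (h z - h w)\<^sup>2) \<le> 8 * s\<^sup>2 * ?\<mu>\<^sup>2 + \<eta>" by simp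
  qed
qed

section \<open>Differentiability in the mean\<close>

text \<open>The sixth power is the order of the integral of \<open>\<bar>z - w\<bar>\<^sup>2\<close> over pairs of points of the cube.\<close>

definition small :: "plane \<Rightarrow> (plane \<times> plane \<Rightarrow> real) \<Rightarrow> bool" where
  "small x G \<longleftrightarrow> (\<exists>d>0. continuous_on (cube x d \<times> cube x d) G) \<and>
     (\<forall>e>0. \<exists>d>0. \<forall>r. 0 < r \<and> r < d \<longrightarrow> integral (cube x r \<times> cube x r) (\<lambda>p. (G p)\<^sup>2) \<le> e * r ^ 6)"

lemma smallI:
  assumes "d0 > 0" "continuous_on (cube x d0 \<times> cube x d0) G"
    and "\<And>e. e > 0 \<Longrightarrow> \<exists>d>0. \<forall>r. 0 < r \<and> r < d \<and> r \<le> d0 \<longrightarrow> integral (cube x r \<times> cube x r) (\<lambda>p. (G p)\<^sup>2) \<le> e * r ^ 6"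
  shows "small x G"
  unfolding small_def
proof (intro conjI allI impI)
  show "\<exists>d>0. continuous_on (cube x d \<times> cube x d) G" using assms(1,2) by blast
  fix e :: real assume "e > 0"
  then obtain d where "d > 0" "\<forall>r. 0 < r \<and> r < d \<and> r \<le> d0 \<longrightarrow> integral (cube x r \<times> cube x r) (\<lambda>p. (G p)\<^sup>2) \<le> e * r ^ 6"
    using assms(3) by blast
  then show "\<exists>d>0. \<forall>r. 0 < r \<and> r < d \<longrightarrow> integral (cube x r \<times> cube x r) (\<lambda>p. (G p)\<^sup>2) \<le> e * r ^ 6"
    using assms(1) by (intro exI[of _ "min d d0"]) auto
qed

lemma smallE:
  assumes "small x G" "e > 0"
  obtains d where "d > 0" "continuous_on (cube x d \<times> cube x d) G"
    "\<And>r. 0 < r \<Longrightarrow> r < d \<Longrightarrow> integral (cube x r \<times> cube x r) (\<lambda>p. (G p)\<^sup>2) \<le> e * r ^ 6"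
proof -
  obtain d1 where d1: "d1 > 0" "continuous_on (cube x d1 \<times> cube x d1) G"
    using assms unfolding small_def by blast
  obtain d2 where d2: "d2 > 0" "\<forall>r. 0 < r \<and> r < d2 \<longrightarrow> integral (cube x r \<times> cube x r) (\<lambda>p. (G p)\<^sup>2) \<le> e * r ^ 6"
    using assms unfolding small_def by blast
  show thesis
    by (rule that[of "min d1 d2"])
       (use d1 d2 cube_mono[of "min d1 d2" d1 x] in \<open>auto intro: continuous_on_subset\<close>)
qed

lemma cube_Times_mono: "r \<le> s \<Longrightarrow> cube x r \<times> cube x r \<subseteq> cube x s \<times> cube x s"
  using cube_mono by blast

lemma integrable_square:
  fixes G :: "plane \<times> plane \<Rightarrow> real"
  assumes "continuous_on (cube x d \<times> cube x d) G" "r \<le> d"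
  shows "(\<lambda>p. k * (G p)\<^sup>2) integrable_on (cube x r \<times> cube x r)"
  using assms by (intro integrable_on_cube_Times continuous_intros continuous_on_subset[OF assms(1) cube_Times_mono])

lemma integrable_square':
  fixes G :: "plane \<times> plane \<Rightarrow> real"
  assumes "continuous_on (cube x d \<times> cube x d) G" "r \<le> d"
  shows "(\<lambda>p. (G p)\<^sup>2) integrable_on (cube x r \<times> cube x r)"
  using integrable_square[OF assms, of 1] by simp

lemma small_add:
  assumes "small x G" "small x H" shows "small x (\<lambda>p. G p + H p)"
proof -
  obtain d1 where d1: "d1 > 0" "continuous_on (cube x d1 \<times> cube x d1) G" using assms small_def by blast
  obtain d2 where d2: "d2 > 0" "continuous_on (cube x d2 \<times> cube x d2) H" using assms small_def by blast
  show ?thesis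
  proof (rule smallI[of "min d1 d2"])
    show "continuous_on (cube x (min d1 d2) \<times> cube x (min d1 d2)) (\<lambda>p. G p + H p)"
      by (intro continuous_intros continuous_on_subset[OF d1(2)] continuous_on_subset[OF d2(2)] cube_Times_mono) auto
    fix e :: real assume e: "e > 0"
    obtain d3 where d3: "d3 > 0" "continuous_on (cube x d3 \<times> cube x d3) G"
      "\<And>r. 0 < r \<Longrightarrow> r < d3 \<Longrightarrow> integral (cube x r \<times> cube x r) (\<lambda>p. (G p)\<^sup>2) \<le> e / 4 * r ^ 6"
      using smallE[OF assms(1), of "e / 4"] e by (metis divide_pos_pos zero_less_numeral)
    obtain d4 where d4: "d4 > 0" "continuous_on (cube x d4 \<times> cube x d4) H"
      "\<And>r. 0 < r \<Longrightarrow> r < d4 \<Longrightarrow> integral (cube x r \<times> cube x r) (\<lambda>p. (H p)\<^sup>2) \<le> e / 4 * r ^ 6"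
      using smallE[OF assms(2), of "e / 4"] e by (metis divide_pos_pos zero_less_numeral)
    have "integral (cube x r \<times> cube x r) (\<lambda>p. (G p + H p)\<^sup>2) \<le> e * r ^ 6" if r: "0 < r" "r < min d3 d4" for r
    proof -
      let ?S = "cube x r \<times> cube x r"
      have rr: "r \<le> d3" "r \<le> d4" using r by auto
      have c: "continuous_on ?S (\<lambda>p. G p + H p)"
        using rr by (intro continuous_intros continuous_on_subset[OF d3(2)] continuous_on_subset[OF d4(2)] cube_Times_mono)
      have "integral ?S (\<lambda>p. (G p + H p)\<^sup>2) \<le> integral ?S (\<lambda>p. 2 * (G p)\<^sup>2 + 2 * (H p)\<^sup>2)"
        by (intro integral_le integrable_square'[OF c] integrable_add integrable_square[OF d3(2)] integrable_square[OF d4(2)] rr sum_square_le) simp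
      also have "\<dots> = 2 * integral ?S (\<lambda>p. (G p)\<^sup>2) + 2 * integral ?S (\<lambda>p. (H p)\<^sup>2)"
        by (subst Henstock_Kurzweil_Integration.integral_add[OF integrable_square[OF d3(2) rr(1)] integrable_square[OF d4(2) rr(2)]]) simp
      also have "\<dots> \<le> 2 * (e / 4 * r ^ 6) + 2 * (e / 4 * r ^ 6)"
        using d3(3)[of r] d4(3)[of r] r by (intro add_mono mult_left_mono) auto
      finally show ?thesis by simp
    qed
    then show "\<exists>d>0. \<forall>r. 0 < r \<and> r < d \<and> r \<le> min d1 d2 \<longrightarrow> integral (cube x r \<times> cube x r) (\<lambda>p. (G p + H p)\<^sup>2) \<le> e * r ^ 6"
      using d3 d4 by (intro exI[of _ "min d3 d4"]) auto
  qed (use d1 d2 in auto)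
qed

lemma small_mult:
  assumes G: "small x G" and d: "d > 0" and c: "continuous_on (cube x d \<times> cube x d) c"
  shows "small x (\<lambda>p. c p * G p)"
proof -
  obtain d1 where d1: "d1 > 0" "continuous_on (cube x d1 \<times> cube x d1) G" using G small_def by blast
  have cpt: "compact (c ` (cube x d \<times> cube x d))"
    by (intro compact_continuous_image c compact_Times) auto
  obtain B where B0: "\<forall>y\<in>c ` (cube x d \<times> cube x d). norm y \<le> B"
    using compact_imp_bounded[OF cpt] unfolding bounded_iff ..
  have B: "\<bar>c p\<bar> \<le> B" if "p \<in> cube x d \<times> cube x d" for p
    using B0[rule_format, OF imageI[OF that]] by simp
  show ?thesis
  proof (rule smallI[of "min d d1"])
    show cc: "continuous_on (cube x (min d d1) \<times> cube x (min d d1)) (\<lambda>p. c p * G p)"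
      by (intro continuous_intros continuous_on_subset[OF c] continuous_on_subset[OF d1(2)] cube_Times_mono) auto
    fix e :: real assume e: "e > 0"
    have "e / (B\<^sup>2 + 1) > 0" using e by (simp add: add_nonneg_pos)
    then obtain d3 where d3: "d3 > 0" "continuous_on (cube x d3 \<times> cube x d3) G"
      "\<And>r. 0 < r \<Longrightarrow> r < d3 \<Longrightarrow> integral (cube x r \<times> cube x r) (\<lambda>p. (G p)\<^sup>2) \<le> e / (B\<^sup>2 + 1) * r ^ 6"
      using smallE[OF G] by metis
    have "integral (cube x r \<times> cube x r) (\<lambda>p. (c p * G p)\<^sup>2) \<le> e * r ^ 6" if r: "0 < r" "r < d3" "r \<le> min d d1" for r
    proof -
      let ?S = "cube x r \<times> cube x r"
      have "integral ?S (\<lambda>p. (c p * G p)\<^sup>2) \<le> integral ?S (\<lambda>p. B\<^sup>2 * (G p)\<^sup>2)"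
      proof (intro integral_le integrable_square'[OF cc] integrable_square[OF d1(2)])
        fix p assume "p \<in> ?S"
        then have "p \<in> cube x d \<times> cube x d" using cube_Times_mono[of r d x] r by auto
        then have "(c p)\<^sup>2 \<le> B\<^sup>2" using B by (metis abs_le_square_iff abs_of_nonneg order_trans abs_ge_zero)
        then show "(c p * G p)\<^sup>2 \<le> B\<^sup>2 * (G p)\<^sup>2" by (simp add: power_mult_distrib mult_right_mono)
      qed (use r in auto)
      also have "\<dots> = B\<^sup>2 * integral ?S (\<lambda>p. (G p)\<^sup>2)" by simp
      also have "\<dots> \<le> B\<^sup>2 * (e / (B\<^sup>2 + 1) * r ^ 6)"
        using d3(3)[of r] r by (intro mult_left_mono) auto
      also have "\<dots> = (B\<^sup>2 / (B\<^sup>2 + 1)) * (e * r ^ 6)" by simp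
      also have "\<dots> \<le> 1 * (e * r ^ 6)"
        using e r by (intro mult_right_mono) (auto simp: divide_le_eq_1 add_nonneg_pos)
      finally show ?thesis by simp
    qed
    then show "\<exists>d'>0. \<forall>r. 0 < r \<and> r < d' \<and> r \<le> min d d1 \<longrightarrow> integral (cube x r \<times> cube x r) (\<lambda>p. (c p * G p)\<^sup>2) \<le> e * r ^ 6"
      using d3 by (intro exI[of _ d3]) auto
  qed (use d d1 in auto)
qed

lemma small_cmult: "small x G \<Longrightarrow> small x (\<lambda>p. k * G p)"
  using small_mult[of x G 1 "\<lambda>p. k"] by simp

text \<open>A uniform o(r) bound squares to o(r^2), and the set of pairs has volume 16 r^4, which is
  the origin of the 16 in the proof.\<close>

lemma small_uniform:
  assumes "d0 > 0" "continuous_on (cube x d0 \<times> cube x d0) G"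
    and "\<And>e. e > 0 \<Longrightarrow> \<exists>d>0. \<forall>r p. 0 < r \<and> r < d \<and> p \<in> cube x r \<times> cube x r \<longrightarrow> \<bar>G p\<bar> \<le> e * r"
  shows "small x G"
proof (rule smallI[OF assms(1,2)])
  fix e :: real assume e: "e > 0"
  have "sqrt (e / 16) > 0" using e by simp
  then obtain d where d: "d > 0" "\<And>r p. 0 < r \<Longrightarrow> r < d \<Longrightarrow> p \<in> cube x r \<times> cube x r \<Longrightarrow> \<bar>G p\<bar> \<le> sqrt (e / 16) * r"
    using assms(3) by meson
  have "integral (cube x r \<times> cube x r) (\<lambda>p. (G p)\<^sup>2) \<le> e * r ^ 6" if r: "0 < r" "r < d" "r \<le> d0" for r
  proof -
    have "integral (cube x r \<times> cube x r) (\<lambda>p. (G p)\<^sup>2) \<le> integral (cube x r \<times> cube x r) (\<lambda>p. e / 16 * r\<^sup>2)"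
    proof (intro integral_le integrable_square'[OF assms(2)])
      show "(\<lambda>p. e / 16 * r\<^sup>2) integrable_on cube x r \<times> cube x r" by (intro integrable_on_cube_Times) auto
      fix p assume "p \<in> cube x r \<times> cube x r"
      then have "\<bar>G p\<bar> \<le> sqrt (e / 16) * r" using d r by auto
      then have "(G p)\<^sup>2 \<le> (sqrt (e / 16) * r)\<^sup>2"
        using r e by (metis abs_le_square_iff abs_of_nonneg mult_nonneg_nonneg real_sqrt_ge_zero less_imp_le divide_nonneg_nonneg zero_le_numeral)
      then show "(G p)\<^sup>2 \<le> e / 16 * r\<^sup>2" using e by (simp add: power_mult_distrib)
    qed (use r in auto)
    also have "\<dots> = e * r ^ 6" using r by (simp add: integral_cube_Times_const power_add[symmetric])
    finally show ?thesis .
  qed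
  then show "\<exists>d>0. \<forall>r. 0 < r \<and> r < d \<and> r \<le> d0 \<longrightarrow> integral (cube x r \<times> cube x r) (\<lambda>p. (G p)\<^sup>2) \<le> e * r ^ 6"
    using d by blast
qed

lemma small_cong:
  assumes "small x G" "d > 0" "\<And>p. p \<in> cube x d \<times> cube x d \<Longrightarrow> G p = H p"
  shows "small x H"
proof -
  obtain d1 where d1: "d1 > 0" "continuous_on (cube x d1 \<times> cube x d1) G" using assms small_def by blast
  show ?thesis
  proof (rule smallI[of "min d d1"])
    have "continuous_on (cube x (min d d1) \<times> cube x (min d d1)) G"
      by (intro continuous_on_subset[OF d1(2)] cube_Times_mono) auto
    then show "continuous_on (cube x (min d d1) \<times> cube x (min d d1)) H"
      by (rule continuous_on_eq) (use assms(3) cube_Times_mono[of "min d d1" d x] in auto)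
    fix e :: real assume "e > 0"
    then obtain d2 where d2: "d2 > 0" 
      "\<And>r. 0 < r \<Longrightarrow> r < d2 \<Longrightarrow> integral (cube x r \<times> cube x r) (\<lambda>p. (G p)\<^sup>2) \<le> e * r ^ 6"
      using smallE[OF assms(1)] by metis
    have "integral (cube x r \<times> cube x r) (\<lambda>p. (H p)\<^sup>2) = integral (cube x r \<times> cube x r) (\<lambda>p. (G p)\<^sup>2)"
      if "r \<le> min d d1" for r
      by (rule Henstock_Kurzweil_Integration.integral_cong) (use assms(3) cube_Times_mono[of r d x] that in auto)
    then show "\<exists>d'>0. \<forall>r. 0 < r \<and> r < d' \<and> r \<le> min d d1 \<longrightarrow> integral (cube x r \<times> cube x r) (\<lambda>p. (H p)\<^sup>2) \<le> e * r ^ 6"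
      using d2 by (intro exI[of _ d2]) auto
  qed (use assms d1 in auto)
qed

lemma norm_diff_cube: "z \<in> cube x r \<Longrightarrow> w \<in> cube x r \<Longrightarrow> norm (z - w) \<le> 4 * r"
proof -
  assume "z \<in> cube x r" "w \<in> cube x r"
  then have "dist x z \<le> 2 * r" "dist x w \<le> 2 * r" using cube_subset_cball[of x r] by auto
  then show ?thesis using dist_triangle[of z w x] by (simp add: dist_norm[symmetric] dist_commute)
qed

text \<open>The pair integral of the square of a linear form is homogeneous of degree exactly 6 in
  \<open>r\<close>, so it is not o(r^6) unless the form is zero.\<close>

lemma small_linear_imp_zero:
  assumes "small x (\<lambda>(z, w). A \<bullet> (z - w))" shows "A = 0"
proof (rule ccontr)
  assume "A \<noteq> 0"
  define N where "N = \<bar>A $ 1\<bar> + \<bar>A $ 2\<bar>"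
  have "A $ 1 \<noteq> 0 \<or> A $ 2 \<noteq> 0" using \<open>A \<noteq> 0\<close> plane_eqI[of A 0] by auto
  then have N: "N > 0" by (auto simp: N_def)
  \<comment> \<open>The lower bound derived below is N^2 / 64 times r^6, twice this
    tolerance.\<close>
  have "N\<^sup>2 / 128 > 0" using N by simp
  then obtain d where d: "d > 0" "\<And>r. 0 < r \<Longrightarrow> r < d \<Longrightarrow>
      integral (cube x r \<times> cube x r) (\<lambda>p. (case p of (z, w) \<Rightarrow> A \<bullet> (z - w))\<^sup>2) \<le> N\<^sup>2 / 128 * r ^ 6"
    using smallE[OF assms] by metis
  define r where "r = d / 2"
  have r: "r > 0" "r < d" using d by (auto simp: r_def)
  let ?G = "\<lambda>p::plane \<times> plane. (case p of (z, w) \<Rightarrow> A \<bullet> (z - w))\<^sup>2"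
  have cG: "continuous_on S ?G" for S unfolding split_beta by (intro continuous_intros)
  \<comment> \<open>For z near x + \<sigma> and w near x - \<sigma> each coordinate of z - w differs
    from r sgn(A_i) by at most r / 2, so every coordinate contributes at least r / 2 times |A_i| to
    the linear form.\<close>
  define \<sigma> where "\<sigma> = (\<chi> i. (r / 2) * sgn (A $ i))"
  let ?S = "cube (x + \<sigma>) (r / 4) \<times> cube (x - \<sigma>) (r / 4)"
  have \<sigma>: "\<bar>\<sigma> $ i\<bar> \<le> r / 2" for i using r by (auto simp: \<sigma>_def abs_mult sgn_if)
  have sub: "?S \<subseteq> cube x r \<times> cube x r"
  proof safe
    fix z w :: plane
    assume zw: "z \<in> cube (x + \<sigma>) (r / 4)" "w \<in> cube (x - \<sigma>) (r / 4)"
    have "\<bar>z $ i - x $ i\<bar> \<le> r" "\<bar>w $ i - x $ i\<bar> \<le> r" for i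
      using zw[unfolded mem_cube, rule_format, of i] \<sigma>[of i] r
      unfolding vector_add_component vector_minus_component abs_le_iff by linarith+
    then show "z \<in> cube x r" "w \<in> cube x r" by (auto simp: mem_cube)
  qed
  have low: "(r / 2 * N)\<^sup>2 \<le> ?G p" if pS: "p \<in> ?S" for p
  proof -
    obtain z w where p: "p = (z, w)" "z \<in> cube (x + \<sigma>) (r / 4)" "w \<in> cube (x - \<sigma>) (r / 4)" using pS by blast
    have aux: "r / 2 * b \<le> X" if "\<bar>X - r * b\<bar> \<le> b * (r / 2)" for X b :: real
      using that abs_ge_minus_self[of "X - r * b"] by (simp add: field_simps)
    have "r / 2 * \<bar>A $ i\<bar> \<le> A $ i * (z $ i - w $ i)" for i
    proof -
      have "\<bar>(z $ i - w $ i) - 2 * \<sigma> $ i\<bar> \<le> r / 2"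
        using p(2,3)[unfolded mem_cube, rule_format, of i]
        unfolding vector_add_component vector_minus_component by linarith
      then have "\<bar>A $ i * ((z $ i - w $ i) - r * sgn (A $ i))\<bar> \<le> \<bar>A $ i\<bar> * (r / 2)"
        unfolding abs_mult \<sigma>_def by (intro mult_left_mono) auto
      moreover have "A $ i * ((z $ i - w $ i) - r * sgn (A $ i)) = A $ i * (z $ i - w $ i) - r * \<bar>A $ i\<bar>"
        by (simp add: algebra_simps abs_sgn)
      ultimately have "\<bar>A $ i * (z $ i - w $ i) - r * \<bar>A $ i\<bar>\<bar> \<le> \<bar>A $ i\<bar> * (r / 2)" by simp
      then show ?thesis by (rule aux)
    qed
    from this[of 1] this[of 2] have "r / 2 * N \<le> A \<bullet> (z - w)"
      by (simp add: inner_plane N_def algebra_simps)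
    then show ?thesis using r N p(1) by (auto intro!: power_mono)
  qed
  have "(r / 4) ^ 4 * 16 * (r / 2 * N)\<^sup>2 = integral ?S (\<lambda>p. (r / 2 * N)\<^sup>2)"
    using r by (subst integral_cube_Times) (auto simp: integral_cube_const power4_eq_xxxx power2_eq_square)
  also have "\<dots> \<le> integral ?S ?G"
    using low by (intro integral_le integrable_on_cube_Times cG continuous_on_const) auto
  also have "\<dots> \<le> integral (cube x r \<times> cube x r) ?G"
    by (intro integral_subset_le sub integrable_on_cube_Times cG) auto
  also have "\<dots> \<le> N\<^sup>2 / 128 * r ^ 6" using d(2) r by blast
  also have "(r / 4) ^ 4 * 16 * (r / 2 * N)\<^sup>2 = N\<^sup>2 / 64 * r ^ 6"
    by (simp add: field_simps eval_nat_numeral)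
  finally have "N\<^sup>2 / 64 * r ^ 6 \<le> N\<^sup>2 / 128 * r ^ 6" .
  moreover have "N\<^sup>2 * r ^ 6 > 0" using N r by simp
  ultimately show False by simp
qed

text \<open>L^2 differentiability in the mean at \<open>x\<close> with gradient \<open>A\<close>,
  formulated through increments between two arbitrary points of small squares. The value of
  \<open>h\<close> at \<open>x\<close> does not enter, which matches the form of the Poincare
  inequality.\<close>

definition LD :: "(plane \<Rightarrow> real) \<Rightarrow> plane \<Rightarrow> plane \<Rightarrow> bool" where
  "LD h x A \<longleftrightarrow> (\<exists>d>0. continuous_on (cube x d) h) \<and> small x (\<lambda>(z, w). h z - h w - A \<bullet> (z - w))"

lemma LD_cong:
  assumes "LD h x A" "open W" "x \<in> W" "\<And>z. z \<in> W \<Longrightarrow> h z = k z" shows "LD k x A"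
proof -
  obtain d where d: "d > 0" "cube x d \<subseteq> W" using open_contains_cube assms(2,3) by blast
  obtain d1 where d1: "d1 > 0" "continuous_on (cube x d1) h" using assms(1) LD_def by blast
  have "continuous_on (cube x (min d d1)) h"
    by (intro continuous_on_subset[OF d1(2)] cube_mono) auto
  then have "continuous_on (cube x (min d d1)) k"
    by (rule continuous_on_eq) (use assms(4) d(2) cube_mono[of "min d d1" d x] in auto)
  moreover have "small x (\<lambda>(z, w). k z - k w - A \<bullet> (z - w))"
  proof (rule small_cong[of x "\<lambda>(z, w). h z - h w - A \<bullet> (z - w)" d])
    fix p assume "p \<in> cube x d \<times> cube x d"
    then have "fst p \<in> W" "snd p \<in> W" using d by auto
    then show "(case p of (z, w) \<Rightarrow> h z - h w - A \<bullet> (z - w)) = (case p of (z, w) \<Rightarrow> k z - k w - A \<bullet> (z - w))"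
      using assms(4) by (simp add: split_beta)
  qed (use assms d in \<open>auto simp: LD_def\<close>)
  ultimately show ?thesis using d d1 unfolding LD_def by (intro conjI exI[of _ "min d d1"]) auto
qed

text \<open>This turns an identity between functions into an identity between their mean
  derivatives: both sides are differentiated by different rules and the results compared.\<close>

lemma LD_unique:
  assumes "LD h x A" "LD h x B" shows "A = B"
proof -
  have "small x (\<lambda>p. (case p of (z, w) \<Rightarrow> h z - h w - A \<bullet> (z - w)) + (- 1) * (case p of (z, w) \<Rightarrow> h z - h w - B \<bullet> (z - w)))"
    using assms unfolding LD_def by (intro small_add small_cmult) auto
  also have "(\<lambda>p. (case p of (z, w) \<Rightarrow> h z - h w - A \<bullet> (z - w)) + (- 1) * (case p of (z, w) \<Rightarrow> h z - h w - B \<bullet> (z - w)))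
      = (\<lambda>(z, w). (B - A) \<bullet> (z - w))"
    by (auto simp: fun_eq_iff algebra_simps inner_simps)
  finally have "B - A = 0" by (rule small_linear_imp_zero)
  then show ?thesis by simp
qed

lemma LD_add:
  assumes "LD h x A" "LD k x B" shows "LD (\<lambda>z. h z + k z) x (A + B)"
proof -
  obtain d where d: "d > 0" "continuous_on (cube x d) h" using assms(1) LD_def by blast
  obtain d1 where d1: "d1 > 0" "continuous_on (cube x d1) k" using assms(2) LD_def by blast
  have "continuous_on (cube x (min d d1)) (\<lambda>z. h z + k z)"
    by (intro continuous_intros continuous_on_subset[OF d(2)] continuous_on_subset[OF d1(2)] cube_mono) auto
  moreover have "small x (\<lambda>p. (case p of (z, w) \<Rightarrow> h z - h w - A \<bullet> (z - w)) + (case p of (z, w) \<Rightarrow> k z - k w - B \<bullet> (z - w)))"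
    using assms unfolding LD_def by (intro small_add) auto
  then have "small x (\<lambda>(z, w). (h z + k z) - (h w + k w) - (A + B) \<bullet> (z - w))"
    by (rule small_cong[of _ _ 1]) (auto simp: inner_simps)
  ultimately show ?thesis using d d1 unfolding LD_def by (intro conjI exI[of _ "min d d1"]) auto
qed

text \<open>This is the error of freezing a coefficient at \<open>x\<close> in the product rule: the
  coefficient difference tends to zero and the linear form is O(r). The selector \<open>s\<close>
  covers both positions, since one factor is evaluated at z and the other at w.\<close>

lemma small_vanishing_times_linear:
  assumes d: "d > 0" "continuous_on (cube x d) a" and s: "s = fst \<or> s = snd"
  shows "small x (\<lambda>p. (a (s p) - a x) * (B \<bullet> (fst p - snd p)))"
proof (rule small_uniform[OF d(1)])
  have sm: "s p \<in> cube x r" if "p \<in> cube x r \<times> cube x r" for p r using s that by auto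
  have sc: "continuous_on S s" for S using s by (auto intro: continuous_intros)
  show "continuous_on (cube x d \<times> cube x d) (\<lambda>p. (a (s p) - a x) * (B \<bullet> (fst p - snd p)))"
    by (intro continuous_intros continuous_on_compose2[OF d(2) sc]) (use sm in auto)
  fix e :: real assume e: "e > 0"
  have xd: "x \<in> cube x d" using d by (simp add: mem_cube)
  let ?e = "e / (4 * norm B + 1)"
  have e': "?e > 0" using e by (simp add: add_nonneg_pos)
  have "\<exists>\<delta>>0. \<forall>z\<in>cube x d. dist z x < \<delta> \<longrightarrow> dist (a z) (a x) < ?e"
    using d(2) xd e' unfolding continuous_on_iff by blast
  then obtain \<delta> where \<delta>: "\<delta> > 0" "\<And>z. z \<in> cube x d \<Longrightarrow> dist z x < \<delta> \<Longrightarrow> dist (a z) (a x) < ?e"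
    by blast
  have "\<bar>(a (s p) - a x) * (B \<bullet> (fst p - snd p))\<bar> \<le> e * r"
    if r: "0 < r" "r < min d (\<delta> / 2)" "p \<in> cube x r \<times> cube x r" for r p
  proof -
    have "s p \<in> cube x r" using sm r by blast
    then have "dist (s p) x < \<delta>" using cube_subset_cball[of x r] r by (force simp: dist_commute)
    moreover have "s p \<in> cube x d" using \<open>s p \<in> cube x r\<close> cube_mono[of r d x] r by auto
    ultimately have 1: "\<bar>a (s p) - a x\<bar> \<le> ?e" using \<delta>(2) by (force simp: dist_real_def)
    have 2: "\<bar>B \<bullet> (fst p - snd p)\<bar> \<le> norm B * (4 * r)"
    proof -
      have "norm (fst p - snd p) \<le> 4 * r" using r(3) by (intro norm_diff_cube[of _ x]) auto
      then show ?thesis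
        by (intro order_trans[OF Cauchy_Schwarz_ineq2] mult_left_mono) auto
    qed
    have "\<bar>(a (s p) - a x) * (B \<bullet> (fst p - snd p))\<bar> \<le> ?e * (norm B * (4 * r))"
      unfolding abs_mult using e' by (intro mult_mono 1 2) auto
    also have "\<dots> = (4 * norm B / (4 * norm B + 1)) * (e * r)" by simp
    also have "\<dots> \<le> 1 * (e * r)"
      using e r by (intro mult_right_mono) (auto simp: divide_le_eq_1 add_nonneg_pos)
    finally show ?thesis by simp
  qed
  then show "\<exists>\<delta>>0. \<forall>r p. 0 < r \<and> r < \<delta> \<and> p \<in> cube x r \<times> cube x r \<longrightarrow> \<bar>(a (s p) - a x) * (B \<bullet> (fst p - snd p))\<bar> \<le> e * r"
    using d \<delta> by (intro exI[of _ "min d (\<delta> / 2)"]) auto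
qed

text \<open>From a(z) b(z) - a(w) b(w) = a(z) (b(z) - b(w)) + b(w) (a(z) - a(w)); bounded continuous
  factors preserve smallness, and the remaining coefficients are frozen at \<open>x\<close>.\<close>

lemma LD_mult:
  assumes "LD a x A" "LD b x B" shows "LD (\<lambda>z. a z * b z) x (a x *\<^sub>R B + b x *\<^sub>R A)"
proof -
  obtain d1 where d1: "d1 > 0" "continuous_on (cube x d1) a" using assms(1) LD_def by blast
  obtain d2 where d2: "d2 > 0" "continuous_on (cube x d2) b" using assms(2) LD_def by blast
  define d where "d = min d1 d2"
  have d: "d > 0" using d1 d2 by (simp add: d_def)
  have ca: "continuous_on (cube x d) a" and cb: "continuous_on (cube x d) b"
    unfolding d_def by (intro continuous_on_subset[OF d1(2)] continuous_on_subset[OF d2(2)] cube_mono; simp)+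
  let ?GA = "\<lambda>p. case p of (z, w) \<Rightarrow> a z - a w - A \<bullet> (z - w)"
  let ?GB = "\<lambda>p. case p of (z, w) \<Rightarrow> b z - b w - B \<bullet> (z - w)"
  have "small x (\<lambda>p. a (fst p) * ?GB p)" "small x (\<lambda>p. b (snd p) * ?GA p)"
    using assms unfolding LD_def
    by (auto intro!: small_mult[OF _ d] continuous_on_compose2[OF ca] continuous_on_compose2[OF cb] continuous_intros)
  then have "small x (\<lambda>p. (a (fst p) * ?GB p + b (snd p) * ?GA p) +
      ((a (fst p) - a x) * (B \<bullet> (fst p - snd p)) + (b (snd p) - b x) * (A \<bullet> (fst p - snd p))))"
    by (intro small_add small_vanishing_times_linear[OF d ca] small_vanishing_times_linear[OF d cb]) auto
  then have "small x (\<lambda>(z, w). a z * b z - a w * b w - (a x *\<^sub>R B + b x *\<^sub>R A) \<bullet> (z - w))"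
    by (rule small_cong[of _ _ 1]) (auto simp: algebra_simps inner_simps)
  moreover have "continuous_on (cube x d) (\<lambda>z. a z * b z)" by (intro continuous_intros ca cb)
  ultimately show ?thesis unfolding LD_def using d by blast
qed

text \<open>The mean value inequality on a convex square is applied to \<open>h\<close> minus its
  linear part at \<open>x\<close>, whose gradient is small by continuity. The estimate is uniform in
  both points, as a condition on pairs requires.\<close>

lemma strict_differentiable:
  fixes h :: "plane \<Rightarrow> real"
  assumes W: "open W" and h: "Ck_on 1 W h" and x: "x \<in> W" and e: "e > 0"
  obtains d where "d > 0" "cube x d \<subseteq> W"
    "\<And>z w. z \<in> cube x d \<Longrightarrow> w \<in> cube x d \<Longrightarrow> \<bar>h z - h w - grad h x \<bullet> (z - w)\<bar> \<le> e * norm (z - w)"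
proof -
  have "continuous_on W (grad h)"
    unfolding grad_def using h by (intro continuous_on_vec_lambda) auto
  then have "isCont (grad h) x" using W x by (simp add: continuous_on_eq_continuous_at)
  then obtain d1 where d1: "d1 > 0" "\<And>z. dist z x < d1 \<Longrightarrow> dist (grad h z) (grad h x) < e"
    unfolding continuous_at_eps_delta using e by meson
  obtain d2 where d2: "d2 > 0" "cube x d2 \<subseteq> W" using open_contains_cube[OF W x] by blast
  define d where "d = min d2 (d1 / 4)"
  have d: "d > 0" "cube x d \<subseteq> W" using d1 d2 cube_mono[of d d2 x] by (auto simp: d_def)
  show thesis
  proof (rule that[OF d])
    fix z w assume zw: "z \<in> cube x d" "w \<in> cube x d"
    let ?f = "\<lambda>z. h z - grad h x \<bullet> z"
    have "norm (?f z - ?f w) \<le> e * norm (z - w)"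
    proof (rule differentiable_bound[OF convex_cube _ _ zw])
      fix y assume y: "y \<in> cube x d"
      have "(h has_derivative (\<lambda>v. grad h y \<bullet> v)) (at y)"
        using h y d by (intro has_derivative_grad) auto
      then have "(?f has_derivative (\<lambda>v. grad h y \<bullet> v - grad h x \<bullet> v)) (at y)"
        by (auto intro!: derivative_eq_intros)
      then show "(?f has_derivative (\<lambda>v. grad h y \<bullet> v - grad h x \<bullet> v)) (at y within cube x d)"
        by (rule has_derivative_at_withinI)
      have "dist y x \<le> 2 * d" using y cube_subset_cball[of x d] by (auto simp: dist_commute)
      also have "\<dots> < d1" using d1 by (auto simp: d_def min_def)
      finally have "norm (grad h y - grad h x) \<le> e" using d1(2) by (force simp: dist_norm)
      then show "onorm (\<lambda>v. grad h y \<bullet> v - grad h x \<bullet> v) \<le> e"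
        unfolding inner_diff_left[symmetric]
        by (intro onorm_le order_trans[OF Cauchy_Schwarz_ineq2[unfolded real_norm_def[symmetric]]] mult_right_mono) auto
    qed
    then show "\<bar>h z - h w - grad h x \<bullet> (z - w)\<bar> \<le> e * norm (z - w)"
      by (simp add: inner_diff_right algebra_simps)
  qed
qed

lemma small_C1:
  fixes h :: "plane \<Rightarrow> real"
  assumes W: "open W" and h: "Ck_on 1 W h" and x: "x \<in> W"
  shows "small x (\<lambda>(z, w). h z - h w - grad h x \<bullet> (z - w))"
proof -
  obtain d where d: "d > 0" "cube x d \<subseteq> W" using open_contains_cube[OF W x] by blast
  have c: "continuous_on (cube x d) h" by (rule continuous_on_subset[OF Ck_on_continuous[OF h] d(2)])
  show ?thesis
  proof (rule small_uniform[OF d(1)])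
    show "continuous_on (cube x d \<times> cube x d) (\<lambda>(z, w). h z - h w - grad h x \<bullet> (z - w))"
      unfolding split_beta by (intro continuous_intros continuous_on_compose2[OF c]) auto
    fix e :: real assume "e > 0"
    then obtain d1 where d1: "d1 > 0" "cube x d1 \<subseteq> W"
      "\<And>z w. z \<in> cube x d1 \<Longrightarrow> w \<in> cube x d1 \<Longrightarrow> \<bar>h z - h w - grad h x \<bullet> (z - w)\<bar> \<le> e / 4 * norm (z - w)"
      using strict_differentiable[OF W h x, of "e / 4"] by (metis divide_pos_pos zero_less_numeral)
    have "\<bar>h z - h w - grad h x \<bullet> (z - w)\<bar> \<le> e * r" if "0 < r" "r < d1" "z \<in> cube x r" "w \<in> cube x r" for r z w
    proof -
      have "e / 4 * norm (z - w) \<le> e / 4 * (4 * r)"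
        using norm_diff_cube[OF that(3,4)] \<open>e > 0\<close> by (intro mult_left_mono) auto
      then show ?thesis using d1(3)[of z w] cube_mono[of r d1 x] that by force
    qed
    then show "\<exists>d>0. \<forall>r p. 0 < r \<and> r < d \<and> p \<in> cube x r \<times> cube x r \<longrightarrow>
        \<bar>case p of (z, w) \<Rightarrow> h z - h w - grad h x \<bullet> (z - w)\<bar> \<le> e * r"
      using d1(1) by (intro exI[of _ d1]) auto
  qed
qed

lemma LD_C1:
  assumes W: "open W" and h: "Ck_on 1 W h" and x: "x \<in> W"
  shows "LD h x (grad h x)"
  using small_C1[OF assms] open_contains_cube[OF W x] continuous_on_subset[OF Ck_on_continuous[OF h]]
  unfolding LD_def by metis

lemma LD_const: "LD (\<lambda>z. k) x 0"
  using LD_C1[OF open_UNIV Ck_on_const, of x k] by (simp add: grad_def vec_eq_iff zero_vec_def)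

lemma LD_sum:
  assumes "\<And>i. i \<in> I \<Longrightarrow> LD (h i) x (A i)"
  shows "LD (\<lambda>z. \<Sum>i\<in>I. h i z) x (\<Sum>i\<in>I. A i)"
  using assms by (induction I rule: infinite_finite_induct) (auto intro: LD_const LD_add)

section \<open>Behaviour of mean derivatives under a change of variables\<close>

lemma integral_change_of_variables_real:
  fixes f :: "plane \<Rightarrow> real" and g :: "plane \<Rightarrow> plane"
  assumes S: "S \<in> sets lebesgue" and der: "\<And>x. x \<in> S \<Longrightarrow> (g has_derivative g' x) (at x within S)"
    and inj: "inj_on g S" and f: "f absolutely_integrable_on (g ` S)"
  shows "(\<lambda>x. \<bar>det (matrix (g' x))\<bar> * f (g x)) absolutely_integrable_on S"
    "integral (g ` S) f = integral S (\<lambda>x. \<bar>det (matrix (g' x))\<bar> * f (g x))"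
proof -
  let ?f = "\<lambda>x. vec (f x) :: real ^ 1"
  have f': "?f absolutely_integrable_on (g ` S)"
    using f by (simp add: absolutely_integrable_on_1_iff)
  have 1: "(\<lambda>x. \<bar>det (matrix (g' x))\<bar> *\<^sub>R ?f (g x)) absolutely_integrable_on S"
    "integral (g ` S) ?f = integral S (\<lambda>x. \<bar>det (matrix (g' x))\<bar> *\<^sub>R ?f (g x))"
    using absolutely_integrable_change_of_variables[OF S der inj, of ?f] integral_change_of_variables[OF S der inj, of ?f] f' by blast+
  from 1(1) show "(\<lambda>x. \<bar>det (matrix (g' x))\<bar> * f (g x)) absolutely_integrable_on S"
    by (simp add: absolutely_integrable_on_1_iff)
  from 1(2) show "integral (g ` S) f = integral S (\<lambda>x. \<bar>det (matrix (g' x))\<bar> * f (g x))"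
    by (simp add: integral_on_1_eq vec_eq_iff)
qed

lemma compact_imp_lebesgue: "compact S \<Longrightarrow> S \<in> sets lebesgue" for S :: "'a::euclidean_space set"
  using lmeasurable_compact fmeasurableD by blast

lemma absolutely_integrable_on_compact:
  fixes f :: "plane \<Rightarrow> real"
  assumes "continuous_on S f" "compact S" shows "f absolutely_integrable_on S"
proof -
  have "integrable lborel (\<lambda>x. indicator S x *\<^sub>R f x)" by (rule borel_integrable_compact[OF assms(2,1)])
  then show ?thesis unfolding set_integrable_def
    using integrable_completion borel_measurable_integrable by blast
qed

text \<open>\<open>C\<close> bounds the reciprocal of the Jacobian. As \<open>f\<close> is
  nonnegative, inserting \<open>C\<close> times the Jacobian and enlarging the image to a full
  square can only increase the integral.\<close>

lemma integral_compose_le: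
  fixes f :: "plane \<Rightarrow> real" and g :: "plane \<Rightarrow> plane"
  assumes f: "continuous_on (cube y R) f" "\<And>w. w \<in> cube y R \<Longrightarrow> 0 \<le> f w"
    and g: "\<And>z. z \<in> cube x r \<Longrightarrow> (g has_derivative g' z) (at z)" "g ` cube x r \<subseteq> cube y R" "inj_on g (cube x r)"
    and det: "\<And>z. z \<in> cube x r \<Longrightarrow> 1 \<le> C * \<bar>det (matrix (g' z))\<bar>" and C: "C \<ge> 0"
  shows "integral (cube x r) (\<lambda>z. f (g z)) \<le> C * integral (cube y R) f"
proof -
  let ?Q = "cube x r"
  have gc: "continuous_on ?Q g"
    by (rule has_derivative_continuous_on[OF has_derivative_at_withinI[OF g(1)]])
  have cpt: "compact (g ` ?Q)" by (rule compact_continuous_image[OF gc]) auto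
  have der: "(g has_derivative g' z) (at z within ?Q)" if "z \<in> ?Q" for z
    using g(1)[OF that] by (rule has_derivative_at_withinI)
  have fa: "f absolutely_integrable_on (g ` ?Q)"
    by (rule absolutely_integrable_on_compact[OF continuous_on_subset[OF f(1) g(2)] cpt])
  note cv = integral_change_of_variables_real[OF compact_imp_lebesgue[OF compact_cube] der g(3) fa]
  have ci: "(\<lambda>z. f (g z)) integrable_on ?Q"
    by (rule integrable_on_cube) (use g(2) in \<open>auto intro!: continuous_on_compose2[OF f(1) gc]\<close>)
  have "integral ?Q (\<lambda>z. f (g z)) \<le> integral ?Q (\<lambda>z. C * (\<bar>det (matrix (g' z))\<bar> * f (g z)))"
  proof (rule integral_le[OF ci])
    show "(\<lambda>z. C * (\<bar>det (matrix (g' z))\<bar> * f (g z))) integrable_on ?Q"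
      by (intro integrable_on_mult_right set_lebesgue_integral_eq_integral(1)[OF cv(1)])
    fix z assume z: "z \<in> ?Q"
    then have "0 \<le> f (g z)" using f(2) g(2) by blast
    then have "1 * f (g z) \<le> (C * \<bar>det (matrix (g' z))\<bar>) * f (g z)" by (intro mult_right_mono det z)
    then show "f (g z) \<le> C * (\<bar>det (matrix (g' z))\<bar> * f (g z))" by (simp add: mult.assoc)
  qed
  also have "\<dots> = C * integral (g ` ?Q) f" using cv(2) by simp
  also have "\<dots> \<le> C * integral (cube y R) f"
    using C fa f by (intro mult_left_mono integral_subset_le g(2) integrable_on_cube) (auto simp: absolutely_integrable_on_def)
  finally show ?thesis .
qed

text \<open>Fubini and the one-variable estimate, once in each variable, give the factor
  \<open>C\<close> squared.\<close>

lemma integral_compose_le_Times: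
  fixes F :: "plane \<times> plane \<Rightarrow> real" and g :: "plane \<Rightarrow> plane"
  assumes F: "continuous_on (cube y R \<times> cube y R) F" "\<And>p. 0 \<le> F p"
    and g: "\<And>z. z \<in> cube x r \<Longrightarrow> (g has_derivative g' z) (at z)" "g ` cube x r \<subseteq> cube y R" "inj_on g (cube x r)"
    and det: "\<And>z. z \<in> cube x r \<Longrightarrow> 1 \<le> C * \<bar>det (matrix (g' z))\<bar>" and C: "C \<ge> 0"
  shows "integral (cube x r \<times> cube x r) (\<lambda>(z, w). F (g z, g w)) \<le> C\<^sup>2 * integral (cube y R \<times> cube y R) F"
proof -
  let ?Q = "cube x r" and ?R = "cube y R"
  have gc: "continuous_on ?Q g"
    by (rule has_derivative_continuous_on[OF has_derivative_at_withinI[OF g(1)]])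
  have cF: "continuous_on (?Q \<times> ?Q) (\<lambda>(z, w). F (g z, g w))"
    unfolding split_beta
    by (intro continuous_on_compose2[OF F(1)] continuous_intros continuous_on_compose2[OF gc]) (use g(2) in auto)
  have sl: "continuous_on ?R (\<lambda>w. F (v, w))" if "v \<in> ?R" for v
    using that by (intro continuous_on_compose2[OF F(1)] continuous_intros) auto
  have cI: "continuous_on ?R (\<lambda>v. integral ?R (\<lambda>w. F (v, w)))" by (rule continuous_on_integral_cube[OF F(1)])
  have "integral (?Q \<times> ?Q) (\<lambda>(z, w). F (g z, g w)) = integral ?Q (\<lambda>z. integral ?Q (\<lambda>w. F (g z, g w)))"
    using integral_cube_Times[OF cF] by simp
  also have "\<dots> \<le> integral ?Q (\<lambda>z. C * integral ?R (\<lambda>w. F (g z, w)))"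
  proof (rule integral_le)
    show "(\<lambda>z. integral ?Q (\<lambda>w. F (g z, g w))) integrable_on ?Q"
      using continuous_on_integral_cube[OF cF] by (intro integrable_on_cube) simp
    show "(\<lambda>z. C * integral ?R (\<lambda>w. F (g z, w))) integrable_on ?Q"
      by (intro integrable_on_cube continuous_intros continuous_on_compose2[OF cI gc]) (use g(2) in auto)
    show "integral ?Q (\<lambda>w. F (g z, g w)) \<le> C * integral ?R (\<lambda>w. F (g z, w))" if "z \<in> ?Q" for z
      using that g(2) by (intro integral_compose_le[OF sl F(2) g det C]) auto
  qed
  also have "\<dots> = C * integral ?Q (\<lambda>z. integral ?R (\<lambda>w. F (g z, w)))" by simp
  also have "\<dots> \<le> C * (C * integral ?R (\<lambda>v. integral ?R (\<lambda>w. F (v, w))))"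
  proof (intro mult_left_mono C integral_compose_le[OF cI _ g det C])
    show "0 \<le> integral ?R (\<lambda>w. F (v, w))" if "v \<in> ?R" for v
      using sl[OF that] F(2) by (intro integral_nonneg integrable_on_cube) auto
  qed auto
  also have "\<dots> = C\<^sup>2 * integral (?R \<times> ?R) F"
    unfolding integral_cube_Times[OF F(1)] by (simp add: power2_eq_square)
  finally show ?thesis .
qed

lemma det_frechet:
  fixes \<Psi> :: "plane \<Rightarrow> plane"
  shows "det (matrix (frechet_derivative \<Psi> (at x))) = pd 1 \<Psi> x $ 1 * pd 2 \<Psi> x $ 2 - pd 2 \<Psi> x $ 1 * pd 1 \<Psi> x $ 2"
  by (simp add: det_2 matrix_def pd_def)

lemma has_derivative_component:
  fixes \<Psi> :: "plane \<Rightarrow> 'b::real_normed_vector ^ 'n"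
  assumes "\<Psi> differentiable (at x)"
  shows "((\<lambda>x. \<Psi> x $ k) has_derivative (\<lambda>v. frechet_derivative \<Psi> (at x) v $ k)) (at x)"
  using assms by (intro bounded_linear.has_derivative[OF bounded_linear_vec_nth]) (simp add: frechet_derivative_works)

lemma pd_component:
  fixes \<Psi> :: "plane \<Rightarrow> 'b::real_normed_vector ^ 'n"
  assumes "\<Psi> differentiable (at x)" shows "pd i (\<lambda>x. \<Psi> x $ k) x = pd i \<Psi> x $ k"
  using pd_eqI[OF has_derivative_component[OF assms]] by (simp add: pd_def)

lemma Ck_on_component:
  fixes \<Psi> :: "plane \<Rightarrow> 'b::real_normed_vector ^ 'n"
  assumes "open W" "Ck_on k W \<Psi>" shows "Ck_on k W (\<lambda>x. \<Psi> x $ j)"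
  using assms(2)
proof (induction k arbitrary: \<Psi>)
  case 0 then show ?case by (auto intro: continuous_intros)
next
  case (Suc k)
  have "Ck_on k W (pd i (\<lambda>x. \<Psi> x $ j))" for i
  proof -
    have "Ck_on k W (\<lambda>x. pd i \<Psi> x $ j)" using Suc by auto
    then show ?thesis
      by (rule Ck_on_cong[OF assms(1), THEN iffD1, rotated]) (use Suc.prems in \<open>simp add: pd_component\<close>)
  qed
  moreover have "(\<lambda>x. \<Psi> x $ j) differentiable (at x)" if "x \<in> W" for x
    using Suc.prems that by (auto intro: differentiableI[OF has_derivative_component])
  ultimately show ?case by simp
qed

text \<open>The increment of h o \<Psi> splits into the error of \<open>h\<close> between \<Psi>(z)
  and \<Psi>(w), whose pair integral is only distorted by a bounded factor under a change of
  variables, and the increment of the C^1 function H . \<Psi>.\<close>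

lemma LD_compose:
  fixes \<Psi> :: "plane \<Rightarrow> plane"
  assumes W: "open W" and \<Psi>: "Ck_on 1 W \<Psi>" and x: "x \<in> W" and inj: "inj_on \<Psi> W"
    and det: "det (matrix (frechet_derivative \<Psi> (at x))) \<noteq> 0" and h: "LD h (\<Psi> x) H"
  shows "LD (\<lambda>z. h (\<Psi> z)) x (\<chi> i. \<Sum>k\<in>UNIV. H $ k * pd i \<Psi> x $ k)"
proof -
  let ?y = "\<Psi> x" let ?A = "\<chi> i. \<Sum>k\<in>UNIV. H $ k * pd i \<Psi> x $ k"
  let ?J = "\<lambda>z. det (matrix (frechet_derivative \<Psi> (at z)))"
  let ?G = "\<lambda>(z, w). h z - h w - H \<bullet> (z - w)"
  have dif: "\<Psi> differentiable (at z)" if "z \<in> W" for z using \<Psi> that by simp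
  have comp: "Ck_on 1 W (\<lambda>z. \<Psi> z $ k)" for k by (rule Ck_on_component[OF W \<Psi>])
  have \<Psi>c: "continuous_on W \<Psi>" by (rule Ck_on_continuous[OF \<Psi>])
  have Jc: "continuous_on W ?J"
    unfolding det_frechet using \<Psi> by (intro continuous_intros) auto
  obtain dh where dh: "dh > 0" "continuous_on (cube ?y dh) h" using h LD_def by blast
  \<comment> \<open>Each component of \<Psi> moves by at most (|gradient| + 1) times 2 r on the
    square of half side r, so that square is mapped into one of half side
    \<open>L * r\<close>.\<close>
  define L where "L = 2 * (norm (grad (\<lambda>z. \<Psi> z $ 1) x) + norm (grad (\<lambda>z. \<Psi> z $ 2) x) + 1)"
  have L: "L \<ge> 1" by (simp add: L_def)
  obtain d1 where d1: "d1 > 0" "cube x d1 \<subseteq> W"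
      "\<And>z w. z \<in> cube x d1 \<Longrightarrow> w \<in> cube x d1 \<Longrightarrow> \<bar>\<Psi> z $ 1 - \<Psi> w $ 1 - grad (\<lambda>z. \<Psi> z $ 1) x \<bullet> (z - w)\<bar> \<le> 1 * norm (z - w)"
    using strict_differentiable[OF W comp[of 1] x zero_less_one] by metis
  obtain d2 where d2: "d2 > 0" "cube x d2 \<subseteq> W"
      "\<And>z w. z \<in> cube x d2 \<Longrightarrow> w \<in> cube x d2 \<Longrightarrow> \<bar>\<Psi> z $ 2 - \<Psi> w $ 2 - grad (\<lambda>z. \<Psi> z $ 2) x \<bullet> (z - w)\<bar> \<le> 1 * norm (z - w)"
    using strict_differentiable[OF W comp[of 2] x zero_less_one] by metis
  have "isCont ?J x" using Jc W x by (simp add: continuous_on_eq_continuous_at)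
  then obtain d3 where d3: "d3 > 0" "\<And>z. dist z x < d3 \<Longrightarrow> dist (?J z) (?J x) < \<bar>?J x\<bar> / 2"
    unfolding continuous_at_eps_delta using det by (metis zero_less_abs_iff half_gt_zero)
  define C where "C = 2 / \<bar>?J x\<bar>"
  have C: "C \<ge> 0" by (simp add: C_def)
  define d0 where "d0 = min (min d1 d2) (min (d3 / 4) (dh / L))"
  have d0: "d0 > 0" using d1 d2 d3 dh L by (simp add: d0_def)
  have "d0 \<le> d1" unfolding d0_def by linarith
  then have d0W: "cube x d0 \<subseteq> W" using d1(2) cube_mono[of d0 d1 x] by blast
  have Jlow: "1 \<le> C * \<bar>?J z\<bar>" if "z \<in> cube x d0" for z
  proof -
    have "dist z x \<le> 2 * d0" using that cube_subset_cball[of x d0] by (auto simp: dist_commute)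
    also have "d0 \<le> d3 / 4" unfolding d0_def by linarith
    then have "2 * d0 < d3" using d3(1) by linarith
    finally have "\<bar>?J z - ?J x\<bar> < \<bar>?J x\<bar> / 2" using d3(2) by (simp add: dist_real_def)
    then have "\<bar>?J x\<bar> / 2 \<le> \<bar>?J z\<bar>" by linarith
    then show ?thesis using det by (simp add: C_def field_simps)
  qed
  have lip: "\<Psi> ` cube x r \<subseteq> cube ?y (L * r)" if r: "r > 0" "r \<le> d0" for r
  proof
    fix v assume "v \<in> \<Psi> ` cube x r"
    then obtain z where z: "z \<in> cube x r" "v = \<Psi> z" by auto
    have zd: "z \<in> cube x d1" "z \<in> cube x d2" "x \<in> cube x d1" "x \<in> cube x d2"
    proof -
      have "r \<le> d1" "r \<le> d2" using r by (auto simp: d0_def)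
      then show "z \<in> cube x d1" "z \<in> cube x d2" using z cube_mono by blast+
      show "x \<in> cube x d1" "x \<in> cube x d2" using d1(1) d2(1) by (auto simp: mem_cube)
    qed
    have nz: "norm (z - x) \<le> 2 * r" using z cube_subset_cball[of x r] by (auto simp: dist_norm norm_minus_commute)
    have aux: "\<bar>a\<bar> \<le> (norm g + 1) * (2 * r)" if "\<bar>a - g \<bullet> (z - x)\<bar> \<le> 1 * norm (z - x)" for a :: real and g
    proof -
      have "\<bar>a\<bar> \<le> norm g * norm (z - x) + norm (z - x)"
        using that Cauchy_Schwarz_ineq2[of g "z - x"] by linarith
      also have "\<dots> = (norm g + 1) * norm (z - x)" by (simp add: algebra_simps)
      also have "\<dots> \<le> (norm g + 1) * (2 * r)" using nz by (intro mult_left_mono) auto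
      finally show ?thesis .
    qed
    have "\<bar>\<Psi> z $ 1 - ?y $ 1\<bar> \<le> L * r"
      by (rule order_trans[OF aux[OF d1(3)[OF zd(1,3)]]]) (use r in \<open>auto simp: L_def algebra_simps\<close>)
    moreover have "\<bar>\<Psi> z $ 2 - ?y $ 2\<bar> \<le> L * r"
      by (rule order_trans[OF aux[OF d2(3)[OF zd(2,4)]]]) (use r in \<open>auto simp: L_def algebra_simps\<close>)
    ultimately show "v \<in> cube ?y (L * r)" using z by (simp add: mem_cube2)
  qed
  have "d0 \<le> dh / L" unfolding d0_def by linarith
  then have Ld0: "L * d0 \<le> dh" using L by (simp add: field_simps)
  have hcomp: "continuous_on (cube x d0) (\<lambda>z. h (\<Psi> z))"
    by (rule continuous_on_compose2[OF dh(2) continuous_on_subset[OF \<Psi>c d0W]])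
       (use lip[OF d0] cube_mono[OF Ld0, of ?y] in auto)
  have cG: "continuous_on (cube ?y dh \<times> cube ?y dh) ?G"
    unfolding split_beta by (intro continuous_intros continuous_on_compose2[OF dh(2)]) auto
  have s1: "small x (\<lambda>(z, w). ?G (\<Psi> z, \<Psi> w))"
  proof (rule smallI[OF d0])
    show "continuous_on (cube x d0 \<times> cube x d0) (\<lambda>(z, w). ?G (\<Psi> z, \<Psi> w))"
      unfolding split_beta fst_conv snd_conv
      by (intro continuous_intros continuous_on_compose2[OF hcomp] continuous_on_compose2[OF continuous_on_subset[OF \<Psi>c d0W]]) auto
    fix e :: real assume e: "e > 0"
    \<comment> \<open>The factor L^6 pays for passing from r to L r, and C^2 for the Jacobian in
      both variables; the summand 1 keeps the denominator positive.\<close>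
    define e' where "e' = e / ((C\<^sup>2 + 1) * L ^ 6)"
    have "e' > 0" using e L by (auto simp: e'_def add_nonneg_pos)
    then obtain d where d: "d > 0" "\<And>r. 0 < r \<Longrightarrow> r < d \<Longrightarrow> integral (cube ?y r \<times> cube ?y r) (\<lambda>p. (?G p)\<^sup>2) \<le> e' * r ^ 6"
      by (rule smallE[OF conjunct2[OF h[unfolded LD_def]]]) blast
    have "integral (cube x r \<times> cube x r) (\<lambda>p. (case p of (z, w) \<Rightarrow> ?G (\<Psi> z, \<Psi> w))\<^sup>2) \<le> e * r ^ 6"
      if r: "0 < r" "r < d / L" "r \<le> d0" for r
    proof -
      have Lr: "0 < L * r" "L * r < d" "L * r \<le> dh"
      proof -
        show "0 < L * r" "L * r < d" using r L by (auto simp: field_simps)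
        have "L * r \<le> L * d0" using r(3) L by (intro mult_left_mono) auto
        with Ld0 show "L * r \<le> dh" by linarith
      qed
      have "integral (cube x r \<times> cube x r) (\<lambda>p. (case p of (z, w) \<Rightarrow> ?G (\<Psi> z, \<Psi> w))\<^sup>2)
          = integral (cube x r \<times> cube x r) (\<lambda>(z, w). (?G (\<Psi> z, \<Psi> w))\<^sup>2)"
        by (rule Henstock_Kurzweil_Integration.integral_cong) auto
      also have "\<dots> \<le> C\<^sup>2 * integral (cube ?y (L * r) \<times> cube ?y (L * r)) (\<lambda>p. (?G p)\<^sup>2)"
      proof (rule integral_compose_le_Times[OF _ _ _ lip[OF r(1,3)] _ _ C])
        show "continuous_on (cube ?y (L * r) \<times> cube ?y (L * r)) (\<lambda>p. (?G p)\<^sup>2)"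
          by (intro continuous_intros continuous_on_subset[OF cG] cube_Times_mono Lr)
        have sub: "cube x r \<subseteq> cube x d0" using cube_mono[OF r(3)] .
        show "(\<Psi> has_derivative frechet_derivative \<Psi> (at z)) (at z)" if "z \<in> cube x r" for z
          using that sub d0W dif frechet_derivative_works by blast
        show "inj_on \<Psi> (cube x r)" using inj sub d0W by (meson inj_on_subset order_trans)
        show "1 \<le> C * \<bar>?J z\<bar>" if "z \<in> cube x r" for z using that sub Jlow by blast
      qed auto
      also have "\<dots> \<le> C\<^sup>2 * (e' * (L * r) ^ 6)" by (intro mult_left_mono d(2) Lr) auto
      also have "\<dots> = (C\<^sup>2 / (C\<^sup>2 + 1)) * (e * r ^ 6)"
        using L by (simp add: e'_def power_mult_distrib)
      also have "\<dots> \<le> 1 * (e * r ^ 6)"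
        using e r by (intro mult_right_mono) (auto simp: divide_le_eq_1 add_nonneg_pos)
      finally show ?thesis by simp
    qed
    then show "\<exists>d>0. \<forall>r. 0 < r \<and> r < d \<and> r \<le> d0 \<longrightarrow> integral (cube x r \<times> cube x r) (\<lambda>p. (case p of (z, w) \<Rightarrow> ?G (\<Psi> z, \<Psi> w))\<^sup>2) \<le> e * r ^ 6"
      using d L by (intro exI[of _ "d / L"]) auto
  qed
  let ?k = "\<lambda>z. H $ 1 * \<Psi> z $ 1 + H $ 2 * \<Psi> z $ 2"
  have k: "Ck_on 1 W ?k" by (intro Ck_on_add Ck_on_mult Ck_on_const comp W)
  have gk: "grad ?k x = ?A"
  proof -
    have cd: "(\<lambda>z. \<Psi> z $ j) differentiable (at x)" for j using comp[of j] x by simp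
    show ?thesis
      unfolding grad_def by (simp add: vec_eq_iff pd_add pd_mult cd pd_component[OF dif[OF x]] sum_2 UNIV_2_eq)
  qed
  have s2: "small x (\<lambda>(z, w). ?k z - ?k w - ?A \<bullet> (z - w))"
    using small_C1[OF W k x] unfolding gk .
  have "small x (\<lambda>p. (case p of (z, w) \<Rightarrow> ?G (\<Psi> z, \<Psi> w)) + (case p of (z, w) \<Rightarrow> ?k z - ?k w - ?A \<bullet> (z - w)))"
    by (rule small_add[OF s1 s2])
  then have "small x (\<lambda>(z, w). h (\<Psi> z) - h (\<Psi> w) - ?A \<bullet> (z - w))"
    by (rule small_cong[of _ _ 1]) (auto simp: inner_plane algebra_simps)
  then show ?thesis unfolding LD_def using d0 hcomp by blast
qed

section \<open>Mean differentiability of functions with derivatives of bounded variation\<close>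

text \<open>The distributional derivative is P - N; the minus sign of integration by parts exchanges
  the two measures on the right-hand side.\<close>

definition weak_pd :: "2 \<Rightarrow> plane set \<Rightarrow> (plane \<Rightarrow> real) \<Rightarrow> plane measure \<Rightarrow> plane measure \<Rightarrow> bool" where
  "weak_pd i W h P N \<longleftrightarrow> radon_measure_on W P \<and> radon_measure_on W N \<and>
     (\<forall>\<phi>. test_function W \<phi> \<longrightarrow> (LINT x|lborel. h x * pd i \<phi> x) = (LINT x|N. \<phi> x) - (LINT x|P. \<phi> x))"

lemma test_functionD:
  assumes "test_function W \<phi>"
  shows "continuous_on UNIV \<phi>" "\<phi> \<in> borel_measurable borel" "Ck_on k UNIV \<phi>"
  using test_function_Ck[OF assms] Ck_on_continuous continuous_imp_borel_measurable by blast+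

lemma integrable_test_function:
  assumes "sets M = sets borel" "\<And>K. compact K \<Longrightarrow> K \<subseteq> W \<Longrightarrow> emeasure M K < \<infinity>" "test_function W \<phi>"
  shows "integrable M \<phi>"
proof -
  obtain K where "compact K" "K \<subseteq> W" "\<And>x. x \<notin> K \<Longrightarrow> \<phi> x = 0" using test_functionE[OF assms(3)] by metis
  then show ?thesis
    using assms test_functionD(1)[OF assms(3)] by (intro integrable_compact_support[of M \<phi> K]) auto
qed

text \<open>Comparing \<open>d\<close> with rational constants reduces the Lebesgue point property to the
  vanishing density of a measure at points of a set that it does not charge.\<close>

lemma AE_Lebesgue_point:
  fixes d :: "plane \<Rightarrow> real"
  assumes W: "open W" and d: "d \<in> borel_measurable borel"
    and fin: "\<And>K. compact K \<Longrightarrow> K \<subseteq> W \<Longrightarrow> (\<integral>\<^sup>+x. ennreal \<bar>d x\<bar> * indicator K x \<partial>lborel) < \<infinity>"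
  shows "AE x in lebesgue. x \<in> W \<longrightarrow> (\<forall>e>0. \<exists>\<delta>>0. \<forall>r. 0 < r \<and> r < \<delta> \<longrightarrow>
    emeasure (density lborel (\<lambda>y. ennreal \<bar>d y - d x\<bar>)) (cball x r) \<le> ennreal (e * r\<^sup>2))"
proof -
  note [measurable] = d
  \<comment> \<open>\<open>ennreal\<close> truncates negative numbers to zero, so the density is the
    positive part of |d - q| - s and \<open>D q s\<close> does not charge
    \<open>E q s\<close>.\<close>
  define D where "D q s = density lborel (\<lambda>y. ennreal (\<bar>d y - real_of_rat q\<bar> - real_of_rat s))" for q s
  define E where "E q s = {y. \<bar>d y - real_of_rat q\<bar> \<le> real_of_rat s}" for q s
  have Eb: "E q s \<in> sets borel" for q s unfolding E_def by measurable
  have "AE x in lebesgue. x \<in> E q s \<inter> W \<longrightarrow> (\<forall>e>0. \<exists>\<delta>>0. \<forall>r. 0 < r \<and> r < \<delta> \<longrightarrow> emeasure (D q s) (cball x r) \<le> ennreal (e * r\<^sup>2))"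
    if s: "s > 0" for q s
  proof (rule AE_density_zero[OF _ W _ Eb])
    show "sets (D q s) = sets borel" by (simp add: D_def)
    show "emeasure (D q s) K < \<infinity>" if K: "compact K" "K \<subseteq> W" for K
    proof -
      have Kb: "K \<in> sets borel" using borel_compact[OF K(1)] .
      have "emeasure (D q s) K = (\<integral>\<^sup>+y. ennreal (\<bar>d y - real_of_rat q\<bar> - real_of_rat s) * indicator K y \<partial>lborel)"
        unfolding D_def using Kb by (subst emeasure_density) auto
      also have "\<dots> \<le> (\<integral>\<^sup>+y. ennreal \<bar>d y\<bar> * indicator K y + ennreal \<bar>real_of_rat q\<bar> * indicator K y \<partial>lborel)"
      proof (rule nn_integral_mono)
        fix y
        have "ennreal (\<bar>d y - real_of_rat q\<bar> - real_of_rat s) \<le> ennreal (\<bar>d y\<bar> + \<bar>real_of_rat q\<bar>)"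
        proof (rule ennreal_leI)
          have "0 < real_of_rat s" using s by simp
          then show "\<bar>d y - real_of_rat q\<bar> - real_of_rat s \<le> \<bar>d y\<bar> + \<bar>real_of_rat q\<bar>" by linarith
        qed
        also have "\<dots> = ennreal \<bar>d y\<bar> + ennreal \<bar>real_of_rat q\<bar>" by simp
        finally show "ennreal (\<bar>d y - real_of_rat q\<bar> - real_of_rat s) * indicator K y
            \<le> ennreal \<bar>d y\<bar> * indicator K y + ennreal \<bar>real_of_rat q\<bar> * indicator K y"
          by (cases "y \<in> K") auto
      qed
      also have "\<dots> = (\<integral>\<^sup>+y. ennreal \<bar>d y\<bar> * indicator K y \<partial>lborel) + ennreal \<bar>real_of_rat q\<bar> * emeasure lborel K"
        using Kb by (subst nn_integral_add) (auto simp: nn_integral_cmult_indicator)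
      also have "\<dots> < \<infinity>"
        using fin[OF K] emeasure_compact_finite[OF K(1)] by (auto simp: ennreal_mult_less_top)
      finally show ?thesis .
    qed
    have "emeasure (D q s) (E q s \<inter> W) = (\<integral>\<^sup>+y. ennreal (\<bar>d y - real_of_rat q\<bar> - real_of_rat s) * indicator (E q s \<inter> W) y \<partial>lborel)"
      unfolding D_def using Eb W by (subst emeasure_density) auto
    also have "\<dots> = (\<integral>\<^sup>+y. 0 \<partial>(lborel :: plane measure))"
      by (intro nn_integral_cong) (auto simp: E_def indicator_def ennreal_neg)
    finally show "emeasure (D q s) (E q s \<inter> W) = 0" by simp
  qed
  then have "AE x in lebesgue. \<forall>q s. s > 0 \<longrightarrow> x \<in> E q s \<inter> W \<longrightarrow> (\<forall>e>0. \<exists>\<delta>>0. \<forall>r. 0 < r \<and> r < \<delta> \<longrightarrow> emeasure (D q s) (cball x r) \<le> ennreal (e * r\<^sup>2))"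
    unfolding AE_all_countable by auto
  then show ?thesis
  proof eventually_elim
    case (elim x)
    show ?case
    proof (intro impI allI)
      fix e :: real assume x: "x \<in> W" and e: "e > 0"
      \<comment> \<open>With \<open>q\<close> within \<open>s\<close> of \<open>d x\<close>, |d y -
        d x| is at most the density of \<open>D q s\<close> plus 2 s, hence plus e / 8. As a disc
        has area at most 4 r^2 this summand costs e / 2, and the other half is left for
        \<open>D q s\<close>.\<close>
      obtain s where s: "0 < real_of_rat s" "real_of_rat s < e / 16"
        using of_rat_dense[of 0 "e / 16"] e by auto
      have s0: "s > 0" using s by simp
      obtain q where q: "d x - real_of_rat s < real_of_rat q" "real_of_rat q < d x"
        using of_rat_dense[of "d x - real_of_rat s" "d x"] s by auto
      have "x \<in> E q s \<inter> W" using x q by (auto simp: E_def)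
      moreover have "e / 2 > 0" using e by simp
      ultimately obtain \<delta> where \<delta>: "\<delta> > 0" "\<And>r. 0 < r \<Longrightarrow> r < \<delta> \<Longrightarrow> emeasure (D q s) (cball x r) \<le> ennreal (e / 2 * r\<^sup>2)"
        using elim s0 by meson
      have "emeasure (density lborel (\<lambda>y. ennreal \<bar>d y - d x\<bar>)) (cball x r) \<le> ennreal (e * r\<^sup>2)"
        if r: "0 < r" "r < \<delta>" for r
      proof -
        have [measurable]: "cball x r \<in> sets borel" by simp
        have "emeasure (density lborel (\<lambda>y. ennreal \<bar>d y - d x\<bar>)) (cball x r)
            = (\<integral>\<^sup>+y. ennreal \<bar>d y - d x\<bar> * indicator (cball x r) y \<partial>lborel)"
          by (subst emeasure_density) auto
        also have "\<dots> \<le> (\<integral>\<^sup>+y. ennreal (\<bar>d y - real_of_rat q\<bar> - real_of_rat s) * indicator (cball x r) y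
            + ennreal (e / 8) * indicator (cball x r) y \<partial>lborel)"
        proof (rule nn_integral_mono)
          fix y
          have "ennreal \<bar>d y - d x\<bar> \<le> ennreal (max 0 (\<bar>d y - real_of_rat q\<bar> - real_of_rat s) + e / 8)"
            using q s e by (intro ennreal_leI) (auto simp: abs_if max_def)
          also have "\<dots> = ennreal (\<bar>d y - real_of_rat q\<bar> - real_of_rat s) + ennreal (e / 8)"
            using e by (subst ennreal_plus) (auto simp: max_def ennreal_neg)
          finally show "ennreal \<bar>d y - d x\<bar> * indicator (cball x r) y
              \<le> ennreal (\<bar>d y - real_of_rat q\<bar> - real_of_rat s) * indicator (cball x r) y + ennreal (e / 8) * indicator (cball x r) y"
            by (auto simp: indicator_def)
        qed
        also have "\<dots> = emeasure (D q s) (cball x r) + ennreal (e / 8) * emeasure lborel (cball x r)"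
          unfolding D_def by (subst nn_integral_add) (auto simp: nn_integral_cmult_indicator emeasure_density)
        also have "\<dots> \<le> ennreal (e / 2 * r\<^sup>2) + ennreal (e / 8) * ennreal (4 * r\<^sup>2)"
        proof (intro add_mono \<delta>(2)[OF r] mult_left_mono)
          show "emeasure lborel (cball x r) \<le> ennreal (4 * r\<^sup>2)"
            using emeasure_mono[OF cball_subset_cube[of x r], of lborel] r by (simp add: emeasure_lborel_cube)
        qed simp
        also have "\<dots> = ennreal (e * r\<^sup>2)"
          using e by (simp add: ennreal_mult[symmetric] ennreal_plus[symmetric] field_simps del: ennreal_plus)
        finally show ?thesis .
      qed
      with \<delta>(1) show "\<exists>\<delta>>0. \<forall>r. 0 < r \<and> r < \<delta> \<longrightarrow>
          emeasure (density lborel (\<lambda>y. ennreal \<bar>d y - d x\<bar>)) (cball x r) \<le> ennreal (e * r\<^sup>2)" by blast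
    qed
  qed
qed

lemma ac_density_decomposition:
  fixes M :: "plane measure"
  assumes "ac_density M p" and M: "sets M = sets borel"
  obtains S Z where "sets S = sets borel" "Z \<in> null_sets lborel" "emeasure S (- Z) = 0"
    "M = add_measure (density lborel (\<lambda>x. ennreal (p x))) S"
proof -
  obtain S Z where S: "sets S = sets borel" "Z \<in> null_sets lborel" "emeasure S (- Z) = 0"
    "\<And>A. A \<in> sets borel \<Longrightarrow> emeasure M A = emeasure (density lborel (\<lambda>x. ennreal (p x))) A + emeasure S A"
    using assms(1) unfolding ac_density_def by blast
  have "M = add_measure (density lborel (\<lambda>x. ennreal (p x))) S"
    by (rule measure_eqI) (use S M in \<open>auto simp: emeasure_add_measure\<close>)
  with S that show thesis by blast
qed

text \<open>At Lebesgue points of the densities where the singular parts have density zero,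
  subtracting the linear function formed by the densities leaves a derivative of mass o(r^2) on
  discs of radius r. The Poincare inequality bounds the pair integral by r^2 times the squared mass,
  that is by o(r^6).\<close>

lemma AE_LD:
  assumes W: "open W" and h: "continuous_on W h" and weak: "\<And>i. weak_pd i W h (P i) (N i)"
    and p: "\<And>i. ac_density (P i) (p i)" and n: "\<And>i. ac_density (N i) (n i)"
  shows "AE x in lebesgue. x \<in> W \<longrightarrow> LD h x (\<chi> i. p i x - n i x)"
proof -
  have sPN: "sets (P i) = sets borel" "sets (N i) = sets borel"
    and fPN: "\<And>K. compact K \<Longrightarrow> K \<subseteq> W \<Longrightarrow> emeasure (P i) K < \<infinity>" "\<And>K. compact K \<Longrightarrow> K \<subseteq> W \<Longrightarrow> emeasure (N i) K < \<infinity>" for i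
    using weak[of i] by (auto simp: weak_pd_def radon_measure_on_def)
  have pb [measurable]: "p i \<in> borel_measurable borel" "n i \<in> borel_measurable borel"
    and pos: "0 \<le> p i x" "0 \<le> n i x" for i x
    using p[of i] n[of i] by (auto simp: ac_density_def)
  have "\<exists>S Z. sets S = sets borel \<and> Z \<in> null_sets lborel \<and> emeasure S (- Z) = 0 \<and> P i = add_measure (density lborel (\<lambda>x. ennreal (p i x))) S" for i
    using ac_density_decomposition[OF p sPN(1)] by metis
  then obtain SP ZP where SP: "\<And>i. sets (SP i) = sets borel" "\<And>i. ZP i \<in> null_sets lborel" "\<And>i. emeasure (SP i) (- ZP i) = 0"
    "\<And>i. P i = add_measure (density lborel (\<lambda>x. ennreal (p i x))) (SP i)" by metis
  have "\<exists>S Z. sets S = sets borel \<and> Z \<in> null_sets lborel \<and> emeasure S (- Z) = 0 \<and> N i = add_measure (density lborel (\<lambda>x. ennreal (n i x))) S" for i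
    using ac_density_decomposition[OF n sPN(2)] by metis
  then obtain SN ZN where SN: "\<And>i. sets (SN i) = sets borel" "\<And>i. ZN i \<in> null_sets lborel" "\<And>i. emeasure (SN i) (- ZN i) = 0"
    "\<And>i. N i = add_measure (density lborel (\<lambda>x. ennreal (n i x))) (SN i)" by metis
  let ?LP = "\<lambda>i. density lborel (\<lambda>x. ennreal (p i x))" and ?LN = "\<lambda>i. density lborel (\<lambda>x. ennreal (n i x))"
  have split: "emeasure (P i) A = emeasure (?LP i) A + emeasure (SP i) A" "emeasure (N i) A = emeasure (?LN i) A + emeasure (SN i) A"
    if "A \<in> sets borel" for i A
    by (subst SP(4), rule emeasure_add_measure, use SP(1) that in auto)
       (subst SN(4), rule emeasure_add_measure, use SN(1) that in auto)
  have fin: "emeasure (?LP i) K < \<infinity>" "emeasure (SP i) K < \<infinity>" "emeasure (?LN i) K < \<infinity>" "emeasure (SN i) K < \<infinity>"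
    if K: "compact K" "K \<subseteq> W" for i K
    using fPN(1)[OF K, of i] fPN(2)[OF K, of i] split[OF borel_compact[OF K(1)], of i] by (auto simp: less_top)
  define d where "d i y = p i y - n i y" for i y
  have dm [measurable]: "d i \<in> borel_measurable borel" for i unfolding d_def by measurable
  have dfin: "(\<integral>\<^sup>+x. ennreal \<bar>d i x\<bar> * indicator K x \<partial>lborel) < \<infinity>" if K: "compact K" "K \<subseteq> W" for i K
  proof -
    have [measurable]: "K \<in> sets borel" using borel_compact[OF K(1)] .
    have "(\<integral>\<^sup>+x. ennreal \<bar>d i x\<bar> * indicator K x \<partial>lborel)
        \<le> (\<integral>\<^sup>+x. ennreal (p i x) * indicator K x + ennreal (n i x) * indicator K x \<partial>lborel)"
    proof (rule nn_integral_mono)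
      fix x
      have "\<bar>d i x\<bar> \<le> p i x + n i x" using pos[of i x] by (simp add: d_def)
      then have "ennreal \<bar>d i x\<bar> \<le> ennreal (p i x) + ennreal (n i x)"
        using pos by (simp add: ennreal_plus[symmetric] del: ennreal_plus)
      then show "ennreal \<bar>d i x\<bar> * indicator K x \<le> ennreal (p i x) * indicator K x + ennreal (n i x) * indicator K x"
        by (auto simp: indicator_def)
    qed
    also have "\<dots> = emeasure (?LP i) K + emeasure (?LN i) K"
      by (subst nn_integral_add) (auto simp: emeasure_density)
    also have "\<dots> < \<infinity>" using fin[OF K] by simp
    finally show ?thesis .
  qed
  have leb: "AE x in lebesgue. \<forall>i. x \<in> W \<longrightarrow> (\<forall>e>0. \<exists>\<delta>>0. \<forall>r. 0 < r \<and> r < \<delta> \<longrightarrow>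
      emeasure (density lborel (\<lambda>y. ennreal \<bar>d i y - d i x\<bar>)) (cball x r) \<le> ennreal (e * r\<^sup>2))"
    unfolding AE_all_countable using AE_Lebesgue_point[OF W dm dfin] by blast
  \<comment> \<open>\<open>S i\<close> does not charge the complement of \<open>Z i\<close>, so its
    density vanishes at almost every point there; and \<open>Z i\<close> itself is a null
    set.\<close>
  have sing: "AE x in lebesgue. \<forall>i. x \<in> W \<longrightarrow> (\<forall>e>0. \<exists>\<delta>>0. \<forall>r. 0 < r \<and> r < \<delta> \<longrightarrow> emeasure (S i) (cball x r) \<le> ennreal (e * r\<^sup>2))"
    if S: "\<And>i. sets (S i) = sets borel" "\<And>i. Z i \<in> null_sets lborel" "\<And>i. emeasure (S i) (- Z i) = 0"
      "\<And>i K. compact K \<Longrightarrow> K \<subseteq> W \<Longrightarrow> emeasure (S i) K < \<infinity>" for S :: "2 \<Rightarrow> plane measure" and Z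
  proof -
    have "AE x in lebesgue. x \<in> W \<longrightarrow> (\<forall>e>0. \<exists>\<delta>>0. \<forall>r. 0 < r \<and> r < \<delta> \<longrightarrow> emeasure (S i) (cball x r) \<le> ennreal (e * r\<^sup>2))" for i
    proof -
      have Zb: "- Z i \<in> sets borel" using S(2)[of i] by (auto simp: null_sets_def)
      have "emeasure (S i) (- Z i \<inter> W) \<le> emeasure (S i) (- Z i)" using Zb S(1) by (intro emeasure_mono) auto
      then have "emeasure (S i) (- Z i \<inter> W) = 0" using S(3) by simp
      from AE_density_zero[OF S(1) W S(4) Zb this]
      have "AE x in lebesgue. x \<in> - Z i \<inter> W \<longrightarrow> (\<forall>e>0. \<exists>\<delta>>0. \<forall>r. 0 < r \<and> r < \<delta> \<longrightarrow> emeasure (S i) (cball x r) \<le> ennreal (e * r\<^sup>2))" .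
      moreover have "AE x in lebesgue. x \<notin> Z i"
        using AE_completion[OF AE_not_in[OF S(2)]] .
      ultimately show ?thesis by eventually_elim blast
    qed
    then show ?thesis unfolding AE_all_countable by blast
  qed
  have "AE x in lebesgue. \<forall>i. x \<in> W \<longrightarrow> (\<forall>e>0. \<exists>\<delta>>0. \<forall>r. 0 < r \<and> r < \<delta> \<longrightarrow> emeasure (SP i) (cball x r) \<le> ennreal (e * r\<^sup>2))"
    by (rule sing[OF SP(1-3) fin(2)])
  moreover have "AE x in lebesgue. \<forall>i. x \<in> W \<longrightarrow> (\<forall>e>0. \<exists>\<delta>>0. \<forall>r. 0 < r \<and> r < \<delta> \<longrightarrow> emeasure (SN i) (cball x r) \<le> ennreal (e * r\<^sup>2))"
    by (rule sing[OF SN(1-3) fin(4)])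
  moreover note leb
  ultimately show ?thesis
  proof eventually_elim
    case (elim x)
    show ?case
    proof
      assume x: "x \<in> W"
      let ?A = "\<chi> i. p i x - n i x" let ?h = "\<lambda>z. h z - ?A \<bullet> z"
      have cA: "continuous_on S (\<lambda>z. ?A \<bullet> z)" for S by (intro continuous_intros)
      define L where "L i = density lborel (\<lambda>y. ennreal \<bar>d i y - d i x\<bar>)" for i
      \<comment> \<open>The derivative of \<open>?h\<close> in direction i is d i - d i x times
        Lebesgue measure, plus the singular parts. \<open>M i\<close> dominates its variation and
        has vanishing density at \<open>x\<close>.\<close>
      define M where "M i = add_measure (L i) (add_measure (SP i) (SN i))" for i
      have eM: "emeasure (M i) B = emeasure (L i) B + (emeasure (SP i) B + emeasure (SN i) B)" if "B \<in> sets borel" for i B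
        unfolding M_def using that SP(1) SN(1) by (simp add: emeasure_add_measure L_def)
      have finL: "emeasure (L i) K < \<infinity>" if K: "compact K" "K \<subseteq> W" for i K
      proof -
        have [measurable]: "K \<in> sets borel" using borel_compact[OF K(1)] .
        have "emeasure (L i) K = (\<integral>\<^sup>+y. ennreal \<bar>d i y - d i x\<bar> * indicator K y \<partial>lborel)"
          unfolding L_def by (subst emeasure_density) auto
        also have "\<dots> \<le> (\<integral>\<^sup>+y. ennreal \<bar>d i y\<bar> * indicator K y + ennreal \<bar>d i x\<bar> * indicator K y \<partial>lborel)"
          by (intro nn_integral_mono) (auto simp: indicator_def ennreal_plus[symmetric] simp del: ennreal_plus intro!: ennreal_leI)
        also have "\<dots> = (\<integral>\<^sup>+y. ennreal \<bar>d i y\<bar> * indicator K y \<partial>lborel) + ennreal \<bar>d i x\<bar> * emeasure lborel K"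
          by (subst nn_integral_add) (auto simp: nn_integral_cmult_indicator)
        also have "\<dots> < \<infinity>"
          using dfin[OF K, of i] emeasure_compact_finite[OF K(1)] by (auto simp: ennreal_mult_less_top)
        finally show ?thesis .
      qed
      have dom: "pd_dominated i W ?h (M i)" for i
        unfolding pd_dominated_def
      proof (intro conjI allI impI)
        show "sets (M i) = sets borel" by (simp add: M_def)
        show "emeasure (M i) K < \<infinity>" if "compact K \<and> K \<subseteq> W" for K
          using that finL[of K i] fin(2,4)[of K i] eM[OF borel_compact, of K i] by simp
        fix \<phi> assume \<phi>: "test_function W \<phi> \<and> (\<forall>x. 0 \<le> \<phi> x)"
        then have t: "test_function W \<phi>" by blast
        obtain K where K: "compact K" "K \<subseteq> W" "\<And>x. x \<notin> K \<Longrightarrow> \<phi> x = 0" using test_functionE[OF t] by metis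
        note \<phi>b [measurable] = test_functionD(2)[OF t]
        have pc: "continuous_on UNIV (pd i \<phi>)" using test_functionD(3)[OF t, of 1] by simp
        have pout: "pd i \<phi> z = 0" if "z \<notin> K" for z
          using K that by (intro pd_eq_0_outside[of K]) (auto intro: compact_imp_closed)
        have i1: "integrable lborel (\<lambda>z. h z * pd i \<phi> z)"
          using continuous_on_extend_0[OF W h pc K(1,2) pout] pout
          by (intro integrable_continuous_compact[OF _ K(1)]) auto
        have i2: "integrable lborel (\<lambda>z. (?A \<bullet> z) * pd i \<phi> z)"
          using pout by (intro integrable_continuous_compact[OF _ K(1)] continuous_intros pc) auto
        have lin: "(LINT z|lborel. (?A \<bullet> z) * pd i \<phi> z) = - (LINT z|lborel. d i x * \<phi> z)"
        proof -
          have hd: "((\<lambda>z. ?A \<bullet> z) has_derivative (\<lambda>v. ?A \<bullet> v)) (at z)" for z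
            by (auto intro!: derivative_eq_intros)
          have pdA: "pd j (\<lambda>z. ?A \<bullet> z) z = d j x" for j z
            using pd_eqI[OF hd] by (simp add: inner_axis d_def)
          then have pdA': "pd j (\<lambda>z. ?A \<bullet> z) = (\<lambda>z. d j x)" for j by blast
          have "Ck_on 1 W (\<lambda>z. ?A \<bullet> z)"
            using differentiableI[OF hd] by (simp add: pdA')
          from integral_by_parts[OF W this Ck_on_subset[OF test_functionD(3)[OF t] subset_UNIV] K, of i]
          show ?thesis by (simp add: pdA')
        qed
        have iL: "integrable lborel \<phi>"
          by (rule integrable_continuous_compact[OF test_functionD(1)[OF t] K(1,3)])
        have iP: "integrable (?LP i) \<phi>" "integrable (SP i) \<phi>" and iN: "integrable (?LN i) \<phi>" "integrable (SN i) \<phi>"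
          using fin SP(1) SN(1) t by (auto intro!: integrable_test_function[of _ W])
        have eP: "(LINT z|P i. \<phi> z) = (LINT z|lborel. p i z * \<phi> z) + (LINT z|SP i. \<phi> z)"
          by (subst SP(4), subst integrable_add_measure(2)) (use SP(1) iP pos in \<open>auto simp: integral_density\<close>)
        have eN: "(LINT z|N i. \<phi> z) = (LINT z|lborel. n i z * \<phi> z) + (LINT z|SN i. \<phi> z)"
          by (subst SN(4), subst integrable_add_measure(2)) (use SN(1) iN pos in \<open>auto simp: integral_density\<close>)
        have ip: "integrable lborel (\<lambda>z. p i z * \<phi> z)" and iin: "integrable lborel (\<lambda>z. n i z * \<phi> z)"
          using iP(1) iN(1) pos by (auto simp: integrable_density)
        have "(LINT z|lborel. ?h z * pd i \<phi> z) = (LINT z|lborel. h z * pd i \<phi> z) - (LINT z|lborel. (?A \<bullet> z) * pd i \<phi> z)"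
          using i1 i2 by (simp add: left_diff_distrib)
        also have "\<dots> = (LINT z|N i. \<phi> z) - (LINT z|P i. \<phi> z) + (LINT z|lborel. d i x * \<phi> z)"
          using weak[of i] t unfolding weak_pd_def lin by auto
        also have "\<dots> = (LINT z|lborel. d i x * \<phi> z - d i z * \<phi> z) + ((LINT z|SN i. \<phi> z) - (LINT z|SP i. \<phi> z))"
          unfolding eP eN using ip iin iL by (simp add: d_def left_diff_distrib)
        finally have eq: "(LINT z|lborel. ?h z * pd i \<phi> z)
            = (LINT z|lborel. (d i x - d i z) * \<phi> z) + ((LINT z|SN i. \<phi> z) - (LINT z|SP i. \<phi> z))"
          by (simp add: left_diff_distrib)
        have iLL: "integrable (L i) \<phi>"
          by (rule integrable_test_function[OF _ finL t]) (simp add: L_def)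
        have eL: "(LINT z|L i. \<phi> z) = (LINT z|lborel. \<bar>d i z - d i x\<bar> * \<phi> z)"
          unfolding L_def by (subst integral_density) auto
        have "\<bar>LINT z|lborel. (d i x - d i z) * \<phi> z\<bar> \<le> (LINT z|lborel. \<bar>(d i x - d i z) * \<phi> z\<bar>)"
          by (rule integral_abs_bound)
        also have "\<dots> = (LINT z|L i. \<phi> z)"
          unfolding eL using \<phi> by (intro Bochner_Integration.integral_cong) (auto simp: abs_mult abs_minus_commute)
        finally have b1: "\<bar>LINT z|lborel. (d i x - d i z) * \<phi> z\<bar> \<le> (LINT z|L i. \<phi> z)" .
        have b2: "0 \<le> (LINT z|SN i. \<phi> z)" "0 \<le> (LINT z|SP i. \<phi> z)" using \<phi> by simp_all
        have "integrable (add_measure (SP i) (SN i)) \<phi>" "(LINT z|add_measure (SP i) (SN i). \<phi> z) = (LINT z|SP i. \<phi> z) + (LINT z|SN i. \<phi> z)"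
          using integrable_add_measure[OF SP(1) SN(1) iP(2) iN(2)] by auto
        then have "(LINT z|M i. \<phi> z) = (LINT z|L i. \<phi> z) + ((LINT z|SP i. \<phi> z) + (LINT z|SN i. \<phi> z))"
          unfolding M_def using iLL by (subst integrable_add_measure(2)) (auto simp: L_def)
        then show "\<bar>LINT z|lborel. ?h z * pd i \<phi> z\<bar> \<le> (LINT z|M i. \<phi> z)"
          unfolding eq using b1 b2 by linarith
      qed
      have dens: "\<exists>\<delta>>0. \<forall>r. 0 < r \<and> r < \<delta> \<longrightarrow> measure (M i) (cball x r) \<le> e * r\<^sup>2" if e: "e > 0" for e i
      proof -
        have e3: "e / 3 > 0" using e by simp
        obtain d1 where d1: "d1 > 0" "\<And>r. 0 < r \<Longrightarrow> r < d1 \<Longrightarrow> emeasure (L i) (cball x r) \<le> ennreal (e / 3 * r\<^sup>2)"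
          using elim(3) x e3 unfolding L_def by meson
        obtain d2 where d2: "d2 > 0" "\<And>r. 0 < r \<Longrightarrow> r < d2 \<Longrightarrow> emeasure (SP i) (cball x r) \<le> ennreal (e / 3 * r\<^sup>2)"
          using elim(1) x e3 by meson
        obtain d3 where d3: "d3 > 0" "\<And>r. 0 < r \<Longrightarrow> r < d3 \<Longrightarrow> emeasure (SN i) (cball x r) \<le> ennreal (e / 3 * r\<^sup>2)"
          using elim(2) x e3 by meson
        have "measure (M i) (cball x r) \<le> e * r\<^sup>2" if r: "0 < r" "r < min d1 (min d2 d3)" for r
        proof -
          have "emeasure (M i) (cball x r) \<le> ennreal (e / 3 * r\<^sup>2) + (ennreal (e / 3 * r\<^sup>2) + ennreal (e / 3 * r\<^sup>2))"
            unfolding eM[OF borel_closed[OF closed_cball]] using r by (intro add_mono d1 d2 d3) auto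
          also have "\<dots> = ennreal (e * r\<^sup>2)"
            using e by (simp add: ennreal_plus[symmetric] field_simps del: ennreal_plus)
          finally show ?thesis using e by (simp add: measure_def enn2real_leI)
        qed
        then show ?thesis using d1 d2 d3 by (intro exI[of _ "min d1 (min d2 d3)"]) auto
      qed
      obtain d0 where d0: "d0 > 0" "cube x d0 \<subseteq> W" using open_contains_cube[OF W x] by blast
      have hc: "continuous_on (cube x d0) h" by (rule continuous_on_subset[OF h d0(2)])
      have hc': "continuous_on W ?h" by (intro continuous_intros h)
      have "small x (\<lambda>(z, w). h z - h w - ?A \<bullet> (z - w))"
      proof (rule smallI[OF d0(1)])
        show "continuous_on (cube x d0 \<times> cube x d0) (\<lambda>(z, w). h z - h w - ?A \<bullet> (z - w))"
          unfolding split_beta by (intro continuous_intros continuous_on_compose2[OF hc]) auto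
        fix e :: real assume e: "e > 0"
        \<comment> \<open>Two masses of at most e' (4 r)^2 = 16 e' r^2 enter the Poincare bound 8
          r^2 times the square of their sum, and 8 times 32^2 is 8192.\<close>
        define e' where "e' = sqrt (e / 8192)"
        have e': "e' > 0" "8192 * e'\<^sup>2 = e" using e by (auto simp: e'_def)
        obtain d1 where d1: "d1 > 0" "\<And>r. 0 < r \<Longrightarrow> r < d1 \<Longrightarrow> measure (M 1) (cball x r) \<le> e' * r\<^sup>2"
          using dens[OF e'(1), of 1] by blast
        obtain d2 where d2: "d2 > 0" "\<And>r. 0 < r \<Longrightarrow> r < d2 \<Longrightarrow> measure (M 2) (cball x r) \<le> e' * r\<^sup>2"
          using dens[OF e'(1), of 2] by blast
        have "integral (cube x r \<times> cube x r) (\<lambda>p. (case p of (z, w) \<Rightarrow> h z - h w - ?A \<bullet> (z - w))\<^sup>2) \<le> e * r ^ 6"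
          if r: "0 < r" "r < min (d0 / 8) (min (d1 / 4) (d2 / 4))" for r
        proof -
          have big: "cube x (r + r) \<subseteq> cball x (4 * r)" using cube_subset_cball[of x "r + r"] by simp
          have bigW: "cball x (4 * r) \<subseteq> W"
            using cball_subset_cube[of x "4 * r"] cube_mono[of "4 * r" d0 x] r d0 by auto
          have Mi: "measure (M i) (cube x (r + r)) \<le> e' * (4 * r)\<^sup>2"
            if "measure (M i) (cball x (4 * r)) \<le> e' * (4 * r)\<^sup>2" for i
          proof -
            have "emeasure (M i) (cball x (4 * r)) \<noteq> \<infinity>"
              using dom[of i] bigW unfolding pd_dominated_def by (metis compact_cball less_irrefl)
            then have "measure (M i) (cube x (r + r)) \<le> measure (M i) (cball x (4 * r))"
              unfolding measure_def using big dom[of i]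
              by (intro enn2real_mono emeasure_mono) (auto simp: pd_dominated_def less_top)
            with that show ?thesis by linarith
          qed
          have "integral (cube x r \<times> cube x r) (\<lambda>p. (case p of (z, w) \<Rightarrow> h z - h w - ?A \<bullet> (z - w))\<^sup>2)
              = integral (cube x r \<times> cube x r) (\<lambda>(z, w). (?h z - ?h w)\<^sup>2)"
            by (rule Henstock_Kurzweil_Integration.integral_cong) (auto simp: inner_diff_right algebra_simps)
          also have "\<dots> \<le> 8 * r\<^sup>2 * (measure (M 1) (cube x (r + r)) + measure (M 2) (cube x (r + r)))\<^sup>2"
            using big bigW by (intro Poincare_BV[OF W hc' dom r(1) r(1)]) blast
          also have "\<dots> \<le> 8 * r\<^sup>2 * (e' * (4 * r)\<^sup>2 + e' * (4 * r)\<^sup>2)\<^sup>2"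
            using r by (intro mult_left_mono power_mono add_mono Mi d1(2) d2(2)) auto
          also have "\<dots> = (8192 * e'\<^sup>2) * r ^ 6" by (simp add: power2_eq_square eval_nat_numeral)
          finally show ?thesis unfolding e'(2) .
        qed
        then show "\<exists>d>0. \<forall>r. 0 < r \<and> r < d \<and> r \<le> d0 \<longrightarrow>
            integral (cube x r \<times> cube x r) (\<lambda>p. (case p of (z, w) \<Rightarrow> h z - h w - ?A \<bullet> (z - w))\<^sup>2) \<le> e * r ^ 6"
          using d0 d1 d2 by (intro exI[of _ "min (d0 / 8) (min (d1 / 4) (d2 / 4))"]) auto
      qed
      then show "LD h x ?A" unfolding LD_def using d0(1) hc by blast
    qed
  qed
qed

section \<open>Localisation of Hessian measures\<close>

lemma test_function_add:
  assumes "test_function W \<phi>" "test_function W \<psi>" shows "test_function W (\<lambda>x. \<phi> x + \<psi> x)"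
proof -
  obtain K where K: "compact K" "K \<subseteq> W" "\<And>x. x \<notin> K \<Longrightarrow> \<phi> x = 0" using test_functionE[OF assms(1)] by metis
  obtain L where L: "compact L" "L \<subseteq> W" "\<And>x. x \<notin> L \<Longrightarrow> \<psi> x = 0" using test_functionE[OF assms(2)] by metis
  show ?thesis
    by (rule test_functionI[of _ "K \<union> L"])
       (use K L test_functionD(3)[OF assms(1)] test_functionD(3)[OF assms(2)] in \<open>auto intro: Ck_on_add\<close>)
qed

lemma test_function_sum:
  assumes "\<And>n. n \<in> I \<Longrightarrow> test_function W (\<phi> n)" shows "test_function W (\<lambda>x. \<Sum>n\<in>I. \<phi> n x)"
  using assms
proof (induction I rule: infinite_finite_induct)
  case (insert n I) then show ?case using test_function_add[of W "\<phi> n" "\<lambda>x. \<Sum>n\<in>I. \<phi> n x"] by simp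
qed (auto intro!: test_functionI[of _ "{}"] Ck_on_const)

lemma telescoping_partition:
  fixes s :: "nat \<Rightarrow> real"
  shows "(\<Sum>n<k. s n * (\<Prod>m<n. 1 - s m)) = 1 - (\<Prod>m<k. 1 - s m)"
  by (induction k) (auto simp: algebra_simps)

text \<open>The smooth partition of unity \<open>s\<^sub>n \<Prod>\<^sub>m\<^sub><\<^sub>n (1 - s\<^sub>m)\<close> glues the local measures,
  so no uniqueness on overlaps is needed.\<close>

lemma glue_local_measures:
  fixes \<Lambda> :: "(plane \<Rightarrow> real) \<Rightarrow> real"
  assumes W: "open W"
    and add: "\<And>\<phi> \<psi>. test_function W \<phi> \<Longrightarrow> test_function W \<psi> \<Longrightarrow> \<Lambda> (\<lambda>x. \<phi> x + \<psi> x) = \<Lambda> \<phi> + \<Lambda> \<psi>"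
    and loc: "\<And>x. x \<in> W \<Longrightarrow> \<exists>V P N. open V \<and> x \<in> V \<and> V \<subseteq> W \<and> sets P = sets borel \<and> sets N = sets borel \<and>
       finite_measure P \<and> finite_measure N \<and> (\<forall>\<phi>. test_function V \<phi> \<longrightarrow> \<Lambda> \<phi> = (LINT y|P. \<phi> y) - (LINT y|N. \<phi> y))"
  shows "\<exists>P N. radon_measure_on W P \<and> radon_measure_on W N \<and>
       (\<forall>\<phi>. test_function W \<phi> \<longrightarrow> \<Lambda> \<phi> = (LINT y|P. \<phi> y) - (LINT y|N. \<phi> y))"
proof -
  have test0: "test_function W (\<lambda>x. 0)" by (rule test_functionI[of _ "{}"]) (auto intro: Ck_on_const)
  have \<Lambda>0: "\<Lambda> (\<lambda>x. 0) = 0" using add[OF test0 test0] by simp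
  have \<Lambda>sum: "\<Lambda> (\<lambda>x. \<Sum>n\<in>I. \<phi> n x) = (\<Sum>n\<in>I. \<Lambda> (\<phi> n))"
    if "finite I" "\<And>n. n \<in> I \<Longrightarrow> test_function W (\<phi> n)" for I :: "nat set" and \<phi>
    using that
  proof (induction I rule: finite_induct)
    case (insert n I)
    then show ?case using add[of "\<phi> n" "\<lambda>x. \<Sum>n\<in>I. \<phi> n x"] test_function_sum[of I W \<phi>] by simp
  qed (simp add: \<Lambda>0)
  show ?thesis
  proof (cases "W = {}")
    \<comment> \<open>Treated apart, because the centres of the covering are enumerated by
      \<open>from_nat_into\<close>, which presupposes a nonempty set.\<close>
    case True
    have "\<phi> = (\<lambda>x. 0)" if "test_function W \<phi>" for \<phi>
      using that True by (auto elim!: test_functionE)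
    then have "\<forall>\<phi>. test_function W \<phi> \<longrightarrow> \<Lambda> \<phi> = (LINT y|null_measure borel. \<phi> y) - (LINT y|null_measure borel. \<phi> y)"
      using \<Lambda>0 by auto
    moreover have "radon_measure_on W (null_measure borel)" by (simp add: radon_measure_on_def)
    ultimately show ?thesis by blast
  next
    case False
    define C where "C x t \<longleftrightarrow> (case t of (V, P, N) \<Rightarrow> open V \<and> x \<in> V \<and> V \<subseteq> W \<and> sets P = sets borel \<and> sets N = sets borel \<and>
       finite_measure P \<and> finite_measure N \<and> (\<forall>\<phi>. test_function V \<phi> \<longrightarrow> \<Lambda> \<phi> = (LINT y|P. \<phi> y) - (LINT y|N. \<phi> y)))" for x t
    have "\<exists>t. C x t" if "x \<in> W" for x using loc[OF that] unfolding C_def by auto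
    then obtain t where t: "\<And>x. x \<in> W \<Longrightarrow> C x (t x)" by metis
    define V where "V x = fst (t x)" for x
    define P where "P x = fst (snd (t x))" for x
    define N where "N x = snd (snd (t x))" for x
    have VPN: "open (V x)" "x \<in> V x" "V x \<subseteq> W" "sets (P x) = sets borel" "sets (N x) = sets borel"
       "finite_measure (P x)" "finite_measure (N x)"
       "\<forall>\<phi>. test_function (V x) \<phi> \<longrightarrow> \<Lambda> \<phi> = (LINT y|P x. \<phi> y) - (LINT y|N x. \<phi> y)" if "x \<in> W" for x
      using t[OF that] by (simp_all add: C_def split_beta V_def P_def N_def)
    note V = VPN(1-3) and sP = VPN(4) and sN = VPN(5) and fP = VPN(6) and fN = VPN(7)
    have rep: "\<Lambda> \<phi> = (LINT y|P x. \<phi> y) - (LINT y|N x. \<phi> y)" if "x \<in> W" "test_function (V x) \<phi>" for x \<phi>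
      using VPN(8)[OF that(1)] that(2) by blast
    have "\<exists>r>0. cube x (2 * r) \<subseteq> V x" if xW: "x \<in> W" for x
    proof -
      obtain r where "r > 0" "cube x r \<subseteq> V x" using open_contains_cube[OF V(1)[OF xW] V(2)[OF xW]] by blast
      then show ?thesis by (intro exI[of _ "r / 2"]) auto
    qed
    then obtain r where r: "\<And>x. x \<in> W \<Longrightarrow> r x > 0" "\<And>x. x \<in> W \<Longrightarrow> cube x (2 * r x) \<subseteq> V x" by metis
    obtain F where F: "F \<subseteq> (\<lambda>x. ball x (r x)) ` W" "countable F" "\<Union>F = \<Union>((\<lambda>x. ball x (r x)) ` W)"
    proof (rule Lindelof)
      show "open S" if "S \<in> (\<lambda>x. ball x (r x)) ` W" for S using that by blast
    qed
    obtain X where X: "countable X" "X \<subseteq> W" "F = (\<lambda>x. ball x (r x)) ` X"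
      using countable_subset_image[THEN iffD1, OF conjI[OF F(2,1)]] by blast
    have cov: "W \<subseteq> (\<Union>x\<in>X. ball x (r x))"
    proof
      fix x assume x: "x \<in> W"
      then have "x \<in> \<Union>((\<lambda>x. ball x (r x)) ` W)" using r(1)[OF x] by (intro UN_I[OF x]) simp
      then show "x \<in> (\<Union>x\<in>X. ball x (r x))" unfolding F(3)[symmetric] X(3) .
    qed
    have "X \<noteq> {}" using cov False by auto
    define c where "c n = from_nat_into X n" for n
    have rc: "range c = X" unfolding c_def using range_from_nat_into[OF \<open>X \<noteq> {}\<close> X(1)] .
    have cW: "c n \<in> W" for n using rc X(2) by auto
    define s where "s n = cutoff (c n) (r (c n))" for n
    define \<eta> where "\<eta> n x = s n x * (\<Prod>m<n. 1 - s m x)" for n x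
    have s01: "0 \<le> s n x" "s n x \<le> 1" for n x unfolding s_def using cutoff_bounds[OF r(1)[OF cW]] by auto
    have sC: "Ck_on k UNIV (s n)" for k n unfolding s_def by (rule Ck_on_cutoff[OF r(1)[OF cW]])
    have \<eta>0: "0 \<le> \<eta> n x" for n x unfolding \<eta>_def using s01 by (intro mult_nonneg_nonneg prod_nonneg) auto
    have \<eta>1: "\<eta> n x \<le> 1" for n x unfolding \<eta>_def using s01 by (intro mult_le_one prod_nonneg prod_le_1) auto
    have \<eta>C: "Ck_on k UNIV (\<eta> n)" for k n
      unfolding \<eta>_def[abs_def] by (intro Ck_on_mult Ck_on_prod Ck_on_diff Ck_on_const sC open_UNIV)
    have \<eta>b [measurable]: "\<eta> n \<in> borel_measurable borel" for n
      using \<eta>C[of 0 n] continuous_imp_borel_measurable by simp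
    have \<eta>out: "\<eta> n x = 0" if "x \<notin> cube (c n) (2 * r (c n))" for n x
      unfolding \<eta>_def s_def using cutoff_eq_0[OF that] by simp
    have fin: "\<exists>k. (\<forall>x\<in>K. (\<Sum>n<k. \<eta> n x) = 1) \<and> (\<forall>x\<in>K. \<forall>n\<ge>k. \<eta> n x = 0)" if K: "compact K" "K \<subseteq> W" for K
    proof -
      have "K \<subseteq> (\<Union>n. ball (c n) (r (c n)))" using K cov rc by auto
      then obtain I where I: "finite I" "K \<subseteq> (\<Union>n\<in>I. ball (c n) (r (c n)))"
        using compactE_image[OF K(1), of UNIV "\<lambda>n. ball (c n) (r (c n))"] by auto
      obtain k where k: "I \<subseteq> {..<k}" using finite_nat_iff_bounded I(1) by blast
      \<comment> \<open>As soon as one earlier cut-off equals one at \<open>x\<close>, the product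
        vanishes. On a compact set finitely many cut-offs suffice for this, so the partition is
        finite there.\<close>
      have z: "(\<Prod>m<n. 1 - s m x) = 0" if x: "x \<in> K" and n: "n \<ge> k" for x n
      proof -
        obtain m where m: "m \<in> I" "x \<in> ball (c m) (r (c m))" using I(2) x by blast
        then have "x \<in> cube (c m) (r (c m))" using cball_subset_cube[of "c m" "r (c m)"] by auto
        then have "s m x = 1" unfolding s_def by (rule cutoff_eq_1[OF r(1)[OF cW]])
        then show ?thesis using m k n by (intro prod_zero) (auto intro!: bexI[of _ m])
      qed
      show ?thesis
      proof (intro exI[of _ k] conjI ballI allI impI)
        show "(\<Sum>n<k. \<eta> n x) = 1" if "x \<in> K" for x
          unfolding \<eta>_def telescoping_partition using z[OF that] by simp
        show "\<eta> n x = 0" if "x \<in> K" "n \<ge> k" for x n unfolding \<eta>_def using z[OF that] by simp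
      qed
    qed
    \<comment> \<open>Stated for an arbitrary family of finite measures, because it is applied to
      the positive and to the negative parts separately.\<close>
    have glue: "radon_measure_on W (sum_measure (\<lambda>n. density (M (c n)) (\<lambda>x. ennreal (\<eta> n x)))) \<and>
        (\<forall>\<phi> k K. test_function W \<phi> \<and> (\<forall>x. x \<notin> K \<longrightarrow> \<phi> x = 0) \<and> (\<forall>x\<in>K. \<forall>n\<ge>k. \<eta> n x = 0) \<longrightarrow>
           (LINT y|sum_measure (\<lambda>n. density (M (c n)) (\<lambda>x. ennreal (\<eta> n x))). \<phi> y) = (\<Sum>n<k. LINT y|M (c n). \<eta> n y * \<phi> y))"
      if sM: "\<And>x. x \<in> W \<Longrightarrow> sets (M x) = sets borel" and fM: "\<And>x. x \<in> W \<Longrightarrow> finite_measure (M x)" for M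
    proof -
      let ?D = "\<lambda>n. density (M (c n)) (\<lambda>x. ennreal (\<eta> n x))"
      have sMc [measurable_cong]: "sets (M (c n)) = sets borel" for n using sM cW by blast
      have sD: "sets (?D n) = sets borel" for n using sMc by simp
      have eD: "emeasure (?D n) A = (\<integral>\<^sup>+x. ennreal (\<eta> n x) * indicator A x \<partial>M (c n))" if "A \<in> sets borel" for A n
        using that sMc by (subst emeasure_density) auto
      have eDle: "emeasure (?D n) A < \<infinity>" if A: "A \<in> sets borel" for A n
      proof -
        have "emeasure (?D n) A \<le> (\<integral>\<^sup>+x. 1 \<partial>M (c n))"
          unfolding eD[OF A] using \<eta>1 by (intro nn_integral_mono) (auto simp: indicator_def)
        also have "\<dots> < \<infinity>" using finite_measure.emeasure_finite[OF fM[OF cW]] by (simp add: less_top)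
        finally show ?thesis .
      qed
      have r1: "emeasure (sum_measure ?D) (- W) = 0"
      proof -
        have Wb: "- W \<in> sets borel" using W by auto
        have z: "ennreal (\<eta> n x) * indicator (- W) x = 0" for n x
        proof (cases "x \<in> W")
          case False
          then have "x \<notin> cube (c n) (2 * r (c n))" using r(2)[OF cW] V(3)[OF cW] by blast
          then show ?thesis by (simp add: \<eta>out)
        qed simp
        have "emeasure (?D n) (- W) = 0" for n unfolding eD[OF Wb] z by simp
        then show ?thesis by (simp add: emeasure_sum_measure[OF sD Wb])
      qed
      have r2: "emeasure (sum_measure ?D) K < \<infinity>" if K: "compact K" "K \<subseteq> W" for K
      proof -
        have Kb: "K \<in> sets borel" using borel_compact[OF K(1)] .
        obtain k where k: "\<forall>x\<in>K. \<forall>n\<ge>k. \<eta> n x = 0" using fin[OF K] by blast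
        have z: "ennreal (\<eta> n x) * indicator K x = 0" if "n \<ge> k" for n x using k that by (cases "x \<in> K") auto
        have "emeasure (?D n) K = 0" if "n \<ge> k" for n unfolding eD[OF Kb] z[OF that] by simp
        then have "emeasure (sum_measure ?D) K = (\<Sum>n<k. emeasure (?D n) K)"
          unfolding emeasure_sum_measure[OF sD Kb] by (intro suminf_finite) (auto simp: not_less)
        also have "\<dots> < \<infinity>" using eDle[OF Kb] by (simp add: ennreal_sum_less_top)
        finally show ?thesis .
      qed
      have r3: "(LINT y|sum_measure ?D. \<phi> y) = (\<Sum>n<k. LINT y|M (c n). \<eta> n y * \<phi> y)"
        if t: "test_function W \<phi>" and K: "\<And>x. x \<notin> K \<Longrightarrow> \<phi> x = 0" "\<And>x n. x \<in> K \<Longrightarrow> n \<ge> k \<Longrightarrow> \<eta> n x = 0" for \<phi> k K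
      proof -
        note \<phi>b [measurable] = test_functionD(2)[OF t]
        have "integrable (?D n) \<phi>" for n
          by (rule integrable_test_function[OF sD _ t], rule eDle, erule borel_compact)
        moreover have "(\<integral>\<^sup>+x. ennreal \<bar>\<phi> x\<bar> \<partial>?D n) = 0" if n: "n \<ge> k" for n
        proof -
          have z: "ennreal (\<eta> n x) * ennreal \<bar>\<phi> x\<bar> = 0" for x using K n by (cases "x \<in> K") auto
          have "(\<integral>\<^sup>+x. ennreal \<bar>\<phi> x\<bar> \<partial>?D n) = (\<integral>\<^sup>+x. ennreal (\<eta> n x) * ennreal \<bar>\<phi> x\<bar> \<partial>M (c n))"
            by (rule nn_integral_density) auto
          also have "\<dots> = 0" unfolding z by simp
          finally show ?thesis .
        qed
        ultimately have "(LINT y|sum_measure ?D. \<phi> y) = (\<Sum>n<k. LINT y|?D n. \<phi> y)"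
          by (intro integral_sum_measure(2)[OF sD \<phi>b])
        also have "\<dots> = (\<Sum>n<k. LINT y|M (c n). \<eta> n y * \<phi> y)"
          using \<eta>0 by (intro sum.cong refl) (subst integral_density, auto simp: sMc)
        finally show ?thesis .
      qed
      show ?thesis
        unfolding radon_measure_on_def
      proof (intro conjI allI impI r1 sets_sum_measure; elim conjE)
        show "emeasure (sum_measure ?D) K < \<infinity>" if "compact K" "K \<subseteq> W" for K using that by (rule r2)
        fix \<phi> k K
        assume "test_function W \<phi>" "\<forall>x. x \<notin> K \<longrightarrow> \<phi> x = 0" "\<forall>x\<in>K. \<forall>n\<ge>k. \<eta> n x = 0"
        then show "(LINT y|sum_measure ?D. \<phi> y) = (\<Sum>n<k. LINT y|M (c n). \<eta> n y * \<phi> y)"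
          by (intro r3[of \<phi> K k]) auto
      qed
    qed
    let ?P = "sum_measure (\<lambda>n. density (P (c n)) (\<lambda>x. ennreal (\<eta> n x)))"
    let ?N = "sum_measure (\<lambda>n. density (N (c n)) (\<lambda>x. ennreal (\<eta> n x)))"
    have "\<Lambda> \<phi> = (LINT y|?P. \<phi> y) - (LINT y|?N. \<phi> y)" if t: "test_function W \<phi>" for \<phi>
    proof -
      obtain K where K: "compact K" "K \<subseteq> W" "\<And>x. x \<notin> K \<Longrightarrow> \<phi> x = 0" using test_functionE[OF t] by metis
      obtain k where k: "\<And>x. x \<in> K \<Longrightarrow> (\<Sum>n<k. \<eta> n x) = 1" "\<forall>x\<in>K. \<forall>n\<ge>k. \<eta> n x = 0" using fin[OF K(1,2)] by blast
      have tn: "test_function (V (c n)) (\<lambda>x. \<eta> n x * \<phi> x)" for n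
        by (rule test_functionI[OF Ck_on_mult[OF open_UNIV \<eta>C test_functionD(3)[OF t]] compact_cube r(2)[OF cW]])
           (simp add: \<eta>out)
      have "\<phi> = (\<lambda>x. \<Sum>n<k. \<eta> n x * \<phi> x)"
      proof
        fix x show "\<phi> x = (\<Sum>n<k. \<eta> n x * \<phi> x)"
          using k(1)[of x] K(3)[of x] by (cases "x \<in> K") (auto simp: sum_distrib_right[symmetric])
      qed
      then have "\<Lambda> \<phi> = \<Lambda> (\<lambda>x. \<Sum>n<k. \<eta> n x * \<phi> x)" by simp
      also have "\<dots> = (\<Sum>n<k. \<Lambda> (\<lambda>x. \<eta> n x * \<phi> x))"
        by (rule \<Lambda>sum) (auto intro: test_function_subset[OF tn V(3)[OF cW]])
      also have "\<dots> = (\<Sum>n<k. (LINT y|P (c n). \<eta> n y * \<phi> y) - (LINT y|N (c n). \<eta> n y * \<phi> y))"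
        by (intro sum.cong refl rep cW tn)
      also have "\<dots> = (LINT y|?P. \<phi> y) - (LINT y|?N. \<phi> y)"
      proof -
        have c: "test_function W \<phi> \<and> (\<forall>x. x \<notin> K \<longrightarrow> \<phi> x = 0) \<and> (\<forall>x\<in>K. \<forall>n\<ge>k. \<eta> n x = 0)"
          using t K(3) k(2) by blast
        have "(LINT y|?P. \<phi> y) = (\<Sum>n<k. LINT y|P (c n). \<eta> n y * \<phi> y)"
          by (rule glue[OF sP fP, THEN conjunct2, rule_format, OF _ _ c])
        moreover have "(LINT y|?N. \<phi> y) = (\<Sum>n<k. LINT y|N (c n). \<eta> n y * \<phi> y)"
          by (rule glue[OF sN fN, THEN conjunct2, rule_format, OF _ _ c])
        ultimately show ?thesis by (simp only: sum_subtractf)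
      qed
      finally show ?thesis .
    qed
    moreover have "radon_measure_on W ?P" by (rule glue[OF sP fP, THEN conjunct1])
    moreover have "radon_measure_on W ?N" by (rule glue[OF sN fN, THEN conjunct1])
    ultimately show ?thesis by blast
  qed
qed

text \<open>Local hypotheses are given on Lipschitz domains, and discs are enough to exploit them.
  In the frame of tangent and inward normal at a boundary point, a disc lies above the arc R -
  sqrt(R^2 - s^2).\<close>

lemma bounded_lipschitz_domain_ball:
  assumes R: "R > 0" shows "bounded_lipschitz_domain (ball c R)"
  unfolding bounded_lipschitz_domain_def
proof (intro conjI ballI)
  show "planar_domain (ball c R)" using R by (auto simp: planar_domain_def)
  show "bounded (ball c R)" by simp
  fix p assume "p \<in> frontier (ball c R)"
  then have p: "norm (c - p) = R" using R by (simp add: dist_norm)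
  define n where "n = (c - p) /\<^sub>R R"
  define e where "e = pt (- (n $ 2)) (n $ 1)"
  have nn: "norm n = 1" using p R by (simp add: n_def)
  have n2: "(n $ 1)\<^sup>2 + (n $ 2)\<^sup>2 = 1"
    using nn by (simp add: norm_eq_1 inner_plane power2_eq_square)
  have ee: "norm e = 1" using n2 by (simp add: norm_eq_1 inner_plane e_def power2_eq_square)
  have en: "e \<bullet> n = 0" by (simp add: inner_plane e_def)
  define m where "m s = min R \<bar>s\<bar> / 2 + min R \<bar>s\<bar> / 2" for s :: real
  \<comment> \<open>The argument is clamped at R / 2, where the root is still at least R / 2, to
    obtain a globally Lipschitz function. Within distance R / 2 of \<open>p\<close> the clamp is
    inactive.\<close>
  define \<gamma> where "\<gamma> s = R - sqrt (R\<^sup>2 - (min (R / 2) \<bar>s\<bar>)\<^sup>2)" for s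
  have lip: "2-lipschitz_on UNIV \<gamma>"
  proof (rule lipschitz_onI)
    fix s t :: real
    let ?s = "min (R / 2) \<bar>s\<bar>" let ?t = "min (R / 2) \<bar>t\<bar>"
    have b: "0 \<le> ?s" "?s \<le> R / 2" "0 \<le> ?t" "?t \<le> R / 2" using R by auto
    have low: "R / 2 \<le> sqrt (R\<^sup>2 - x\<^sup>2)" if "0 \<le> x" "x \<le> R / 2" for x
    proof (rule real_le_rsqrt)
      have "x\<^sup>2 \<le> (R / 2)\<^sup>2" using that by (intro power_mono) auto
      then have "x\<^sup>2 \<le> R\<^sup>2 / 4" by (simp add: power_divide)
      moreover have "(R / 2)\<^sup>2 = R\<^sup>2 / 4" by (simp add: power_divide)
      ultimately show "(R / 2)\<^sup>2 \<le> R\<^sup>2 - x\<^sup>2" using zero_le_power2[of R] by linarith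
    qed
    have nn: "0 \<le> R\<^sup>2 - x\<^sup>2" if "0 \<le> x" "x \<le> R / 2" for x
      using power_mono[of x R 2] that R by auto
    let ?a = "sqrt (R\<^sup>2 - ?s\<^sup>2)" let ?b = "sqrt (R\<^sup>2 - ?t\<^sup>2)"
    have "(?a - ?b) * (?a + ?b) = (?t - ?s) * (?t + ?s)"
      using nn[OF b(1,2)] nn[OF b(3,4)] by (simp add: algebra_simps power2_eq_square[symmetric])
    then have "\<bar>?a - ?b\<bar> * \<bar>?a + ?b\<bar> = \<bar>?t - ?s\<bar> * \<bar>?t + ?s\<bar>"
      by (simp only: abs_mult[symmetric])
    moreover have "0 \<le> ?a + ?b" "0 \<le> ?t + ?s" using low[OF b(1,2)] low[OF b(3,4)] b R by linarith+
    ultimately have "\<bar>?a - ?b\<bar> * (?a + ?b) = \<bar>?t - ?s\<bar> * (?t + ?s)"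
      by (simp only: abs_of_nonneg)
    moreover have "\<bar>?a - ?b\<bar> * R \<le> \<bar>?a - ?b\<bar> * (?a + ?b)"
      using low[OF b(1,2)] low[OF b(3,4)] by (intro mult_left_mono) auto
    moreover have "\<bar>?t - ?s\<bar> * (?t + ?s) \<le> \<bar>?t - ?s\<bar> * R"
      using b by (intro mult_left_mono) auto
    ultimately have "\<bar>?a - ?b\<bar> * R \<le> \<bar>?t - ?s\<bar> * R" by linarith
    then have "\<bar>?a - ?b\<bar> \<le> \<bar>?t - ?s\<bar>" using R by (rule mult_right_le_imp_le)
    also have "\<dots> \<le> \<bar>t - s\<bar>" by (auto simp: min_def abs_if)
    finally have le: "\<bar>?a - ?b\<bar> \<le> \<bar>t - s\<bar>" .
    have "dist (\<gamma> s) (\<gamma> t) = \<bar>?a - ?b\<bar>" unfolding \<gamma>_def dist_real_def by (simp add: abs_minus_commute)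
    moreover have "\<bar>t - s\<bar> \<le> 2 * dist s t" unfolding dist_real_def by (simp add: abs_minus_commute)
    ultimately show "dist (\<gamma> s) (\<gamma> t) \<le> 2 * dist s t" using le by linarith
  qed simp
  have eq: "y \<in> ball c R \<longleftrightarrow> \<gamma> ((y - p) \<bullet> e) < (y - p) \<bullet> n" if y: "y \<in> ball p (R / 2)" for y
  proof -
    let ?w = "y - p" let ?s = "(y - p) \<bullet> e" let ?t = "(y - p) \<bullet> n"
    have w: "norm ?w < R / 2" using y by (simp add: dist_norm norm_minus_commute)
    have sw: "\<bar>?s\<bar> \<le> norm ?w" "\<bar>?t\<bar> \<le> norm ?w"
      using Cauchy_Schwarz_ineq2[of ?w e] Cauchy_Schwarz_ineq2[of ?w n] ee nn by auto
    have "?s\<^sup>2 + ?t\<^sup>2 = ((?w $ 1)\<^sup>2 + (?w $ 2)\<^sup>2) * ((n $ 1)\<^sup>2 + (n $ 2)\<^sup>2)"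
      by (simp add: inner_plane e_def power2_eq_square algebra_simps)
    then have norm_w: "?s\<^sup>2 + ?t\<^sup>2 = (norm ?w)\<^sup>2"
    proof -
      assume "?s\<^sup>2 + ?t\<^sup>2 = ((?w $ 1)\<^sup>2 + (?w $ 2)\<^sup>2) * ((n $ 1)\<^sup>2 + (n $ 2)\<^sup>2)"
      moreover have "(norm ?w)\<^sup>2 = (?w $ 1)\<^sup>2 + (?w $ 2)\<^sup>2"
        unfolding power2_norm_eq_inner by (simp only: inner_plane power2_eq_square)
      ultimately show ?thesis unfolding n2 by (simp only: mult_1_right)
    qed
    have cp: "c - p = R *\<^sub>R n" using R by (simp add: n_def)
    have "y - c = ?w - R *\<^sub>R n" using cp by (simp add: algebra_simps)
    then have "(norm (y - c))\<^sup>2 = (norm ?w)\<^sup>2 - 2 * R * ?t + R\<^sup>2"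
    proof -
      assume yc: "y - c = ?w - R *\<^sub>R n"
      have gen: "(a - R *\<^sub>R b) \<bullet> (a - R *\<^sub>R b) = a \<bullet> a - 2 * R * (a \<bullet> b) + R\<^sup>2 * (b \<bullet> b)" for a b :: plane
        by (simp add: inner_plane algebra_simps power2_eq_square)
      have "n \<bullet> n = 1" using nn by (simp add: norm_eq_1)
      then show ?thesis
        unfolding power2_norm_eq_inner yc gen by (simp only: mult_1_right)
    qed
    then have "(norm (y - c))\<^sup>2 = ?s\<^sup>2 + (R - ?t)\<^sup>2"
      unfolding norm_w[symmetric] by (simp add: power2_eq_square algebra_simps)
    moreover have "y \<in> ball c R \<longleftrightarrow> (norm (y - c))\<^sup>2 < R\<^sup>2"
      using R by (metis abs_of_nonneg dist_commute dist_norm less_imp_le mem_ball norm_ge_zero power_less_imp_less_base power_strict_mono zero_less_numeral)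
    ultimately have "y \<in> ball c R \<longleftrightarrow> (R - ?t)\<^sup>2 < R\<^sup>2 - ?s\<^sup>2" by linarith
    also have "\<dots> \<longleftrightarrow> R - ?t < sqrt (R\<^sup>2 - ?s\<^sup>2)"
    proof -
      have "R - ?t > 0" using sw w R by linarith
      then show ?thesis
        by (metis less_imp_le real_less_rsqrt real_sqrt_abs abs_of_pos real_sqrt_less_iff)
    qed
    also have "\<dots> \<longleftrightarrow> \<gamma> ?s < ?t"
    proof -
      have "min (R / 2) \<bar>?s\<bar> = \<bar>?s\<bar>" using sw w by linarith
      then show ?thesis by (auto simp: \<gamma>_def)
    qed
    finally show ?thesis .
  qed
  have loc: "ball c R \<inter> ball p (R / 2) = {y \<in> ball p (R / 2). \<gamma> ((y - p) \<bullet> e) < (y - p) \<bullet> n}"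
    using eq by blast
  have "0 < R / 2" using R by simp
  then show "\<exists>e n r L. \<exists>\<gamma> :: real \<Rightarrow> real. norm e = 1 \<and> norm n = 1 \<and> e \<bullet> n = 0 \<and> r > 0 \<and> L-lipschitz_on UNIV \<gamma> \<and>
      ball c R \<inter> ball p r = {y \<in> ball p r. \<gamma> ((y - p) \<bullet> e) < (y - p) \<bullet> n}"
    by (intro exI[of _ e] exI[of _ n] exI[of _ "R / 2"] exI[of _ 2] exI[of _ \<gamma>] conjI ee nn en lip loc)
qed

text \<open>A single entry of \<open>hessian_measure\<close>, so that entries can be represented,
  glued and exchanged independently; the integral is taken against \<open>lborel\<close>, where
  integration by parts is available.\<close>

definition hessian_rep :: "plane set \<Rightarrow> (plane \<Rightarrow> real) \<Rightarrow> 2 \<Rightarrow> 2 \<Rightarrow> plane measure \<Rightarrow> plane measure \<Rightarrow> bool" where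
  "hessian_rep W h i j P N \<longleftrightarrow> radon_measure_on W P \<and> radon_measure_on W N \<and>
     (\<forall>\<phi>. test_function W \<phi> \<longrightarrow> (LINT x|lborel. h x * pd i (pd j \<phi>) x) = (LINT x|P. \<phi> x) - (LINT x|N. \<phi> x))"

lemma integrable_times_test_function:
  assumes "open W" "continuous_on W h" "test_function W \<phi>"
  shows "continuous_on UNIV (\<lambda>x. h x * \<phi> x)" "integrable lborel (\<lambda>x. h x * \<phi> x)"
    "(\<lambda>x. h x * \<phi> x) \<in> borel_measurable borel"
proof -
  obtain K where K: "compact K" "K \<subseteq> W" "\<And>x. x \<notin> K \<Longrightarrow> \<phi> x = 0" using test_functionE[OF assms(3)] by metis
  show c: "continuous_on UNIV (\<lambda>x. h x * \<phi> x)"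
    by (rule continuous_on_extend_0[OF assms(1,2) test_functionD(1)[OF assms(3)] K])
  show "integrable lborel (\<lambda>x. h x * \<phi> x)"
    by (rule integrable_continuous_compact[OF c K(1)]) (simp add: K(3))
  show "(\<lambda>x. h x * \<phi> x) \<in> borel_measurable borel" by (rule continuous_imp_borel_measurable[OF c])
qed

lemma set_integral_times_test_function:
  assumes "open W" "continuous_on W h" "test_function W \<phi>"
  shows "(LINT x:W|lebesgue. h x * \<phi> x) = (LINT x|lborel. h x * \<phi> x)"
proof (rule set_integral_lebesgue_eq_lborel[OF integrable_times_test_function(3)[OF assms]])
  show "h x * \<phi> x = 0" if "x \<notin> W" for x using that assms(3) by (auto elim!: test_functionE)
qed

lemma pd_test_add:
  assumes "test_function W \<phi>" "test_function W \<psi>"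
  shows "pd i (pd j (\<lambda>x. \<phi> x + \<psi> x)) x = pd i (pd j \<phi>) x + pd i (pd j \<psi>) x"
proof -
  have d: "\<phi> differentiable (at x)" "pd j \<phi> differentiable (at x)" "\<psi> differentiable (at x)" "pd j \<psi> differentiable (at x)" for x
    using test_functionD(3)[OF assms(1), of 2] test_functionD(3)[OF assms(2), of 2] by (auto simp: numeral_2_eq_2)
  have "pd j (\<lambda>x. \<phi> x + \<psi> x) = (\<lambda>x. pd j \<phi> x + pd j \<psi> x)" using pd_add d by blast
  then show ?thesis by (simp add: pd_add[OF d(2,4)])
qed

lemma glue_hessian:
  assumes W: "open W" and h: "continuous_on W h"
    and loc: "\<And>x. x \<in> W \<Longrightarrow> \<exists>V P N. open V \<and> x \<in> V \<and> V \<subseteq> W \<and> sets P = sets borel \<and> sets N = sets borel \<and>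
       finite_measure P \<and> finite_measure N \<and>
       (\<forall>\<phi>. test_function V \<phi> \<longrightarrow> (LINT x|lborel. h x * pd i (pd j \<phi>) x) = (LINT y|P. \<phi> y) - (LINT y|N. \<phi> y))"
  shows "\<exists>P N. hessian_rep W h i j P N"
  unfolding hessian_rep_def
proof (rule glue_local_measures[OF W _ loc])
  fix \<phi> \<psi> assume t: "test_function W \<phi>" "test_function W \<psi>"
  have "integrable lborel (\<lambda>x. h x * pd i (pd j \<phi>) x)" "integrable lborel (\<lambda>x. h x * pd i (pd j \<psi>) x)"
    using t by (auto intro!: integrable_times_test_function(2)[OF W h] test_function_pd)
  then show "(LINT x|lborel. h x * pd i (pd j (\<lambda>x. \<phi> x + \<psi> x)) x)
      = (LINT x|lborel. h x * pd i (pd j \<phi>) x) + (LINT x|lborel. h x * pd i (pd j \<psi>) x)"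
    by (simp add: pd_test_add[OF t] distrib_left)
qed

text \<open>\<open>BV2\<close> on small discs supplies finite measures that depend on the disc;
  glueing produces one pair of Radon measures on all of \<open>U\<close>.\<close>

lemma locally_BV2_hessian_rep:
  assumes U: "open U" and h: "continuous_on U h" and BV: "locally_in BV2 U h"
  shows "\<exists>P N. hessian_rep U h i j P N"
proof (rule glue_hessian[OF U h])
  fix x assume "x \<in> U"
  then obtain e where e: "e > 0" "cball x e \<subseteq> U" using U open_contains_cball by blast
  have "BV2 (ball x e) h"
    using BV bounded_lipschitz_domain_ball[OF e(1)] e unfolding locally_in_def by auto
  then obtain P N where PN: "hessian_measure (ball x e) h P N" "\<And>i j. finite_measure (P i j) \<and> finite_measure (N i j)"
    unfolding BV2_def by blast
  have hV: "continuous_on (ball x e) h" using h e(2) ball_subset_cball by (meson continuous_on_subset order_trans)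
  have "(LINT x|lborel. h x * pd i (pd j \<phi>) x) = (LINT y|P i j. \<phi> y) - (LINT y|N i j. \<phi> y)"
    if "test_function (ball x e) \<phi>" for \<phi>
  proof -
    have "(LINT x:ball x e|lebesgue. h x * pd i (pd j \<phi>) x) = (LINT y|P i j. \<phi> y) - (LINT y|N i j. \<phi> y)"
      using PN(1) that unfolding hessian_measure_def by blast
    then show ?thesis
      unfolding set_integral_times_test_function[OF open_ball hV test_function_pd[OF test_function_pd[OF that]]] .
  qed
  then show "\<exists>V P N. open V \<and> x \<in> V \<and> V \<subseteq> U \<and> sets P = sets borel \<and> sets N = sets borel \<and>
       finite_measure P \<and> finite_measure N \<and>
       (\<forall>\<phi>. test_function V \<phi> \<longrightarrow> (LINT x|lborel. h x * pd i (pd j \<phi>) x) = (LINT y|P. \<phi> y) - (LINT y|N. \<phi> y))"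
    using PN e ball_subset_cball[of x e] unfolding hessian_measure_def radon_measure_on_def
    by (intro exI[of _ "ball x e"] exI[of _ "P i j"] exI[of _ "N i j"]) auto
qed

text \<open>For C^1 functions one integration by parts moves the outer derivative to
  \<open>h\<close>. Its sign is already built into \<open>weak_pd\<close>, so the same measures
  represent both.\<close>

lemma hessian_rep_iff_weak_pd:
  assumes W: "open W" and h: "Ck_on 1 W h"
  shows "hessian_rep W h i j P N \<longleftrightarrow> weak_pd j W (pd i h) P N"
proof -
  have "(LINT x|lborel. h x * pd i (pd j \<phi>) x) = - (LINT x|lborel. pd i h x * pd j \<phi> x)" if t: "test_function W \<phi>" for \<phi>
  proof -
    note t' = test_function_pd[OF t, of j]
    obtain K where K: "compact K" "K \<subseteq> W" "\<And>x. x \<notin> K \<Longrightarrow> pd j \<phi> x = 0" using test_functionE[OF t'] by metis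
    show ?thesis
      by (rule integral_by_parts[OF W h Ck_on_subset[OF test_functionD(3)[OF t']] K]) auto
  qed
  then show ?thesis unfolding hessian_rep_def weak_pd_def by (auto simp: algebra_simps)
qed

text \<open>Inherited from the equality of mixed partials of test functions. It later allows one
  pair of measures to serve both mixed entries, which makes the mean Hessian literally
  symmetric.\<close>

lemma hessian_rep_commute:
  assumes "hessian_rep W h i j P N" shows "hessian_rep W h j i P N"
  unfolding hessian_rep_def
proof (intro conjI allI impI)
  fix \<phi> assume t: "test_function W \<phi>"
  have eq: "pd j (pd i \<phi>) = pd i (pd j \<phi>)"
    using pd_commute[OF test_functionD(3)[OF t]] by blast
  show "(LINT x|lborel. h x * pd j (pd i \<phi>) x) = (LINT x|P. \<phi> x) - (LINT x|N. \<phi> x)"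
    unfolding eq using assms t unfolding hessian_rep_def by blast
qed (use assms in \<open>auto simp: hessian_rep_def\<close>)

text \<open>Sigma-finiteness is shown simultaneously for \<open>M\<close> and Lebesgue measure:
  inside \<open>W\<close> by countably many discs with closure in \<open>W\<close>, outside, where
  \<open>M\<close> has no mass, by intersecting with large squares.\<close>

lemma radon_ac_density_exists:
  assumes W: "open W" and M: "radon_measure_on W M"
  shows "\<exists>p. ac_density M p"
proof -
  have sM: "sets M = sets borel" using M by (simp add: radon_measure_on_def)
  have sp: "space M = UNIV" using sets_eq_imp_space_eq[OF sM] by simp
  have "\<exists>F. countable F \<and> F \<subseteq> sets borel \<and> \<Union>F = UNIV \<and> (\<forall>A\<in>F. emeasure M A < \<infinity> \<and> emeasure lborel A < \<infinity>)"
  proof -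
    let ?F = "{ball x e | x e. cball x e \<subseteq> W}"
    obtain F where F: "F \<subseteq> ?F" "countable F" "\<Union>F = \<Union>?F" using Lindelof[of ?F] by auto
    have cov: "\<Union>F = W"
    proof
      show "\<Union>F \<subseteq> W" using F(1) ball_subset_cball by blast
      show "W \<subseteq> \<Union>F"
      proof
        fix x assume "x \<in> W"
        then obtain e where "e > 0" "cball x e \<subseteq> W" using W open_contains_cball by blast
        then show "x \<in> \<Union>F" unfolding F(3) by (auto intro!: exI[of _ "ball x e"])
      qed
    qed
    have A: "emeasure M A < \<infinity> \<and> emeasure lborel A < \<infinity>" if "A \<in> F" for A
    proof -
      obtain x e where x: "A = ball x e" "cball x e \<subseteq> W" using F(1) \<open>A \<in> F\<close> by blast
      have "emeasure M A \<le> emeasure M (cball x e)" using x sM by (intro emeasure_mono) auto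
      also have "\<dots> < \<infinity>" using M x unfolding radon_measure_on_def by auto
      finally show ?thesis using x emeasure_bounded_finite[OF bounded_ball, of x e] by simp
    qed
    let ?G = "range (\<lambda>n::nat. (- W) \<inter> cube 0 (real n))"
    have G: "\<Union>?G = - W"
    proof -
      have "\<exists>n::nat. x \<in> cube 0 (real n)" for x :: plane
      proof -
        obtain n :: nat where "norm x \<le> n" using real_arch_simple by blast
        then show ?thesis using cball_subset_cube[of 0 "real n"] by auto
      qed
      then show ?thesis by auto
    qed
    have "emeasure M B < \<infinity> \<and> emeasure lborel B < \<infinity>" if "B \<in> ?G" for B
    proof -
      obtain n :: nat where n: "B = (- W) \<inter> cube 0 (real n)" using \<open>B \<in> ?G\<close> by blast
      have "emeasure M B \<le> emeasure M (- W)" using n sM W by (intro emeasure_mono) auto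
      then have "emeasure M B = 0" using M by (simp add: radon_measure_on_def)
      moreover have "bounded B" using n by (auto intro: bounded_subset compact_imp_bounded)
      ultimately show ?thesis using emeasure_bounded_finite[of B] by simp
    qed
    moreover have "?G \<subseteq> sets borel" using W by auto
    moreover have "F \<subseteq> sets borel" using F(1) by auto
    ultimately show ?thesis
      using A F(2) G cov by (intro exI[of _ "F \<union> ?G"]) auto
  qed
  then obtain F where F: "countable F" "F \<subseteq> sets borel" "\<Union>F = UNIV" "\<And>A. A \<in> F \<Longrightarrow> emeasure M A < \<infinity> \<and> emeasure lborel A < \<infinity>"
    by metis
  have "emeasure (add_measure lborel M) A \<noteq> \<infinity>" if "A \<in> F" for A
    using F(2) F(4)[OF that] that sM by (subst emeasure_add_measure) (auto simp: less_top)
  moreover have "emeasure M A \<noteq> \<infinity>" if "A \<in> F" for A using F(4)[OF that] by auto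
  ultimately have "sigma_finite_measure (add_measure lborel M)" "sigma_finite_measure M"
    using F(1-3) sM sp by (auto intro!: sigma_finite_measure.intro exI[of _ F])
  then show ?thesis by (rule ac_density_exists[OF sM])
qed

section \<open>Products of continuous functions of bounded variation\<close>

definition C0_cube :: "plane \<Rightarrow> real \<Rightarrow> (plane \<Rightarrow> real) \<Rightarrow> bool" where
  "C0_cube c s \<eta> \<longleftrightarrow> continuous_on UNIV \<eta> \<and> (\<forall>x. x \<notin> cube c s \<longrightarrow> \<eta> x = 0)"

text \<open>The functional is a finite signed measure. Continuous test functions are used instead of
  smooth ones, so that multiplying the test function by a continuous factor stays within the
  class.\<close>

definition signed_rep :: "plane \<Rightarrow> real \<Rightarrow> ((plane \<Rightarrow> real) \<Rightarrow> real) \<Rightarrow> bool" where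
  "signed_rep c s T \<longleftrightarrow> (\<exists>P N. sets P = sets borel \<and> sets N = sets borel \<and> finite_measure P \<and> finite_measure N \<and>
     (\<forall>\<eta>. C0_cube c s \<eta> \<longrightarrow> T \<eta> = (LINT x|P. \<eta> x) - (LINT x|N. \<eta> x)))"

lemma signed_repE:
  assumes "signed_rep c s T"
  obtains P N where "sets P = sets borel" "sets N = sets borel" "finite_measure P" "finite_measure N"
    "\<And>\<eta>. C0_cube c s \<eta> \<Longrightarrow> T \<eta> = (LINT x|P. \<eta> x) - (LINT x|N. \<eta> x)"
  using assms unfolding signed_rep_def by (elim exE conjE) (assumption | rule that | erule allE, erule mp)+

lemma integrable_C0:
  assumes "sets M = sets borel" "finite_measure M" "C0_cube c s \<eta>"
  shows "integrable M \<eta>"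
proof -
  have "emeasure M (cube c s) < \<infinity>"
    using finite_measure.emeasure_finite[OF assms(2)] by (simp add: less_top)
  then show ?thesis
    using assms unfolding C0_cube_def by (intro integrable_compact_support[of M \<eta> "cube c s"]) auto
qed

lemma C0_bounded:
  assumes "C0_cube c s \<eta>" obtains S where "S > 0" "\<And>x. \<bar>\<eta> x\<bar> \<le> S"
proof -
  have "continuous_on (cube c s) \<eta>"
    using assms continuous_on_subset unfolding C0_cube_def by blast
  then have cpt: "compact (\<eta> ` cube c s)" by (rule compact_continuous_image) simp
  obtain B where B: "\<forall>y\<in>\<eta> ` cube c s. norm y \<le> B"
    using compact_imp_bounded[OF cpt] unfolding bounded_iff ..
  have "\<bar>\<eta> x\<bar> \<le> \<bar>B\<bar> + 1" for x
  proof (cases "x \<in> cube c s")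
    case True then show ?thesis using B[rule_format, OF imageI[OF True]] by simp
  next
    case False then show ?thesis using assms by (simp add: C0_cube_def)
  qed
  then show thesis by (intro that[of "\<bar>B\<bar> + 1"]) auto
qed

lemma continuous_on_cube_bounded:
  fixes h :: "plane \<Rightarrow> real"
  assumes "continuous_on (cube c s) h" obtains B where "B > 0" "\<And>x. x \<in> cube c s \<Longrightarrow> \<bar>h x\<bar> \<le> B"
proof -
  have cpt: "compact (h ` cube c s)" by (rule compact_continuous_image[OF assms]) simp
  obtain B where B: "\<forall>y\<in>h ` cube c s. norm y \<le> B"
    using compact_imp_bounded[OF cpt] unfolding bounded_iff ..
  have "\<bar>h x\<bar> \<le> \<bar>B\<bar> + 1" if "x \<in> cube c s" for x
    using B[rule_format, OF imageI[OF that]] by simp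
  then show thesis by (intro that[of "\<bar>B\<bar> + 1"]) auto
qed

lemma C0_mult:
  assumes "open W" "continuous_on W h" "cube c s \<subseteq> W" "C0_cube c s \<eta>"
  shows "C0_cube c s (\<lambda>x. h x * \<eta> x)"
  using assms continuous_on_extend_0[OF assms(1,2), of \<eta> "cube c s"] unfolding C0_cube_def by simp

lemma signed_rep_add:
  assumes "signed_rep c s T" "signed_rep c s S" shows "signed_rep c s (\<lambda>\<eta>. T \<eta> + S \<eta>)"
proof -
  obtain P N where PN: "sets P = sets borel" "sets N = sets borel" "finite_measure P" "finite_measure N"
    "\<And>\<eta>. C0_cube c s \<eta> \<Longrightarrow> T \<eta> = (LINT x|P. \<eta> x) - (LINT x|N. \<eta> x)"
    by (rule signed_repE[OF assms(1)]) blast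
  obtain P' N' where PN': "sets P' = sets borel" "sets N' = sets borel" "finite_measure P'" "finite_measure N'"
    "\<And>\<eta>. C0_cube c s \<eta> \<Longrightarrow> S \<eta> = (LINT x|P'. \<eta> x) - (LINT x|N'. \<eta> x)"
    by (rule signed_repE[OF assms(2)]) blast
  have "T \<eta> + S \<eta> = (LINT x|add_measure P P'. \<eta> x) - (LINT x|add_measure N N'. \<eta> x)" if e: "C0_cube c s \<eta>" for \<eta>
    using PN PN' e by (simp add: integrable_add_measure integrable_C0)
  moreover have "finite_measure (add_measure P P')" "finite_measure (add_measure N N')"
    using PN PN' by (auto intro: finite_measure_add_measure)
  ultimately show ?thesis unfolding signed_rep_def
    by (intro exI[of _ "add_measure P P'"] exI[of _ "add_measure N N'"] conjI allI impI sets_add_measure)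
qed

lemma signed_rep_0: "signed_rep c s (\<lambda>\<eta>. 0)"
  unfolding signed_rep_def
  by (intro exI[of _ "null_measure borel"]) (auto intro!: finite_measureI)

lemma finite_measure_density_bounded:
  fixes f :: "plane \<Rightarrow> real"
  assumes "sets M = sets borel" "finite_measure M" "f \<in> borel_measurable borel" "\<And>x. f x \<le> B"
  shows "finite_measure (density M (\<lambda>x. ennreal (f x)))"
proof (rule finite_measureI)
  have f: "(\<lambda>x. ennreal (f x)) \<in> borel_measurable M"
    by (rule borel_measurable_transfer[OF assms(1)]) (use assms(3) in auto)
  have "emeasure (density M (\<lambda>x. ennreal (f x))) (space M) = (\<integral>\<^sup>+x. ennreal (f x) * indicator (space M) x \<partial>M)"
    by (rule emeasure_density[OF f sets.top])
  also have "\<dots> \<le> (\<integral>\<^sup>+x. ennreal B \<partial>M)"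
    using assms(4) by (intro nn_integral_mono) (auto intro: ennreal_leI)
  also have "\<dots> < \<infinity>"
    using finite_measure.emeasure_finite[OF assms(2)] by (simp add: ennreal_mult_less_top less_top)
  finally show "emeasure (density M (\<lambda>x. ennreal (f x))) (space (density M (\<lambda>x. ennreal (f x)))) \<noteq> \<infinity>"
    by simp
qed

lemma signed_rep_mult:
  assumes T: "signed_rep c s T" and W: "open W" "continuous_on W h" "cube c s \<subseteq> W"
  shows "signed_rep c s (\<lambda>\<eta>. T (\<lambda>x. h x * \<eta> x))"
proof -
  obtain P N where PN: "sets P = sets borel" "sets N = sets borel" "finite_measure P" "finite_measure N"
    "\<And>\<eta>. C0_cube c s \<eta> \<Longrightarrow> T \<eta> = (LINT x|P. \<eta> x) - (LINT x|N. \<eta> x)"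
    by (rule signed_repE[OF T]) blast
  have hR: "continuous_on (cube c s) h" by (rule continuous_on_subset[OF W(2,3)])
  obtain B where B: "B > 0" "\<And>x. x \<in> cube c s \<Longrightarrow> \<bar>h x\<bar> \<le> B" using continuous_on_cube_bounded[OF hR] by blast
  \<comment> \<open>Cutting \<open>h\<close> off outside the square makes it bounded and Borel
    measurable; test functions vanish there anyway.\<close>
  define k where "k x = indicator (cube c s) x *\<^sub>R h x" for x
  have km [measurable]: "k \<in> borel_measurable borel"
    unfolding k_def[abs_def] by (rule borel_measurable_continuous_on_indicator[OF borel_cube hR])
  have kB: "\<bar>k x\<bar> \<le> B" for x using B by (auto simp: k_def indicator_def)
  define p where "p x = max 0 (k x)" for x
  define n where "n x = max 0 (- k x)" for x
  have pn [measurable]: "p \<in> borel_measurable borel" "n \<in> borel_measurable borel"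
    unfolding p_def[abs_def] n_def[abs_def] by measurable
  have pn0: "0 \<le> p x" "0 \<le> n x" "p x - n x = k x" "p x \<le> B" "n x \<le> B" for x
    using kB[of x] by (auto simp: p_def n_def)
  let ?D = "\<lambda>M f. density M (\<lambda>x. ennreal (f x))"
  have fin: "finite_measure (?D P p)" "finite_measure (?D P n)" "finite_measure (?D N p)" "finite_measure (?D N n)"
    using PN pn0 by (auto intro!: finite_measure_density_bounded[where B=B])
  have int: "integrable M (\<lambda>x. f x * \<eta> x)" "(LINT x|?D M f. \<eta> x) = (LINT x|M. f x * \<eta> x)"
    if M: "sets M = sets borel" "finite_measure (?D M f)" and f: "f \<in> borel_measurable borel" "\<And>x. 0 \<le> f x"
      and e: "C0_cube c s \<eta>" for M f \<eta>
  proof -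
    have fM: "f \<in> borel_measurable M" by (rule borel_measurable_transfer[OF M(1) f(1)])
    have eM: "\<eta> \<in> borel_measurable M"
      by (rule borel_measurable_transfer[OF M(1) continuous_imp_borel_measurable]) (use e in \<open>auto simp: C0_cube_def\<close>)
    have "integrable (?D M f) \<eta>" by (rule integrable_C0[OF _ M(2) e]) (simp add: M(1))
    then show "integrable M (\<lambda>x. f x * \<eta> x)"
      using integrable_density[OF eM fM] f(2) by simp
    show "(LINT x|?D M f. \<eta> x) = (LINT x|M. f x * \<eta> x)"
      using integral_density[OF eM fM] f(2) by simp
  qed
  \<comment> \<open>The product (p - n)(P - N) is sorted by sign: pP + nN is positive and nP + pN is
    subtracted.\<close>
  let ?P = "add_measure (?D P p) (?D N n)" and ?N = "add_measure (?D P n) (?D N p)"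
  have "T (\<lambda>x. h x * \<eta> x) = (LINT x|?P. \<eta> x) - (LINT x|?N. \<eta> x)" if e: "C0_cube c s \<eta>" for \<eta>
  proof -
    have heq: "h x * \<eta> x = p x * \<eta> x - n x * \<eta> x" for x
      using e pn0(3)[of x] unfolding left_diff_distrib[symmetric]
      by (cases "x \<in> cube c s") (auto simp: k_def C0_cube_def)
    have s1: "sets (?D M f) = sets borel" if "sets M = sets borel" for M :: "plane measure" and f using that by simp
    have "(LINT x|?P. \<eta> x) = (LINT x|?D P p. \<eta> x) + (LINT x|?D N n. \<eta> x)"
      by (rule integrable_add_measure(2)[OF s1[OF PN(1)] s1[OF PN(2)] integrable_C0[OF s1[OF PN(1)] fin(1) e] integrable_C0[OF s1[OF PN(2)] fin(4) e]])
    moreover have "(LINT x|?N. \<eta> x) = (LINT x|?D P n. \<eta> x) + (LINT x|?D N p. \<eta> x)"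
      by (rule integrable_add_measure(2)[OF s1[OF PN(1)] s1[OF PN(2)] integrable_C0[OF s1[OF PN(1)] fin(2) e] integrable_C0[OF s1[OF PN(2)] fin(3) e]])
    moreover have "T (\<lambda>x. h x * \<eta> x) = (LINT x|P. h x * \<eta> x) - (LINT x|N. h x * \<eta> x)"
      by (rule PN(5)[OF C0_mult[OF W e]])
    moreover have "(LINT x|P. h x * \<eta> x) = (LINT x|P. p x * \<eta> x) - (LINT x|P. n x * \<eta> x)"
      unfolding heq by (rule Bochner_Integration.integral_diff) (use int(1) PN fin pn pn0 e in auto)
    moreover have "(LINT x|N. h x * \<eta> x) = (LINT x|N. p x * \<eta> x) - (LINT x|N. n x * \<eta> x)"
      unfolding heq by (rule Bochner_Integration.integral_diff) (use int(1) PN fin pn pn0 e in auto)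
    ultimately show ?thesis
      using int(2)[OF PN(1) fin(1) pn(1) pn0(1) e] int(2)[OF PN(1) fin(2) pn(2) pn0(2) e]
        int(2)[OF PN(2) fin(3) pn(1) pn0(1) e] int(2)[OF PN(2) fin(4) pn(2) pn0(2) e] by linarith
  qed
  moreover have "finite_measure ?P" "finite_measure ?N"
    using PN fin by (auto intro!: finite_measure_add_measure)
  ultimately show ?thesis unfolding signed_rep_def
    by (intro exI[of _ ?P] exI[of _ ?N] conjI allI impI sets_add_measure)
qed

text \<open>Continuous functions of bounded variation, given through smooth approximations whose
  gradients converge weakly to measures. This class is closed under algebraic operations.\<close>

definition approx_seq :: "plane \<Rightarrow> real \<Rightarrow> (plane \<Rightarrow> real) \<Rightarrow> (nat \<Rightarrow> plane \<Rightarrow> real) \<Rightarrow> bool" where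
  "approx_seq c s h H \<longleftrightarrow>
     (\<forall>n. \<forall>x\<in>cube c s. H n differentiable (at x)) \<and> (\<forall>n i. continuous_on (cube c s) (pd i (H n))) \<and>
     (\<forall>e>0. \<exists>m. \<forall>n\<ge>m. \<forall>x\<in>cube c s. \<bar>H n x - h x\<bar> \<le> e) \<and>
     (\<exists>C. \<forall>n. \<forall>x\<in>cube c s. \<bar>H n x\<bar> \<le> C) \<and>
     (\<forall>i. \<exists>B. \<forall>n. integral (cube c s) (\<lambda>x. \<bar>pd i (H n) x\<bar>) \<le> B) \<and>
     (\<forall>i. \<exists>T. signed_rep c s T \<and>
        (\<forall>\<eta>. C0_cube c s \<eta> \<longrightarrow> (\<lambda>n. integral (cube c s) (\<lambda>x. \<eta> x * pd i (H n) x)) \<longlonglongrightarrow> T \<eta>))"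

definition BVC :: "plane set \<Rightarrow> plane \<Rightarrow> real \<Rightarrow> (plane \<Rightarrow> real) \<Rightarrow> bool" where
  "BVC W c s h \<longleftrightarrow> open W \<and> cube c s \<subseteq> W \<and> continuous_on W h \<and> (\<exists>H. approx_seq c s h H)"

lemma approx_seqD:
  assumes "approx_seq c s h H"
  shows "x \<in> cube c s \<Longrightarrow> H n differentiable (at x)" "continuous_on (cube c s) (pd i (H n))"
  using assms unfolding approx_seq_def by blast+

lemma approx_seq_continuous: "approx_seq c s h H \<Longrightarrow> continuous_on (cube c s) (H n)"
  unfolding approx_seq_def
  by (intro differentiable_imp_continuous_on differentiable_at_imp_differentiable_on) auto

lemma integral_abs_le:
  fixes f g :: "plane \<Rightarrow> real"
  assumes "continuous_on (cube c s) f" "continuous_on (cube c s) g" "\<And>x. x \<in> cube c s \<Longrightarrow> \<bar>f x\<bar> \<le> g x"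
  shows "\<bar>integral (cube c s) f\<bar> \<le> integral (cube c s) g"
  using integral_norm_bound_integral[OF integrable_on_cube[OF assms(1)] integrable_on_cube[OF assms(2)]] assms(3) by simp

text \<open>A uniformly convergent factor may be replaced by its limit in front of a weakly
  convergent sequence bounded in L^1; the error is at most sup|A_n - a| times sup|\<eta>| times
  \<open>B\<close>.\<close>

lemma weak_limit_times:
  assumes W: "open W" "cube c s \<subseteq> W" and a: "continuous_on W a" and an: "\<And>n. continuous_on (cube c s) (A n)"
    and unif: "\<forall>e>0. \<exists>m. \<forall>n\<ge>m. \<forall>x\<in>cube c s. \<bar>A n x - a x\<bar> \<le> e"
    and G: "\<And>n. continuous_on (cube c s) (G n)" and B: "\<And>n. integral (cube c s) (\<lambda>x. \<bar>G n x\<bar>) \<le> B"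
    and T: "\<And>\<eta>. C0_cube c s \<eta> \<Longrightarrow> (\<lambda>n. integral (cube c s) (\<lambda>x. \<eta> x * G n x)) \<longlonglongrightarrow> T \<eta>"
    and \<eta>: "C0_cube c s \<eta>"
  shows "(\<lambda>n. integral (cube c s) (\<lambda>x. \<eta> x * (A n x * G n x))) \<longlonglongrightarrow> T (\<lambda>x. a x * \<eta> x)"
proof -
  let ?R = "cube c s"
  have aR: "continuous_on ?R a" by (rule continuous_on_subset[OF a W(2)])
  have \<eta>c: "continuous_on ?R \<eta>" using \<eta> continuous_on_subset unfolding C0_cube_def by blast
  obtain S where S: "S > 0" "\<And>x. \<bar>\<eta> x\<bar> \<le> S" using C0_bounded[OF \<eta>] by blast
  have lim: "(\<lambda>n. integral ?R (\<lambda>x. (a x * \<eta> x) * G n x)) \<longlonglongrightarrow> T (\<lambda>x. a x * \<eta> x)"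
    by (rule T[OF C0_mult[OF W(1) a W(2) \<eta>]])
  have "(\<lambda>n. integral ?R (\<lambda>x. \<eta> x * (A n x * G n x)) - integral ?R (\<lambda>x. (a x * \<eta> x) * G n x)) \<longlonglongrightarrow> 0"
  proof (rule LIMSEQ_I)
    fix e :: real assume e: "e > 0"
    have B0: "0 \<le> B" using order_trans[OF integral_nonneg[OF integrable_on_cube] B[of 0]] G by (auto intro!: continuous_intros)
    define d where "d = e / (2 * S * (B + 1))"
    have d: "d > 0" using e S B0 by (simp add: d_def)
    obtain m where m: "\<And>n x. n \<ge> m \<Longrightarrow> x \<in> ?R \<Longrightarrow> \<bar>A n x - a x\<bar> \<le> d" using unif d by meson
    have "norm (integral ?R (\<lambda>x. \<eta> x * (A n x * G n x)) - integral ?R (\<lambda>x. (a x * \<eta> x) * G n x) - 0) < e" if n: "n \<ge> m" for n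
    proof -
      have "integral ?R (\<lambda>x. \<eta> x * (A n x * G n x)) - integral ?R (\<lambda>x. (a x * \<eta> x) * G n x)
          = integral ?R (\<lambda>x. \<eta> x * (A n x * G n x) - (a x * \<eta> x) * G n x)"
        by (rule Henstock_Kurzweil_Integration.integral_diff[symmetric])
           (intro integrable_on_cube continuous_intros \<eta>c an G aR)+
      also have "\<bar>\<dots>\<bar> \<le> integral ?R (\<lambda>x. S * d * \<bar>G n x\<bar>)"
      proof (rule integral_abs_le)
        fix x assume x: "x \<in> ?R"
        have "\<bar>\<eta> x * (A n x * G n x) - (a x * \<eta> x) * G n x\<bar> = \<bar>\<eta> x\<bar> * \<bar>A n x - a x\<bar> * \<bar>G n x\<bar>"
          unfolding abs_mult[symmetric] by (simp add: algebra_simps)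
        also have "\<dots> \<le> S * d * \<bar>G n x\<bar>" using S m[OF n x] by (intro mult_mono) auto
        finally show "\<bar>\<eta> x * (A n x * G n x) - (a x * \<eta> x) * G n x\<bar> \<le> S * d * \<bar>G n x\<bar>" .
      qed (intro continuous_intros \<eta>c an G aR)+
      also have "\<dots> = S * d * integral ?R (\<lambda>x. \<bar>G n x\<bar>)" by simp
      also have "\<dots> \<le> S * d * B" using S d B by (intro mult_left_mono) auto
      also have "S * d = e / (2 * (B + 1))" using S(1) by (simp add: d_def)
      also have "e / (2 * (B + 1)) * B = B / (B + 1) * (e / 2)" using B0 by (simp add: field_simps)
      also have "\<dots> \<le> 1 * (e / 2)" using e B0 by (intro mult_right_mono) auto
      also have "\<dots> < e" using e by simp
      finally show ?thesis by simp
    qed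
    then show "\<exists>m. \<forall>n\<ge>m. norm (integral ?R (\<lambda>x. \<eta> x * (A n x * G n x)) - integral ?R (\<lambda>x. (a x * \<eta> x) * G n x) - 0) < e" by blast
  qed
  from tendsto_add[OF this lim] show ?thesis by simp
qed

lemma BVC_const: "open W \<Longrightarrow> cube c s \<subseteq> W \<Longrightarrow> BVC W c s (\<lambda>x. k)"
proof -
  assume W: "open W" "cube c s \<subseteq> W"
  have pd0: "pd i (\<lambda>x. k) = (\<lambda>x. 0)" for i by (simp add: fun_eq_iff)
  have "approx_seq c s (\<lambda>x. k) (\<lambda>n x. k)"
    unfolding approx_seq_def pd0
  proof (intro conjI allI ballI impI)
    show "\<exists>C. \<forall>n::nat. \<forall>x\<in>cube c s. \<bar>k\<bar> \<le> C" by blast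
    show "\<exists>B. \<forall>n::nat. integral (cube c s) (\<lambda>x. \<bar>0::real\<bar>) \<le> B" by auto
    show "\<exists>T. signed_rep c s T \<and> (\<forall>\<eta>. C0_cube c s \<eta> \<longrightarrow> (\<lambda>n::nat. integral (cube c s) (\<lambda>x. \<eta> x * 0)) \<longlonglongrightarrow> T \<eta>)"
      by (intro exI[of _ "\<lambda>\<eta>. 0"]) (simp add: signed_rep_0)
  qed auto
  then show ?thesis unfolding BVC_def using W by auto
qed

lemma BVC_add:
  assumes "BVC W c s h" "BVC W c s k" shows "BVC W c s (\<lambda>x. h x + k x)"
proof -
  let ?R = "cube c s"
  obtain H where H: "approx_seq c s h H" using assms(1) BVC_def by blast
  obtain K where K: "approx_seq c s k K" using assms(2) BVC_def by blast
  note Hd = H[unfolded approx_seq_def] and Kd = K[unfolded approx_seq_def]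
  have pdc: "continuous_on ?R (pd i (H n))" "continuous_on ?R (pd i (K n))" for i n by (rule approx_seqD(2)[OF H], rule approx_seqD(2)[OF K])
  have pde: "pd i (\<lambda>x. H n x + K n x) x = pd i (H n) x + pd i (K n) x" if "x \<in> ?R" for i n x
    by (intro pd_add approx_seqD(1)[OF H that] approx_seqD(1)[OF K that])
  have "approx_seq c s (\<lambda>x. h x + k x) (\<lambda>n x. H n x + K n x)"
    unfolding approx_seq_def
  proof (intro conjI allI ballI impI)
    show "(\<lambda>x. H n x + K n x) differentiable (at x)" if "x \<in> ?R" for n x by (intro differentiable_add approx_seqD(1)[OF H that] approx_seqD(1)[OF K that])
    show "continuous_on ?R (pd i (\<lambda>x. H n x + K n x))" for n i
      by (rule continuous_on_eq[of _ "\<lambda>x. pd i (H n) x + pd i (K n) x"]) (use pdc pde in \<open>auto intro!: continuous_intros\<close>)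
    show "\<exists>m. \<forall>n\<ge>m. \<forall>x\<in>?R. \<bar>(H n x + K n x) - (h x + k x)\<bar> \<le> e" if e: "e > 0" for e
    proof -
      have "e / 2 > 0" using e by simp
      then obtain m1 where m1: "\<And>n x. n \<ge> m1 \<Longrightarrow> x \<in> ?R \<Longrightarrow> \<bar>H n x - h x\<bar> \<le> e / 2" using Hd by meson
      obtain m2 where m2: "\<And>n x. n \<ge> m2 \<Longrightarrow> x \<in> ?R \<Longrightarrow> \<bar>K n x - k x\<bar> \<le> e / 2" using Kd \<open>e / 2 > 0\<close> by meson
      have "\<bar>(H n x + K n x) - (h x + k x)\<bar> \<le> e" if "n \<ge> max m1 m2" "x \<in> ?R" for n x
        using m1[of n x] m2[of n x] that by linarith
      then show ?thesis by blast
    qed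
    obtain C1 C2 where "\<And>n x. x \<in> ?R \<Longrightarrow> \<bar>H n x\<bar> \<le> C1" "\<And>n x. x \<in> ?R \<Longrightarrow> \<bar>K n x\<bar> \<le> C2" using Hd Kd by meson
    then have "\<bar>H n x + K n x\<bar> \<le> C1 + C2" if "x \<in> ?R" for n x using that by (meson abs_triangle_ineq add_mono order_trans)
    then show "\<exists>C. \<forall>n. \<forall>x\<in>?R. \<bar>H n x + K n x\<bar> \<le> C" by blast
    fix i
    obtain B1 B2 where B: "\<And>n. integral ?R (\<lambda>x. \<bar>pd i (H n) x\<bar>) \<le> B1" "\<And>n. integral ?R (\<lambda>x. \<bar>pd i (K n) x\<bar>) \<le> B2" using Hd Kd by meson
    have "integral ?R (\<lambda>x. \<bar>pd i (\<lambda>x. H n x + K n x) x\<bar>) \<le> B1 + B2" for n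
    proof -
      have "integral ?R (\<lambda>x. \<bar>pd i (\<lambda>x. H n x + K n x) x\<bar>) = integral ?R (\<lambda>x. \<bar>pd i (H n) x + pd i (K n) x\<bar>)"
        by (rule Henstock_Kurzweil_Integration.integral_cong) (simp add: pde)
      also have "\<dots> \<le> integral ?R (\<lambda>x. \<bar>pd i (H n) x\<bar> + \<bar>pd i (K n) x\<bar>)"
        by (intro integral_le integrable_on_cube continuous_intros pdc abs_triangle_ineq)
      also have "\<dots> = integral ?R (\<lambda>x. \<bar>pd i (H n) x\<bar>) + integral ?R (\<lambda>x. \<bar>pd i (K n) x\<bar>)"
        by (intro Henstock_Kurzweil_Integration.integral_add integrable_on_cube continuous_intros pdc)
      finally show ?thesis using B[of n] by linarith
    qed
    then show "\<exists>B. \<forall>n. integral ?R (\<lambda>x. \<bar>pd i (\<lambda>x. H n x + K n x) x\<bar>) \<le> B" by blast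
    obtain T where T: "signed_rep c s T" "\<And>\<eta>. C0_cube c s \<eta> \<Longrightarrow> (\<lambda>n. integral ?R (\<lambda>x. \<eta> x * pd i (H n) x)) \<longlonglongrightarrow> T \<eta>" using Hd by meson
    obtain S where S: "signed_rep c s S" "\<And>\<eta>. C0_cube c s \<eta> \<Longrightarrow> (\<lambda>n. integral ?R (\<lambda>x. \<eta> x * pd i (K n) x)) \<longlonglongrightarrow> S \<eta>" using Kd by meson
    have "(\<lambda>n. integral ?R (\<lambda>x. \<eta> x * pd i (\<lambda>x. H n x + K n x) x)) \<longlonglongrightarrow> T \<eta> + S \<eta>" if e: "C0_cube c s \<eta>" for \<eta>
    proof -
      have \<eta>c: "continuous_on ?R \<eta>" using e continuous_on_subset unfolding C0_cube_def by blast
      have "integral ?R (\<lambda>x. \<eta> x * pd i (\<lambda>x. H n x + K n x) x) = integral ?R (\<lambda>x. \<eta> x * pd i (H n) x + \<eta> x * pd i (K n) x)" for n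
        by (rule Henstock_Kurzweil_Integration.integral_cong) (simp add: pde distrib_left)
      moreover have "\<dots> n = integral ?R (\<lambda>x. \<eta> x * pd i (H n) x) + integral ?R (\<lambda>x. \<eta> x * pd i (K n) x)" for n
        by (intro Henstock_Kurzweil_Integration.integral_add integrable_on_cube continuous_intros pdc \<eta>c)
      ultimately show ?thesis using tendsto_add[OF T(2)[OF e] S(2)[OF e]] by simp
    qed
    then show "\<exists>T. signed_rep c s T \<and> (\<forall>\<eta>. C0_cube c s \<eta> \<longrightarrow> (\<lambda>n. integral ?R (\<lambda>x. \<eta> x * pd i (\<lambda>x. H n x + K n x) x)) \<longlonglongrightarrow> T \<eta>)"
      using signed_rep_add[OF T(1) S(1)] by blast
  qed
  then show ?thesis using assms unfolding BVC_def by (auto intro: continuous_intros)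
qed

text \<open>The Leibniz rule for the smooth approximations gives two terms, each a uniformly
  convergent factor times weakly convergent gradients. The limit is the product rule for measures
  with continuous coefficients.\<close>

lemma BVC_mult:
  assumes "BVC W c s h" "BVC W c s k" shows "BVC W c s (\<lambda>x. h x * k x)"
proof -
  let ?R = "cube c s"
  obtain H where H: "approx_seq c s h H" using assms(1) BVC_def by blast
  obtain K where K: "approx_seq c s k K" using assms(2) BVC_def by blast
  have W: "open W" "?R \<subseteq> W" and hk: "continuous_on W h" "continuous_on W k" using assms by (auto simp: BVC_def)
  note Hd = H[unfolded approx_seq_def] and Kd = K[unfolded approx_seq_def]
  have Hc: "continuous_on ?R (H n)" and Kc: "continuous_on ?R (K n)" for n using approx_seq_continuous H K by blast+
  have Hu: "\<forall>e>0. \<exists>m. \<forall>n\<ge>m. \<forall>x\<in>?R. \<bar>H n x - h x\<bar> \<le> e" and Ku: "\<forall>e>0. \<exists>m. \<forall>n\<ge>m. \<forall>x\<in>?R. \<bar>K n x - k x\<bar> \<le> e"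
    using Hd Kd by blast+
  have pdc: "continuous_on ?R (pd i (H n))" "continuous_on ?R (pd i (K n))" for i n by (rule approx_seqD(2)[OF H], rule approx_seqD(2)[OF K])
  have pde: "pd i (\<lambda>x. H n x * K n x) x = H n x * pd i (K n) x + K n x * pd i (H n) x" if x: "x \<in> ?R" for i n x
  proof -
    have "H n differentiable (at x)" "K n differentiable (at x)" by (rule approx_seqD(1)[OF H x], rule approx_seqD(1)[OF K x])
    from pd_mult[OF this] show ?thesis by (simp add: mult.commute)
  qed
  obtain C1 C2 where C: "\<And>n x. x \<in> ?R \<Longrightarrow> \<bar>H n x\<bar> \<le> C1" "\<And>n x. x \<in> ?R \<Longrightarrow> \<bar>K n x\<bar> \<le> C2" using Hd Kd by meson
  obtain B2 where kB: "B2 > 0" "\<And>x. x \<in> ?R \<Longrightarrow> \<bar>k x\<bar> \<le> B2" using continuous_on_cube_bounded[OF continuous_on_subset[OF hk(2) W(2)]] by blast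
  have "approx_seq c s (\<lambda>x. h x * k x) (\<lambda>n x. H n x * K n x)"
    unfolding approx_seq_def
  proof (intro conjI allI ballI impI)
    show "(\<lambda>x. H n x * K n x) differentiable (at x)" if "x \<in> ?R" for n x by (intro differentiable_mult approx_seqD(1)[OF H that] approx_seqD(1)[OF K that])
    show "continuous_on ?R (pd i (\<lambda>x. H n x * K n x))" for n i
      by (rule continuous_on_eq[of _ "\<lambda>x. H n x * pd i (K n) x + K n x * pd i (H n) x"])
         (use pdc pde Hc Kc in \<open>auto intro!: continuous_intros\<close>)
    show "\<exists>m. \<forall>n\<ge>m. \<forall>x\<in>?R. \<bar>H n x * K n x - h x * k x\<bar> \<le> e" if e: "e > 0" for e
    proof -
      let ?d1 = "e / (2 * B2)" and ?d2 = "e / (2 * (\<bar>C1\<bar> + 1))"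
      have d: "?d1 > 0" "?d2 > 0" using e kB by auto
      obtain m1 where m1: "\<And>n x. n \<ge> m1 \<Longrightarrow> x \<in> ?R \<Longrightarrow> \<bar>H n x - h x\<bar> \<le> ?d1" using Hu d(1) by meson
      obtain m2 where m2: "\<And>n x. n \<ge> m2 \<Longrightarrow> x \<in> ?R \<Longrightarrow> \<bar>K n x - k x\<bar> \<le> ?d2" using Ku d(2) by meson
      have "\<bar>H n x * K n x - h x * k x\<bar> \<le> e" if n: "n \<ge> max m1 m2" and x: "x \<in> ?R" for n x
      proof -
        have "\<bar>H n x * K n x - h x * k x\<bar> = \<bar>H n x * (K n x - k x) + (H n x - h x) * k x\<bar>"
          by (simp add: algebra_simps)
        also have "\<dots> \<le> \<bar>H n x\<bar> * \<bar>K n x - k x\<bar> + \<bar>H n x - h x\<bar> * \<bar>k x\<bar>"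
          unfolding abs_mult[symmetric] by (rule abs_triangle_ineq)
        also have "\<dots> \<le> (\<bar>C1\<bar> + 1) * ?d2 + ?d1 * B2"
        proof (intro add_mono mult_mono)
          show "\<bar>H n x\<bar> \<le> \<bar>C1\<bar> + 1" using C(1)[OF x, of n] by linarith
        qed (use m1[of n x] m2[of n x] kB n x e in auto)
        also have "\<dots> = e" using kB by (simp add: field_simps)
        finally show ?thesis .
      qed
      then show ?thesis by blast
    qed
    have "\<bar>H n x * K n x\<bar> \<le> \<bar>C1\<bar> * \<bar>C2\<bar>" if "x \<in> ?R" for n x
      unfolding abs_mult using C(1)[OF that, of n] C(2)[OF that, of n] by (intro mult_mono) auto
    then show "\<exists>C. \<forall>n. \<forall>x\<in>?R. \<bar>H n x * K n x\<bar> \<le> C" by blast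
    fix i
    obtain A1 A2 where A: "\<And>n. integral ?R (\<lambda>x. \<bar>pd i (H n) x\<bar>) \<le> A1" "\<And>n. integral ?R (\<lambda>x. \<bar>pd i (K n) x\<bar>) \<le> A2" using Hd Kd by meson
    have "integral ?R (\<lambda>x. \<bar>pd i (\<lambda>x. H n x * K n x) x\<bar>) \<le> \<bar>C1\<bar> * A2 + \<bar>C2\<bar> * A1" for n
    proof -
      have "integral ?R (\<lambda>x. \<bar>pd i (\<lambda>x. H n x * K n x) x\<bar>) = integral ?R (\<lambda>x. \<bar>H n x * pd i (K n) x + K n x * pd i (H n) x\<bar>)"
        by (rule Henstock_Kurzweil_Integration.integral_cong) (simp add: pde)
      also have "\<dots> \<le> integral ?R (\<lambda>x. \<bar>C1\<bar> * \<bar>pd i (K n) x\<bar> + \<bar>C2\<bar> * \<bar>pd i (H n) x\<bar>)"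
      proof (intro integral_le integrable_on_cube continuous_intros pdc Hc Kc)
        fix x assume x: "x \<in> ?R"
        have "\<bar>H n x * pd i (K n) x + K n x * pd i (H n) x\<bar> \<le> \<bar>H n x\<bar> * \<bar>pd i (K n) x\<bar> + \<bar>K n x\<bar> * \<bar>pd i (H n) x\<bar>"
          unfolding abs_mult[symmetric] by (rule abs_triangle_ineq)
        also have "\<dots> \<le> \<bar>C1\<bar> * \<bar>pd i (K n) x\<bar> + \<bar>C2\<bar> * \<bar>pd i (H n) x\<bar>"
          using C(1)[OF x, of n] C(2)[OF x, of n] by (intro add_mono mult_right_mono) auto
        finally show "\<bar>H n x * pd i (K n) x + K n x * pd i (H n) x\<bar> \<le> \<bar>C1\<bar> * \<bar>pd i (K n) x\<bar> + \<bar>C2\<bar> * \<bar>pd i (H n) x\<bar>" .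
      qed
      also have "\<dots> = integral ?R (\<lambda>x. \<bar>C1\<bar> * \<bar>pd i (K n) x\<bar>) + integral ?R (\<lambda>x. \<bar>C2\<bar> * \<bar>pd i (H n) x\<bar>)"
        by (intro Henstock_Kurzweil_Integration.integral_add integrable_on_cube continuous_intros pdc)
      also have "\<dots> = \<bar>C1\<bar> * integral ?R (\<lambda>x. \<bar>pd i (K n) x\<bar>) + \<bar>C2\<bar> * integral ?R (\<lambda>x. \<bar>pd i (H n) x\<bar>)" by simp
      also have "\<dots> \<le> \<bar>C1\<bar> * A2 + \<bar>C2\<bar> * A1" by (intro add_mono mult_left_mono A) auto
      finally show ?thesis .
    qed
    then show "\<exists>B. \<forall>n. integral ?R (\<lambda>x. \<bar>pd i (\<lambda>x. H n x * K n x) x\<bar>) \<le> B" by blast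
    obtain T where T: "signed_rep c s T" "\<And>\<eta>. C0_cube c s \<eta> \<Longrightarrow> (\<lambda>n. integral ?R (\<lambda>x. \<eta> x * pd i (H n) x)) \<longlonglongrightarrow> T \<eta>" using Hd by meson
    obtain S where S: "signed_rep c s S" "\<And>\<eta>. C0_cube c s \<eta> \<Longrightarrow> (\<lambda>n. integral ?R (\<lambda>x. \<eta> x * pd i (K n) x)) \<longlonglongrightarrow> S \<eta>" using Kd by meson
    have "(\<lambda>n. integral ?R (\<lambda>x. \<eta> x * pd i (\<lambda>x. H n x * K n x) x)) \<longlonglongrightarrow> S (\<lambda>x. h x * \<eta> x) + T (\<lambda>x. k x * \<eta> x)" if e: "C0_cube c s \<eta>" for \<eta>
    proof -
      have \<eta>c: "continuous_on ?R \<eta>" using e continuous_on_subset unfolding C0_cube_def by blast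
      have eq: "integral ?R (\<lambda>x. \<eta> x * pd i (\<lambda>x. H n x * K n x) x)
         = integral ?R (\<lambda>x. \<eta> x * (H n x * pd i (K n) x)) + integral ?R (\<lambda>x. \<eta> x * (K n x * pd i (H n) x))" for n
      proof -
        have "integral ?R (\<lambda>x. \<eta> x * pd i (\<lambda>x. H n x * K n x) x)
          = integral ?R (\<lambda>x. \<eta> x * (H n x * pd i (K n) x) + \<eta> x * (K n x * pd i (H n) x))"
          by (rule Henstock_Kurzweil_Integration.integral_cong) (simp add: pde distrib_left)
        also have "\<dots> = integral ?R (\<lambda>x. \<eta> x * (H n x * pd i (K n) x)) + integral ?R (\<lambda>x. \<eta> x * (K n x * pd i (H n) x))"
          by (intro Henstock_Kurzweil_Integration.integral_add integrable_on_cube continuous_intros pdc Hc Kc \<eta>c)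
        finally show ?thesis .
      qed
      show ?thesis unfolding eq
        by (intro tendsto_add weak_limit_times[OF W hk(1) Hc Hu pdc(2) A(2) S(2) e] weak_limit_times[OF W hk(2) Kc Ku pdc(1) A(1) T(2) e])
    qed
    then show "\<exists>T. signed_rep c s T \<and> (\<forall>\<eta>. C0_cube c s \<eta> \<longrightarrow> (\<lambda>n. integral ?R (\<lambda>x. \<eta> x * pd i (\<lambda>x. H n x * K n x) x)) \<longlonglongrightarrow> T \<eta>)"
      using signed_rep_add[OF signed_rep_mult[OF S(1) W(1) hk(1) W(2)] signed_rep_mult[OF T(1) W(1) hk(2) W(2)]] by blast
  qed
  then show ?thesis using assms unfolding BVC_def by (auto intro: continuous_intros)
qed

lemma BVC_diff:
  assumes "BVC W c s h" "BVC W c s k" shows "BVC W c s (\<lambda>x. h x - k x)"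
proof -
  have "BVC W c s (\<lambda>x. h x + (-1) * k x)"
    using assms by (intro BVC_add BVC_mult BVC_const) (auto simp: BVC_def)
  then show ?thesis by simp
qed

text \<open>By compactness \<open>h\<close> stays away from zero on the square, so late
  approximations may be inverted. Their gradients carry the uniformly convergent factor -1 / K^2, to
  which the argument for products applies.\<close>

lemma BVC_inverse:
  assumes "BVC W c s h" and nz: "\<And>x. x \<in> W \<Longrightarrow> h x \<noteq> 0" shows "BVC W c s (\<lambda>x. inverse (h x))"
proof -
  let ?R = "cube c s"
  obtain H where H: "approx_seq c s h H" using assms(1) BVC_def by blast
  have W: "open W" "?R \<subseteq> W" and hc: "continuous_on W h" using assms by (auto simp: BVC_def)
  note Hd = H[unfolded approx_seq_def]
  have ihc: "continuous_on W (\<lambda>x. inverse (h x))" using hc nz by (intro continuous_intros) auto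
  obtain B where B: "B > 0" "\<And>x. x \<in> ?R \<Longrightarrow> \<bar>inverse (h x)\<bar> \<le> B"
    using continuous_on_cube_bounded[OF continuous_on_subset[OF ihc W(2)]] by blast
  have low: "1 / B \<le> \<bar>h x\<bar>" if x: "x \<in> ?R" for x
    using B(2)[OF x] B(1) nz[of x] x W(2) by (auto simp: field_simps)
  have "1 / (2 * B) > 0" using B by simp
  then obtain m0 where m0: "\<And>n x. n \<ge> m0 \<Longrightarrow> x \<in> ?R \<Longrightarrow> \<bar>H n x - h x\<bar> \<le> 1 / (2 * B)" using Hd by meson
  \<comment> \<open>Early approximations may have zeros; after the shift all of them satisfy |K n|
    >= 1 / (2 B).\<close>
  define K where "K n = H (n + m0)" for n
  have Klow: "1 / (2 * B) \<le> \<bar>K n x\<bar>" if x: "x \<in> ?R" for n x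
  proof -
    have "1 / B = 1 / (2 * B) + 1 / (2 * B)" using B(1) by (simp add: field_simps)
    moreover have "\<bar>K n x - h x\<bar> \<le> 1 / (2 * B)" unfolding K_def by (rule m0[OF _ x]) simp
    ultimately show ?thesis using low[OF x] by linarith
  qed
  have Knz: "K n x \<noteq> 0" if "x \<in> ?R" for n x using Klow[OF that, of n] B(1) by auto
  have Kinv: "\<bar>inverse (K n x)\<bar> \<le> 2 * B" if "x \<in> ?R" for n x
    using Klow[OF that, of n] Knz[OF that, of n] B(1) by (auto simp: field_simps)
  have Kc: "continuous_on ?R (K n)" for n unfolding K_def by (rule approx_seq_continuous[OF H])
  have pdc: "continuous_on ?R (pd i (K n))" for i n unfolding K_def by (rule approx_seqD(2)[OF H])
  have Kdif: "K n differentiable (at x)" if "x \<in> ?R" for n x unfolding K_def by (rule approx_seqD(1)[OF H that])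
  have Ku: "\<exists>m. \<forall>n\<ge>m. \<forall>x\<in>?R. \<bar>K n x - h x\<bar> \<le> e" if e: "e > 0" for e
  proof -
    obtain m where "\<And>n x. n \<ge> m \<Longrightarrow> x \<in> ?R \<Longrightarrow> \<bar>H n x - h x\<bar> \<le> e" using Hd e by meson
    then show ?thesis unfolding K_def by (intro exI[of _ m]) auto
  qed
  have iu: "\<forall>e>0. \<exists>m. \<forall>n\<ge>m. \<forall>x\<in>?R. \<bar>inverse (K n x) - inverse (h x)\<bar> \<le> e"
  proof (intro allI impI)
    fix e :: real assume e: "e > 0"
    have "e / (2 * B * B) > 0" using e B by simp
    then obtain m where m: "\<And>n x. n \<ge> m \<Longrightarrow> x \<in> ?R \<Longrightarrow> \<bar>K n x - h x\<bar> \<le> e / (2 * B * B)" using Ku by meson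
    have "\<bar>inverse (K n x) - inverse (h x)\<bar> \<le> e" if n: "n \<ge> m" and x: "x \<in> ?R" for n x
    proof -
      have hx: "h x \<noteq> 0" using nz x W by auto
      have "\<bar>inverse (K n x) - inverse (h x)\<bar> = \<bar>K n x - h x\<bar> * (\<bar>inverse (K n x)\<bar> * \<bar>inverse (h x)\<bar>)"
        unfolding abs_mult[symmetric] inverse_diff_inverse[OF Knz[OF x] hx] abs_minus_cancel
        by (simp add: abs_mult abs_minus_commute mult.commute mult.left_commute)
      also have "\<dots> \<le> e / (2 * B * B) * (2 * B * B)"
        using m[OF n x] Kinv[OF x, of n] B(2)[OF x] B(1) e by (intro mult_mono) auto
      also have "\<dots> = e" using B by simp
      finally show ?thesis .
    qed
    then show "\<exists>m. \<forall>n\<ge>m. \<forall>x\<in>?R. \<bar>inverse (K n x) - inverse (h x)\<bar> \<le> e" by blast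
  qed
  have pde: "pd i (\<lambda>x. inverse (K n x)) x = inverse (K n x) * ((- inverse (K n x)) * pd i (K n) x)" if x: "x \<in> ?R" for i n x
    using pd_inverse[OF Kdif[OF x] Knz[OF x]] by simp
  have ic: "continuous_on ?R (\<lambda>x. inverse (K n x))" for n using Kc Knz by (intro continuous_intros) auto
  have a: "continuous_on W (\<lambda>x. - (inverse (h x) * inverse (h x)))" by (intro continuous_intros ihc) 
  have Ac: "continuous_on ?R (\<lambda>x. - (inverse (K n x) * inverse (K n x)))" for n by (intro continuous_intros ic)
  have Au: "\<forall>e>0. \<exists>m. \<forall>n\<ge>m. \<forall>x\<in>?R. \<bar>- (inverse (K n x) * inverse (K n x)) - - (inverse (h x) * inverse (h x))\<bar> \<le> e"
  proof (intro allI impI)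
    fix e :: real assume e: "e > 0"
    have "e / (3 * B) > 0" using e B by simp
    then obtain m where m: "\<And>n x. n \<ge> m \<Longrightarrow> x \<in> ?R \<Longrightarrow> \<bar>inverse (K n x) - inverse (h x)\<bar> \<le> e / (3 * B)" using iu by meson
    have "\<bar>- (inverse (K n x) * inverse (K n x)) - - (inverse (h x) * inverse (h x))\<bar> \<le> e" if n: "n \<ge> m" and x: "x \<in> ?R" for n x
    proof -
      have "\<bar>- (inverse (K n x) * inverse (K n x)) - - (inverse (h x) * inverse (h x))\<bar>
          = \<bar>inverse (K n x) - inverse (h x)\<bar> * \<bar>inverse (K n x) + inverse (h x)\<bar>"
        unfolding abs_mult[symmetric] by (subst abs_minus_cancel[symmetric]) (simp add: algebra_simps)
      also have "\<dots> \<le> e / (3 * B) * (3 * B)"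
      proof (intro mult_mono m[OF n x])
        show "\<bar>inverse (K n x) + inverse (h x)\<bar> \<le> 3 * B"
          using abs_triangle_ineq[of "inverse (K n x)" "inverse (h x)"] Kinv[OF x, of n] B(2)[OF x] by linarith
      qed (use B(1) e in auto)
      also have "\<dots> = e" using B by simp
      finally show ?thesis .
    qed
    then show "\<exists>m. \<forall>n\<ge>m. \<forall>x\<in>?R. \<bar>- (inverse (K n x) * inverse (K n x)) - - (inverse (h x) * inverse (h x))\<bar> \<le> e" by blast
  qed
  have pde': "pd i (\<lambda>x. inverse (K n x)) x = - (inverse (K n x) * inverse (K n x)) * pd i (K n) x" if x: "x \<in> ?R" for i n x
    using pde[OF x] by simp
  have "approx_seq c s (\<lambda>x. inverse (h x)) (\<lambda>n x. inverse (K n x))"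
    unfolding approx_seq_def
  proof (intro conjI allI ballI impI)
    show "\<exists>m. \<forall>n\<ge>m. \<forall>x\<in>?R. \<bar>inverse (K n x) - inverse (h x)\<bar> \<le> e" if "e > 0" for e
      using iu that by blast
    show "(\<lambda>x. inverse (K n x)) differentiable (at x)" if "x \<in> ?R" for n x
      using Kdif[OF that] Knz[OF that] by (rule differentiable_inverse)
    show "continuous_on ?R (pd i (\<lambda>x. inverse (K n x)))" for n i
      by (rule continuous_on_eq[of _ "\<lambda>x. - (inverse (K n x) * inverse (K n x)) * pd i (K n) x"])
         (use pdc pde' Ac in \<open>auto intro!: continuous_intros ic\<close>)
    show "\<exists>C. \<forall>n. \<forall>x\<in>?R. \<bar>inverse (K n x)\<bar> \<le> C" using Kinv by blast
    fix i
    obtain A0 where A0: "\<And>n. integral ?R (\<lambda>x. \<bar>pd i (H n) x\<bar>) \<le> A0" using Hd by meson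
    have A: "integral ?R (\<lambda>x. \<bar>pd i (K n) x\<bar>) \<le> A0" for n unfolding K_def by (rule A0)
    have "integral ?R (\<lambda>x. \<bar>pd i (\<lambda>x. inverse (K n x)) x\<bar>) \<le> 2 * B * (2 * B) * A0" for n
    proof -
      have "integral ?R (\<lambda>x. \<bar>pd i (\<lambda>x. inverse (K n x)) x\<bar>) = integral ?R (\<lambda>x. \<bar>- (inverse (K n x) * inverse (K n x)) * pd i (K n) x\<bar>)"
        by (rule Henstock_Kurzweil_Integration.integral_cong) (simp only: pde')
      also have "\<dots> \<le> integral ?R (\<lambda>x. 2 * B * (2 * B) * \<bar>pd i (K n) x\<bar>)"
      proof (intro integral_le integrable_on_cube continuous_on_rabs continuous_on_mult continuous_on_minus continuous_on_const pdc ic)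
        fix x assume x: "x \<in> ?R"
        show "\<bar>- (inverse (K n x) * inverse (K n x)) * pd i (K n) x\<bar> \<le> 2 * B * (2 * B) * \<bar>pd i (K n) x\<bar>"
          unfolding abs_mult abs_minus_cancel using Kinv[OF x, of n] B(1) by (intro mult_mono) auto
      qed
      also have "\<dots> = 2 * B * (2 * B) * integral ?R (\<lambda>x. \<bar>pd i (K n) x\<bar>)" by simp
      also have "\<dots> \<le> 2 * B * (2 * B) * A0" using B(1) by (intro mult_left_mono A) auto
      finally show ?thesis .
    qed
    then show "\<exists>B. \<forall>n. integral ?R (\<lambda>x. \<bar>pd i (\<lambda>x. inverse (K n x)) x\<bar>) \<le> B" by blast
    obtain T where T: "signed_rep c s T" "\<And>\<eta>. C0_cube c s \<eta> \<Longrightarrow> (\<lambda>n. integral ?R (\<lambda>x. \<eta> x * pd i (H n) x)) \<longlonglongrightarrow> T \<eta>" using Hd by meson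
    have T2: "(\<lambda>n. integral ?R (\<lambda>x. \<eta> x * pd i (K n) x)) \<longlonglongrightarrow> T \<eta>" if "C0_cube c s \<eta>" for \<eta>
      unfolding K_def using LIMSEQ_ignore_initial_segment[OF T(2)[OF that], of m0] .
    have "(\<lambda>n. integral ?R (\<lambda>x. \<eta> x * pd i (\<lambda>x. inverse (K n x)) x)) \<longlonglongrightarrow> T (\<lambda>x. - (inverse (h x) * inverse (h x)) * \<eta> x)" if e: "C0_cube c s \<eta>" for \<eta>
    proof -
      have eq: "integral ?R (\<lambda>x. \<eta> x * pd i (\<lambda>x. inverse (K n x)) x)
         = integral ?R (\<lambda>x. \<eta> x * (- (inverse (K n x) * inverse (K n x)) * pd i (K n) x))" for n
        by (rule Henstock_Kurzweil_Integration.integral_cong) (simp only: pde')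
      show ?thesis unfolding eq by (rule weak_limit_times[OF W a Ac Au pdc A T2 e])
    qed
    then show "\<exists>T. signed_rep c s T \<and> (\<forall>\<eta>. C0_cube c s \<eta> \<longrightarrow> (\<lambda>n. integral ?R (\<lambda>x. \<eta> x * pd i (\<lambda>x. inverse (K n x)) x)) \<longlonglongrightarrow> T \<eta>)"
      using signed_rep_mult[OF T(1) W(1) a W(2)] by blast
  qed
  then show ?thesis using W ihc unfolding BVC_def by blast
qed

text \<open>For the approximations this is classical, since \<phi> vanishes near the boundary of the
  square. In the limit one side converges uniformly and the other weakly.\<close>

lemma BVC_integral_by_parts:
  assumes "BVC W c s a"
  shows "\<exists>T. signed_rep c s T \<and> (\<forall>\<phi> K. Ck_on 1 W \<phi> \<and> compact K \<and> K \<subseteq> interior (cube c s) \<and> (\<forall>x. x \<notin> K \<longrightarrow> \<phi> x = 0) \<longrightarrow>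
     integral (cube c s) (\<lambda>x. a x * pd i \<phi> x) = - T \<phi>)"
proof -
  let ?R = "cube c s" and ?I = "interior (cube c s)"
  obtain H where H: "approx_seq c s a H" using assms BVC_def by blast
  have W: "open W" "?R \<subseteq> W" and ac: "continuous_on W a" using assms by (auto simp: BVC_def)
  note Hd = H[unfolded approx_seq_def]
  have Hc: "continuous_on ?R (H n)" for n by (rule approx_seq_continuous[OF H])
  obtain T where T: "signed_rep c s T" "\<And>\<eta>. C0_cube c s \<eta> \<Longrightarrow> (\<lambda>n. integral ?R (\<lambda>x. \<eta> x * pd i (H n) x)) \<longlonglongrightarrow> T \<eta>" using Hd by meson
  have "integral ?R (\<lambda>x. a x * pd i \<phi> x) = - T \<phi>"
    if \<phi>: "Ck_on 1 W \<phi>" and K: "compact K" "K \<subseteq> ?I" "\<And>x. x \<notin> K \<Longrightarrow> \<phi> x = 0" for \<phi> K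
  proof -
    have KR: "K \<subseteq> ?R" "K \<subseteq> W" using K(2) interior_subset W(2) by blast+
    have cl: "closed K" using K(1) compact_imp_closed by blast
    have out: "pd i \<phi> x = 0" if "x \<notin> K" for x using that K(3) by (intro pd_eq_0_outside[OF cl]) auto
    have ext: "continuous_on UNIV f" if "continuous_on W f" "\<And>x. x \<notin> K \<Longrightarrow> f x = 0" for f :: "plane \<Rightarrow> real"
    proof -
      have "continuous_on (W \<union> - K) f"
        by (rule continuous_on_open_Un) (use that W cl in \<open>auto intro: continuous_on_eq[of _ "\<lambda>x. 0"]\<close>)
      moreover have "W \<union> - K = UNIV" using KR by auto
      ultimately show ?thesis by simp
    qed
    have \<phi>c: "continuous_on UNIV \<phi>" by (rule ext[OF Ck_on_continuous[OF \<phi>] K(3)])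
    have dc: "continuous_on UNIV (pd i \<phi>)" using \<phi> by (intro ext[OF _ out]) auto
    have \<phi>0: "C0_cube c s \<phi>" unfolding C0_cube_def using \<phi>c K(3) KR by auto
    have d0: "C0_cube c s (pd i \<phi>)" unfolding C0_cube_def using dc out KR by auto
    have dR: "continuous_on ?R (pd i \<phi>)" "continuous_on ?R \<phi>" using dc \<phi>c continuous_on_subset by blast+
    have HI: "Ck_on 1 ?I (H n)" for n
      using Hd continuous_on_subset[OF approx_seqD(2)[OF H] interior_subset] interior_subset[of ?R] by auto
    have lb: "integral ?R f = (LINT x|lborel. f x)" if "continuous_on ?I f" "\<And>x. x \<notin> K \<Longrightarrow> f x = 0" for f :: "plane \<Rightarrow> real"
    proof -
      have "continuous_on (?I \<union> - K) f"
        by (rule continuous_on_open_Un) (use that cl in \<open>auto intro: continuous_on_eq[of _ "\<lambda>x. 0"]\<close>)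
      moreover have "?I \<union> - K = UNIV" using K by auto
      ultimately show ?thesis
        unfolding cube_def using that(2) KR(1) by (intro lborel_integral_eq_integral_cbox[symmetric]) (auto simp: cube_def)
    qed
    have ibp: "integral ?R (\<lambda>x. H n x * pd i \<phi> x) = - integral ?R (\<lambda>x. \<phi> x * pd i (H n) x)" for n
    proof -
      have cI: "continuous_on ?I (H n)" "continuous_on ?I (pd i (H n))" "continuous_on ?I \<phi>" "continuous_on ?I (pd i \<phi>)"
        using HI[of n] Ck_on_continuous[OF HI] continuous_on_subset[OF \<phi>c subset_UNIV] continuous_on_subset[OF dc subset_UNIV] by auto
      have "(LINT x|lborel. H n x * pd i \<phi> x) = - (LINT x|lborel. pd i (H n) x * \<phi> x)"
        using interior_subset[of ?R] W by (intro integral_by_parts[OF open_interior HI Ck_on_subset[OF \<phi>] K]) auto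
      moreover have "integral ?R (\<lambda>x. H n x * pd i \<phi> x) = (LINT x|lborel. H n x * pd i \<phi> x)"
        by (rule lb) (auto intro!: continuous_intros cI simp: out)
      moreover have "integral ?R (\<lambda>x. \<phi> x * pd i (H n) x) = (LINT x|lborel. \<phi> x * pd i (H n) x)"
        by (rule lb) (auto intro!: continuous_intros cI simp: K(3))
      ultimately show ?thesis by (simp add: mult.commute)
    qed
    have lim1: "(\<lambda>n. integral ?R (\<lambda>x. H n x * pd i \<phi> x)) \<longlonglongrightarrow> - T \<phi>"
      unfolding ibp by (intro tendsto_minus T(2)[OF \<phi>0])
    \<comment> \<open>Passing to the uniform limit under the integral is the case of the constant
      sequence G = 1 in \<open>weak_limit_times\<close>.\<close>
    have lim2: "(\<lambda>n. integral ?R (\<lambda>x. pd i \<phi> x * (H n x * 1))) \<longlonglongrightarrow> integral ?R (\<lambda>x. (a x * pd i \<phi> x) * 1)"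
      using Hd[THEN conjunct2, THEN conjunct2, THEN conjunct1]
      by (intro weak_limit_times[OF W ac Hc, where G="\<lambda>n x. 1" and B="integral ?R (\<lambda>x. 1)" and T="\<lambda>\<eta>. integral ?R (\<lambda>x. \<eta> x * 1)" and \<eta>="pd i \<phi>"] d0) auto
    from lim2 have "(\<lambda>n. integral ?R (\<lambda>x. H n x * pd i \<phi> x)) \<longlonglongrightarrow> integral ?R (\<lambda>x. a x * pd i \<phi> x)"
      by (simp add: mult.commute)
    from LIMSEQ_unique[OF this lim1] show ?thesis .
  qed
  with T(1) show ?thesis by blast
qed

section \<open>Change of variables for Hessian measures\<close>

text \<open>By Fubini, testing the smeared measure with \<eta> amounts to testing \<open>M\<close>
  with the smeared \<eta>, which differs from \<eta> by at most \<open>e\<close> because the kernel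
  has mass one and small support.\<close>

lemma kernel_pair_close:
  assumes M: "sets M = sets borel" "finite_measure M" and r: "r > 0" and \<eta>: "C0_cube c s \<eta>"
    and e: "\<And>x z. z \<in> cube x r \<Longrightarrow> \<bar>\<eta> x - \<eta> z\<bar> \<le> e"
  shows "integrable lborel (\<lambda>x. \<eta> x * (LINT z|M. kernel r (x - z)))"
    "\<bar>(LINT x|lborel. \<eta> x * (LINT z|M. kernel r (x - z))) - (LINT z|M. \<eta> z)\<bar> \<le> e * measure M UNIV"
proof -
  interpret M: finite_measure M by fact
  interpret P: pair_sigma_finite lborel M ..
  have [measurable_cong]: "sets M = sets borel" by (rule M(1))
  have spM: "space M = UNIV" using sets_eq_imp_space_eq[OF M(1)] by simp
  obtain S where S: "S > 0" "\<And>x. \<bar>\<eta> x\<bar> \<le> S" using C0_bounded[OF \<eta>] by blast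
  have \<eta>m [measurable]: "\<eta> \<in> borel_measurable borel"
    using \<eta> continuous_imp_borel_measurable unfolding C0_cube_def by blast
  let ?f = "\<lambda>(x, z). \<eta> x * kernel r (x - z)"
  have fm: "?f \<in> borel_measurable (lborel \<Otimes>\<^sub>M M)" by measurable
  have k1: "(LINT x|lborel. kernel r (x - z)) = 1" for z
    using lborel_integral_translate[of "kernel r" "- z"] kernel_integral[OF r] by simp
  have ki: "integrable lborel (\<lambda>x. kernel r (x - z))" for z
  proof -
    have sym: "(\<lambda>x. kernel r (x - z)) = (\<lambda>x. kernel r (z - x))"
      by (metis kernel_minus minus_diff_eq)
    have "continuous_on UNIV (\<lambda>x. kernel r (z - x))"
      using Ck_on_kernel_shift[of 0 r z] by simp
    then show ?thesis
      unfolding sym by (rule integrable_continuous_compact[OF _ compact_cube[of z r]])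
        (use r in \<open>auto simp: cube_shift intro: kernel_eq_0\<close>)
  qed
  have kn: "(\<integral>\<^sup>+x. ennreal (kernel r (x - z)) \<partial>lborel) = 1" for z
    using nn_integral_eq_integral[OF ki, of z] kernel_nonneg k1 by simp
  have int: "integrable (lborel \<Otimes>\<^sub>M M) ?f"
  proof (rule integrableI_bounded[OF fm])
    have "(\<integral>\<^sup>+p. ennreal (norm (?f p)) \<partial>(lborel \<Otimes>\<^sub>M M)) = (\<integral>\<^sup>+z. \<integral>\<^sup>+x. ennreal (norm (?f (x, z))) \<partial>lborel \<partial>M)"
      by (rule P.nn_integral_snd[symmetric]) (use fm in measurable)
    also have "\<dots> \<le> (\<integral>\<^sup>+z. \<integral>\<^sup>+x. ennreal S * ennreal (kernel r (x - z)) \<partial>lborel \<partial>M)"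
      using S kernel_nonneg
      by (intro nn_integral_mono) (auto simp: abs_mult ennreal_mult[symmetric] intro!: ennreal_leI mult_mono)
    also have "\<dots> = ennreal S * emeasure M (space M)"
      by (simp add: nn_integral_cmult kn)
    also have "\<dots> < \<infinity>" by (simp add: ennreal_mult_less_top M.emeasure_eq_measure)
    finally show "(\<integral>\<^sup>+p. ennreal (norm (?f p)) \<partial>(lborel \<Otimes>\<^sub>M M)) < \<infinity>" .
  qed
  have i1: "integrable lborel (\<lambda>x. LINT z|M. \<eta> x * kernel r (x - z))"
    using P.integrable_fst'[OF int] by simp
  then show "integrable lborel (\<lambda>x. \<eta> x * (LINT z|M. kernel r (x - z)))" by simp
  have i2: "integrable M (\<lambda>z. LINT x|lborel. \<eta> x * kernel r (x - z))"
    using P.integrable_snd[OF int] by simp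
  have iM: "integrable M \<eta>" by (rule integrable_C0[OF M \<eta>])
  have "(LINT x|lborel. \<eta> x * (LINT z|M. kernel r (x - z))) = (LINT x|lborel. LINT z|M. \<eta> x * kernel r (x - z))"
    by simp
  also have "\<dots> = (LINT z|M. LINT x|lborel. \<eta> x * kernel r (x - z))"
    using P.Fubini_integral[OF int] by simp
  finally have eq: "(LINT x|lborel. \<eta> x * (LINT z|M. kernel r (x - z))) - (LINT z|M. \<eta> z)
      = (LINT z|M. (LINT x|lborel. \<eta> x * kernel r (x - z)) - \<eta> z)"
    using i2 iM by simp
  have close: "\<bar>(LINT x|lborel. \<eta> x * kernel r (x - z)) - \<eta> z\<bar> \<le> e" for z
  proof -
    have ie: "integrable lborel (\<lambda>x. \<eta> x * kernel r (x - z))"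
    proof (rule Bochner_Integration.integrable_bound)
      show "integrable lborel (\<lambda>x. S * kernel r (x - z))" using ki by simp
      show "AE x in lborel. norm (\<eta> x * kernel r (x - z)) \<le> norm (S * kernel r (x - z))"
        using S kernel_nonneg[of r] by (auto simp: abs_mult intro!: mult_right_mono)
    qed measurable
    have "(LINT x|lborel. \<eta> x * kernel r (x - z)) - \<eta> z = (LINT x|lborel. \<eta> x * kernel r (x - z)) - \<eta> z * (LINT x|lborel. kernel r (x - z))"
      by (simp add: k1)
    also have "\<dots> = (LINT x|lborel. \<eta> x * kernel r (x - z) - \<eta> z * kernel r (x - z))" using ie ki by simp
    also have "\<bar>\<dots>\<bar> \<le> (LINT x|lborel. e * kernel r (x - z))"
    proof (intro order_trans[OF integral_abs_bound] integral_mono)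
      fix x
      show "\<bar>\<eta> x * kernel r (x - z) - \<eta> z * kernel r (x - z)\<bar> \<le> e * kernel r (x - z)"
      proof (cases "z \<in> cube x r")
        case True
        have "\<bar>\<eta> x * kernel r (x - z) - \<eta> z * kernel r (x - z)\<bar> = \<bar>\<eta> x - \<eta> z\<bar> * kernel r (x - z)"
          using kernel_nonneg[of r "x - z"] by (simp add: abs_mult left_diff_distrib[symmetric])
        also have "\<dots> \<le> e * kernel r (x - z)" by (intro mult_right_mono e[OF True] kernel_nonneg)
        finally show ?thesis .
      next
        case False
        then have "kernel r (x - z) = 0" using r by (intro kernel_eq_0) (auto simp: cube_shift)
        then show ?thesis by simp
      qed
    qed (use ie ki in auto)
    finally show ?thesis by (simp add: k1)
  qed
  have "\<bar>LINT z|M. (LINT x|lborel. \<eta> x * kernel r (x - z)) - \<eta> z\<bar> \<le> (LINT z|M. e)"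
    using i2 iM close by (intro order_trans[OF integral_abs_bound] integral_mono) auto
  then show "\<bar>(LINT x|lborel. \<eta> x * (LINT z|M. kernel r (x - z))) - (LINT z|M. \<eta> z)\<bar> \<le> e * measure M UNIV"
    unfolding eq by (simp add: spM mult.commute)
qed

text \<open>The approximations are mollifications, whose gradient at a point is the kernel paired
  with P - N. The margin \<open>t\<close> around the square accommodates all radii t / (n +
  1).\<close>

lemma BVC_of_weak_pd:
  assumes W: "open W" and h: "continuous_on W h" and weak: "\<And>i. weak_pd i W h (P i) (N i)"
    and st: "s > 0" "t > 0" and c: "cube c (s + t) \<subseteq> W"
  shows "BVC W c s h"
proof -
  let ?R = "cube c s" and ?Q = "cube c (s + t)"
  have sPN: "sets (P i) = sets borel" "sets (N i) = sets borel"
    and fPN: "\<And>K. compact K \<Longrightarrow> K \<subseteq> W \<Longrightarrow> emeasure (P i) K < \<infinity>" "\<And>K. compact K \<Longrightarrow> K \<subseteq> W \<Longrightarrow> emeasure (N i) K < \<infinity>" for i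
    using weak[of i] by (auto simp: weak_pd_def radon_measure_on_def)
  have RQ: "?R \<subseteq> ?Q" using st by (intro cube_mono) auto
  have hQ: "continuous_on ?Q h" by (rule continuous_on_subset[OF h c])
  define r where "r n = t / real (Suc n)" for n
  have r: "r n > 0" "r n \<le> t" for n using st by (auto simp: r_def field_simps)
  have rlim: "r \<longlonglongrightarrow> 0" unfolding r_def[abs_def] by (rule LIMSEQ_Suc[OF lim_const_over_n])
  have cr: "cube c (s + r n) \<subseteq> ?Q" for n using r[of n] by (intro cube_mono) auto
  have crW: "cube c (s + r n) \<subseteq> W" for n using cr c by blast
  define H where "H n = mollify c (s + r n) (r n) h" for n
  have HC: "Ck_on 1 UNIV (H n)" for n
    unfolding H_def by (rule Ck_on_mollify[OF continuous_on_subset[OF h crW]])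
  have pdc: "continuous_on UNIV (pd i (H n))" for i n using HC[of n] by simp
  have near: "z \<in> ?Q" if "z \<in> cube x (r n)" "x \<in> ?R" for z x n
    using cube_trans[OF that] cr by blast
  obtain S where S: "S > 0" "\<And>x. x \<in> ?Q \<Longrightarrow> \<bar>h x\<bar> \<le> S" using continuous_on_cube_bounded[OF hQ] by blast
  have "approx_seq c s h H"
    unfolding approx_seq_def
  proof (intro conjI allI ballI impI)
    show "H n differentiable (at x)" for n x using HC[of n] by simp
    show "continuous_on ?R (pd i (H n))" for n i by (rule continuous_on_subset[OF pdc]) simp
    show "\<exists>m. \<forall>n\<ge>m. \<forall>x\<in>?R. \<bar>H n x - h x\<bar> \<le> e" if e: "e > 0" for e
    proof -
      have "uniformly_continuous_on ?Q h" by (rule compact_uniformly_continuous[OF hQ]) auto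
      then obtain d where d: "d > 0" "\<And>x y. x \<in> ?Q \<Longrightarrow> y \<in> ?Q \<Longrightarrow> dist y x < d \<Longrightarrow> dist (h y) (h x) < e"
        unfolding uniformly_continuous_on_def using e by metis
      obtain m where m: "\<And>n. n \<ge> m \<Longrightarrow> r n < d / 2"
        using order_tendstoD(2)[OF rlim, of "d / 2"] d(1) unfolding eventually_sequentially by auto
      have "\<bar>H n x - h x\<bar> \<le> e" if n: "n \<ge> m" and x: "x \<in> ?R" for n x
        unfolding H_def
      proof (rule mollify_close[OF W h r(1) crW x])
        fix z assume z: "z \<in> cube x (r n)"
        have "dist z x \<le> 2 * r n" using cube_subset_cball[of x "r n"] z by (auto simp: dist_commute)
        then have "dist z x < d" using m[OF n] by linarith
        then show "\<bar>h z - h x\<bar> \<le> e" using d(2)[of x z] near[OF z x] x RQ by (auto simp: dist_real_def)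
      qed
      then show ?thesis by blast
    qed
    have "\<bar>H n x\<bar> \<le> 3 * S" if x: "x \<in> ?R" for n x
    proof -
      have hx: "\<bar>h x\<bar> \<le> S" using S(2) x RQ by blast
      have "\<bar>H n x - h x\<bar> \<le> 2 * S"
        unfolding H_def
      proof (rule mollify_close[OF W h r(1) crW x])
        fix z assume z: "z \<in> cube x (r n)"
        show "\<bar>h z - h x\<bar> \<le> 2 * S" using S(2)[OF near[OF z x]] hx by linarith
      qed
      with hx show ?thesis by linarith
    qed
    then show "\<exists>C. \<forall>n. \<forall>x\<in>?R. \<bar>H n x\<bar> \<le> C" by blast
    fix i
    let ?M = "add_measure (P i) (N i)"
    have iPN: "integrable (P i) \<phi>" "integrable (N i) \<phi>" if "test_function W \<phi>" for \<phi>
      using that sPN fPN by (auto intro!: integrable_test_function[of _ W])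
    have eM: "emeasure ?M K < \<infinity>" if K: "compact K" "K \<subseteq> W" for K
      using fPN(1)[OF K, of i] fPN(2)[OF K, of i] emeasure_add_measure[OF sPN borel_compact[OF K(1)], of i] by simp
    have dom: "pd_dominated i W h ?M"
      unfolding pd_dominated_def
    proof (intro conjI allI impI sets_add_measure)
      show "emeasure ?M K < \<infinity>" if "compact K \<and> K \<subseteq> W" for K using that eM by blast
      fix \<phi> assume \<phi>: "test_function W \<phi> \<and> (\<forall>x. 0 \<le> \<phi> x)"
      have "(LINT x|lborel. h x * pd i \<phi> x) = (LINT x|N i. \<phi> x) - (LINT x|P i. \<phi> x)"
        using weak[of i] \<phi> unfolding weak_pd_def by blast
      moreover have "(LINT x|?M. \<phi> x) = (LINT x|P i. \<phi> x) + (LINT x|N i. \<phi> x)"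
        using \<phi> iPN by (intro integrable_add_measure(2) sPN) auto
      moreover have "0 \<le> (LINT x|P i. \<phi> x)" "0 \<le> (LINT x|N i. \<phi> x)" using \<phi> by simp_all
      ultimately show "\<bar>LINT x|lborel. h x * pd i \<phi> x\<bar> \<le> (LINT x|?M. \<phi> x)" by linarith
    qed
    have "integral ?R (\<lambda>x. \<bar>pd i (H n) x\<bar>) \<le> measure ?M ?Q" for n
    proof -
      have ac: "continuous_on ?R (\<lambda>x. \<bar>pd i (H n) x\<bar>)" by (intro continuous_intros continuous_on_subset[OF pdc]) auto
      have "ennreal (integral ?R (\<lambda>x. \<bar>pd i (H n) x\<bar>)) = (\<integral>\<^sup>+x. ennreal \<bar>pd i (H n) x\<bar> * indicator ?R x \<partial>lborel)"
        by (rule nn_integral_cube[OF ac, symmetric]) simp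
      also have "\<dots> \<le> emeasure ?M (cube c (s + r n))"
        unfolding H_def by (rule mollify_L1_bound[OF W h dom r(1) crW])
      also have "\<dots> \<le> emeasure ?M ?Q" using cr by (intro emeasure_mono) auto
      also have "\<dots> = ennreal (measure ?M ?Q)" using eM[OF compact_cube c] by (intro emeasure_eq_ennreal_measure) auto
      finally show ?thesis by (subst (asm) ennreal_le_iff) auto
    qed
    then show "\<exists>B. \<forall>n. integral ?R (\<lambda>x. \<bar>pd i (H n) x\<bar>) \<le> B" by blast
    \<comment> \<open>Radon measures need not be finite; on the compact square \<open>?Q\<close>
      they are, and kernels centred in the smaller square do not reach beyond it.\<close>
    define RM where "RM M = density M (indicator ?Q)" for M :: "plane measure"
    have RMs: "sets (RM M) = sets M" for M by (simp add: RM_def)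
    have RMfin: "finite_measure (RM M)" if "sets M = sets borel" "emeasure M ?Q < \<infinity>" for M
    proof (rule finite_measureI)
      have Q: "?Q \<in> sets M" using that by simp
      show "emeasure (RM M) (space (RM M)) \<noteq> \<infinity>"
        using emeasure_restricted[OF Q sets.top] that(2) Q by (simp add: RM_def sets.Int_space_eq2)
    qed
    have finP: "finite_measure (RM (P i))" "finite_measure (RM (N i))"
      using RMfin sPN fPN c by auto
    have RMint: "(LINT z|RM M. \<phi> z) = (LINT z|M. \<phi> z)" if M: "sets M = sets borel" and \<phi>: "continuous_on UNIV \<phi>" "\<And>z. z \<notin> ?Q \<Longrightarrow> \<phi> z = 0" for M and \<phi> :: "plane \<Rightarrow> real"
    proof -
      have Q: "?Q \<in> sets M" using M by simp
      have \<phi>M: "\<phi> \<in> borel_measurable M" by (rule borel_measurable_transfer[OF M continuous_imp_borel_measurable[OF \<phi>(1)]])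
      have "RM M = density M (\<lambda>z. ennreal (indicator ?Q z))"
        unfolding RM_def by (rule arg_cong[where f="density M"]) (auto simp: indicator_def)
      then have "(LINT z|RM M. \<phi> z) = (LINT z|M. indicator ?Q z *\<^sub>R \<phi> z)"
        using Q \<phi>M by (simp add: integral_density)
      also have "(\<lambda>z. indicator ?Q z *\<^sub>R \<phi> z) = \<phi>"
        using \<phi>(2) by (auto simp: fun_eq_iff indicator_def)
      finally show ?thesis .
    qed
    define T where "T \<eta> = (LINT x|RM (P i). \<eta> x) - (LINT x|RM (N i). \<eta> x)" for \<eta> :: "plane \<Rightarrow> real"
    have Trep: "signed_rep c s T"
      unfolding signed_rep_def T_def
      by (intro exI[of _ "RM (P i)"] exI[of _ "RM (N i)"] conjI allI impI finP) (simp_all add: RMs sPN)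
    have "(\<lambda>n. integral ?R (\<lambda>x. \<eta> x * pd i (H n) x)) \<longlonglongrightarrow> T \<eta>" if \<eta>: "C0_cube c s \<eta>" for \<eta>
    proof (rule LIMSEQ_I)
      fix e :: real assume e: "e > 0"
      have \<eta>c: "continuous_on UNIV \<eta>" and \<eta>0: "\<And>x. x \<notin> ?R \<Longrightarrow> \<eta> x = 0" using \<eta> by (auto simp: C0_cube_def)
      let ?m = "measure (RM (P i)) UNIV + measure (RM (N i)) UNIV"
      define e' where "e' = e / (2 * (?m + 1))"
      have m0: "0 \<le> ?m" by simp
      then have e': "e' > 0" using e by (simp add: e'_def add_nonneg_pos)
      have "uniformly_continuous_on (cube c (s + t + t)) \<eta>"
        by (rule compact_uniformly_continuous[OF continuous_on_subset[OF \<eta>c]]) auto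
      then obtain d where d: "d > 0" "\<And>x y. x \<in> cube c (s + t + t) \<Longrightarrow> y \<in> cube c (s + t + t) \<Longrightarrow> dist y x < d \<Longrightarrow> dist (\<eta> y) (\<eta> x) < e'"
        unfolding uniformly_continuous_on_def using e' by metis
      obtain m where m: "\<And>n. n \<ge> m \<Longrightarrow> r n < d / 2"
        using order_tendstoD(2)[OF rlim, of "d / 2"] d(1) unfolding eventually_sequentially by auto
      have "norm (integral ?R (\<lambda>x. \<eta> x * pd i (H n) x) - T \<eta>) < e" if n: "n \<ge> m" for n
      proof -
        \<comment> \<open>Uniform continuity holds only on compact sets. If neither point lies in
          the inner square both values vanish, otherwise both points lie in the enlarged compact
          square.\<close>
        have cl: "\<bar>\<eta> x - \<eta> z\<bar> \<le> e'" if z: "z \<in> cube x (r n)" for x z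
        proof (cases "x \<in> ?R \<or> z \<in> ?R")
          case True
          have zx: "x \<in> cube z (r n)" using z by (simp add: mem_cube abs_minus_commute)
          have "x \<in> cube c (s + r n) \<and> z \<in> cube c (s + r n)"
            using True cube_trans[OF z, of c s] cube_trans[OF zx, of c s] r[of n] cube_mono[of s "s + r n" c] by auto
          then have "x \<in> cube c (s + t + t)" "z \<in> cube c (s + t + t)"
            using r[of n] st cube_mono[of "s + r n" "s + t + t" c] by auto
          moreover have "dist x z < d"
            using cube_subset_cball[of x "r n"] z m[OF n] by fastforce
          ultimately show ?thesis using d(2)[of z x] by (auto simp: dist_real_def)
        next
          case False
          then show ?thesis using \<eta>0 e' by simp
        qed
        have eq: "\<eta> x * pd i (H n) x = \<eta> x * (LINT z|RM (P i). kernel (r n) (x - z)) - \<eta> x * (LINT z|RM (N i). kernel (r n) (x - z))" for x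
        proof (cases "x \<in> ?R")
          case True
          have sub: "cube x (r n) \<subseteq> ?Q" using near[OF _ True] by blast
          have tf: "test_function W (\<lambda>z. kernel (r n) (x - z))" using test_function_kernel[OF r(1)] sub c by blast
          have out: "kernel (r n) (x - z) = 0" if "z \<notin> ?Q" for z
            using r sub that by (intro kernel_eq_0) (auto simp: cube_shift)
          have kc: "continuous_on UNIV (\<lambda>z. kernel (r n) (x - z))" using Ck_on_kernel_shift[of 0 "r n" x] by simp
          have "pd i (H n) x = - (LINT z|lborel. h z * pd i (\<lambda>z. kernel (r n) (x - z)) z)"
            unfolding H_def by (rule mollify_pd_eq[OF W h r(1) crW True])
          also have "\<dots> = (LINT z|P i. kernel (r n) (x - z)) - (LINT z|N i. kernel (r n) (x - z))"
            using weak[of i] tf unfolding weak_pd_def by auto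
          also have "\<dots> = (LINT z|RM (P i). kernel (r n) (x - z)) - (LINT z|RM (N i). kernel (r n) (x - z))"
            using RMint[OF sPN(1) kc out] RMint[OF sPN(2) kc out] by simp
          finally show ?thesis by (simp add: right_diff_distrib)
        qed (simp add: \<eta>0)
        note kP = kernel_pair_close[OF _ finP(1) r(1)[of n] \<eta> cl] and kN = kernel_pair_close[OF _ finP(2) r(1)[of n] \<eta> cl]
        have sR: "sets (RM (P i)) = sets borel" "sets (RM (N i)) = sets borel" by (simp_all add: RMs sPN)
        have pc: "continuous_on UNIV (\<lambda>x. \<eta> x * pd i (H n) x)" by (intro continuous_intros \<eta>c pdc)
        have "integral ?R (\<lambda>x. \<eta> x * pd i (H n) x) = (LINT x|lborel. \<eta> x * pd i (H n) x)"
          unfolding cube_def by (rule lborel_integral_eq_integral_cbox[OF pc, symmetric]) (use \<eta>0 in \<open>auto simp: cube_def\<close>)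
        also have "\<dots> = (LINT x|lborel. \<eta> x * (LINT z|RM (P i). kernel (r n) (x - z))) - (LINT x|lborel. \<eta> x * (LINT z|RM (N i). kernel (r n) (x - z)))"
          unfolding eq by (rule Bochner_Integration.integral_diff[OF kP(1)[OF sR(1)] kN(1)[OF sR(2)]])
        finally have "\<bar>integral ?R (\<lambda>x. \<eta> x * pd i (H n) x) - T \<eta>\<bar> \<le> e' * measure (RM (P i)) UNIV + e' * measure (RM (N i)) UNIV"
          unfolding T_def using kP(2)[OF sR(1)] kN(2)[OF sR(2)] by linarith
        also have "\<dots> = e' * ?m" by (simp add: distrib_left)
        also have "\<dots> = ?m / (?m + 1) * (e / 2)" using m0 by (simp add: e'_def field_simps)
        also have "\<dots> \<le> 1 * (e / 2)"
        proof (rule mult_right_mono)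
          have "x / (x + 1) \<le> 1" if "0 \<le> x" for x :: real using that by simp
          from this[OF m0] show "?m / (?m + 1) \<le> 1" .
        qed (use e in simp)
        also have "\<dots> < e" using e by simp
        finally show ?thesis by simp
      qed
      then show "\<exists>m. \<forall>n\<ge>m. norm (integral ?R (\<lambda>x. \<eta> x * pd i (H n) x) - T \<eta>) < e" by blast
    qed
    with Trep show "\<exists>T. signed_rep c s T \<and> (\<forall>\<eta>. C0_cube c s \<eta> \<longrightarrow> (\<lambda>n. integral ?R (\<lambda>x. \<eta> x * pd i (H n) x)) \<longlonglongrightarrow> T \<eta>)" by blast
  qed
  then show ?thesis unfolding BVC_def using W h RQ c by blast
qed

lemma BVC_cong: "BVC W c s h \<Longrightarrow> (\<And>x. x \<in> W \<Longrightarrow> h x = k x) \<Longrightarrow> BVC W c s k"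
proof -
  assume B: "BVC W c s h" and eq: "\<And>x. x \<in> W \<Longrightarrow> h x = k x"
  obtain H where H: "approx_seq c s h H" using B BVC_def by blast
  have "h x = k x" if "x \<in> cube c s" for x using B eq that unfolding BVC_def by blast
  then have "approx_seq c s k H" using H unfolding approx_seq_def by simp
  moreover have "continuous_on W k" using B eq continuous_on_eq unfolding BVC_def by blast
  ultimately show ?thesis using B unfolding BVC_def by blast
qed

lemma pd_chain:
  fixes v :: "plane \<Rightarrow> real" and \<Psi> :: "plane \<Rightarrow> plane"
  assumes "\<Psi> differentiable (at x)" "v differentiable (at (\<Psi> x))"
  shows "(\<lambda>x. v (\<Psi> x)) differentiable (at x)"
    "pd i (\<lambda>x. v (\<Psi> x)) x = pd 1 v (\<Psi> x) * pd i \<Psi> x $ 1 + pd 2 v (\<Psi> x) * pd i \<Psi> x $ 2"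
proof -
  have "((\<lambda>x. v (\<Psi> x)) has_derivative (\<lambda>t. grad v (\<Psi> x) \<bullet> frechet_derivative \<Psi> (at x) t)) (at x)"
    by (rule has_derivative_compose[where f=\<Psi> and g=v, OF _ has_derivative_grad[OF assms(2)]])
       (use assms(1) frechet_derivative_works in blast)
  from differentiableI[OF this] pd_eqI[OF this, of i]
  show "(\<lambda>x. v (\<Psi> x)) differentiable (at x)"
    "pd i (\<lambda>x. v (\<Psi> x)) x = pd 1 v (\<Psi> x) * pd i \<Psi> x $ 1 + pd 2 v (\<Psi> x) * pd i \<Psi> x $ 2"
    by (simp_all add: inner_plane grad_def pd_def)
qed

text \<open>Image measures under \<Psi>. The functional is evaluated on compositions with \<Psi>,
  and the resulting measures act on functions of the target variable.\<close>

lemma signed_rep_push: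
  fixes \<Psi> :: "plane \<Rightarrow> plane"
  assumes T: "signed_rep c s T" and \<Psi>: "continuous_on (cube c s) \<Psi>"
  shows "\<exists>P N. sets P = sets borel \<and> sets N = sets borel \<and> finite_measure P \<and> finite_measure N \<and>
     (\<forall>\<phi> \<eta>. \<phi> \<in> borel_measurable borel \<and> C0_cube c s \<eta> \<and> (\<forall>x\<in>cube c s. \<eta> x = \<phi> (\<Psi> x)) \<longrightarrow>
        T \<eta> = (LINT y|P. \<phi> y) - (LINT y|N. \<phi> y))"
proof -
  obtain P N where PN: "sets P = sets borel" "sets N = sets borel" "finite_measure P" "finite_measure N"
    "\<And>\<eta>. C0_cube c s \<eta> \<Longrightarrow> T \<eta> = (LINT x|P. \<eta> x) - (LINT x|N. \<eta> x)"
    by (rule signed_repE[OF T]) blast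
  \<comment> \<open>The value zero off the square serves only to make the map Borel on the whole
    plane; the density with the indicator removes the mass there before the image is taken.\<close>
  define \<Psi>' where "\<Psi>' x = indicator (cube c s) x *\<^sub>R \<Psi> x" for x
  have m: "\<Psi>' \<in> borel_measurable borel"
    unfolding \<Psi>'_def[abs_def] by (rule borel_measurable_continuous_on_indicator[OF borel_cube \<Psi>])
  define Q where "Q M = distr (density M (\<lambda>x. ennreal (indicator (cube c s) x))) borel \<Psi>'" for M
  have Q: "sets (Q M) = sets borel" for M by (simp add: Q_def)
  have fin: "finite_measure (Q M)" if M: "sets M = sets borel" "finite_measure M" for M
  proof -
    have "finite_measure (density M (\<lambda>x. ennreal (indicator (cube c s) x)))"
      by (rule finite_measure_density_bounded[OF M, of _ 1]) (auto simp: indicator_def)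
    moreover have "\<Psi>' \<in> measurable (density M (\<lambda>x. ennreal (indicator (cube c s) x))) borel"
      using borel_measurable_transfer[OF M(1) m] by simp
    ultimately show ?thesis unfolding Q_def by (rule finite_measure.finite_measure_distr)
  qed
  have int: "(LINT y|Q M. \<phi> y) = (LINT x|M. \<eta> x)"
    if M: "sets M = sets borel" and \<phi>: "\<phi> \<in> borel_measurable borel" and \<eta>: "C0_cube c s \<eta>" "\<And>x. x \<in> cube c s \<Longrightarrow> \<eta> x = \<phi> (\<Psi> x)" for M and \<phi> \<eta> :: "plane \<Rightarrow> real"
  proof -
    have mM: "\<Psi>' \<in> measurable M borel" by (rule borel_measurable_transfer[OF M m])
    have cM: "cube c s \<in> sets M" using M by simp
    have "(LINT y|Q M. \<phi> y) = (LINT x|density M (\<lambda>x. ennreal (indicator (cube c s) x)). \<phi> (\<Psi>' x))"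
      unfolding Q_def by (rule integral_distr) (use mM \<phi> in auto)
    also have "\<dots> = (LINT x|M. indicator (cube c s) x *\<^sub>R \<phi> (\<Psi>' x))"
    proof (rule integral_density)
      show "(\<lambda>x. \<phi> (\<Psi>' x)) \<in> borel_measurable M" by (rule measurable_compose[OF mM \<phi>])
      show "indicator (cube c s) \<in> borel_measurable M" using cM by simp
    qed auto
    also have "(\<lambda>x. indicator (cube c s) x *\<^sub>R \<phi> (\<Psi>' x)) = \<eta>"
      using \<eta> by (auto simp: fun_eq_iff indicator_def \<Psi>'_def C0_cube_def)
    finally show ?thesis .
  qed
  have "T \<eta> = (LINT y|Q P. \<phi> y) - (LINT y|Q N. \<phi> y)"
    if "\<phi> \<in> borel_measurable borel \<and> C0_cube c s \<eta> \<and> (\<forall>x\<in>cube c s. \<eta> x = \<phi> (\<Psi> x))" for \<phi> \<eta>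
    using that PN(5)[of \<eta>] int[OF PN(1), of \<phi> \<eta>] int[OF PN(2), of \<phi> \<eta>] by simp
  then show ?thesis
    by (intro exI[of _ "Q P"] exI[of _ "Q N"] conjI allI impI Q fin PN)
qed

text \<open>By connectedness of the square. The absolute value of the Jacobian in the change of
  variables thus becomes a constant times the Jacobian, to which the cofactor identity
  applies.\<close>

lemma constant_sign_on_cube:
  fixes J :: "plane \<Rightarrow> real"
  assumes "continuous_on (cube c s) J" "\<And>x. x \<in> cube c s \<Longrightarrow> J x \<noteq> 0"
  obtains \<sigma> :: real where "\<And>x. x \<in> cube c s \<Longrightarrow> \<bar>J x\<bar> = \<sigma> * J x"
proof -
  have conn: "connected (J ` cube c s)"
    by (intro connected_continuous_image assms(1) convex_connected convex_cube)
  have "(\<forall>x\<in>cube c s. J x > 0) \<or> (\<forall>x\<in>cube c s. J x < 0)"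
  proof (rule ccontr)
    assume "\<not> ?thesis"
    then obtain x y where xy: "x \<in> cube c s" "y \<in> cube c s" "J x \<le> 0" "0 \<le> J y"
      by (auto simp: not_less)
    then have "0 \<in> J ` cube c s"
      using connectedD_interval[OF conn, of "J x" "J y" 0] by blast
    then show False using assms(2) by force
  qed
  then show thesis
  proof
    assume "\<forall>x\<in>cube c s. J x > 0"
    then show thesis by (intro that[of 1]) auto
  next
    assume "\<forall>x\<in>cube c s. J x < 0"
    then show thesis by (intro that[of "-1"]) auto
  qed
qed

text \<open>The change of variables uses the Piola identity: multiplied by the Jacobian, the derivative
  \<open>\<partial>\<^sub>j\<phi>\<close> becomes a combination of derivatives of \<open>\<phi> \<circ> \<Psi>\<close> with cofactors of \<open>D\<Psi>\<close>
  as coefficients, so only the cofactors times \<open>w \<circ> \<Psi>\<close> have to be of bounded variation.\<close>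

lemma weak_pd_transport:
  fixes \<Psi> :: "plane \<Rightarrow> plane" and w :: "plane \<Rightarrow> real"
  assumes U: "open U" and U': "open U'" and \<Psi>: "Ck_on 1 U \<Psi>" "inj_on \<Psi> U" "\<Psi> ` U = U'"
    and J: "\<And>x. x \<in> U \<Longrightarrow> det (matrix (frechet_derivative \<Psi> (at x))) \<noteq> 0"
    and w: "continuous_on U' w" and c: "cube c s \<subseteq> U"
    and B: "\<And>m k. BVC U c s (\<lambda>x. w (\<Psi> x) * pd m \<Psi> x $ k)"
    and V: "open V" "V \<subseteq> \<Psi> ` interior (cube c s)"
    and \<Phi>: "continuous_on U' \<Phi>" "\<And>x. x \<in> U \<Longrightarrow> \<Phi> (\<Psi> x) = x"
  shows "\<exists>P N. sets P = sets borel \<and> sets N = sets borel \<and> finite_measure P \<and> finite_measure N \<and>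
     (\<forall>\<phi>. test_function V \<phi> \<longrightarrow> (LINT y|lborel. w y * pd j \<phi> y) = (LINT y|P. \<phi> y) - (LINT y|N. \<phi> y))"
proof -
  let ?R = "cube c s" and ?J = "\<lambda>x. det (matrix (frechet_derivative \<Psi> (at x)))"
  have dif: "\<Psi> differentiable (at x)" if "x \<in> U" for x using \<Psi>(1) that by simp
  have \<Psi>c: "continuous_on U \<Psi>" by (rule Ck_on_continuous[OF \<Psi>(1)])
  have pdc: "continuous_on U (pd i \<Psi>)" for i using \<Psi>(1) by simp
  have pdkc: "continuous_on U (\<lambda>x. pd i \<Psi> x $ k)" for i k by (intro continuous_intros pdc)
  have Jc: "continuous_on U ?J" unfolding det_frechet by (intro continuous_intros pdkc)
  obtain \<sigma> where \<sigma>: "\<And>x. x \<in> ?R \<Longrightarrow> \<bar>?J x\<bar> = \<sigma> * ?J x"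
    using constant_sign_on_cube[OF continuous_on_subset[OF Jc c]] J c by blast
  have BV0: "BVC U c s (\<lambda>x. (-1) * (w (\<Psi> x) * pd m \<Psi> x $ k))" for m k
    by (intro BVC_mult BVC_const U c B)
  \<comment> \<open>Cramer's rule. The numbers \<phi>1 and \<phi>2 stand for the partial derivatives
    of a test function at \<Psi>(x), the brackets for those of its composition with \<Psi>; A1 and
    A2 are cofactors multiplied by w o \<Psi>.\<close>
  have "\<exists>A1 A2. BVC U c s A1 \<and> BVC U c s A2 \<and> (\<forall>x\<in>U. \<forall>\<phi>1 \<phi>2.
     ?J x * (w (\<Psi> x) * (if j = 1 then \<phi>1 else \<phi>2)) =
       A1 x * (\<phi>1 * pd 1 \<Psi> x $ 1 + \<phi>2 * pd 1 \<Psi> x $ 2) + A2 x * (\<phi>1 * pd 2 \<Psi> x $ 1 + \<phi>2 * pd 2 \<Psi> x $ 2))"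
  proof (cases "j = 1")
    case True
    then show ?thesis
      by (intro exI[of _ "\<lambda>x. w (\<Psi> x) * pd 2 \<Psi> x $ 2"] exI[of _ "\<lambda>x. (-1) * (w (\<Psi> x) * pd 1 \<Psi> x $ 2)"] conjI B BV0)
         (auto simp: det_frechet algebra_simps)
  next
    case False
    then show ?thesis
      by (intro exI[of _ "\<lambda>x. (-1) * (w (\<Psi> x) * pd 2 \<Psi> x $ 1)"] exI[of _ "\<lambda>x. w (\<Psi> x) * pd 1 \<Psi> x $ 1"] conjI B BV0)
         (auto simp: det_frechet algebra_simps)
  qed
  then obtain A1 A2 where A: "BVC U c s A1" "BVC U c s A2"
    "\<And>x \<phi>1 \<phi>2. x \<in> U \<Longrightarrow> ?J x * (w (\<Psi> x) * (if j = 1 then \<phi>1 else \<phi>2)) =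
       A1 x * (\<phi>1 * pd 1 \<Psi> x $ 1 + \<phi>2 * pd 1 \<Psi> x $ 2) + A2 x * (\<phi>1 * pd 2 \<Psi> x $ 1 + \<phi>2 * pd 2 \<Psi> x $ 2)"
    by blast
  obtain T1 where T1: "signed_rep c s T1" "\<And>\<phi> K. Ck_on 1 U \<phi> \<Longrightarrow> compact K \<Longrightarrow> K \<subseteq> interior ?R \<Longrightarrow> (\<And>x. x \<notin> K \<Longrightarrow> \<phi> x = 0) \<Longrightarrow>
     integral ?R (\<lambda>x. A1 x * pd 1 \<phi> x) = - T1 \<phi>"
    using BVC_integral_by_parts[OF A(1), of 1] by (elim exE conjE) (rule that, assumption, blast)
  obtain T2 where T2: "signed_rep c s T2" "\<And>\<phi> K. Ck_on 1 U \<phi> \<Longrightarrow> compact K \<Longrightarrow> K \<subseteq> interior ?R \<Longrightarrow> (\<And>x. x \<notin> K \<Longrightarrow> \<phi> x = 0) \<Longrightarrow>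
     integral ?R (\<lambda>x. A2 x * pd 2 \<phi> x) = - T2 \<phi>"
    using BVC_integral_by_parts[OF A(2), of 2] by (elim exE conjE) (rule that, assumption, blast)
  \<comment> \<open>Integration by parts contributes the minus sign and the change of variables the
    sign \<sigma> of the Jacobian; both are absorbed into the functional before it is pushed
    forward.\<close>
  have srep: "signed_rep c s (\<lambda>\<eta>. (T1 (\<lambda>x. (- \<sigma>) * \<eta> x)) + T2 (\<lambda>x. (- \<sigma>) * \<eta> x))"
    by (intro signed_rep_add signed_rep_mult[OF T1(1) U _ c] signed_rep_mult[OF T2(1) U _ c] continuous_on_const)
  have lin: "T (\<lambda>x. (- \<sigma>) * \<eta> x) = - \<sigma> * T \<eta>" if T: "signed_rep c s T" and \<eta>: "C0_cube c s \<eta>" for T \<eta>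
  proof -
    obtain P N where PN: "\<And>\<eta>. C0_cube c s \<eta> \<Longrightarrow> T \<eta> = (LINT x|P. \<eta> x) - (LINT x|N. \<eta> x)"
      by (rule signed_repE[OF T]) blast
    have C: "C0_cube c s (\<lambda>x. (- \<sigma>) * \<eta> x)" by (rule C0_mult[OF U continuous_on_const c \<eta>])
    show ?thesis unfolding PN[OF C] PN[OF \<eta>] by (simp add: algebra_simps)
  qed
  obtain P N where PN: "sets P = sets borel" "sets N = sets borel" "finite_measure P" "finite_measure N"
    "\<And>\<phi> \<eta>. \<phi> \<in> borel_measurable borel \<and> C0_cube c s \<eta> \<and> (\<forall>x\<in>?R. \<eta> x = \<phi> (\<Psi> x)) \<Longrightarrow>
        T1 (\<lambda>x. (- \<sigma>) * \<eta> x) + T2 (\<lambda>x. (- \<sigma>) * \<eta> x) = (LINT y|P. \<phi> y) - (LINT y|N. \<phi> y)"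
    using signed_rep_push[OF srep continuous_on_subset[OF \<Psi>c c]] by blast
  have "(LINT y|lborel. w y * pd j \<phi> y) = (LINT y|P. \<phi> y) - (LINT y|N. \<phi> y)" if t: "test_function V \<phi>" for \<phi>
  proof -
    obtain K where K: "compact K" "K \<subseteq> V" "\<And>x. x \<notin> K \<Longrightarrow> \<phi> x = 0" using test_functionE[OF t] by metis
    have KU': "K \<subseteq> U'" using K(2) V(2) interior_subset[of ?R] c \<Psi>(3) by blast
    define L where "L = \<Phi> ` K"
    have Lc: "compact L" unfolding L_def by (rule compact_continuous_image[OF continuous_on_subset[OF \<Phi>(1) KU'] K(1)])
    have LI: "L \<subseteq> interior ?R"
    proof
      fix x assume "x \<in> L"
      then obtain y where y: "y \<in> K" "x = \<Phi> y" by (auto simp: L_def)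
      then obtain z where "z \<in> interior ?R" "y = \<Psi> z" using K(2) V(2) by blast
      then show "x \<in> interior ?R" using y \<Phi>(2) interior_subset[of ?R] c by auto
    qed
    \<comment> \<open>The composition is extended by zero, which is continuous because its support
      is carried by the compact set \<open>L\<close> inside \<open>U\<close>. It is only C^1, as
      \<Psi> is.\<close>
    define \<eta> where "\<eta> x = (if x \<in> U then \<phi> (\<Psi> x) else 0)" for x
    have \<eta>out: "\<eta> x = 0" if "x \<notin> L" for x
    proof (cases "x \<in> U")
      case True
      have "\<Psi> x \<notin> K"
      proof
        assume "\<Psi> x \<in> K"
        then have "\<Phi> (\<Psi> x) \<in> L" by (simp add: L_def)
        with \<Phi>(2)[OF True] that show False by simp
      qed
      then show ?thesis using K(3) by (simp add: \<eta>_def)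
    qed (simp add: \<eta>_def)
    have \<phi>d: "\<phi> differentiable (at y)" for y using test_functionD(3)[OF t, of 1] by simp
    have \<phi>pc: "continuous_on UNIV (pd i \<phi>)" for i using test_functionD(3)[OF t, of 1] by simp
    have chain: "(\<lambda>x. \<phi> (\<Psi> x)) differentiable (at x)"
      "pd i (\<lambda>x. \<phi> (\<Psi> x)) x = pd 1 \<phi> (\<Psi> x) * pd i \<Psi> x $ 1 + pd 2 \<phi> (\<Psi> x) * pd i \<Psi> x $ 2" if "x \<in> U" for x i
      by (rule pd_chain[OF dif[OF that] \<phi>d])+
    have comp: "Ck_on 1 U (\<lambda>x. \<phi> (\<Psi> x))"
    proof -
      have "continuous_on U (\<lambda>x. pd 1 \<phi> (\<Psi> x) * pd i \<Psi> x $ 1 + pd 2 \<phi> (\<Psi> x) * pd i \<Psi> x $ 2)" for i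
        by (intro continuous_intros pdc continuous_on_compose2[OF \<phi>pc \<Psi>c]) auto
      then have "continuous_on U (pd i (\<lambda>x. \<phi> (\<Psi> x)))" for i
        by (rule continuous_on_eq) (simp add: chain(2))
      with chain(1) show ?thesis by simp
    qed
    have \<eta>C: "Ck_on 1 U \<eta>"
      by (rule Ck_on_cong[OF U, THEN iffD1, OF _ comp]) (simp add: \<eta>_def)
    have p\<eta>: "pd i \<eta> x = pd 1 \<phi> (\<Psi> x) * pd i \<Psi> x $ 1 + pd 2 \<phi> (\<Psi> x) * pd i \<Psi> x $ 2" if "x \<in> U" for x i
      using pd_cong[OF U that, of \<eta> "\<lambda>x. \<phi> (\<Psi> x)" i] chain(2)[OF that] by (simp add: \<eta>_def)
    have LU: "L \<subseteq> U" using LI interior_subset c by blast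
    have \<eta>c: "continuous_on UNIV \<eta>"
    proof -
      have "continuous_on (U \<union> - L) \<eta>"
        by (rule continuous_on_open_Un)
           (use U Lc Ck_on_continuous[OF \<eta>C] \<eta>out in \<open>auto intro: continuous_on_eq[of _ "\<lambda>x. 0"] compact_imp_closed\<close>)
      moreover have "U \<union> - L = UNIV" using LU by auto
      ultimately show ?thesis by simp
    qed
    have \<eta>0: "C0_cube c s \<eta>"
      unfolding C0_cube_def using \<eta>c \<eta>out LI interior_subset[of ?R] by blast
    let ?f = "\<lambda>y. w y * pd j \<phi> y"
    have pout: "pd j \<phi> y = 0" if "y \<notin> K" for y
      using K that by (intro pd_eq_0_outside[of K]) (auto intro: compact_imp_closed)
    have fc: "continuous_on UNIV ?f" by (rule continuous_on_extend_0[OF U' w \<phi>pc K(1) KU' pout])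
    have fi: "integrable lborel ?f" by (rule integrable_continuous_compact[OF fc K(1)]) (simp add: pout)
    have KR: "K \<subseteq> \<Psi> ` ?R" using K(2) V(2) interior_subset[of ?R] by blast
    have "(LINT y|lborel. ?f y) = integral UNIV ?f"
      using has_integral_integral_lborel[OF fi] by (simp add: integral_unique)
    also have "\<dots> = integral UNIV (\<lambda>y. if y \<in> \<Psi> ` ?R then ?f y else 0)"
      by (rule Henstock_Kurzweil_Integration.integral_cong) (use KR pout in auto)
    also have "\<dots> = integral (\<Psi> ` ?R) ?f" by (rule integral_restrict_UNIV)
    also have "\<dots> = integral ?R (\<lambda>x. \<bar>?J x\<bar> * ?f (\<Psi> x))"
    proof (rule integral_change_of_variables_real(2))
      show "?R \<in> sets lebesgue" by (rule compact_imp_lebesgue[OF compact_cube])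
      show "(\<Psi> has_derivative frechet_derivative \<Psi> (at x)) (at x within ?R)" if "x \<in> ?R" for x
        using dif c that frechet_derivative_works has_derivative_at_withinI by blast
      show "inj_on \<Psi> ?R" by (rule inj_on_subset[OF \<Psi>(2) c])
      have "compact (\<Psi> ` ?R)" by (intro compact_continuous_image continuous_on_subset[OF \<Psi>c c]) simp
      then show "?f absolutely_integrable_on \<Psi> ` ?R"
        by (intro absolutely_integrable_on_compact continuous_on_subset[OF fc]) auto
    qed
    also have "\<dots> = integral ?R (\<lambda>x. \<sigma> * (A1 x * pd 1 \<eta> x + A2 x * pd 2 \<eta> x))"
    proof (rule Henstock_Kurzweil_Integration.integral_cong)
      fix x assume x: "x \<in> ?R"
      then have xU: "x \<in> U" using c by blast
      have "pd j \<phi> (\<Psi> x) = (if j = 1 then pd 1 \<phi> (\<Psi> x) else pd 2 \<phi> (\<Psi> x))"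
        using exhaust_2[of j] by auto
      then have "\<bar>?J x\<bar> * ?f (\<Psi> x) = \<sigma> * (?J x * (w (\<Psi> x) * (if j = 1 then pd 1 \<phi> (\<Psi> x) else pd 2 \<phi> (\<Psi> x))))"
        unfolding \<sigma>[OF x] by simp
      then show "\<bar>?J x\<bar> * ?f (\<Psi> x) = \<sigma> * (A1 x * pd 1 \<eta> x + A2 x * pd 2 \<eta> x)"
        unfolding A(3)[OF xU] p\<eta>[OF xU] .
    qed
    also have "\<dots> = \<sigma> * (integral ?R (\<lambda>x. A1 x * pd 1 \<eta> x) + integral ?R (\<lambda>x. A2 x * pd 2 \<eta> x))"
    proof -
      have cU: "continuous_on U A1" "continuous_on U A2" "continuous_on U (pd i \<eta>)" for i
        using A(1,2) \<eta>C by (auto simp: BVC_def)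
      have cc: "continuous_on ?R A1" "continuous_on ?R A2" "continuous_on ?R (pd i \<eta>)" for i
        by (rule continuous_on_subset[OF cU(1) c], rule continuous_on_subset[OF cU(2) c], rule continuous_on_subset[OF cU(3) c])
      have "integral ?R (\<lambda>x. A1 x * pd 1 \<eta> x + A2 x * pd 2 \<eta> x) = integral ?R (\<lambda>x. A1 x * pd 1 \<eta> x) + integral ?R (\<lambda>x. A2 x * pd 2 \<eta> x)"
        by (intro Henstock_Kurzweil_Integration.integral_add integrable_on_cube continuous_on_mult cc)
      then show ?thesis by simp
    qed
    also have "\<dots> = - \<sigma> * T1 \<eta> + - \<sigma> * T2 \<eta>"
    proof -
      have "integral ?R (\<lambda>x. A1 x * pd 1 \<eta> x) = - T1 \<eta>" by (rule T1(2)[OF \<eta>C Lc LI]) (rule \<eta>out)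
      moreover have "integral ?R (\<lambda>x. A2 x * pd 2 \<eta> x) = - T2 \<eta>" by (rule T2(2)[OF \<eta>C Lc LI]) (rule \<eta>out)
      ultimately show ?thesis by (simp add: right_diff_distrib)
    qed
    also have "\<dots> = T1 (\<lambda>x. (- \<sigma>) * \<eta> x) + T2 (\<lambda>x. (- \<sigma>) * \<eta> x)"
      by (simp only: lin[OF T1(1) \<eta>0] lin[OF T2(1) \<eta>0])
    also have "\<dots> = (LINT y|P. \<phi> y) - (LINT y|N. \<phi> y)"
      using c by (intro PN(5) conjI test_functionD(2)[OF t] \<eta>0) (auto simp: \<eta>_def)
    finally show ?thesis .
  qed
  then show ?thesis
    by (intro exI[of _ P] exI[of _ N] conjI allI impI PN(1-4))
qed

section \<open>Graphs over a diffeomorphic domain\<close>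

lemma C1_diffeomorphism_det:
  assumes "C1_diffeomorphism U U' \<Psi> \<Phi>" "x \<in> U"
  shows "det (matrix (frechet_derivative \<Psi> (at x))) \<noteq> 0"
proof -
  have U: "open U" and h: "homeomorphism U U' \<Psi> \<Phi>" and C: "Ck_on 1 U \<Psi>" "Ck_on 1 U' \<Phi>"
    using assms(1) by (auto simp: C1_diffeomorphism_def)
  have y: "\<Psi> x \<in> U'" using h assms(2) by (auto simp: homeomorphism_def)
  have d: "(\<Psi> has_derivative frechet_derivative \<Psi> (at x)) (at x)"
    "(\<Phi> has_derivative frechet_derivative \<Phi> (at (\<Psi> x))) (at (\<Psi> x))"
    using C assms(2) y by (simp_all flip: frechet_derivative_works)
  have "((\<lambda>x. \<Phi> (\<Psi> x)) has_derivative (\<lambda>w. frechet_derivative \<Phi> (at (\<Psi> x)) (frechet_derivative \<Psi> (at x) w))) (at x)"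
    by (rule has_derivative_compose[OF d(1), of \<Phi>]) (use d(2) in simp)
  then have "((\<lambda>x. x) has_derivative (\<lambda>w. frechet_derivative \<Phi> (at (\<Psi> x)) (frechet_derivative \<Psi> (at x) w))) (at x)"
    by (rule has_derivative_transform_within_open[OF _ U assms(2)]) (use h in \<open>auto simp: homeomorphism_def\<close>)
  then have "frechet_derivative \<Phi> (at (\<Psi> x)) \<circ> frechet_derivative \<Psi> (at x) = id"
    using has_derivative_unique[OF _ has_derivative_ident] by (simp add: o_def id_def)
  then have "matrix (frechet_derivative \<Phi> (at (\<Psi> x))) ** matrix (frechet_derivative \<Psi> (at x)) = mat 1"
    using matrix_compose[OF has_derivative_linear[OF d(1)] has_derivative_linear[OF d(2)]]
    by (simp add: matrix_id_mat_1)
  then have "det (matrix (frechet_derivative \<Phi> (at (\<Psi> x)))) * det (matrix (frechet_derivative \<Psi> (at x))) = 1"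
    by (metis det_I det_mul)
  then show ?thesis by auto
qed

lemma Ck_on_1_compose:
  fixes v :: "plane \<Rightarrow> real" and \<Psi> :: "plane \<Rightarrow> plane"
  assumes v: "Ck_on 1 W v" and \<Psi>: "Ck_on 1 U \<Psi>" and im: "\<Psi> ` U \<subseteq> W"
  shows "Ck_on 1 U (\<lambda>x. v (\<Psi> x))"
proof -
  have \<Psi>c: "continuous_on U \<Psi>" by (rule Ck_on_continuous[OF \<Psi>])
  have d: "\<Psi> differentiable (at x)" "v differentiable (at (\<Psi> x))" if "x \<in> U" for x
    using v \<Psi> im that by auto
  have pc: "continuous_on U (pd i \<Psi>)" "continuous_on W (pd i v)" for i using v \<Psi> by auto
  have "continuous_on U (\<lambda>x. pd 1 v (\<Psi> x) * pd i \<Psi> x $ 1 + pd 2 v (\<Psi> x) * pd i \<Psi> x $ 2)" for i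
    by (intro continuous_intros pc continuous_on_compose2[OF pc(2) \<Psi>c im])
  then have "continuous_on U (pd i (\<lambda>x. v (\<Psi> x)))" for i
    by (rule continuous_on_eq) (simp add: pd_chain(2)[OF d])
  then show ?thesis using pd_chain(1)[OF d] by simp
qed

lemma C1_diffeomorphism_transported_pd:
  fixes f v :: "plane \<Rightarrow> real"
  assumes D: "C1_diffeomorphism U U' \<Psi> \<Phi>" and v: "Ck_on 1 U v" and f: "\<And>y. y \<in> U' \<Longrightarrow> f y = v (\<Phi> y)"
  shows "Ck_on 1 U' f" "x \<in> U \<Longrightarrow> pd i v x = pd 1 f (\<Psi> x) * pd i \<Psi> x $ 1 + pd 2 f (\<Psi> x) * pd i \<Psi> x $ 2"
proof -
  have U: "open U" "open U'" and h: "homeomorphism U U' \<Psi> \<Phi>" and C: "Ck_on 1 U \<Psi>" "Ck_on 1 U' \<Phi>"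
    using D by (auto simp: C1_diffeomorphism_def)
  have "Ck_on 1 U' (\<lambda>y. v (\<Phi> y))"
    by (rule Ck_on_1_compose[OF v C(2)]) (use h in \<open>auto simp: homeomorphism_def\<close>)
  then show fC: "Ck_on 1 U' f"
    using Ck_on_cong[OF U(2), of f "\<lambda>y. v (\<Phi> y)" 1] f by simp
  assume x: "x \<in> U"
  have "\<Psi> x \<in> U'" using h x by (auto simp: homeomorphism_def)
  then have d: "\<Psi> differentiable (at x)" "f differentiable (at (\<Psi> x))" using C fC x by auto
  have "f (\<Psi> z) = v z" if "z \<in> U" for z
    using h that f by (auto simp: homeomorphism_def)
  then have "pd i (\<lambda>z. f (\<Psi> z)) x = pd i v x" by (intro pd_cong[OF U(1) x])
  with pd_chain(2)[OF d] show "pd i v x = pd 1 f (\<Psi> x) * pd i \<Psi> x $ 1 + pd 2 f (\<Psi> x) * pd i \<Psi> x $ 2" by simp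
qed

lemma hessian_rep_graph:
  fixes f v :: "plane \<Rightarrow> real"
  assumes D: "C1_diffeomorphism U U' \<Psi> \<Phi>" and v: "Ck_on 1 U v" and f: "\<And>y. y \<in> U' \<Longrightarrow> f y = v (\<Phi> y)"
    and hv: "\<And>i j. \<exists>P N. hessian_rep U v i j P N"
    and h\<Psi>: "\<And>k i j. \<exists>P N. hessian_rep U (\<lambda>x. \<Psi> x $ k) i j P N"
  shows "\<exists>P N. hessian_rep U' f i j P N"
proof -
  have U: "open U" "open U'" and h: "homeomorphism U U' \<Psi> \<Phi>" and C: "Ck_on 1 U \<Psi>" "Ck_on 1 U' \<Phi>"
    using D by (auto simp: C1_diffeomorphism_def)
  have \<Phi>: "\<Phi> y \<in> U" "\<Psi> (\<Phi> y) = y" if "y \<in> U'" for y using h that by (auto simp: homeomorphism_def)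
  have \<Psi>: "\<Psi> x \<in> U'" "\<Phi> (\<Psi> x) = x" if "x \<in> U" for x using h that by (auto simp: homeomorphism_def)
  have \<Phi>c: "continuous_on U' \<Phi>" by (rule Ck_on_continuous[OF C(2)])
  have fC: "Ck_on 1 U' f" by (rule C1_diffeomorphism_transported_pd(1)[OF D v f])
  have fc: "continuous_on U' f" by (rule Ck_on_continuous[OF fC])
  have \<Psi>k: "Ck_on 1 U (\<lambda>x. \<Psi> x $ k)" for k by (rule Ck_on_component[OF U(1) C(1)])
  have pk: "pd m (\<lambda>x. \<Psi> x $ k) x = pd m \<Psi> x $ k" if "x \<in> U" for m k x
    using C(1) that by (intro pd_component) auto
  let ?J = "\<lambda>x. pd 1 \<Psi> x $ 1 * pd 2 \<Psi> x $ 2 - pd 2 \<Psi> x $ 1 * pd 1 \<Psi> x $ 2"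
  have J: "?J x \<noteq> 0" if "x \<in> U" for x
    using C1_diffeomorphism_det[OF D that] unfolding det_frechet .
  show ?thesis
  proof (rule glue_hessian[OF U(2) fc])
    fix y assume y: "y \<in> U'"
    obtain t where t: "t > 0" "cube (\<Phi> y) t \<subseteq> U" using open_contains_cube[OF U(1) \<Phi>(1)[OF y]] .
    \<comment> \<open>Half the side is given up as the margin that \<open>BVC_of_weak_pd\<close>
      requires around the square.\<close>
    define s where "s = t / 2"
    have s: "s > 0" "cube (\<Phi> y) (s + s) \<subseteq> U" "cube (\<Phi> y) s \<subseteq> U"
      using t cube_mono[of s t "\<Phi> y"] by (auto simp: s_def)
    have BV: "BVC U (\<Phi> y) s (pd m q)" if q: "Ck_on 1 U q" and hq: "\<And>i j. \<exists>P N. hessian_rep U q i j P N" for q m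
    proof -
      obtain P N where "\<And>j. hessian_rep U q m j (P j) (N j)" using hq by metis
      then have "weak_pd j U (pd m q) (P j) (N j)" for j using hessian_rep_iff_weak_pd[OF U(1) q] by blast
      moreover have "continuous_on U (pd m q)" using q by simp
      ultimately show ?thesis using BVC_of_weak_pd[OF U(1) _ _ s(1) s(1) s(2)] by blast
    qed
    have bv: "BVC U (\<Phi> y) s (pd m v)" for m by (rule BV[OF v hv])
    have bp: "BVC U (\<Phi> y) s (\<lambda>x. pd m \<Psi> x $ k)" for m k
      by (rule BVC_cong[OF BV[OF \<Psi>k h\<Psi>]]) (rule pk)
    have bJ: "BVC U (\<Phi> y) s (\<lambda>x. inverse (?J x))"
      by (intro BVC_inverse BVC_diff BVC_mult bp) (use J in auto)
    \<comment> \<open>The chain rule for v = f o \<Psi> is a linear system for the two partial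
      derivatives of \<open>f\<close>; Cramer's rule solves it with denominator
      \<open>?J\<close>.\<close>
    have b1: "BVC U (\<Phi> y) s (\<lambda>x. pd i f (\<Psi> x))"
    proof (cases "i = 1")
      case True
      have "BVC U (\<Phi> y) s (\<lambda>x. (pd 1 v x * pd 2 \<Psi> x $ 2 - pd 2 v x * pd 1 \<Psi> x $ 2) * inverse (?J x))"
        by (intro BVC_mult BVC_diff bv bp bJ)
      then show ?thesis
        by (rule BVC_cong) (use J in \<open>simp add: True C1_diffeomorphism_transported_pd(2)[OF D v f] field_simps\<close>)
    next
      case False
      then have "i = 2" using exhaust_2 by blast
      have "BVC U (\<Phi> y) s (\<lambda>x. (pd 2 v x * pd 1 \<Psi> x $ 1 - pd 1 v x * pd 2 \<Psi> x $ 1) * inverse (?J x))"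
        by (intro BVC_mult BVC_diff bv bp bJ)
      then show ?thesis
        by (rule BVC_cong) (use J in \<open>simp add: \<open>i = 2\<close> C1_diffeomorphism_transported_pd(2)[OF D v f] field_simps\<close>)
    qed
    define V where "V = U' \<inter> \<Phi> -` interior (cube (\<Phi> y) s)"
    have Vo: "open V" unfolding V_def by (intro continuous_open_preimage \<Phi>c U(2)) auto
    have Vs: "V \<subseteq> \<Psi> ` interior (cube (\<Phi> y) s)"
    proof
      fix z assume "z \<in> V"
      then have "z = \<Psi> (\<Phi> z)" "\<Phi> z \<in> interior (cube (\<Phi> y) s)" using \<Phi> by (auto simp: V_def)
      then show "z \<in> \<Psi> ` interior (cube (\<Phi> y) s)" by blast
    qed
    have yV: "y \<in> V"
    proof -
      have "ball (\<Phi> y) s \<subseteq> cube (\<Phi> y) s" using cball_subset_cube[of "\<Phi> y" s] ball_subset_cball by blast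
      then have "\<Phi> y \<in> interior (cube (\<Phi> y) s)"
        using s(1) by (intro interiorI[of "ball (\<Phi> y) s"]) auto
      then show ?thesis using y by (simp add: V_def)
    qed
    have wc: "continuous_on U' (pd i f)" using fC by simp
    have inj: "inj_on \<Psi> U" "\<Psi> ` U = U'"
      using h by (auto simp: homeomorphism_def intro: inj_on_inverseI[of _ \<Phi>])
    obtain P N where PN: "sets P = sets borel" "sets N = sets borel" "finite_measure P" "finite_measure N"
      "\<And>\<phi>. test_function V \<phi> \<Longrightarrow> (LINT y|lborel. pd i f y * pd j \<phi> y) = (LINT y|P. \<phi> y) - (LINT y|N. \<phi> y)"
      using weak_pd_transport[OF U C(1) inj C1_diffeomorphism_det[OF D] wc s(3) BVC_mult[OF b1 bp] Vo Vs \<Phi>c \<Psi>(2), where j=j] by blast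
    \<comment> \<open>The integration by parts that moves one derivative to \<open>f\<close> changes
      the sign, so the two measures swap their roles.\<close>
    have "(LINT x|lborel. f x * pd i (pd j \<phi>) x) = (LINT y|N. \<phi> y) - (LINT y|P. \<phi> y)" if tf: "test_function V \<phi>" for \<phi>
    proof -
      obtain K where K: "compact K" "K \<subseteq> V" "\<And>x. x \<notin> K \<Longrightarrow> pd j \<phi> x = 0"
        using test_functionE[OF test_function_pd[OF tf]] by metis
      have "Ck_on 1 U' (pd j \<phi>)"
        by (rule Ck_on_subset[OF test_functionD(3)[OF test_function_pd[OF tf]]]) simp
      moreover have "K \<subseteq> U'" using K(2) by (auto simp: V_def)
      ultimately have "(LINT x|lborel. f x * pd i (pd j \<phi>) x) = - (LINT x|lborel. pd i f x * pd j \<phi> x)"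
        by (intro integral_by_parts[OF U(2) fC _ K(1)] K(3))
      then show ?thesis using PN(5)[OF tf] by simp
    qed
    then show "\<exists>V P N. open V \<and> y \<in> V \<and> V \<subseteq> U' \<and> sets P = sets borel \<and> sets N = sets borel \<and>
       finite_measure P \<and> finite_measure N \<and>
       (\<forall>\<phi>. test_function V \<phi> \<longrightarrow> (LINT x|lborel. f x * pd i (pd j \<phi>) x) = (LINT y|P. \<phi> y) - (LINT y|N. \<phi> y))"
      using Vo yV PN(1-4) by (intro exI[of _ V] exI[of _ N] exI[of _ P]) (auto simp: V_def)
  qed
qed

section \<open>The Gauss curvature in terms of the metric\<close>

lemma matrix_inv_2:
  fixes A :: "real ^ 2 ^ 2"
  assumes "det A \<noteq> 0"
  shows "matrix_inv A $ 1 $ 1 = A $ 2 $ 2 / det A" "matrix_inv A $ 1 $ 2 = - A $ 1 $ 2 / det A"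
    "matrix_inv A $ 2 $ 1 = - A $ 2 $ 1 / det A" "matrix_inv A $ 2 $ 2 = A $ 1 $ 1 / det A"
proof -
  define B :: "real ^ 2 ^ 2" where
    "B = (\<chi> i j. (if i = 1 then if j = 1 then A $ 2 $ 2 else - A $ 1 $ 2 else if j = 1 then - A $ 2 $ 1 else A $ 1 $ 1) / det A)"
  define d where "d = det A"
  have d: "d \<noteq> 0" "A $ 1 $ 1 * A $ 2 $ 2 = d + A $ 1 $ 2 * A $ 2 $ 1" using assms by (simp_all add: d_def det_2)
  have AB: "A ** B = mat 1"
    unfolding B_def d_def[symmetric]
    by (simp add: vec_eq_iff matrix_matrix_mult_def mat_def forall_2 sum_2 d(1)
        flip: add_divide_distrib diff_divide_distrib) (use d in \<open>simp add: algebra_simps\<close>)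
  then have BA: "B ** A = mat 1" by (simp add: matrix_left_right_inverse)
  have "A ** matrix_inv A = mat 1"
    unfolding matrix_inv_def by (rule someI2[where a=B]) (auto simp: AB BA)
  then have "matrix_inv A = B"
    by (metis BA matrix_mul_assoc matrix_mul_lid matrix_mul_rid)
  then show "matrix_inv A $ 1 $ 1 = A $ 2 $ 2 / det A" "matrix_inv A $ 1 $ 2 = - A $ 1 $ 2 / det A"
    "matrix_inv A $ 2 $ 1 = - A $ 2 $ 1 / det A" "matrix_inv A $ 2 $ 2 = A $ 1 $ 1 / det A"
    by (auto simp: B_def)
qed

text \<open>Christoffel symbols of the first kind, with the lowered index \<open>k\<close> in the
  place of the upper index of \<open>christoffel\<close>.\<close>

definition christoffel_lower :: "(plane \<Rightarrow> real ^ 2 ^ 2) \<Rightarrow> 2 \<Rightarrow> 2 \<Rightarrow> 2 \<Rightarrow> plane \<Rightarrow> real" where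
  "christoffel_lower g k i j x =
     (pd i (\<lambda>y. g y $ j $ k) x + pd j (\<lambda>y. g y $ i $ k) x - pd k (\<lambda>y. g y $ i $ j) x) / 2"

text \<open>The part of the fully covariant curvature component that contains second derivatives of
  the metric. It equals d_1 \<Gamma>_{1,22} - d_2 \<Gamma>_{1,12} for the symbols of the first
  kind.\<close>

definition curvature_second_order :: "(plane \<Rightarrow> real ^ 2 ^ 2) \<Rightarrow> plane \<Rightarrow> real" where
  "curvature_second_order g x = pd 1 (pd 2 (\<lambda>y. g y $ 1 $ 2)) x
     - pd 1 (pd 1 (\<lambda>y. g y $ 2 $ 2)) x / 2 - pd 2 (pd 2 (\<lambda>y. g y $ 1 $ 1)) x / 2"

lemma riemannian_metric_entries:
  assumes U: "open U" and g: "riemannian_metric_on U g"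
  shows "Ck_on k U (\<lambda>y. g y $ i $ j)"
    and "x \<in> U \<Longrightarrow> g x $ i $ j = g x $ j $ i" and "x \<in> U \<Longrightarrow> det (g x) > 0"
proof -
  show "Ck_on k U (\<lambda>y. g y $ i $ j)"
    using g by (intro Ck_on_component[OF U] Ck_on_component[OF U]) (auto simp: riemannian_metric_on_def smooth_on_def)
  assume x: "x \<in> U"
  then have sym: "transpose (g x) = g x" and pos: "\<And>\<xi>. \<xi> \<noteq> 0 \<Longrightarrow> \<xi> \<bullet> (g x *v \<xi>) > 0"
    using g by (auto simp: riemannian_metric_on_def)
  have s: "g x $ i $ j = g x $ j $ i" for i j
    using arg_cong[OF sym, of "\<lambda>A. A $ j $ i"] by (simp add: transpose_def)
  then show "g x $ i $ j = g x $ j $ i" .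
  have "(axis 1 1 :: plane) \<noteq> 0" by (simp add: axis_eq_0_iff)
  from pos[OF this] have a: "g x $ 1 $ 1 > 0"
    by (simp add: inner_plane matrix_vector_mult_def sum_2)
  \<comment> \<open>On this vector the quadratic form takes the value g_11 det g, so positivity of
    g_11 transfers to the determinant.\<close>
  let ?\<xi> = "pt (- g x $ 1 $ 2) (g x $ 1 $ 1)"
  have "?\<xi> \<noteq> 0" using a by (metis order_less_irrefl pt_nth(2) zero_index)
  from pos[OF this] have "g x $ 1 $ 1 * det (g x) > 0"
    using s[of 1 2] by (simp add: inner_plane matrix_vector_mult_def sum_2 det_2 algebra_simps)
  then show "det (g x) > 0" using a by (simp add: zero_less_mult_iff)
qed

lemma christoffel_eq:
  assumes "det (g x) \<noteq> 0"
  shows "christoffel g 1 i j x = (g x $ 2 $ 2 * christoffel_lower g 1 i j x - g x $ 1 $ 2 * christoffel_lower g 2 i j x) / det (g x)"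
    "christoffel g 2 i j x = (g x $ 1 $ 1 * christoffel_lower g 2 i j x - g x $ 2 $ 1 * christoffel_lower g 1 i j x) / det (g x)"
  using assms by (simp_all add: christoffel_def christoffel_lower_def matrix_inv_2 sum_2 field_simps)

text \<open>Multiplication by the square of the determinant clears the inverse metric and leaves a
  polynomial identity in the metric, its second order part and the symbols of the first kind, the
  form in which the embedding enters.\<close>

lemma gauss_curvature_eq:
  assumes U: "open U" and g: "riemannian_metric_on U g" and x: "x \<in> U"
  shows "gauss_curvature g x * (det (g x))\<^sup>2 = det (g x) * curvature_second_order g x
    - (g x $ 2 $ 2 * (christoffel_lower g 1 1 1 x * christoffel_lower g 1 2 2 x - (christoffel_lower g 1 1 2 x)\<^sup>2)
     - g x $ 1 $ 2 * (christoffel_lower g 1 1 1 x * christoffel_lower g 2 2 2 x + christoffel_lower g 2 1 1 x * christoffel_lower g 1 2 2 x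
          - 2 * christoffel_lower g 1 1 2 x * christoffel_lower g 2 1 2 x)
     + g x $ 1 $ 1 * (christoffel_lower g 2 1 1 x * christoffel_lower g 2 2 2 x - (christoffel_lower g 2 1 2 x)\<^sup>2))"
proof -
  note entries = riemannian_metric_entries[OF U g]
  let ?d = "det (g x)"
  have C: "Ck_on k U (pd m (\<lambda>y. g y $ i $ j))" for k m i j
    using entries(1)[of "Suc k" i j] by simp
  have dg: "(\<lambda>y. g y $ i $ j) differentiable (at x)" "pd m (\<lambda>y. g y $ i $ j) differentiable (at x)" for i j m
    using entries(1)[of 1 i j] C[of 1 m i j] x by auto
  have lowerC: "Ck_on 1 U (christoffel_lower g k i j)" for k i j
  proof -
    have "Ck_on 1 U (\<lambda>y. (pd i (\<lambda>y. g y $ j $ k) y + pd j (\<lambda>y. g y $ i $ k) y - pd k (\<lambda>y. g y $ i $ j) y) * (1 / 2))"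
      by (intro Ck_on_mult Ck_on_diff Ck_on_add C Ck_on_const U)
    then show ?thesis by (simp add: christoffel_lower_def[abs_def])
  qed
  have dC: "Ck_on 1 U (\<lambda>y. inverse (det (g y)))"
    unfolding det_2 by (intro Ck_on_inverse Ck_on_diff Ck_on_mult entries(1) U)
      (use entries(3) in \<open>force simp: det_2\<close>)
  have chC: "Ck_on 1 U (christoffel g k i j)" for k i j
  proof -
    have c: "Ck_on 1 U (\<lambda>y. (g y $ 2 $ 2 * christoffel_lower g 1 i j y - g y $ 1 $ 2 * christoffel_lower g 2 i j y) * inverse (det (g y)))"
      "Ck_on 1 U (\<lambda>y. (g y $ 1 $ 1 * christoffel_lower g 2 i j y - g y $ 2 $ 1 * christoffel_lower g 1 i j y) * inverse (det (g y)))"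
      by (intro Ck_on_mult Ck_on_diff entries(1) lowerC dC U)+
    have "Ck_on 1 U (christoffel g 1 i j)"
      by (rule Ck_on_cong[OF U, THEN iffD1, OF _ c(1)]) (use entries(3) in \<open>force simp: christoffel_eq divide_inverse\<close>)
    moreover have "Ck_on 1 U (christoffel g 2 i j)"
      by (rule Ck_on_cong[OF U, THEN iffD1, OF _ c(2)]) (use entries(3) in \<open>force simp: christoffel_eq divide_inverse\<close>)
    ultimately have "Ck_on 1 U (christoffel g 1 i j)" "Ck_on 1 U (christoffel g 2 i j)" .
    then show ?thesis using exhaust_2[of k] by auto
  qed
  have dch: "christoffel g k i j differentiable (at x)" for k i j using chC[of k i j] x by simp
  have ch: "det (g y) * christoffel g 1 i j y = g y $ 2 $ 2 * christoffel_lower g 1 i j y - g y $ 1 $ 2 * christoffel_lower g 2 i j y"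
    "det (g y) * christoffel g 2 i j y = g y $ 1 $ 1 * christoffel_lower g 2 i j y - g y $ 1 $ 2 * christoffel_lower g 1 i j y"
    if "y \<in> U" for y i j
    using entries(2)[OF that, of 2 1] entries(3)[OF that] by (simp_all add: christoffel_eq)
  have low: "g y $ l $ 1 * christoffel g 1 i j y + g y $ l $ 2 * christoffel g 2 i j y = christoffel_lower g l i j y"
    if "y \<in> U" for y l i j
  proof -
    have d: "g y $ 2 $ 1 = g y $ 1 $ 2" "det (g y) \<noteq> 0" using entries(2)[OF that, of 2 1] entries(3)[OF that] by simp_all
    have "det (g y) * (g y $ l $ 1 * christoffel g 1 i j y + g y $ l $ 2 * christoffel g 2 i j y)
      = g y $ l $ 1 * (det (g y) * christoffel g 1 i j y) + g y $ l $ 2 * (det (g y) * christoffel g 2 i j y)"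
      by (simp add: algebra_simps)
    also have "\<dots> = det (g y) * christoffel_lower g l i j y"
      unfolding ch[OF that] using exhaust_2[of l] d(1) by (auto simp: det_2 algebra_simps)
    finally show ?thesis using d(2) by simp
  qed
  \<comment> \<open>Differentiating the relation that lowers the index avoids computing derivatives
    of the inverse metric.\<close>
  have dlow: "g x $ l $ 1 * pd m (christoffel g 1 i j) x + g x $ l $ 2 * pd m (christoffel g 2 i j) x
      = pd m (christoffel_lower g l i j) x - pd m (\<lambda>y. g y $ l $ 1) x * christoffel g 1 i j x
        - pd m (\<lambda>y. g y $ l $ 2) x * christoffel g 2 i j x" for m l i j
  proof -
    have "pd m (christoffel_lower g l i j) x
      = pd m (\<lambda>y. g y $ l $ 1 * christoffel g 1 i j y + g y $ l $ 2 * christoffel g 2 i j y) x"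
      by (rule pd_cong[OF U x]) (simp add: low)
    then show ?thesis by (simp add: pd_add pd_mult dg dch)
  qed
  have sym: "pd m (\<lambda>y. g y $ 2 $ 1) y = pd m (\<lambda>y. g y $ 1 $ 2) y" if "y \<in> U" for m y
    by (rule pd_cong[OF U that]) (rule entries(2))
  have sym2: "pd m (pd n (\<lambda>y. g y $ 2 $ 1)) x = pd m (pd n (\<lambda>y. g y $ 1 $ 2)) x" for m n
    by (rule pd_cong[OF U x]) (rule sym)
  have second: "pd 1 (christoffel_lower g 1 2 2) x - pd 2 (christoffel_lower g 1 1 2) x = curvature_second_order g x"
  proof -
    have "pd 1 (christoffel_lower g 1 2 2) x = pd 1 (\<lambda>y. pd 2 (\<lambda>y. g y $ 1 $ 2) y - pd 1 (\<lambda>y. g y $ 2 $ 2) y * (1 / 2)) x"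
      by (rule pd_cong[OF U x]) (simp add: christoffel_lower_def sym field_simps)
    moreover have "pd 2 (christoffel_lower g 1 1 2) x = pd 2 (\<lambda>y. pd 2 (\<lambda>y. g y $ 1 $ 1) y * (1 / 2)) x"
      by (rule pd_cong[OF U x]) (simp add: christoffel_lower_def sym field_simps)
    moreover have "pd m (\<lambda>y. h y * (1 / 2)) x = pd m h x * (1 / 2)" if "h differentiable (at x)" for m and h :: "plane \<Rightarrow> real"
      using pd_mult[OF that, of "\<lambda>y. 1 / 2" m] by simp
    moreover have "(\<lambda>y. pd m (\<lambda>y. g y $ i $ j) y * (1 / 2)) differentiable (at x)" for m i j
      by (intro differentiable_mult dg differentiable_const)
    ultimately show ?thesis
      by (simp only: pd_diff dg curvature_second_order_def)
  qed
  have K: "gauss_curvature g x * ?d = curvature_second_order g x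
     - (christoffel g 1 2 2 x * christoffel_lower g 1 1 1 x + christoffel g 2 2 2 x * christoffel_lower g 2 1 1 x)
     + (christoffel g 1 1 2 x * christoffel_lower g 1 1 2 x + christoffel g 2 1 2 x * christoffel_lower g 2 1 2 x)"
  proof -
    have "gauss_curvature g x * ?d = g x $ 1 $ 1 * riemann_coeff g 1 1 2 2 x + g x $ 1 $ 2 * riemann_coeff g 2 1 2 2 x"
      using entries(3)[OF x] by (simp add: gauss_curvature_def sum_2)
    also have "\<dots> = (g x $ 1 $ 1 * pd 1 (christoffel g 1 2 2) x + g x $ 1 $ 2 * pd 1 (christoffel g 2 2 2) x)
       - (g x $ 1 $ 1 * pd 2 (christoffel g 1 1 2) x + g x $ 1 $ 2 * pd 2 (christoffel g 2 1 2) x)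
       + christoffel g 1 2 2 x * (g x $ 1 $ 1 * christoffel g 1 1 1 x + g x $ 1 $ 2 * christoffel g 2 1 1 x)
       + christoffel g 2 2 2 x * (g x $ 1 $ 1 * christoffel g 1 1 2 x + g x $ 1 $ 2 * christoffel g 2 1 2 x)
       - christoffel g 1 1 2 x * (g x $ 1 $ 1 * christoffel g 1 2 1 x + g x $ 1 $ 2 * christoffel g 2 2 1 x)
       - christoffel g 2 1 2 x * (g x $ 1 $ 1 * christoffel g 1 2 2 x + g x $ 1 $ 2 * christoffel g 2 2 2 x)"
      by (simp add: riemann_coeff_def sum_2 algebra_simps)
    also have "\<dots> = curvature_second_order g x
       + christoffel g 1 2 2 x * (christoffel_lower g 1 1 1 x - pd 1 (\<lambda>y. g y $ 1 $ 1) x)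
       + christoffel g 2 2 2 x * (christoffel_lower g 1 1 2 x - pd 1 (\<lambda>y. g y $ 1 $ 2) x)
       - christoffel g 1 1 2 x * (christoffel_lower g 1 2 1 x - pd 2 (\<lambda>y. g y $ 1 $ 1) x)
       - christoffel g 2 1 2 x * (christoffel_lower g 1 2 2 x - pd 2 (\<lambda>y. g y $ 1 $ 2) x)"
      unfolding dlow low[OF x] second[symmetric] by (simp add: algebra_simps)
    \<comment> \<open>Since d_m g_1l = \<Gamma>_{1,ml} + \<Gamma>_{l,m1}, each bracket is minus a
      single symbol of the first kind.\<close>
    also have "\<dots> = curvature_second_order g x
     - (christoffel g 1 2 2 x * christoffel_lower g 1 1 1 x + christoffel g 2 2 2 x * christoffel_lower g 2 1 1 x)
     + (christoffel g 1 1 2 x * christoffel_lower g 1 1 2 x + christoffel g 2 1 2 x * christoffel_lower g 2 1 2 x)"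
      by (simp add: christoffel_lower_def sym[OF x] field_simps)
    finally show ?thesis .
  qed
  have "gauss_curvature g x * ?d\<^sup>2 = (gauss_curvature g x * ?d) * ?d" by (simp add: power2_eq_square)
  also have "\<dots> = ?d * curvature_second_order g x
     - ((?d * christoffel g 1 2 2 x) * christoffel_lower g 1 1 1 x + (?d * christoffel g 2 2 2 x) * christoffel_lower g 2 1 1 x)
     + ((?d * christoffel g 1 1 2 x) * christoffel_lower g 1 1 2 x + (?d * christoffel g 2 1 2 x) * christoffel_lower g 2 1 2 x)"
    unfolding K by (simp add: algebra_simps)
  finally show ?thesis unfolding ch[OF x] by (simp add: algebra_simps power2_eq_square)
qed

section \<open>The second order part of the Gauss equation\<close>

text \<open>Two powers of 1 / r come from the normalisation in the plane and two from
  differentiating the rescaled bump twice.\<close>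

lemma kernel_second_derivative_bound:
  obtains C where "C > 0" "\<And>r x z i j. r > 0 \<Longrightarrow> \<bar>pd i (pd j (\<lambda>z. kernel r (x - z))) z\<bar> \<le> C / r ^ 4"
proof -
  let ?N = "LINT x|lborel. bump 0 1 x"
  have Ck: "Ck_on k UNIV (bump 0 1)" for k by (rule Ck_on_bump)
  have t: "test_function UNIV (bump 0 1)"
    by (rule test_functionI[OF Ck compact_cube[of 0 1] subset_UNIV bump_eq_0])
  have "\<exists>B. \<forall>z. \<bar>pd i (pd j (bump 0 1)) z\<bar> \<le> B" for i j
  proof -
    have t2: "test_function UNIV (pd i (pd j (bump 0 1)))" by (intro test_function_pd t)
    obtain K where K: "compact K" "\<And>z. z \<notin> K \<Longrightarrow> pd i (pd j (bump 0 1)) z = 0"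
      using test_functionE[OF t2] by metis
    have "compact (pd i (pd j (bump 0 1)) ` K)"
      by (intro compact_continuous_image K(1) continuous_on_subset[OF test_functionD(1)[OF t2]] subset_UNIV)
    then obtain B where "\<forall>y\<in>pd i (pd j (bump 0 1)) ` K. norm y \<le> B"
      using compact_imp_bounded bounded_iff by metis
    then have "\<bar>pd i (pd j (bump 0 1)) z\<bar> \<le> max B 0" for z
      using K(2)[of z] by (cases "z \<in> K") force+
    then show ?thesis by blast
  qed
  then obtain B where B: "\<And>i j z. \<bar>pd i (pd j (bump 0 1)) z\<bar> \<le> B i j" by metis
  define C where "C = (\<Sum>i\<in>UNIV. \<Sum>j\<in>UNIV. B i j) / ?N + 1"
  have B0: "B i j \<ge> 0" for i j using B[of i j 0] by linarith
  have BC: "B i j / ?N \<le> C" for i j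
  proof -
    have "B i j \<le> (\<Sum>j\<in>UNIV. B i j)" by (intro member_le_sum) (auto simp: B0)
    also have "\<dots> \<le> (\<Sum>i\<in>UNIV. \<Sum>j\<in>UNIV. B i j)" by (intro member_le_sum) (auto simp: B0 sum_nonneg)
    finally have "B i j / ?N \<le> (\<Sum>i\<in>UNIV. \<Sum>j\<in>UNIV. B i j) / ?N"
      using bump_integral_pos by (intro divide_right_mono) auto
    then show ?thesis by (simp add: C_def)
  qed
  show thesis
  proof (rule that[of C])
    show "C > 0" unfolding C_def using bump_integral_pos by (intro add_nonneg_pos divide_nonneg_nonneg sum_nonneg B0) auto
    fix r :: real and x z :: plane and i j :: 2 assume r: "r > 0"
    let ?k = "1 / (r\<^sup>2 * ?N)" and ?c = "- (x /\<^sub>R r)"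
    have e: "(\<lambda>z. kernel r (x - z)) = (\<lambda>z. ?k * bump 0 1 ((1 / r) *\<^sub>R z + ?c))"
    proof
      fix z
      have "kernel r (x - z) = kernel r (z - x)" using kernel_minus[of r "z - x"] by simp
      then show "kernel r (x - z) = ?k * bump 0 1 ((1 / r) *\<^sub>R z + ?c)"
        by (simp add: kernel_def scaleR_diff_right divide_inverse)
    qed
    have d1: "bump 0 1 differentiable (at y)" "pd j (bump 0 1) differentiable (at y)" for y
      using Ck[of 2] by (auto simp: numeral_2_eq_2)
    have sc: "pd m (\<lambda>z. k * h ((1 / r) *\<^sub>R z + ?c)) = (\<lambda>z. (k * (1 / r)) * pd m h ((1 / r) *\<^sub>R z + ?c))"
      if h: "\<And>y. h differentiable (at y)" for m k and h :: "plane \<Rightarrow> real"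
    proof
      fix z
      have "(\<lambda>z. h ((1 / r) *\<^sub>R z + ?c)) differentiable (at z)"
        by (rule differentiable_chain_at[where g=h, unfolded o_def]) (auto intro!: h derivative_intros)
      then show "pd m (\<lambda>z. k * h ((1 / r) *\<^sub>R z + ?c)) z = (k * (1 / r)) * pd m h ((1 / r) *\<^sub>R z + ?c)"
        using pd_mult[of "\<lambda>z. k" z "\<lambda>z. h ((1 / r) *\<^sub>R z + ?c)" m] pd_affine[OF h, where a="1 / r" and c="?c"] by simp
    qed
    have "pd i (pd j (\<lambda>z. kernel r (x - z))) z = (?k * (1 / r) * (1 / r)) * pd i (pd j (bump 0 1)) ((1 / r) *\<^sub>R z + ?c)"
      unfolding e sc[OF d1(1)] sc[OF d1(2)] ..
    then have "\<bar>pd i (pd j (\<lambda>z. kernel r (x - z))) z\<bar> = (?k * (1 / r) * (1 / r)) * \<bar>pd i (pd j (bump 0 1)) ((1 / r) *\<^sub>R z + ?c)\<bar>"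
      using r bump_integral_pos by (simp add: abs_mult)
    also have "\<dots> \<le> (?k * (1 / r) * (1 / r)) * B i j"
      using r bump_integral_pos by (intro mult_left_mono B) auto
    also have "\<dots> = (B i j / ?N) / r ^ 4" by (simp add: power2_eq_square power4_eq_xxxx)
    also have "\<dots> \<le> C / r ^ 4" using r by (intro divide_right_mono BC) auto
    finally show "\<bar>pd i (pd j (\<lambda>z. kernel r (x - z))) z\<bar> \<le> C / r ^ 4" .
  qed
qed

lemma integral_by_parts_test:
  fixes h \<phi> :: "plane \<Rightarrow> real"
  assumes W: "open W" and h: "Ck_on 1 W h" and t: "test_function W \<phi>"
  shows "(LINT x|lborel. h x * pd i \<phi> x) = - (LINT x|lborel. pd i h x * \<phi> x)"
proof -
  obtain K where K: "compact K" "K \<subseteq> W" "\<And>x. x \<notin> K \<Longrightarrow> \<phi> x = 0" using test_functionE[OF t] by metis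
  have "Ck_on 1 W \<phi>" by (rule Ck_on_subset[OF test_functionD(3)[OF t] subset_UNIV])
  from integral_by_parts[OF W h this K] show ?thesis .
qed

lemma integral_by_parts_twice:
  fixes h \<phi> :: "plane \<Rightarrow> real"
  assumes W: "open W" and h: "Ck_on 2 W h" and t: "test_function W \<phi>"
  shows "(LINT x|lborel. h x * pd i (pd j \<phi>) x) = (LINT x|lborel. pd j (pd i h) x * \<phi> x)"
proof -
  have "Ck_on 1 W h" "Ck_on 1 W (pd i h)" using h Ck_on_Suc_D[of 1 W h] by (auto simp: numeral_2_eq_2)
  then show ?thesis
    using integral_by_parts_test[OF W, of h "pd j \<phi>" i] integral_by_parts_test[OF W, of "pd i h" \<phi> j] t test_function_pd by simp
qed

text \<open>Both sides are, up to the same sign, \<open>h\<close> tested with third derivatives of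
  \<phi>, which commute. This produces the cancellation of the terms that no estimate
  controls.\<close>

lemma gradient_curl_free:
  fixes h \<phi> :: "plane \<Rightarrow> real"
  assumes W: "open W" and h: "Ck_on 1 W h" and t: "test_function W \<phi>"
  shows "(LINT x|lborel. pd i h x * pd j (pd k \<phi>) x) = (LINT x|lborel. pd j h x * pd i (pd k \<phi>) x)"
proof -
  have tk: "test_function W (pd k \<phi>)" by (rule test_function_pd[OF t])
  have "pd i (pd j (pd k \<phi>)) x = pd j (pd i (pd k \<phi>)) x" for x
    by (rule pd_commute) (rule test_functionD(3)[OF tk])
  then show ?thesis
    using integral_by_parts_test[OF W h test_function_pd[OF tk], of i j] integral_by_parts_test[OF W h test_function_pd[OF tk], of j i]
    by simp
qed

lemma pd_affine_functional [simp]: "pd i (\<lambda>z::plane. A \<bullet> z + k) z = A $ i"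
proof -
  have "((\<lambda>z::plane. A \<bullet> z + k) has_derivative (\<lambda>v. A \<bullet> v)) (at z)" by (auto intro!: derivative_eq_intros)
  from pd_eqI[OF this] show ?thesis by (simp add: inner_axis)
qed

lemma Ck_on_affine_functional: "Ck_on n S (\<lambda>z::plane. A \<bullet> z + k)"
proof (cases n)
  case 0 then show ?thesis by (auto intro!: continuous_intros)
next
  case (Suc m)
  have "pd i (\<lambda>z::plane. A \<bullet> z + k) = (\<lambda>z. A $ i)" for i by (rule ext) simp
  moreover have "(\<lambda>z::plane. A \<bullet> z + k) differentiable (at x)" for x by (auto intro!: derivative_intros)
  ultimately show ?thesis using Suc by (simp add: Ck_on_const)
qed

text \<open>A product of two affine functions has constant second derivatives, so it passes through
  any normalised kernel unchanged.\<close>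

lemma integral_quadratic_times_hessian:
  assumes W: "open W" and t: "test_function W \<phi>"
  shows "(LINT z|lborel. ((A \<bullet> z + k) * (B \<bullet> z + l)) * pd i (pd j \<phi>) z) = (A $ i * B $ j + A $ j * B $ i) * (LINT z|lborel. \<phi> z)"
proof -
  have d: "(\<lambda>z::plane. A \<bullet> z + k) differentiable (at z)" for A k z using Ck_on_affine_functional[of 1 UNIV A k] by simp
  have "pd i (\<lambda>z. (A \<bullet> z + k) * (B \<bullet> z + l)) = (\<lambda>z. (A \<bullet> z + k) * B $ i + A $ i * (B \<bullet> z + l))"
    by (rule ext) (simp add: pd_mult d)
  also have "\<dots> = (\<lambda>z. (B $ i *\<^sub>R A + A $ i *\<^sub>R B) \<bullet> z + (k * B $ i + l * A $ i))"
    by (simp add: fun_eq_iff inner_simps algebra_simps)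
  finally have E: "pd i (\<lambda>z. (A \<bullet> z + k) * (B \<bullet> z + l)) = (\<lambda>z. (B $ i *\<^sub>R A + A $ i *\<^sub>R B) \<bullet> z + (k * B $ i + l * A $ i))" .
  have "pd j (pd i (\<lambda>z. (A \<bullet> z + k) * (B \<bullet> z + l))) z = A $ i * B $ j + A $ j * B $ i" for z
    unfolding E pd_affine_functional by simp
  then show ?thesis
    using integral_by_parts_twice[OF W Ck_on_mult[OF W Ck_on_affine_functional Ck_on_affine_functional] t]
    by simp
qed

text \<open>Smallness over pairs is turned into smallness around one base point \<open>w\<close>,
  common to both functions. The two pair integrals add up to at most 2 e r^6; if every
  \<open>w\<close> in the square of area 4 r^2 exceeded e r^4, the total would be at least 4 e
  r^6.\<close>

lemma LD_mean_point:
  assumes "LD p x A" "LD q x B" and e: "e > 0"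
  obtains d where "d > 0" "\<And>r. 0 < r \<Longrightarrow> r < d \<Longrightarrow> \<exists>w\<in>cube x r.
    integral (cube x r) (\<lambda>z. (p z - p w - A \<bullet> (z - w))\<^sup>2 + (q z - q w - B \<bullet> (z - w))\<^sup>2) \<le> e * r ^ 4"
proof -
  let ?G = "\<lambda>(z, w). p z - p w - A \<bullet> (z - w)" and ?H = "\<lambda>(z, w). q z - q w - B \<bullet> (z - w)"
  have sm: "small x ?G" "small x ?H" using assms(1,2) by (simp_all add: LD_def)
  obtain d1 where d1: "d1 > 0" "continuous_on (cube x d1 \<times> cube x d1) ?G"
      "\<And>r. 0 < r \<Longrightarrow> r < d1 \<Longrightarrow> integral (cube x r \<times> cube x r) (\<lambda>p. (?G p)\<^sup>2) \<le> e * r ^ 6"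
    by (rule smallE[OF sm(1) e]) (rule that; assumption)
  obtain d2 where d2: "d2 > 0" "continuous_on (cube x d2 \<times> cube x d2) ?H"
      "\<And>r. 0 < r \<Longrightarrow> r < d2 \<Longrightarrow> integral (cube x r \<times> cube x r) (\<lambda>p. (?H p)\<^sup>2) \<le> e * r ^ 6"
    by (rule smallE[OF sm(2) e]) (rule that; assumption)
  show thesis
  proof (rule that[of "min d1 d2"])
    show "min d1 d2 > 0" using d1(1) d2(1) by simp
    fix r assume r: "0 < r" "r < min d1 d2"
    let ?Q = "cube x r"
    have c: "continuous_on (?Q \<times> ?Q) ?G" "continuous_on (?Q \<times> ?Q) ?H"
      by (rule continuous_on_subset[OF d1(2) cube_Times_mono], use r in simp,
          rule continuous_on_subset[OF d2(2) cube_Times_mono], use r in simp)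
    \<comment> \<open>Swapped, so that the base point is the outer variable when Fubini is
      applied.\<close>
    let ?F = "\<lambda>v. (?G (prod.swap v))\<^sup>2 + (?H (prod.swap v))\<^sup>2"
    have swK: "continuous_on (?Q \<times> ?Q) (\<lambda>v. K (prod.swap v))" if "continuous_on (?Q \<times> ?Q) K" for K :: "plane \<times> plane \<Rightarrow> real"
      by (rule continuous_on_compose2[OF that continuous_on_swap]) auto
    note sw = swK[OF c(1)] swK[OF c(2)]
    have Fc: "continuous_on (?Q \<times> ?Q) ?F" by (intro continuous_intros sw)
    have swap_int: "integral (?Q \<times> ?Q) (\<lambda>v. K (prod.swap v)) = integral (?Q \<times> ?Q) K"
      if K: "continuous_on (?Q \<times> ?Q) K" for K :: "plane \<times> plane \<Rightarrow> real"
    proof -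
      have "integral ?Q (\<lambda>z. integral ?Q (\<lambda>w. K (w, z))) = integral ?Q (\<lambda>w. integral ?Q (\<lambda>z. K (w, z)))"
        using integral_swap_continuous[of "x - (\<chi> i. r)" "x - (\<chi> i. r)" "x + (\<chi> i. r)" "x + (\<chi> i. r)" "\<lambda>w z. K (w, z)"] K
        unfolding cube_def cbox_Pair_eq by simp
      then show ?thesis unfolding integral_cube_Times[OF swK[OF K]] integral_cube_Times[OF K] by simp
    qed
    have "integral (?Q \<times> ?Q) ?F = integral (?Q \<times> ?Q) (\<lambda>v. (?G v)\<^sup>2 + (?H v)\<^sup>2)"
      by (rule swap_int[of "\<lambda>v. (?G v)\<^sup>2 + (?H v)\<^sup>2"]) (intro continuous_intros c)
    also have "\<dots> = integral (?Q \<times> ?Q) (\<lambda>v. (?G v)\<^sup>2) + integral (?Q \<times> ?Q) (\<lambda>v. (?H v)\<^sup>2)"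
      by (intro Henstock_Kurzweil_Integration.integral_add integrable_on_cube_Times continuous_intros c)
    also have "\<dots> \<le> e * r ^ 6 + e * r ^ 6" using r by (intro add_mono d1(3) d2(3)) auto
    finally have le: "integral ?Q (\<lambda>w. integral ?Q (\<lambda>z. ?F (w, z))) \<le> 2 * e * r ^ 6"
      unfolding integral_cube_Times[OF Fc] by simp
    have "\<exists>w\<in>?Q. integral ?Q (\<lambda>z. ?F (w, z)) \<le> e * r ^ 4"
    proof (rule ccontr)
      assume "\<not> ?thesis"
      then have "e * r ^ 4 \<le> integral ?Q (\<lambda>z. ?F (w, z))" if "w \<in> ?Q" for w using that by force
      then have "integral ?Q (\<lambda>w. e * r ^ 4) \<le> integral ?Q (\<lambda>w. integral ?Q (\<lambda>z. ?F (w, z)))"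
        by (intro integral_le integrable_on_cube continuous_on_integral_cube Fc continuous_on_const)
      also have "integral ?Q (\<lambda>w. e * r ^ 4) = 4 * r\<^sup>2 * (e * r ^ 4)" using r by (intro integral_cube_const) simp
      finally have "4 * r\<^sup>2 * (e * r ^ 4) \<le> 2 * e * r ^ 6" using le by (rule order_trans)
      moreover have "4 * r\<^sup>2 * (e * r ^ 4) = 4 * (e * r ^ 6)" by (simp add: power_numeral_reduce)
      moreover have "e * r ^ 6 > 0" using e r by simp
      ultimately show False by linarith
    qed
    then show "\<exists>w\<in>?Q. integral ?Q (\<lambda>z. (p z - p w - A \<bullet> (z - w))\<^sup>2 + (q z - q w - B \<bullet> (z - w))\<^sup>2) \<le> e * r ^ 4"
      by simp
  qed
qed

text \<open>For smooth h the combination (h_1^2)_22 - 2 (h_1 h_2)_12 + (h_2^2)_11 equals -2 det D^2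
  h, the third derivatives cancelling. \<open>J\<close> evaluates it weakly on kernels, where only
  first derivatives of \<open>h\<close> occur.\<close>

lemma hessian_det_limit:
  fixes h :: "plane \<Rightarrow> real"
  assumes U: "open U" and h: "Ck_on 1 U h" and x: "x \<in> U"
    and LD: "LD (pd 1 h) x A" "LD (pd 2 h) x B" and sym: "A $ 2 = B $ 1" and \<eta>: "\<eta> > 0"
  defines "J \<equiv> \<lambda>r H i j. LINT z|lborel. H z * pd i (pd j (\<lambda>z. kernel r (x - z))) z"
  shows "\<exists>d>0. \<forall>r. 0 < r \<and> r < d \<longrightarrow> \<bar>J r (\<lambda>z. pd 1 h z * pd 1 h z) 2 2 - 2 * J r (\<lambda>z. pd 1 h z * pd 2 h z) 1 2
     + J r (\<lambda>z. pd 2 h z * pd 2 h z) 1 1 + 2 * (A $ 1 * B $ 2 - (A $ 2)\<^sup>2)\<bar> \<le> \<eta>"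
proof -
  let ?p = "pd 1 h" and ?q = "pd 2 h"
  obtain C where C: "C > 0" "\<And>r x z i j. r > 0 \<Longrightarrow> \<bar>pd i (pd j (\<lambda>z. kernel r (x - z))) z\<bar> \<le> C / r ^ 4"
    using kernel_second_derivative_bound by blast
  define \<alpha> where "\<alpha> = 2 * (\<bar>A $ 1\<bar> + \<bar>A $ 2\<bar> + \<bar>B $ 1\<bar> + \<bar>B $ 2\<bar>)"
  have \<alpha>0: "\<alpha> \<ge> 0" by (simp add: \<alpha>_def)
  \<comment> \<open>Each of the three remainders contributes at most C (36 \<alpha> + 2) \<delta>,
    and they enter with weights 1, 2 and 1, whence the factor 4. The bound 1 allows \<delta>^2 <=
    \<delta>.\<close>
  define \<delta> where "\<delta> = min 1 (\<eta> / (4 * C * (36 * \<alpha> + 2)))"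
  have \<delta>: "\<delta> > 0" "\<delta> \<le> 1" using \<eta> C(1) \<alpha>0 by (auto simp: \<delta>_def intro!: divide_pos_pos mult_pos_pos add_nonneg_pos)
  have \<delta>2: "4 * C * ((36 * \<alpha> + 2) * \<delta>) \<le> \<eta>"
  proof -
    have pos: "4 * C * (36 * \<alpha> + 2) > 0" using C(1) \<alpha>0 by (intro mult_pos_pos add_nonneg_pos) auto
    have "\<delta> \<le> \<eta> / (4 * C * (36 * \<alpha> + 2))" by (simp add: \<delta>_def)
    then have "\<delta> * (4 * C * (36 * \<alpha> + 2)) \<le> \<eta>" using pos by (simp only: pos_le_divide_eq)
    then show ?thesis by (simp add: algebra_simps)
  qed
  have \<delta>s: "\<delta>\<^sup>2 > 0" using \<delta> by simp
  obtain d1 where d1: "d1 > 0" "\<And>r. 0 < r \<Longrightarrow> r < d1 \<Longrightarrow> \<exists>w\<in>cube x r.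
    integral (cube x r) (\<lambda>z. (?p z - ?p w - A \<bullet> (z - w))\<^sup>2 + (?q z - ?q w - B \<bullet> (z - w))\<^sup>2) \<le> \<delta>\<^sup>2 * r ^ 4"
    by (rule LD_mean_point[OF LD \<delta>s]) (rule that; assumption)
  obtain d2 where d2: "d2 > 0" "cube x d2 \<subseteq> U" using open_contains_cube[OF U x] .
  have "\<bar>J r (\<lambda>z. ?p z * ?p z) 2 2 - 2 * J r (\<lambda>z. ?p z * ?q z) 1 2 + J r (\<lambda>z. ?q z * ?q z) 1 1
      + 2 * (A $ 1 * B $ 2 - (A $ 2)\<^sup>2)\<bar> \<le> \<eta>" if r: "0 < r" "r < d1" "r < d2" for r
  proof -
    let ?Q = "cube x r" and ?\<phi> = "\<lambda>z. kernel r (x - z)"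
    have QU: "?Q \<subseteq> U" using cube_mono[of r d2 x] d2(2) r by auto
    have t: "test_function U ?\<phi>" by (rule test_function_kernel[OF r(1) QU])
    have tpd: "test_function U (pd i (pd j ?\<phi>))" for i j by (intro test_function_pd t)
    have J_add: "J r (\<lambda>z. F z + G z) i j = J r F i j + J r G i j"
      if "continuous_on U F" "continuous_on U G" for F G i j
      unfolding J_def distrib_right
      by (intro Bochner_Integration.integral_add integrable_times_test_function(2)[OF U _ tpd] that)
    have J_cmult: "J r (\<lambda>z. k * F z) i j = k * J r F i j" for k F i j
      unfolding J_def by (simp add: mult.assoc)
    obtain w where w: "w \<in> ?Q" "integral ?Q (\<lambda>z. (?p z - ?p w - A \<bullet> (z - w))\<^sup>2 + (?q z - ?q w - B \<bullet> (z - w))\<^sup>2) \<le> \<delta>\<^sup>2 * r ^ 4"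
      using d1(2)[OF r(1,2)] by blast
    define a where "a z = A \<bullet> (z - w)" for z
    define b where "b z = B \<bullet> (z - w)" for z
    define P where "P z = ?p z - ?p w - a z" for z
    define R where "R z = ?q z - ?q w - b z" for z
    let ?c = "?p w" and ?k = "?q w"
    have pc: "continuous_on U ?p" "continuous_on U ?q" using h by auto
    have ac: "continuous_on S a" "continuous_on S b" for S unfolding a_def b_def by (intro continuous_intros)+
    have Pc: "continuous_on U P" "continuous_on U R" unfolding P_def R_def by (intro continuous_intros pc ac)+
    have p: "?p z = (?c + a z) + P z" "?q z = (?k + b z) + R z" for z by (simp_all add: P_def R_def)
    have aff: "?c + a z = A \<bullet> z + (?c - A \<bullet> w)" "?k + b z = B \<bullet> z + (?k - B \<bullet> w)" for z
      by (simp_all add: a_def b_def inner_diff_right)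
    have one: "(LINT z|lborel. ?\<phi> z) = 1" by (rule kernel_integral_shift[OF r(1)])
    have quad: "J r (\<lambda>z. (?c + a z) * (?c + a z)) i j = 2 * A $ i * A $ j"
      "J r (\<lambda>z. (?c + a z) * (?k + b z)) i j = A $ i * B $ j + A $ j * B $ i"
      "J r (\<lambda>z. (?k + b z) * (?k + b z)) i j = 2 * B $ i * B $ j" for i j
      unfolding aff J_def integral_quadratic_times_hessian[OF U t] one by simp_all
    \<comment> \<open>A single affine function is treated as its product with the constant 1, that
      is with \<open>B = 0\<close> and \<open>l = 1\<close>.\<close>
    have aff0: "J r (\<lambda>z. ?c + a z) i j = 0" "J r (\<lambda>z. ?k + b z) i j = 0" for i j
      using integral_quadratic_times_hessian[OF U t, where B=0 and l=1 and j=j and i=i] unfolding aff J_def by simp_all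
    have JP: "J r ?p i j = J r P i j" "J r ?q i j = J r R i j" for i j
    proof -
      have "J r (\<lambda>z. (?c + a z) + P z) i j = J r (\<lambda>z. ?c + a z) i j + J r P i j"
        "J r (\<lambda>z. (?k + b z) + R z) i j = J r (\<lambda>z. ?k + b z) i j + J r R i j"
        by (intro J_add continuous_intros ac Pc)+
      moreover have "(\<lambda>z. (?c + a z) + P z) = ?p" "(\<lambda>z. (?k + b z) + R z) = ?q"
        by (simp_all add: P_def R_def)
      ultimately show "J r ?p i j = J r P i j" "J r ?q i j = J r R i j" by (simp_all add: aff0)
    qed
    \<comment> \<open>In the final combination the base values occur only as 2 c (J P 22 - J R 12)
      and 2 k (J R 11 - J P 12), with c and k the values at \<open>w\<close>. These identities make
      both brackets zero.\<close>
    have curl: "J r P 2 2 = J r R 1 2" "J r R 1 1 = J r P 1 2"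
    proof -
      show "J r P 2 2 = J r R 1 2"
        using gradient_curl_free[OF U h t, of 1 2 2] JP[of 2 2] JP[of 1 2] by (simp add: J_def)
      have "pd 2 (pd 1 ?\<phi>) z = pd 1 (pd 2 ?\<phi>) z" for z by (rule pd_commute) (rule Ck_on_kernel_shift)
      then show "J r R 1 1 = J r P 1 2"
        using gradient_curl_free[OF U h t, of 2 1 1] JP[of 1 1] JP[of 1 2] by (simp add: J_def)
    qed
    let ?R11 = "\<lambda>z. 2 * a z * P z + P z * P z" and ?R12 = "\<lambda>z. a z * R z + b z * P z + P z * R z"
      and ?R22 = "\<lambda>z. 2 * b z * R z + R z * R z"
    have split: "J r (\<lambda>z. ?p z * ?p z) i j = 2 * A $ i * A $ j + (2 * ?c * J r P i j + J r ?R11 i j)"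
      "J r (\<lambda>z. ?p z * ?q z) i j = (A $ i * B $ j + A $ j * B $ i) + (?c * J r R i j + (?k * J r P i j + J r ?R12 i j))"
      "J r (\<lambda>z. ?q z * ?q z) i j = 2 * B $ i * B $ j + (2 * ?k * J r R i j + J r ?R22 i j)" for i j
    proof -
      have "(\<lambda>z. ?p z * ?p z) = (\<lambda>z. (?c + a z) * (?c + a z) + (2 * ?c * P z + ?R11 z))"
        "(\<lambda>z. ?p z * ?q z) = (\<lambda>z. (?c + a z) * (?k + b z) + (?c * R z + (?k * P z + ?R12 z)))"
        "(\<lambda>z. ?q z * ?q z) = (\<lambda>z. (?k + b z) * (?k + b z) + (2 * ?k * R z + ?R22 z))"
        by (rule ext, simp add: P_def R_def algebra_simps)+
      note eqs = this
      show "J r (\<lambda>z. ?p z * ?p z) i j = 2 * A $ i * A $ j + (2 * ?c * J r P i j + J r ?R11 i j)"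
        unfolding eqs(1) quad(1)[symmetric] J_cmult[symmetric] by (subst J_add, (intro continuous_intros ac Pc)+)+ simp
      show "J r (\<lambda>z. ?p z * ?q z) i j = (A $ i * B $ j + A $ j * B $ i) + (?c * J r R i j + (?k * J r P i j + J r ?R12 i j))"
        unfolding eqs(2) quad(2)[symmetric] J_cmult[symmetric] by (subst J_add, (intro continuous_intros ac Pc)+)+ simp
      show "J r (\<lambda>z. ?q z * ?q z) i j = 2 * B $ i * B $ j + (2 * ?k * J r R i j + J r ?R22 i j)"
        unfolding eqs(3) quad(3)[symmetric] J_cmult[symmetric] by (subst J_add, (intro continuous_intros ac Pc)+)+ simp
    qed
    \<comment> \<open>A common majorant of the three remainders, with generous constants. Its
      integral over the square is at most (36 \<alpha> \<delta> + 2 \<delta>^2) r^4, which balances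
      the size r^-4 of the kernel derivatives.\<close>
    let ?W = "\<lambda>z. 4 * \<alpha> * (2 * \<delta> * r\<^sup>2) + (4 * \<alpha> / \<delta> + 2) * ((P z)\<^sup>2 + (R z)\<^sup>2)"
    have ab: "\<bar>a z\<bar> \<le> \<alpha> * r" "\<bar>b z\<bar> \<le> \<alpha> * r" if z: "z \<in> ?Q" for z
    proof -
      have zw: "\<bar>z $ i - w $ i\<bar> \<le> 2 * r" for i
        using z[unfolded mem_cube, rule_format, of i] w(1)[unfolded mem_cube, rule_format, of i] by linarith
      have D: "\<bar>D \<bullet> (z - w)\<bar> \<le> 2 * (\<bar>D $ 1\<bar> + \<bar>D $ 2\<bar>) * r" for D
      proof -
        have "\<bar>D \<bullet> (z - w)\<bar> \<le> \<bar>D $ 1\<bar> * \<bar>z $ 1 - w $ 1\<bar> + \<bar>D $ 2\<bar> * \<bar>z $ 2 - w $ 2\<bar>"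
          unfolding inner_plane abs_mult[symmetric] by simp
        also have "\<dots> \<le> \<bar>D $ 1\<bar> * (2 * r) + \<bar>D $ 2\<bar> * (2 * r)"
          by (intro add_mono mult_left_mono zw) auto
        finally show ?thesis by (simp add: algebra_simps)
      qed
      have "2 * (\<bar>A $ 1\<bar> + \<bar>A $ 2\<bar>) * r \<le> \<alpha> * r" "2 * (\<bar>B $ 1\<bar> + \<bar>B $ 2\<bar>) * r \<le> \<alpha> * r"
        using r(1) by (auto intro!: mult_right_mono simp: \<alpha>_def)
      then show "\<bar>a z\<bar> \<le> \<alpha> * r" "\<bar>b z\<bar> \<le> \<alpha> * r" using D[of A] D[of B] by (auto simp: a_def b_def)
    qed
    have W: "\<bar>?R11 z\<bar> \<le> ?W z" "\<bar>?R12 z\<bar> \<le> ?W z" "\<bar>?R22 z\<bar> \<le> ?W z" if z: "z \<in> ?Q" for z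
    proof -
      \<comment> \<open>Young's inequality with weight \<delta>: the cross terms are controlled by
        the integral of P^2 + R^2, the only quantity known to be small.\<close>
      have yng: "r * \<bar>y\<bar> \<le> \<delta> * r\<^sup>2 + y\<^sup>2 / \<delta>" for y
      proof -
        have "0 \<le> (\<delta> * r - \<bar>y\<bar>)\<^sup>2" by simp
        also have "\<dots> = \<delta> * (\<delta> * r\<^sup>2 + y\<^sup>2 / \<delta> - 2 * (r * \<bar>y\<bar>))"
          using \<delta>(1) by (simp add: power2_diff field_simps power2_eq_square)
        finally have "0 \<le> \<delta> * r\<^sup>2 + y\<^sup>2 / \<delta> - 2 * (r * \<bar>y\<bar>)" using \<delta>(1) by (simp add: zero_le_mult_iff)
        moreover have "0 \<le> r * \<bar>y\<bar>" using r by simp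
        ultimately show ?thesis by linarith
      qed
      have lin: "\<bar>c * y\<bar> \<le> \<alpha> * (\<delta> * r\<^sup>2 + y\<^sup>2 / \<delta>)" if "\<bar>c\<bar> \<le> \<alpha> * r" for c y
      proof -
        have "\<bar>c * y\<bar> \<le> \<alpha> * r * \<bar>y\<bar>" unfolding abs_mult using that by (intro mult_right_mono) auto
        also have "\<dots> \<le> \<alpha> * (\<delta> * r\<^sup>2 + y\<^sup>2 / \<delta>)" unfolding mult.assoc by (intro mult_left_mono yng \<alpha>0)
        finally show ?thesis .
      qed
      have prod: "\<bar>P z * R z\<bar> \<le> (P z)\<^sup>2 + (R z)\<^sup>2"
      proof -
        have "2 * (\<bar>P z\<bar> * \<bar>R z\<bar>) \<le> (P z)\<^sup>2 + (R z)\<^sup>2"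
          using sum_squares_bound[of "\<bar>P z\<bar>" "\<bar>R z\<bar>"] by (simp add: mult.assoc)
        moreover have "0 \<le> \<bar>P z\<bar> * \<bar>R z\<bar>" by simp
        ultimately show ?thesis unfolding abs_mult by linarith
      qed
      let ?u = "\<alpha> * (\<delta> * r\<^sup>2 + (P z)\<^sup>2 / \<delta>)" and ?v = "\<alpha> * (\<delta> * r\<^sup>2 + (R z)\<^sup>2 / \<delta>)"
      have l: "\<bar>a z * P z\<bar> \<le> ?u" "\<bar>b z * P z\<bar> \<le> ?u" "\<bar>a z * R z\<bar> \<le> ?v" "\<bar>b z * R z\<bar> \<le> ?v"
        by (intro lin ab z)+
      have W_eq: "?W z = 4 * ?u + 4 * ?v + 2 * ((P z)\<^sup>2 + (R z)\<^sup>2)"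
        using \<delta>(1) by (simp add: field_simps)
      have uv: "?u \<ge> 0" "?v \<ge> 0" using \<alpha>0 \<delta> by auto
      have sq: "P z * P z = (P z)\<^sup>2" "R z * R z = (R z)\<^sup>2" by (simp_all add: power2_eq_square)
      have nn: "(P z)\<^sup>2 \<ge> 0" "(R z)\<^sup>2 \<ge> 0" by simp_all
      have aux: "\<bar>2 * t1 + s\<bar> \<le> 4 * u + 4 * v + 2 * (s + s')" "\<bar>2 * t2 + s'\<bar> \<le> 4 * u + 4 * v + 2 * (s + s')"
        "\<bar>t2' + t1' + m\<bar> \<le> 4 * u + 4 * v + 2 * (s + s')"
        if "\<bar>t1\<bar> \<le> u" "\<bar>t1'\<bar> \<le> u" "\<bar>t2'\<bar> \<le> v" "\<bar>t2\<bar> \<le> v" "u \<ge> 0" "v \<ge> 0" "s \<ge> 0" "s' \<ge> 0" "\<bar>m\<bar> \<le> s + s'"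
        for t1 t2 t1' t2' u v s s' m :: real
        using that by (auto simp: abs_le_iff)
      note final = aux[OF l uv nn prod]
      show "\<bar>?R11 z\<bar> \<le> ?W z" unfolding W_eq sq mult.assoc[of 2 "a z" "P z"] by (rule final(1))
      show "\<bar>?R22 z\<bar> \<le> ?W z" unfolding W_eq sq mult.assoc[of 2 "b z" "R z"] by (rule final(2))
      show "\<bar>?R12 z\<bar> \<le> ?W z" unfolding W_eq by (rule final(3))
    qed
    have Jb: "\<bar>J r F i j\<bar> \<le> C * ((36 * \<alpha> + 2) * \<delta>)"
      if F: "continuous_on U F" "\<And>z. z \<in> ?Q \<Longrightarrow> \<bar>F z\<bar> \<le> ?W z" for F i j
    proof -
      have out: "pd i (pd j ?\<phi>) z = 0" if "z \<notin> ?Q" for z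
      proof (rule pd_eq_0_outside[OF closed_cube _ that])
        fix z assume z: "z \<notin> ?Q"
        show "pd j ?\<phi> z = 0"
          by (rule pd_eq_0_outside[OF closed_cube _ z]) (use kernel_eq_0[OF r(1)] cube_shift in blast)
      qed
      have c: "continuous_on ?Q F" "continuous_on ?Q P" "continuous_on ?Q R" "continuous_on ?Q (pd i (pd j ?\<phi>))"
        by (rule continuous_on_subset[OF _ QU], rule F Pc)+
           (rule continuous_on_subset[OF test_functionD(1)[OF tpd] subset_UNIV])
      have w2: "integral ?Q (\<lambda>z. (P z)\<^sup>2 + (R z)\<^sup>2) \<le> \<delta>\<^sup>2 * r ^ 4"
        using w(2) by (simp only: P_def R_def a_def b_def)
      have Wc: "continuous_on ?Q ?W" by (intro continuous_intros c)
      have W1: "integral ?Q ?W = integral ?Q (\<lambda>z. 4 * \<alpha> * (2 * \<delta> * r\<^sup>2)) + integral ?Q (\<lambda>z. (4 * \<alpha> / \<delta> + 2) * ((P z)\<^sup>2 + (R z)\<^sup>2))"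
        by (intro Henstock_Kurzweil_Integration.integral_add integrable_on_cube continuous_intros c)
      have W2: "integral ?Q (\<lambda>z. (4 * \<alpha> / \<delta> + 2) * ((P z)\<^sup>2 + (R z)\<^sup>2)) = (4 * \<alpha> / \<delta> + 2) * integral ?Q (\<lambda>z. (P z)\<^sup>2 + (R z)\<^sup>2)"
        by (rule integral_mult_right)
      have W3: "integral ?Q (\<lambda>z. 4 * \<alpha> * (2 * \<delta> * r\<^sup>2)) = 32 * \<alpha> * \<delta> * r ^ 4"
        using r(1) by (simp add: integral_cube_const power2_eq_square power4_eq_xxxx)
      have "(4 * \<alpha> / \<delta> + 2) * integral ?Q (\<lambda>z. (P z)\<^sup>2 + (R z)\<^sup>2) \<le> (4 * \<alpha> / \<delta> + 2) * (\<delta>\<^sup>2 * r ^ 4)"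
        by (rule mult_left_mono[OF w2]) (use \<alpha>0 \<delta>(1) in simp)
      then have "integral ?Q ?W \<le> 32 * \<alpha> * \<delta> * r ^ 4 + (4 * \<alpha> / \<delta> + 2) * (\<delta>\<^sup>2 * r ^ 4)"
        unfolding W1 W2 W3 by linarith
      also have "\<dots> = (36 * \<alpha> * \<delta> + 2 * \<delta> * \<delta>) * r ^ 4"
        using \<delta>(1) by (simp add: field_simps power2_eq_square)
      finally have WI: "integral ?Q ?W \<le> (36 * \<alpha> * \<delta> + 2 * \<delta> * \<delta>) * r ^ 4" .
      have J: "J r F i j = integral ?Q (\<lambda>z. F z * pd i (pd j ?\<phi>) z)"
        unfolding J_def using integral_cube_lborel[OF U F(1) test_functionD(1)[OF tpd] QU out] by simp
      have "\<bar>J r F i j\<bar> \<le> integral ?Q (\<lambda>z. C / r ^ 4 * ?W z)"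
        unfolding J
      proof (rule integral_abs_le)
        fix z assume z: "z \<in> ?Q"
        have "\<bar>F z * pd i (pd j ?\<phi>) z\<bar> = \<bar>pd i (pd j ?\<phi>) z\<bar> * \<bar>F z\<bar>" by (simp add: abs_mult)
        also have "\<dots> \<le> C / r ^ 4 * ?W z" by (intro mult_mono C(2) r(1) F(2) z) (use C(1) r(1) in auto)
        finally show "\<bar>F z * pd i (pd j ?\<phi>) z\<bar> \<le> C / r ^ 4 * ?W z" .
      qed (rule continuous_on_mult[OF c(1) c(4)], rule continuous_on_mult[OF continuous_on_const Wc])
      then have "\<bar>J r F i j\<bar> \<le> C / r ^ 4 * integral ?Q ?W" unfolding integral_mult_right .
      also have "\<dots> \<le> C / r ^ 4 * ((36 * \<alpha> * \<delta> + 2 * \<delta> * \<delta>) * r ^ 4)"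
        by (rule mult_left_mono[OF WI]) (use C(1) r(1) in simp)
      also have "\<dots> = C * (36 * \<alpha> * \<delta> + 2 * \<delta> * \<delta>)" using r(1) by simp
      also have "\<dots> \<le> C * ((36 * \<alpha> + 2) * \<delta>)"
      proof (rule mult_left_mono)
        have "2 * \<delta> * \<delta> \<le> 2 * \<delta> * 1" using \<delta> by (intro mult_left_mono) auto
        then show "36 * \<alpha> * \<delta> + 2 * \<delta> * \<delta> \<le> (36 * \<alpha> + 2) * \<delta>" by (simp add: algebra_simps)
      qed (use C(1) in simp)
      finally show ?thesis .
    qed
    have "\<bar>J r ?R11 2 2\<bar> \<le> C * ((36 * \<alpha> + 2) * \<delta>)" by (rule Jb[OF _ W(1)]) (intro continuous_intros ac Pc)
    moreover have "\<bar>J r ?R12 1 2\<bar> \<le> C * ((36 * \<alpha> + 2) * \<delta>)" by (rule Jb[OF _ W(2)]) (intro continuous_intros ac Pc)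
    moreover have "\<bar>J r ?R22 1 1\<bar> \<le> C * ((36 * \<alpha> + 2) * \<delta>)" by (rule Jb[OF _ W(3)]) (intro continuous_intros ac Pc)
    ultimately have "\<bar>J r ?R11 2 2 - 2 * J r ?R12 1 2 + J r ?R22 1 1\<bar> \<le> \<eta>" using \<delta>2 by linarith
    \<comment> \<open>The affine parts give 2 A_2^2 - 2 (A_1 B_2 + A_2 B_1) + 2 B_1^2, which for A_2
      = B_1 is -2 (A_1 B_2 - A_2^2).\<close>
    moreover have "J r (\<lambda>z. ?p z * ?p z) 2 2 - 2 * J r (\<lambda>z. ?p z * ?q z) 1 2 + J r (\<lambda>z. ?q z * ?q z) 1 1
      + 2 * (A $ 1 * B $ 2 - (A $ 2)\<^sup>2) = J r ?R11 2 2 - 2 * J r ?R12 1 2 + J r ?R22 1 1"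
      unfolding split curl by (simp add: sym power2_eq_square algebra_simps)
    ultimately show ?thesis by simp
  qed
  then show ?thesis using d1(1) d2(1) by (intro exI[of _ "min d1 d2"]) auto
qed

text \<open>Individual components have no classical second derivatives, but summed over
  \<open>k\<close> the products become \<open>G\<close>, which is C^2. Both derivatives can then be
  moved from the kernel to \<open>G\<close>, and what remains is the mollification of a continuous
  function.\<close>

lemma hessian_second_fundamental_identity:
  fixes h :: "'n::finite \<Rightarrow> plane \<Rightarrow> real" and G :: "2 \<Rightarrow> 2 \<Rightarrow> plane \<Rightarrow> real"
  assumes U: "open U" and h: "\<And>k. Ck_on 1 U (h k)" and G: "\<And>i j. Ck_on 2 U (G i j)" and x: "x \<in> U"
    and eq: "\<And>y i j. y \<in> U \<Longrightarrow> G i j y = (\<Sum>k\<in>UNIV. pd i (h k) y * pd j (h k) y)"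
    and LD: "\<And>k. LD (pd 1 (h k)) x (A k)" "\<And>k. LD (pd 2 (h k)) x (B k)" and sym: "\<And>k. A k $ 2 = B k $ 1"
  shows "(\<Sum>k\<in>UNIV. A k $ 1 * B k $ 2 - (A k $ 2)\<^sup>2)
    = pd 1 (pd 2 (G 1 2)) x - pd 1 (pd 1 (G 2 2)) x / 2 - pd 2 (pd 2 (G 1 1)) x / 2"
proof -
  let ?F = "\<lambda>z. pd 2 (pd 2 (G 1 1)) z - 2 * pd 1 (pd 2 (G 1 2)) z + pd 1 (pd 1 (G 2 2)) z"
  let ?S = "\<Sum>k\<in>UNIV. A k $ 1 * B k $ 2 - (A k $ 2)\<^sup>2"
  have ppc: "continuous_on U (pd i (pd j (G l m)))" for i j l m using G[of l m] by (auto simp: numeral_2_eq_2)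
  have Gc: "continuous_on U (G l m)" for l m by (rule Ck_on_continuous[OF G])
  have Fc: "continuous_on U ?F" by (intro continuous_intros ppc)
  have pc: "continuous_on U (pd i (h k))" for i k using h[of k] by auto
  obtain d0 where d0: "d0 > 0" "cube x d0 \<subseteq> U" using open_contains_cube[OF U x] .
  \<comment> \<open>One \<open>e\<close> is spent for each component and one for the mollification
    of \<open>?F\<close>.\<close>
  have le: "\<bar>?F x + 2 * ?S\<bar> \<le> (real CARD('n) + 1) * e" if e: "e > 0" for e
  proof -
    let ?J = "\<lambda>r H i j. LINT z|lborel. H z * pd i (pd j (\<lambda>z. kernel r (x - z))) z"
    let ?I = "\<lambda>r k. ?J r (\<lambda>z. pd 1 (h k) z * pd 1 (h k) z) 2 2 - 2 * ?J r (\<lambda>z. pd 1 (h k) z * pd 2 (h k) z) 1 2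
       + ?J r (\<lambda>z. pd 2 (h k) z * pd 2 (h k) z) 1 1"
    have "\<forall>k. \<exists>d>0. \<forall>r. 0 < r \<and> r < d \<longrightarrow> \<bar>?I r k + 2 * (A k $ 1 * B k $ 2 - (A k $ 2)\<^sup>2)\<bar> \<le> e"
      by (rule allI, rule hessian_det_limit[OF U h x LD sym e])
    from choice[OF this] obtain d where
      d': "\<forall>k. d k > 0 \<and> (\<forall>r. 0 < r \<and> r < d k \<longrightarrow> \<bar>?I r k + 2 * (A k $ 1 * B k $ 2 - (A k $ 2)\<^sup>2)\<bar> \<le> e)" ..
    have d: "\<And>k. d k > 0" "\<And>k r. 0 < r \<Longrightarrow> r < d k \<Longrightarrow> \<bar>?I r k + 2 * (A k $ 1 * B k $ 2 - (A k $ 2)\<^sup>2)\<bar> \<le> e"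
      by (rule conjunct1[OF d'[rule_format]], rule conjunct2[OF d'[rule_format], rule_format], rule conjI)
    have "isCont ?F x" using Fc U x by (simp add: continuous_on_eq_continuous_at)
    then obtain d1 where d1: "d1 > 0" "\<And>z. dist z x < d1 \<Longrightarrow> dist (?F z) (?F x) < e"
      unfolding continuous_at_eps_delta using e by meson
    \<comment> \<open>One radius below finitely many thresholds serves all components; d1 / 3
      suffices because the square of half side r lies within distance 2 r of
      \<open>x\<close>.\<close>
    define r where "r = Min (insert d0 (insert (d1 / 3) (range d))) / 2"
    have m: "Min (insert d0 (insert (d1 / 3) (range d))) > 0" using d0 d1 d by (subst Min_gr_iff) auto
    have r: "0 < r" "r < d0" "r < d1 / 3" "r < d k" for k
    proof -
      have "Min (insert d0 (insert (d1 / 3) (range d))) \<le> d0" "Min (insert d0 (insert (d1 / 3) (range d))) \<le> d1 / 3"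
        "Min (insert d0 (insert (d1 / 3) (range d))) \<le> d k" by (intro Min_le; simp)+
      then show "0 < r" "r < d0" "r < d1 / 3" "r < d k" using m unfolding r_def by linarith+
    qed
    let ?\<phi> = "\<lambda>z. kernel r (x - z)"
    have QU: "cube x r \<subseteq> U" using cube_mono[of r d0 x] r(2) d0(2) by auto
    have t: "test_function U ?\<phi>" by (rule test_function_kernel[OF r(1) QU])
    have tpd: "test_function U (pd i (pd j ?\<phi>))" for i j by (intro test_function_pd t)
    have JG: "?J r (G l m) i j = (\<Sum>k\<in>UNIV. ?J r (\<lambda>z. pd l (h k) z * pd m (h k) z) i j)" for l m i j
    proof -
      have "G l m z * pd i (pd j ?\<phi>) z = (\<Sum>k\<in>UNIV. (pd l (h k) z * pd m (h k) z) * pd i (pd j ?\<phi>) z)" for z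
      proof (cases "z \<in> U")
        case True then show ?thesis by (simp add: eq sum_distrib_right)
      next
        case False
        obtain K where K: "K \<subseteq> U" "\<And>x. x \<notin> K \<Longrightarrow> pd i (pd j ?\<phi>) x = 0" using test_functionE[OF tpd] by metis
        have "pd i (pd j ?\<phi>) z = 0" using K False by blast
        then show ?thesis by simp
      qed
      then have "?J r (G l m) i j = (LINT z|lborel. (\<Sum>k\<in>UNIV. (pd l (h k) z * pd m (h k) z) * pd i (pd j ?\<phi>) z))"
        by (intro Bochner_Integration.integral_cong) auto
      also have "\<dots> = (\<Sum>k\<in>UNIV. ?J r (\<lambda>z. pd l (h k) z * pd m (h k) z) i j)"
        by (intro Bochner_Integration.integral_sum integrable_times_test_function(2)[OF U _ tpd] continuous_intros pc)
      finally show ?thesis .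
    qed
    have comm: "pd 1 (pd 2 ?\<phi>) z = pd 2 (pd 1 ?\<phi>) z" for z by (rule pd_commute) (rule Ck_on_kernel_shift)
    have pint: "integrable lborel (\<lambda>z. pd i (pd j (G l m)) z * ?\<phi> z)" for i j l m
      by (rule integrable_times_test_function(2)[OF U ppc t])
    have "(\<Sum>k\<in>UNIV. ?I r k) = ?J r (G 1 1) 2 2 - 2 * ?J r (G 1 2) 1 2 + ?J r (G 2 2) 1 1"
      unfolding JG by (simp add: sum.distrib sum_subtractf sum_distrib_left)
    also have "?J r (G 1 1) 2 2 = (LINT z|lborel. pd 2 (pd 2 (G 1 1)) z * ?\<phi> z)" by (rule integral_by_parts_twice[OF U G t])
    also have "?J r (G 1 2) 1 2 = (LINT z|lborel. pd 1 (pd 2 (G 1 2)) z * ?\<phi> z)"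
      unfolding comm by (rule integral_by_parts_twice[OF U G t])
    also have "?J r (G 2 2) 1 1 = (LINT z|lborel. pd 1 (pd 1 (G 2 2)) z * ?\<phi> z)" by (rule integral_by_parts_twice[OF U G t])
    also have "(LINT z|lborel. pd 2 (pd 2 (G 1 1)) z * ?\<phi> z) - 2 * (LINT z|lborel. pd 1 (pd 2 (G 1 2)) z * ?\<phi> z)
        + (LINT z|lborel. pd 1 (pd 1 (G 2 2)) z * ?\<phi> z)
      = (LINT z|lborel. pd 2 (pd 2 (G 1 1)) z * ?\<phi> z - 2 * (pd 1 (pd 2 (G 1 2)) z * ?\<phi> z) + pd 1 (pd 1 (G 2 2)) z * ?\<phi> z)"
      using pint by simp
    also have "\<dots> = (LINT z|lborel. ?F z * ?\<phi> z)" by (intro Bochner_Integration.integral_cong) (auto simp: algebra_simps)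
    \<comment> \<open>Written with radius \<open>0 + r\<close> so that \<open>mollify_close\<close>
      applies to the degenerate square consisting of \<open>x\<close> alone.\<close>
    also have "\<dots> = mollify x (0 + r) r ?F x"
      using integral_cube_lborel[OF U Fc test_functionD(1)[OF t] QU] kernel_eq_0[OF r(1)] cube_shift
      unfolding mollify_def by (simp add: mult.commute)
    finally have sum_eq: "(\<Sum>k\<in>UNIV. ?I r k) = mollify x (0 + r) r ?F x" .
    have "\<bar>mollify x (0 + r) r ?F x - ?F x\<bar> \<le> e"
    proof (rule mollify_close[OF U Fc r(1)])
      show "cube x (0 + r) \<subseteq> U" "x \<in> cube x 0" using QU by (simp_all add: mem_cube)
      fix z assume "z \<in> cube x r"
      then have "dist x z \<le> 2 * r" using cube_subset_cball by fastforce
      then have "dist z x < d1" using r(1,3) d1(1) by (simp add: dist_commute)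
      from d1(2)[OF this] show "\<bar>?F z - ?F x\<bar> \<le> e" unfolding dist_real_def by (rule less_imp_le)
    qed
    moreover have "\<bar>(\<Sum>k\<in>UNIV. ?I r k) + 2 * ?S\<bar> \<le> real CARD('n) * e"
    proof -
      have *: "\<bar>(\<Sum>k\<in>UNIV. f k) + 2 * (\<Sum>k\<in>UNIV. s k)\<bar> \<le> real CARD('n) * e"
        if "\<And>k. \<bar>f k + 2 * s k\<bar> \<le> e" for f s :: "'n \<Rightarrow> real"
      proof -
        have "(\<Sum>k\<in>UNIV. f k) + 2 * (\<Sum>k\<in>UNIV. s k) = (\<Sum>k\<in>UNIV. f k + 2 * s k)"
          by (simp add: sum.distrib sum_distrib_left)
        also have "\<bar>\<dots>\<bar> \<le> (\<Sum>k\<in>UNIV. \<bar>f k + 2 * s k\<bar>)" by (rule sum_abs)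
        also have "\<dots> \<le> (\<Sum>k\<in>(UNIV::'n set). e)" by (intro sum_mono that)
        finally show ?thesis by simp
      qed
      show ?thesis by (rule *) (rule d(2)[OF r(1) r(4)])
    qed
    ultimately show ?thesis unfolding sum_eq by (simp add: distrib_right abs_le_iff)
  qed
  have "\<bar>?F x + 2 * ?S\<bar> \<le> e" if "e > 0" for e
  proof -
    have "e / (real CARD('n) + 1) > 0" using that by (intro divide_pos_pos) auto
    from le[OF this] show ?thesis by (simp add: add_nonneg_eq_0_iff)
  qed
  then have "?F x + 2 * ?S = 0" using field_le_epsilon[of "\<bar>?F x + 2 * ?S\<bar>" 0] by simp
  then show ?thesis by (simp add: field_simps)
qed

section \<open>Almost everywhere mean Hessians\<close>

lemma hessian_rep_cong:
  assumes "open W" "hessian_rep W h i j P N" "\<And>x. x \<in> W \<Longrightarrow> h x = k x"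
  shows "hessian_rep W k i j P N"
proof -
  have "(LINT x|lborel. k x * pd i (pd j \<phi>) x) = (LINT x|lborel. h x * pd i (pd j \<phi>) x)" if "test_function W \<phi>" for \<phi>
  proof (intro Bochner_Integration.integral_cong refl)
    fix x
    have "test_function W (pd i (pd j \<phi>))" by (intro test_function_pd that)
    then obtain K where "K \<subseteq> W" "\<And>x. x \<notin> K \<Longrightarrow> pd i (pd j \<phi>) x = 0" using test_functionE by metis
    then show "k x * pd i (pd j \<phi>) x = h x * pd i (pd j \<phi>) x" using assms(3) by (cases "x \<in> W") auto
  qed
  then show ?thesis using assms(2) by (simp add: hessian_rep_def)
qed

lemma hessian_rep_densities:
  assumes U: "open U" and rep: "\<And>i j. \<exists>P N. hessian_rep U h i j P N"
  obtains P N p n where "\<And>i j. hessian_rep U h i j (P i j) (N i j)"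
    "\<And>i j. ac_density (P i j) (p i j)" "\<And>i j. ac_density (N i j) (n i j)"
proof -
  have "\<exists>P N p n. hessian_rep U h i j P N \<and> ac_density P p \<and> ac_density N n" for i j
  proof -
    obtain P N where PN: "hessian_rep U h i j P N" using rep by blast
    then have "radon_measure_on U P" "radon_measure_on U N" by (auto simp: hessian_rep_def)
    with PN show ?thesis using radon_ac_density_exists[OF U] by meson
  qed
  then show thesis using that by metis
qed

text \<open>Measures representing the entry (1,2) represent (2,1) as well. Using the same measures
  and densities for both entries gives symmetry at once, with no comparison of different
  decompositions.\<close>

lemma AE_LD_symmetric_hessian:
  assumes U: "open U" and h: "Ck_on 1 U h" and rep: "\<And>i j. \<exists>P N. hessian_rep U h i j P N"
  shows "AE x in lebesgue. x \<in> U \<longrightarrow> (\<exists>A B. LD (pd 1 h) x A \<and> LD (pd 2 h) x B \<and> A $ 2 = B $ 1)"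
proof -
  obtain P N p n where *: "\<And>i j. hessian_rep U h i j (P i j) (N i j)"
    "\<And>i j. ac_density (P i j) (p i j)" "\<And>i j. ac_density (N i j) (n i j)"
    by (rule hessian_rep_densities[OF U rep]) (rule that; assumption)
  let ?s = "\<lambda>q i j. if i = (2::2) \<and> j = (1::2) then q 1 2 else q i j"
  have rep': "hessian_rep U h i j (?s P i j) (?s N i j)" for i j
    using *(1)[of i j] hessian_rep_commute[OF *(1)[of 1 2]] by auto
  have ac: "ac_density (?s P i j) (?s p i j)" "ac_density (?s N i j) (?s n i j)" for i j
    using *(2,3) by auto
  have c: "continuous_on U (pd i h)" for i using h by simp
  have "AE x in lebesgue. x \<in> U \<longrightarrow> LD (pd i h) x (\<chi> j. ?s p i j x - ?s n i j x)" for i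
  proof (rule AE_LD[OF U c _ ac])
    show "weak_pd j U (pd i h) (?s P i j) (?s N i j)" for j
      using rep' hessian_rep_iff_weak_pd[OF U h] by blast
  qed
  from this[of 1] this[of 2] show ?thesis
    by eventually_elim (auto intro!: exI)
qed

text \<open>Existence of representing measures with densities makes the choice in
  \<open>ac_hessian\<close> meaningful. Whatever representative is chosen comes with its own
  measures, and the mean derivative is computed from those.\<close>

lemma AE_LD_ac_hessian:
  assumes U: "open U" and h: "Ck_on 1 U h" and rep: "\<And>i j. \<exists>P N. hessian_rep U h i j P N"
  shows "AE x in lebesgue. x \<in> U \<longrightarrow> (\<forall>i. LD (pd i h) x (ac_hessian U h x $ i))"
proof -
  have hc: "continuous_on U h" by (rule Ck_on_continuous[OF h])
  have int: "(LINT x:U|lebesgue. h x * pd i (pd j \<phi>) x) = (LINT x|lborel. h x * pd i (pd j \<phi>) x)"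
    if "test_function U \<phi>" for \<phi> i j
    by (rule set_integral_times_test_function[OF U hc]) (intro test_function_pd that)
  have iff: "hessian_measure U h P N \<longleftrightarrow> (\<forall>i j. hessian_rep U h i j (P i j) (N i j))" for P N
  proof -
    have "h absolutely_integrable_on K" if "compact K" "K \<subseteq> U" for K
      by (rule absolutely_integrable_on_compact[OF continuous_on_subset[OF hc that(2)] that(1)])
    then show ?thesis by (auto simp: hessian_measure_def hessian_rep_def int)
  qed
  obtain P N p n where "\<And>i j. hessian_rep U h i j (P i j) (N i j)"
    "\<And>i j. ac_density (P i j) (p i j)" "\<And>i j. ac_density (N i j) (n i j)"
    by (rule hessian_rep_densities[OF U rep]) (rule that; assumption)
  then have "\<exists>H. \<exists>P N p n. hessian_measure U h P N \<and>
     (\<forall>i j. ac_density (P i j) (p i j) \<and> ac_density (N i j) (n i j)) \<and> H = (\<lambda>x. \<chi> i j. p i j x - n i j x)"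
    unfolding iff by blast
  then have "\<exists>P N p n. hessian_measure U h P N \<and>
     (\<forall>i j. ac_density (P i j) (p i j) \<and> ac_density (N i j) (n i j)) \<and> ac_hessian U h = (\<lambda>x. \<chi> i j. p i j x - n i j x)"
    unfolding ac_hessian_def by (rule someI_ex)
  then obtain P N p n where *: "\<And>i j. hessian_rep U h i j (P i j) (N i j)"
    "\<And>i j. ac_density (P i j) (p i j)" "\<And>i j. ac_density (N i j) (n i j)"
    and H: "ac_hessian U h = (\<lambda>x. \<chi> i j. p i j x - n i j x)"
    unfolding iff by blast
  have c: "continuous_on U (pd i h)" for i using h by simp
  have "AE x in lebesgue. x \<in> U \<longrightarrow> LD (pd i h) x (\<chi> j. p i j x - n i j x)" for i
  proof (rule AE_LD[OF U c _ *(2,3)])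
    show "weak_pd j U (pd i h) (P i j) (N i j)" for j
      using *(1) hessian_rep_iff_weak_pd[OF U h] by blast
  qed
  from this[of 1] this[of 2] show ?thesis
    unfolding H by eventually_elim (auto simp: forall_2)
qed

text \<open>A C^1 map between planar sets sends null sets to null sets, so exceptional sets in
  \<open>U\<close> remain exceptional in \<open>U'\<close>.\<close>

lemma AE_diffeomorphism:
  assumes D: "C1_diffeomorphism U U' \<Psi> \<Phi>" and AE: "AE x in lebesgue. x \<in> U \<longrightarrow> Q x"
  shows "AE y in lebesgue. y \<in> U' \<longrightarrow> Q (\<Phi> y)"
proof -
  have h: "homeomorphism U U' \<Psi> \<Phi>" and C: "Ck_on 1 U \<Psi>"
    using D by (auto simp: C1_diffeomorphism_def)
  obtain N where N: "N \<in> null_sets lebesgue" "{x. \<not> (x \<in> U \<longrightarrow> Q x)} \<subseteq> N"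
    using AE unfolding eventually_ae_filter by auto
  have "negligible (\<Psi> ` (N \<inter> U))"
  proof (rule negligible_differentiable_image_negligible)
    show "negligible (N \<inter> U)" using N(1) negligible_Int by (auto simp: negligible_iff_null_sets)
    show "\<Psi> differentiable_on N \<inter> U"
      using C by (auto simp: differentiable_on_def intro: differentiable_at_withinI)
  qed simp
  then have "AE y in lebesgue. y \<notin> \<Psi> ` (N \<inter> U)"
    by (simp add: AE_not_in negligible_iff_null_sets)
  then show ?thesis
  proof eventually_elim
    case (elim y)
    show ?case
    proof
      assume "y \<in> U'"
      then have "\<Phi> y \<in> U" "\<Psi> (\<Phi> y) = y" using h by (auto simp: homeomorphism_def)
      with elim N(2) show "Q (\<Phi> y)" by (metis (mono_tags, lifting) IntI image_eqI mem_Collect_eq subsetD)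
    qed
  qed
qed

section \<open>The Gauss equation\<close>

text \<open>The Gram determinant of (p, q, a) against (p, q, b), expanded along the last vectors,
  equals the product of the triple products det(p, q, a) and det(p, q, b). The left side is the form
  in which tangential components appear in the Gauss equation.\<close>

lemma gram_identity:
  fixes a1 :: real
  shows "((p1 * p1 + p2 * p2 + p3 * p3) * (q1 * q1 + q2 * q2 + q3 * q3) - (p1 * q1 + p2 * q2 + p3 * q3)\<^sup>2) * (a1 * b1 + a2 * b2 + a3 * b3)
    - ((q1 * q1 + q2 * q2 + q3 * q3) * ((a1 * p1 + a2 * p2 + a3 * p3) * (b1 * p1 + b2 * p2 + b3 * p3))
     - (p1 * q1 + p2 * q2 + p3 * q3) * ((a1 * p1 + a2 * p2 + a3 * p3) * (b1 * q1 + b2 * q2 + b3 * q3)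
         + (a1 * q1 + a2 * q2 + a3 * q3) * (b1 * p1 + b2 * p2 + b3 * p3))
     + (p1 * p1 + p2 * p2 + p3 * p3) * ((a1 * q1 + a2 * q2 + a3 * q3) * (b1 * q1 + b2 * q2 + b3 * q3)))
    = (a1 * (p2 * q3 - p3 * q2) + a2 * (p3 * q1 - p1 * q3) + a3 * (p1 * q2 - p2 * q1))
      * (b1 * (p2 * q3 - p3 * q2) + b2 * (p3 * q1 - p1 * q3) + b3 * (p1 * q2 - p2 * q1))"
  by algebra

text \<open>Here p and q are the tangent vectors of \<open>u\<close>; a, m and b are its mean second
  derivatives 11, 12 and 22; the t are their tangential components. The Gram identity, used for (a,
  b) and for (m, m), leaves only triple products with p x q, in which everything but the transported
  Hessian of \<open>f\<close> cancels.\<close>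

lemma gauss_equation_algebra:
  fixes K :: real
  assumes p3: "p3 = f1 * p1 + f2 * p2" "q3 = f1 * q1 + f2 * q2"
    and a3: "a3 = f1 * a1 + f2 * a2 + (H11 * p1 + H12 * p2) * p1 + (H21 * p1 + H22 * p2) * p2"
      "m3 = f1 * m1 + f2 * m2 + (H11 * q1 + H12 * q2) * p1 + (H21 * q1 + H22 * q2) * p2"
      "m3 = f1 * m1 + f2 * m2 + (H11 * p1 + H12 * p2) * q1 + (H21 * p1 + H22 * p2) * q2"
      "b3 = f1 * b1 + f2 * b2 + (H11 * q1 + H12 * q2) * q1 + (H21 * q1 + H22 * q2) * q2"
    and J: "p1 * q2 - p2 * q1 \<noteq> 0"
    and g: "g11 = p1 * p1 + p2 * p2 + p3 * p3" "g12 = p1 * q1 + p2 * q2 + p3 * q3" "g22 = q1 * q1 + q2 * q2 + q3 * q3"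
    and T: "t111 = a1 * p1 + a2 * p2 + a3 * p3" "t112 = a1 * q1 + a2 * q2 + a3 * q3"
      "t121 = m1 * p1 + m2 * p2 + m3 * p3" "t122 = m1 * q1 + m2 * q2 + m3 * q3"
      "t221 = b1 * p1 + b2 * p2 + b3 * p3" "t222 = b1 * q1 + b2 * q2 + b3 * q3"
    and R: "R = (a1 * b1 + a2 * b2 + a3 * b3) - (m1 * m1 + m2 * m2 + m3 * m3)"
    and K: "K * (g11 * g22 - g12 * g12)\<^sup>2 = (g11 * g22 - g12 * g12) * R
      - (g22 * (t111 * t221 - t121\<^sup>2) - g12 * (t111 * t222 + t112 * t221 - 2 * t121 * t122) + g11 * (t112 * t222 - t122\<^sup>2))"
  shows "H11 * H22 - H12 * H21 = K * (1 + (f1\<^sup>2 + f2\<^sup>2))\<^sup>2"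
proof -
  define J where "J = p1 * q2 - p2 * q1"
  let ?n1 = "p2 * q3 - p3 * q2" and ?n2 = "p3 * q1 - p1 * q3"
  \<comment> \<open>The cross product of the tangent vectors is J times (-f1, -f2, 1), a normal of
    the graph.\<close>
  have n: "?n1 = - f1 * J" "?n2 = - f2 * J" by (simp_all add: p3 J_def algebra_simps)
  have det: "g11 * g22 - g12 * g12 = J\<^sup>2 * (1 + (f1\<^sup>2 + f2\<^sup>2))"
  proof -
    have "g11 * g22 - g12 * g12 = ?n1\<^sup>2 + ?n2\<^sup>2 + J\<^sup>2" unfolding g J_def by algebra
    then show ?thesis unfolding n by (simp add: power_mult_distrib algebra_simps)
  qed
  define \<alpha> where "\<alpha> = (H11 * p1 + H12 * p2) * p1 + (H21 * p1 + H22 * p2) * p2"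
  define \<mu> where "\<mu> = (H11 * q1 + H12 * q2) * p1 + (H21 * q1 + H22 * q2) * p2"
  define \<mu>' where "\<mu>' = (H11 * p1 + H12 * p2) * q1 + (H21 * p1 + H22 * p2) * q2"
  define \<beta> where "\<beta> = (H11 * q1 + H12 * q2) * q1 + (H21 * q1 + H22 * q2) * q2"
  have N: "a1 * ?n1 + a2 * ?n2 + a3 * J = J * \<alpha>" "b1 * ?n1 + b2 * ?n2 + b3 * J = J * \<beta>"
    "m1 * ?n1 + m2 * ?n2 + m3 * J = J * \<mu>"
    unfolding n by (simp_all add: a3(1,2,4) \<alpha>_def \<beta>_def \<mu>_def algebra_simps)
  \<comment> \<open>\<open>H\<close> is not assumed symmetric. The determinant law for the
    congruence of \<open>H\<close> by the matrix with columns (p1, p2) and (q1, q2) involves both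
    mixed entries, and the two expressions for m3 identify them.\<close>
  have "\<mu> = \<mu>'" using a3(2,3) by (simp add: \<mu>_def \<mu>'_def)
  then have detH: "\<alpha> * \<beta> - \<mu> * \<mu> = J\<^sup>2 * (H11 * H22 - H12 * H21)"
  proof -
    have "\<alpha> * \<beta> - \<mu> * \<mu>' = J\<^sup>2 * (H11 * H22 - H12 * H21)"
      unfolding \<alpha>_def \<beta>_def \<mu>_def \<mu>'_def J_def by algebra
    with \<open>\<mu> = \<mu>'\<close> show ?thesis by simp
  qed
  have "K * (g11 * g22 - g12 * g12)\<^sup>2
    = ((g11 * g22 - g12\<^sup>2) * (a1 * b1 + a2 * b2 + a3 * b3)
       - (g22 * (t111 * t221) - g12 * (t111 * t222 + t112 * t221) + g11 * (t112 * t222)))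
     - ((g11 * g22 - g12\<^sup>2) * (m1 * m1 + m2 * m2 + m3 * m3)
       - (g22 * (t121 * t121) - g12 * (t121 * t122 + t122 * t121) + g11 * (t122 * t122)))"
    unfolding K R by (simp add: power2_eq_square algebra_simps)
  also have "\<dots> = (J * \<alpha>) * (J * \<beta>) - (J * \<mu>) * (J * \<mu>)"
    unfolding g T gram_identity J_def[symmetric] N ..
  also have "\<dots> = J\<^sup>2 * (\<alpha> * \<beta> - \<mu> * \<mu>)" by (simp add: power2_eq_square algebra_simps)
  also have "\<dots> = J ^ 4 * (H11 * H22 - H12 * H21)" unfolding detH by (simp add: power2_eq_square power4_eq_xxxx)
  finally have "J ^ 4 * (K * (1 + (f1\<^sup>2 + f2\<^sup>2))\<^sup>2) = J ^ 4 * (H11 * H22 - H12 * H21)"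
    unfolding det by (simp add: power_mult_distrib mult_ac flip: power_mult)
  then show ?thesis using J by (simp add: J_def)
qed

theorem corollary1p4:
  fixes U U' :: "(real ^ 2) set"
    and g :: "real ^ 2 \<Rightarrow> real ^ 2 ^ 2"
    and u :: "real ^ 2 \<Rightarrow> real ^ 3"
    and \<Psi> \<Phi> :: "real ^ 2 \<Rightarrow> real ^ 2"
    and v f :: "real ^ 2 \<Rightarrow> real"
  assumes "planar_domain U"
    and "riemannian_metric_on U g"
    and "\<And>k. locally_in (little_C1_holder (1/2)) U (\<lambda>x. u x $ k)"
    and "\<And>k. locally_in BV2 U (\<lambda>x. u x $ k)"
    and "isometric_embedding U g u"
    and "\<And>x. x \<in> U \<Longrightarrow> u x = vector [\<Psi> x $ 1, \<Psi> x $ 2, v x]"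
    and "C1_diffeomorphism U U' \<Psi> \<Phi>"
    and "\<And>y. y \<in> U' \<Longrightarrow> f y = v (\<Phi> y)"
    and "u ` U = {vector [y $ 1, y $ 2, f y] | y. y \<in> U'}"
  shows "AE x in lebesgue. x \<in> U' \<longrightarrow>
    det (ac_hessian U' f x) = gauss_curvature g (\<Phi> x) * (1 + (norm (grad f x))\<^sup>2)\<^sup>2"
proof -
  let ?h = "\<lambda>k x. u x $ k"
  have U: "open U" and U': "open U'" and hom: "homeomorphism U U' \<Psi> \<Phi>" and \<Psi>C: "Ck_on 1 U \<Psi>"
    using assms(7) by (auto simp: C1_diffeomorphism_def)
  have uC: "Ck_on 1 U u" using assms(5) by (simp add: isometric_embedding_def)
  have hC: "Ck_on 1 U (?h k)" for k by (rule Ck_on_component[OF U uC])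
  have comp: "?h 1 x = \<Psi> x $ 1" "?h 2 x = \<Psi> x $ 2" "?h 3 x = v x" if "x \<in> U" for x
    unfolding assms(6)[OF that] by (simp_all only: vector_3)
  have rep: "\<exists>P N. hessian_rep U (?h k) i j P N" for k i j
    by (rule locally_BV2_hessian_rep[OF U Ck_on_continuous[OF hC] assms(4)])
  have vC: "Ck_on 1 U v" by (rule Ck_on_cong[OF U, THEN iffD1, OF _ hC]) (rule comp)
  have rep_cong: "\<exists>P N. hessian_rep U q i j P N" if "\<And>x. x \<in> U \<Longrightarrow> ?h k x = q x" for k q i j
    using rep[of k i j] hessian_rep_cong[OF U, of "?h k" i j _ _ q] that by blast
  have vrep: "\<exists>P N. hessian_rep U v i j P N" for i j by (rule rep_cong) (rule comp(3))
  have \<Psi>rep: "\<exists>P N. hessian_rep U (\<lambda>x. \<Psi> x $ k) i j P N" for k i j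
  proof (cases "k = 1")
    case True
    show ?thesis unfolding True by (rule rep_cong) (rule comp(1))
  next
    case False
    then have k: "k = 2" using exhaust_2 by blast
    show ?thesis unfolding k by (rule rep_cong) (rule comp(2))
  qed
  have fC: "Ck_on 1 U' f" by (rule C1_diffeomorphism_transported_pd(1)[OF assms(7) vC assms(8)])
  have frep: "\<exists>P N. hessian_rep U' f i j P N" for i j
    by (rule hessian_rep_graph[OF assms(7) vC assms(8) vrep \<Psi>rep])
  have inj: "inj_on \<Psi> U" using hom by (auto simp: homeomorphism_def intro: inj_on_inverseI[of _ \<Phi>])
  have metric: "g x $ i $ j = (\<Sum>k\<in>UNIV. pd i (?h k) x * pd j (?h k) x)" if "x \<in> U" for x i j
  proof -
    have "u differentiable (at x)" using uC that by simp
    then show ?thesis using assms(5) that by (simp add: isometric_embedding_def pd_component inner_vec_def)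
  qed
  have AE_h: "AE x in lebesgue. x \<in> U \<longrightarrow> (\<exists>A B. LD (pd 1 (?h k)) x A \<and> LD (pd 2 (?h k)) x B \<and> A $ 2 = B $ 1)" for k
    by (rule AE_LD_symmetric_hessian[OF U hC rep])
  have "AE x in lebesgue. x \<in> U \<longrightarrow> (\<forall>k. \<exists>A B. LD (pd 1 (?h k)) x A \<and> LD (pd 2 (?h k)) x B \<and> A $ 2 = B $ 1)"
    using AE_h[of 1] AE_h[of 2] AE_h[of 3] by eventually_elim (simp add: forall_3)
  \<comment> \<open>The exceptional set for the components of \<open>u\<close> lies in
    \<open>U\<close>, that for the Hessian of \<open>f\<close> in \<open>U'\<close>; the former is
    carried over, so that both statements hold at a common point.\<close>
  note AE_h' = AE_diffeomorphism[OF assms(7) this]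
  from AE_LD_ac_hessian[OF U' fC frep] AE_h' show ?thesis
  proof eventually_elim
    case (elim y)
    show ?case
    proof
      assume y: "y \<in> U'"
      define x where "x = \<Phi> y"
      have x: "x \<in> U" "\<Psi> x = y" using hom y by (auto simp: homeomorphism_def x_def)
      define H where "H = ac_hessian U' f y"
      have LDf: "LD (pd i f) (\<Psi> x) (H $ i)" for i using elim(1) y x(2) by (simp add: H_def)
      obtain A B where AB: "\<And>k. LD (pd 1 (?h k)) x (A k)" "\<And>k. LD (pd 2 (?h k)) x (B k)" "\<And>k. A k $ 2 = B k $ 1"
        using elim(2) y unfolding x_def[symmetric] by metis
      \<comment> \<open>\<open>?D i k $ j\<close> plays the role of the second derivative of the
        k-th component in directions i and j.\<close>
      let ?D = "\<lambda>i k. if i = (1::2) then A k else B k"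
      have LDh: "LD (pd i (?h k)) x (?D i k)" for i k using AB(1,2)[of k] exhaust_2[of i] by auto
      have Dsym: "?D i k $ j = ?D j k $ i" for i j k using AB(3)[of k] exhaust_2[of i] exhaust_2[of j] by auto
      let ?p = "\<lambda>i k. pd i (?h k) x"
      have gsm: "Ck_on n U (\<lambda>y. g y $ i $ j)" for n i j by (rule riemannian_metric_entries(1)[OF U assms(2)])
      \<comment> \<open>The metric entries are differentiated twice over: as smooth functions, and
        in the mean by the product rule. Uniqueness of the mean derivative equates the
        results.\<close>
      have dg: "pd m (\<lambda>y. g y $ i $ j) x = (\<Sum>k\<in>UNIV. ?p i k * ?D j k $ m + ?p j k * ?D i k $ m)" for m i j
      proof -
        have "LD (\<lambda>z. \<Sum>k\<in>UNIV. pd i (?h k) z * pd j (?h k) z) x (\<Sum>k\<in>UNIV. ?p i k *\<^sub>R ?D j k + ?p j k *\<^sub>R ?D i k)"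
          by (intro LD_sum LD_mult LDh)
        moreover have "LD (\<lambda>z. \<Sum>k\<in>UNIV. pd i (?h k) z * pd j (?h k) z) x (grad (\<lambda>y. g y $ i $ j) x)"
          by (rule LD_cong[OF LD_C1[OF U gsm x(1)] U x(1)]) (rule metric)
        ultimately have "grad (\<lambda>y. g y $ i $ j) x = (\<Sum>k\<in>UNIV. ?p i k *\<^sub>R ?D j k + ?p j k *\<^sub>R ?D i k)"
          by (rule LD_unique[symmetric])
        then have "grad (\<lambda>y. g y $ i $ j) x $ m = (\<Sum>k\<in>UNIV. ?p i k * ?D j k $ m + ?p j k * ?D i k $ m)"
          by simp
        then show ?thesis by (simp add: grad_def)
      qed
      have T: "christoffel_lower g m i j x = (\<Sum>k\<in>UNIV. ?D i k $ j * ?p m k)" for m i j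
      proof -
        \<comment> \<open>The usual permutation of indices: by the symmetry \<open>Dsym\<close> all
          terms cancel in pairs except two copies of one.\<close>
        have "?p j k * ?D m k $ i + ?p m k * ?D j k $ i + (?p i k * ?D m k $ j + ?p m k * ?D i k $ j)
          - (?p i k * ?D j k $ m + ?p j k * ?D i k $ m) = 2 * (?D i k $ j * ?p m k)" for k
          using Dsym[of m k i] Dsym[of m k j] Dsym[of j k i] by simp
        then have "(\<Sum>k\<in>UNIV. 2 * (?D i k $ j * ?p m k)) = pd i (\<lambda>y. g y $ j $ m) x + pd j (\<lambda>y. g y $ i $ m) x - pd m (\<lambda>y. g y $ i $ j) x"
          unfolding dg sum.distrib[symmetric] sum_subtractf[symmetric] by (intro sum.cong refl) simp
        then show ?thesis unfolding christoffel_lower_def by (simp add: sum_distrib_left[symmetric])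
      qed
      have R: "curvature_second_order g x = (\<Sum>k\<in>UNIV. A k $ 1 * B k $ 2 - (A k $ 2)\<^sup>2)"
        unfolding curvature_second_order_def
        by (rule hessian_second_fundamental_identity[symmetric, OF U hC gsm x(1) metric AB])
      have p\<Psi>: "pd i \<Psi> z $ 1 = pd i (?h 1) z" "pd i \<Psi> z $ 2 = pd i (?h 2) z" "pd i v z = pd i (?h 3) z" if "z \<in> U" for i z
      proof -
        have d: "\<Psi> differentiable (at z)" using \<Psi>C that by simp
        show "pd i \<Psi> z $ 1 = pd i (?h 1) z" "pd i \<Psi> z $ 2 = pd i (?h 2) z"
          unfolding pd_component[OF d, symmetric] by (rule pd_cong[OF U that], rule comp[symmetric], assumption)+
        show "pd i v z = pd i (?h 3) z" by (rule pd_cong[OF U that]) (rule comp(3)[symmetric])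
      qed
      have chain: "pd i (?h 3) z = pd 1 f (\<Psi> z) * pd i (?h 1) z + pd 2 f (\<Psi> z) * pd i (?h 2) z" if "z \<in> U" for i z
        using C1_diffeomorphism_transported_pd(2)[OF assms(7) vC assms(8) that, of i] unfolding p\<Psi>[OF that] .
      have J0: "det (matrix (frechet_derivative \<Psi> (at x))) \<noteq> 0" by (rule C1_diffeomorphism_det[OF assms(7) x(1)])
      have J: "?p 1 1 * ?p 2 2 - ?p 1 2 * ?p 2 1 \<noteq> 0"
        using J0 unfolding det_frechet p\<Psi>[OF x(1)] by (simp add: mult.commute)
      let ?M = "\<lambda>l. \<chi> i. \<Sum>k\<in>UNIV. H $ l $ k * pd i \<Psi> x $ k"
      \<comment> \<open>The third component is f o \<Psi>, so its partial derivatives are also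
        differentiable in the mean by product and chain rule. This is the point where the Hessian of
        \<open>f\<close> enters.\<close>
      have D3: "?D i 3 = (pd 1 f y *\<^sub>R ?D i 1 + ?p i 1 *\<^sub>R ?M 1) + (pd 2 f y *\<^sub>R ?D i 2 + ?p i 2 *\<^sub>R ?M 2)" for i
      proof (rule LD_unique[OF LDh])
        have "LD (\<lambda>z. pd 1 f (\<Psi> z) * pd i (?h 1) z + pd 2 f (\<Psi> z) * pd i (?h 2) z) x
          ((pd 1 f (\<Psi> x) *\<^sub>R ?D i 1 + ?p i 1 *\<^sub>R ?M 1) + (pd 2 f (\<Psi> x) *\<^sub>R ?D i 2 + ?p i 2 *\<^sub>R ?M 2))"
          by (intro LD_add LD_mult LDh LD_compose[OF U \<Psi>C x(1) inj J0] LDf)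
        then show "LD (pd i (?h 3)) x ((pd 1 f y *\<^sub>R ?D i 1 + ?p i 1 *\<^sub>R ?M 1) + (pd 2 f y *\<^sub>R ?D i 2 + ?p i 2 *\<^sub>R ?M 2))"
          unfolding x(2) by (rule LD_cong[OF _ U x(1)]) (rule chain[symmetric])
      qed
      have D3': "?D i 3 $ j = pd 1 f y * ?D i 1 $ j + pd 2 f y * ?D i 2 $ j
        + (H $ 1 $ 1 * ?p j 1 + H $ 1 $ 2 * ?p j 2) * ?p i 1 + (H $ 2 $ 1 * ?p j 1 + H $ 2 $ 2 * ?p j 2) * ?p i 2" for i j
        unfolding D3[of i] by (simp add: sum_2 p\<Psi>[OF x(1)] algebra_simps)
      have K: "gauss_curvature g x * (g x $ 1 $ 1 * g x $ 2 $ 2 - g x $ 1 $ 2 * g x $ 1 $ 2)\<^sup>2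
        = (g x $ 1 $ 1 * g x $ 2 $ 2 - g x $ 1 $ 2 * g x $ 1 $ 2) * curvature_second_order g x
        - (g x $ 2 $ 2 * (christoffel_lower g 1 1 1 x * christoffel_lower g 1 2 2 x - (christoffel_lower g 1 1 2 x)\<^sup>2)
         - g x $ 1 $ 2 * (christoffel_lower g 1 1 1 x * christoffel_lower g 2 2 2 x + christoffel_lower g 2 1 1 x * christoffel_lower g 1 2 2 x
              - 2 * christoffel_lower g 1 1 2 x * christoffel_lower g 2 1 2 x)
         + g x $ 1 $ 1 * (christoffel_lower g 2 1 1 x * christoffel_lower g 2 2 2 x - (christoffel_lower g 2 1 2 x)\<^sup>2))"
        using gauss_curvature_eq[OF U assms(2) x(1)] riemannian_metric_entries(2)[OF U assms(2) x(1), of 2 1] by (simp add: det_2)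
      have "H $ 1 $ 1 * H $ 2 $ 2 - H $ 1 $ 2 * H $ 2 $ 1 = gauss_curvature g x * (1 + ((pd 1 f y)\<^sup>2 + (pd 2 f y)\<^sup>2))\<^sup>2"
      proof (rule gauss_equation_algebra[OF _ _ _ _ _ _ J _ _ _ _ _ _ _ _ _ _ K])
        show "?p 1 3 = pd 1 f y * ?p 1 1 + pd 2 f y * ?p 1 2" "?p 2 3 = pd 1 f y * ?p 2 1 + pd 2 f y * ?p 2 2"
          using chain[OF x(1)] x(2) by simp_all
        show "A 3 $ 1 = pd 1 f y * A 1 $ 1 + pd 2 f y * A 2 $ 1
          + (H $ 1 $ 1 * ?p 1 1 + H $ 1 $ 2 * ?p 1 2) * ?p 1 1 + (H $ 2 $ 1 * ?p 1 1 + H $ 2 $ 2 * ?p 1 2) * ?p 1 2"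
          using D3'[of 1 1] by simp
        show "A 3 $ 2 = pd 1 f y * A 1 $ 2 + pd 2 f y * A 2 $ 2
          + (H $ 1 $ 1 * ?p 2 1 + H $ 1 $ 2 * ?p 2 2) * ?p 1 1 + (H $ 2 $ 1 * ?p 2 1 + H $ 2 $ 2 * ?p 2 2) * ?p 1 2"
          using D3'[of 1 2] by simp
        \<comment> \<open>The same entry is obtained a second time from the derivatives in the
          opposite order; this supplies the second expression for the mixed derivative.\<close>
        show "A 3 $ 2 = pd 1 f y * A 1 $ 2 + pd 2 f y * A 2 $ 2
          + (H $ 1 $ 1 * ?p 1 1 + H $ 1 $ 2 * ?p 1 2) * ?p 2 1 + (H $ 2 $ 1 * ?p 1 1 + H $ 2 $ 2 * ?p 1 2) * ?p 2 2"
          using D3'[of 2 1] AB(3) by simp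
        show "B 3 $ 2 = pd 1 f y * B 1 $ 2 + pd 2 f y * B 2 $ 2
          + (H $ 1 $ 1 * ?p 2 1 + H $ 1 $ 2 * ?p 2 2) * ?p 2 1 + (H $ 2 $ 1 * ?p 2 1 + H $ 2 $ 2 * ?p 2 2) * ?p 2 2"
          using D3'[of 2 2] by simp
      qed (simp_all add: metric[OF x(1)] sum_3 T R power2_eq_square)
      moreover have "(norm (grad f y))\<^sup>2 = (pd 1 f y)\<^sup>2 + (pd 2 f y)\<^sup>2"
        unfolding power2_norm_eq_inner inner_plane grad_def by (simp add: power2_eq_square)
      ultimately show "det (ac_hessian U' f y) = gauss_curvature g (\<Phi> y) * (1 + (norm (grad f y))\<^sup>2)\<^sup>2"
        by (simp add: det_2 H_def x_def)
    qed
  qed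
qed

end
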